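(* Let $0<\gamma<\frac{\log\pi}{\log2}-1$. Then $$\#\{n\le x:\ r_Q(n)\ne0,\ \Delta(n)>r_Q(n)^{-\gamma}\}=o(B_Q(x))\quad (x\to\infty),$$ i.e. for all but $o(B_Q(x))$ of the integers $n\in\mathcal{R}_Q(x)$ one has $\Delta(n)\le r_Q(n)^{-\gamma}$.
   Context: $\omega=e^{i\pi/3}$, $\mathfrak{O}=\mathbb{Z}[\omega]$. $Q(x,y)=x^2+xy+y^2$, and $r_Q(n)=\#\{(a,b)\in\mathbb{Z}^2: Q(a,b)=n\}=\#\{\zeta\in\mathfrak{O}:|\zeta|^2=n\}$. $\mathcal{R}_Q(x)=\{n\le x: r_Q(n)\neq0\}$ and $B_Q(x)=|\mathcal{R}_Q(x)|$. For $n$ with $r_Q(n)\ne0$, the discrepancy is $$\Delta(n)=\sup_{0\le\alpha<\beta\le2\pi}\left|\frac{\#\{\zeta\in\mathfrak{O}:|\zeta|^2=n,\ \arg\zeta\in[\alpha,\beta)\}}{r_Q(n)}-\frac{\beta-\alpha}{2\pi}\right|,$$ with $\arg$ taken in $[0,2\pi)$. *)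

theory Defs
  imports "HOL-Analysis.Analysis" "HOL-Library.Landau_Symbols"
begin

definition omega :: complex where
  "omega = cis (pi / 3)"

definition Eis :: "complex set" where
  "Eis = {of_int a + of_int b * omega | a b :: int. True}"

definition Qf :: "int \<Rightarrow> int \<Rightarrow> int" where
  "Qf x y = x^2 + x*y + y^2"

definition lattice_pts :: "nat \<Rightarrow> complex set" where
  "lattice_pts n = {z \<in> Eis. (cmod z)^2 = real n}"

definition rQ :: "nat \<Rightarrow> nat" where
  "rQ n = card {p :: int \<times> int. Qf (fst p) (snd p) = int n}"

definition arg0 :: "complex \<Rightarrow> real" where
  "arg0 z = (if Arg z < 0 then Arg z + 2 * pi else Arg z)"

definition discrepancy :: "nat \<Rightarrow> real" where
  "discrepancy n = (SUP p \<in> {(\<alpha>, \<beta>). 0 \<le> \<alpha> \<and> \<alpha> < \<beta> \<and> \<beta> \<le> 2 * pi}.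
     \<bar>real (card {z \<in> lattice_pts n. arg0 z \<in> {fst p..<snd p}}) / real (rQ n)
        - (snd p - fst p) / (2 * pi)\<bar>)"

definition BQ :: "real \<Rightarrow> nat" where
  "BQ x = card {n :: nat. real n \<le> x \<and> rQ n \<noteq> 0}"

end

theory Submission
  imports Defs "HOL-Number_Theory.Number_Theory" "HOL-Real_Asymp.Real_Asymp"
begin

text \<open>
  Let \<open>hecke k n\<close> be one sixth of the sum of \<open>(z / |z|) ^ (6 k)\<close> over the points of norm \<open>n\<close>; it is
  multiplicative in \<open>n\<close>, and \<open>hecke 0 n = r / 6\<close> for \<open>r = rQ n\<close>. The Fejer kernel bounds the
  discrepancy of \<open>n\<close> by \<open>\<Sum>k\<le>K. |hecke k n| / (k * hecke 0 n)\<close> up to a small error.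

  At a prime \<open>p \<equiv> 1 (mod 3)\<close> one has \<open>hecke k p = 2 cos (k t)\<close> with an angle \<open>t\<close>. The Dirichlet series
  of \<open>hecke k\<close> near 1 is controlled uniformly in \<open>k\<close>, which makes the angles \<open>2 k t\<close> equidistributed
  in logarithmic mean, so that \<open>|hecke k p|\<close> has mean value \<open>4 / pi\<close>. With \<open>2 powr t = pi / 2\<close>, that is
  \<open>t = ln pi / ln 2 - 1\<close>, the nonnegative multiplicative function
  \<open>hecke 0 n powr (t - 1) * |hecke k n|\<close> has mean value 1 on these primes, which are half of all primes.
  Its sum up to \<open>N\<close> is therefore at most \<open>N * ln N powr (- 1/2 + e)\<close>, nearly the number of represented
  integers. By Markov's inequality \<open>\<Sum>k\<le>K. |hecke k n| / (k * hecke 0 n) \<le> ln N powr (2 e) * r powr - t\<close>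
  outside a sparse set, and outside another one \<open>r\<close> exceeds a fixed power of \<open>ln N\<close>, so the factor
  \<open>ln N powr (2 e)\<close> is absorbed by \<open>r powr (t - \<gamma>)\<close>.
\<close>

section \<open>Arithmetic of the Eisenstein integers\<close>

text \<open>The critical exponent is the point where two logarithmic orders meet. At a split prime
  the weight averages \<open>2 powr t * (2 / pi)\<close>. When this equals 1, the value there of the
  indicator function of the represented numbers, the weighted sums have nearly the order of
  \<open>BQ\<close>; a larger \<open>t\<close> would make their bound larger by a power of
  \<open>ln N\<close>.

  The obstacle is uniformity: the kernel calls for harmonics \<open>k\<close> up to a power of
  \<open>ln N\<close>, so the angles must be equidistributed uniformly in this range. Since only
  points \<open>x = 1 + 1 / ln N\<close> enter, it is enough to bound the logarithm of the series of
  \<open>hecke k\<close> by \<open>C * (1 + ln (1 + ln k))\<close> on the real segment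
  \<open>1 < x \<le> 2\<close>. No analytic continuation and no zero-free region is involved. The
  upper bound comes from an approximate self-similarity of lattice sums, the lower bound from the
  positivity of a combination of the harmonics 0, \<open>k\<close> and \<open>2 * k\<close> joined
  with a Lipschitz bound.

  The number of represented integers itself is bounded from below only up to a small power of
  \<open>ln N\<close>. That loss, like the others, is covered by the strict inequality between
  \<open>\<gamma>\<close> and \<open>t\<close>.\<close>

lemma omega_Re: "Re omega = 1/2" and omega_Im: "Im omega = sqrt 3 / 2"
  by (simp_all add: omega_def cos_60 sin_60)

lemma omega_sq: "omega * omega = omega - 1"
  by (simp add: complex_eq_iff omega_Re omega_Im)

lemma cnj_omega: "cnj omega = 1 - omega"
  by (simp add: complex_eq_iff omega_Re omega_Im)

lemma EisI: "of_int a + of_int b * omega \<in> Eis"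
  by (auto simp: Eis_def)

lemma EisE:
  assumes "z \<in> Eis" obtains a b :: int where "z = of_int a + of_int b * omega"
  using assms by (auto simp: Eis_def)

lemma Eis_of_int [simp, intro]: "of_int a \<in> Eis"
  using EisI[of a 0] by simp

lemma Eis_0 [simp, intro]: "0 \<in> Eis" and Eis_1 [simp, intro]: "1 \<in> Eis" 
  and Eis_of_nat [simp, intro]: "of_nat n \<in> Eis" and Eis_omega [simp, intro]: "omega \<in> Eis"
  using Eis_of_int[of 0] Eis_of_int[of 1] Eis_of_int[of "int n"] EisI[of 0 1] by simp_all

lemma Eis_add [intro]: "z \<in> Eis \<Longrightarrow> w \<in> Eis \<Longrightarrow> z + w \<in> Eis"
proof (elim EisE)
  fix a b c d :: int
  assume "z = of_int a + of_int b * omega" "w = of_int c + of_int d * omega"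
  then have "z + w = of_int (a + c) + of_int (b + d) * omega" by (simp add: algebra_simps)
  then show ?thesis using EisI by metis
qed

lemma Eis_uminus [intro]: "z \<in> Eis \<Longrightarrow> - z \<in> Eis"
proof (elim EisE)
  fix a b :: int
  assume "z = of_int a + of_int b * omega"
  then have "- z = of_int (- a) + of_int (- b) * omega" by (simp add: algebra_simps)
  then show ?thesis using EisI by metis
qed

lemma Eis_diff [intro]: "z \<in> Eis \<Longrightarrow> w \<in> Eis \<Longrightarrow> z - w \<in> Eis"
  using Eis_add[of z "- w"] Eis_uminus[of w] by simp

lemma Eis_mult [intro]: "z \<in> Eis \<Longrightarrow> w \<in> Eis \<Longrightarrow> z * w \<in> Eis"
proof (elim EisE)
  fix a b c d :: int
  assume *: "z = of_int a + of_int b * omega" "w = of_int c + of_int d * omega"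
  have "z * w = of_int a * of_int c + (of_int a * of_int d + of_int b * of_int c) * omega
                + of_int b * of_int d * (omega * omega)"
    by (simp add: * algebra_simps)
  also have "\<dots> = of_int (a * c - b * d) + of_int (a * d + b * c + b * d) * omega"
    unfolding omega_sq by (simp add: algebra_simps)
  finally show ?thesis using EisI by metis
qed

lemma Eis_cnj [intro]: "z \<in> Eis \<Longrightarrow> cnj z \<in> Eis"
proof (elim EisE)
  fix a b :: int
  assume "z = of_int a + of_int b * omega"
  then have "cnj z = of_int (a + b) + of_int (- b) * omega" 
    by (simp add: cnj_omega algebra_simps)
  then show ?thesis using EisI by metis
qed

lemma Eis_power [intro]: "z \<in> Eis \<Longrightarrow> z ^ n \<in> Eis"
  by (induction n) auto

lemma cmod_sq_coords: 
  fixes x y :: real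
  shows "(cmod (of_real x + of_real y * omega))\<^sup>2 = x\<^sup>2 + x * y + y\<^sup>2"
  unfolding cmod_power2 by (simp add: omega_Re omega_Im power2_eq_square algebra_simps)

lemma cmod_sq_Eis: "(cmod (of_int a + of_int b * omega))\<^sup>2 = real_of_int (Qf a b)"
  using cmod_sq_coords[of "of_int a" "of_int b"] by (simp add: Qf_def)

lemma Qf_nonneg: "Qf a b \<ge> 0"
proof -
  have "real_of_int (Qf a b) \<ge> 0" by (metis cmod_sq_Eis zero_le_power2)
  then show ?thesis by simp
qed

text \<open>The norm is taken as a natural number so that prime factorisation in \<open>nat\<close>
  applies to it. On \<open>Eis\<close> the floor loses nothing (\<open>real_enorm\<close>).\<close>

definition enorm :: "complex \<Rightarrow> nat" where "enorm z = nat \<lfloor>(cmod z)\<^sup>2\<rfloor>"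

lemma real_enorm: "z \<in> Eis \<Longrightarrow> real (enorm z) = (cmod z)\<^sup>2"
  by (elim EisE) (simp add: enorm_def cmod_sq_Eis Qf_nonneg)

lemma complex_enorm: "z \<in> Eis \<Longrightarrow> of_nat (enorm z) = z * cnj z"
  by (metis complex_norm_square of_real_of_nat_eq real_enorm)

lemma enorm_mult: "z \<in> Eis \<Longrightarrow> w \<in> Eis \<Longrightarrow> enorm (z * w) = enorm z * enorm w"
proof -
  assume "z \<in> Eis" "w \<in> Eis"
  then have "real (enorm (z * w)) = real (enorm z * enorm w)"
    by (simp add: real_enorm Eis_mult norm_mult power_mult_distrib)
  then show ?thesis by (simp only: of_nat_eq_iff)
qed

lemma enorm_of_int: "int (enorm (of_int a)) = a\<^sup>2"
proof -
  have "real_of_int (int (enorm (of_int a))) = real_of_int (a\<^sup>2)"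
    using real_enorm[OF Eis_of_int[of a]] by simp
  then show ?thesis by (simp only: of_int_eq_iff)
qed

lemma enorm_of_nat: "enorm (of_nat a) = a\<^sup>2"
  using enorm_of_int[of "int a"] by (simp flip: of_nat_power)

lemma enorm_eq_0: "z \<in> Eis \<Longrightarrow> enorm z = 0 \<longleftrightarrow> z = 0"
  by (metis norm_eq_zero of_nat_eq_0_iff real_enorm zero_eq_power2)

lemma mem_lattice_pts: "z \<in> lattice_pts n \<longleftrightarrow> z \<in> Eis \<and> enorm z = n"
  unfolding lattice_pts_def by (auto simp flip: real_enorm)

lemma enorm_coords: "int (enorm (of_int a + of_int b * omega)) = Qf a b"
  using real_enorm[OF EisI[of a b]] by (simp add: cmod_sq_Eis flip: of_int_eq_iff)

lemma coords_inj: 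
  assumes "of_int a + of_int b * omega = of_int c + of_int d * omega"
  shows "a = c \<and> b = d"
proof -
  have "Im (of_int a + of_int b * omega) = Im (of_int c + of_int d * omega)" using assms by simp
  then have "b = d" by (simp add: omega_Im)
  then show ?thesis using assms by simp
qed

text \<open>Links the pairs counted by \<open>rQ\<close> with the points whose arguments enter the
  discrepancy.\<close>

lemma coords_bij:
  "bij_betw (\<lambda>(a, b). of_int a + of_int b * omega) {p. Qf (fst p) (snd p) = int n} (lattice_pts n)"
proof (rule bij_betwI')
  fix p q :: "int \<times> int" 
  show "((case p of (a, b) \<Rightarrow> complex_of_int a + of_int b * omega) = (case q of (a, b) \<Rightarrow> of_int a + of_int b * omega)) = (p = q)"
    using coords_inj by (cases p; cases q) auto
next
  fix p :: "int \<times> int" assume "p \<in> {p. Qf (fst p) (snd p) = int n}"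
  then show "(case p of (a, b) \<Rightarrow> of_int a + of_int b * omega) \<in> lattice_pts n"
    using enorm_coords[of "fst p" "snd p"] by (cases p) (auto simp: mem_lattice_pts EisI)
next
  fix z assume "z \<in> lattice_pts n"
  then have z: "z \<in> Eis" "enorm z = n" by (auto simp: mem_lattice_pts)
  then obtain a b where ab: "z = of_int a + of_int b * omega" by (elim EisE)
  then have "Qf a b = int n" using enorm_coords[of a b] z by simp
  then show "\<exists>p\<in>{p. Qf (fst p) (snd p) = int n}. z = (case p of (a, b) \<Rightarrow> of_int a + of_int b * omega)"
    using ab by (intro bexI[of _ "(a, b)"]) auto
qed

text \<open>Completing the square in the other variable. This confines the representations of
  \<open>n\<close> to a finite box and later bounds \<open>cmod\<close> from below outside
  \<open>coord_box\<close>.\<close>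

lemma Qf_ge: fixes a b :: int shows "4 * Qf a b \<ge> 3 * a\<^sup>2" "4 * Qf a b \<ge> 3 * b\<^sup>2"
proof -
  have "4 * Qf a b = 3 * a\<^sup>2 + (a + 2 * b)\<^sup>2" "4 * Qf a b = 3 * b\<^sup>2 + (2 * a + b)\<^sup>2"
    by (simp_all add: Qf_def power2_eq_square algebra_simps)
  then show "4 * Qf a b \<ge> 3 * a\<^sup>2" "4 * Qf a b \<ge> 3 * b\<^sup>2"
    by (smt (verit) zero_le_power2)+
qed

lemma finite_lattice_pts [simp, intro]: "finite (lattice_pts n)"
proof -
  have "a \<in> {-2 * int n..2 * int n}" if "3 * a\<^sup>2 \<le> 4 * int n" for a
  proof -
    have "\<bar>a\<bar> * 1 \<le> \<bar>a\<bar> * \<bar>a\<bar>"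
      by (cases "a = 0") (simp, intro mult_left_mono, auto)
    moreover have "\<bar>a\<bar> * \<bar>a\<bar> = a\<^sup>2" by (simp add: power2_eq_square)
    ultimately have "\<bar>a\<bar> \<le> a\<^sup>2" by linarith
    then show ?thesis using that by (auto simp: abs_le_iff)
  qed
  then have "{p. Qf (fst p) (snd p) = int n} \<subseteq> {-2 * int n..2 * int n} \<times> {-2 * int n..2 * int n}"
    using Qf_ge by (auto simp: mem_Times_iff) metis+
  then have "finite {p. Qf (fst p) (snd p) = int n}" by (rule finite_subset) auto
  then show ?thesis using bij_betw_finite[OF coords_bij] by blast
qed

lemma rQ_eq_card: "rQ n = card (lattice_pts n)"
  unfolding rQ_def using bij_betw_same_card[OF coords_bij] .

text \<open>Rounding both coordinates of the quotient leaves a remainder of norm at most 3/4.\<close>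
lemma Eis_division:
  assumes "z \<in> Eis" "w \<in> Eis" "w \<noteq> 0"
  obtains q where "q \<in> Eis" "cmod (z - q * w) < cmod w"
proof -
  define t where "t = z / w"
  define y where "y = Im t / (sqrt 3 / 2)"
  define x where "x = Re t - y / 2"
  have t: "t = of_real x + of_real y * omega"
    by (simp add: complex_eq_iff omega_Re omega_Im x_def y_def)
  define q where "q = of_int (round x) + of_int (round y) * omega"
  define dx where "dx = x - of_int (round x)"
  define dy where "dy = y - of_int (round y)"
  have d: "\<bar>dx\<bar> \<le> 1/2" "\<bar>dy\<bar> \<le> 1/2"
    unfolding dx_def dy_def using of_int_round_abs_le[of x] of_int_round_abs_le[of y] by linarith+
  have "t - q = of_real dx + of_real dy * omega" 
    by (simp add: t q_def dx_def dy_def algebra_simps)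
  then have "(cmod (t - q))\<^sup>2 = dx\<^sup>2 + dx * dy + dy\<^sup>2" using cmod_sq_coords by simp
  also have "\<dots> \<le> 1/4 + 1/4 + 1/4"
  proof -
    have "dx\<^sup>2 \<le> (1/2)\<^sup>2" "dy\<^sup>2 \<le> (1/2)\<^sup>2" using d by (intro abs_le_square_iff[THEN iffD1]; simp)+
    moreover have "\<bar>dx * dy\<bar> \<le> 1/2 * (1/2)" unfolding abs_mult using d by (intro mult_mono) auto
    ultimately show ?thesis by (simp add: power2_eq_square)
  qed
  finally have "(cmod (t - q))\<^sup>2 < 1\<^sup>2" by simp
  then have 1: "cmod (t - q) < 1" by (rule power2_less_imp_less) simp
  have "z - q * w = (t - q) * w" using assms by (simp add: t_def field_simps)
  then have "cmod (z - q * w) = cmod (t - q) * cmod w" by (simp add: norm_mult)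
  also have "\<dots> < 1 * cmod w" using 1 assms by (intro mult_strict_right_mono) auto
  finally show ?thesis using that[of q] EisI by (simp add: q_def)
qed

text \<open>The quotient is required to lie in \<open>Eis\<close>: in the field
  \<open>complex\<close> the relation \<open>dvd\<close> would be trivial.\<close>

definition edvd :: "complex \<Rightarrow> complex \<Rightarrow> bool" where
  "edvd a b \<longleftrightarrow> (\<exists>c\<in>Eis. b = a * c)"

lemma edvdI: "c \<in> Eis \<Longrightarrow> b = a * c \<Longrightarrow> edvd a b" by (auto simp: edvd_def)

text \<open>A nonzero element of least norm in the ideal generated by \<open>a\<close> and
  \<open>b\<close> divides every element of it, since the remainder from \<open>Eis_division\<close>
  would have smaller norm.\<close>

lemma Eis_bezout:
  assumes "a \<in> Eis" "b \<in> Eis" "a \<noteq> 0"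
  obtains d u v where "d \<in> Eis" "u \<in> Eis" "v \<in> Eis" "d = a * u + b * v" "edvd d a" "edvd d b" "d \<noteq> 0"
proof -
  define I where "I = {a * u + b * v | u v. u \<in> Eis \<and> v \<in> Eis}"
  have a: "a \<in> I" unfolding I_def using assms by (intro CollectI exI[of _ 1] exI[of _ 0]) auto
  have b: "b \<in> I" unfolding I_def using assms by (intro CollectI exI[of _ 0] exI[of _ 1]) auto
  have IE: "z \<in> Eis" if "z \<in> I" for z using that assms by (auto simp: I_def)
  have cl: "z - q * w \<in> I" if "z \<in> I" "w \<in> I" "q \<in> Eis" for z w q
  proof -
    from that(1) obtain u v where "z = a * u + b * v" "u \<in> Eis" "v \<in> Eis" unfolding I_def by blast
    moreover from that(2) obtain u' v' where "w = a * u' + b * v'" "u' \<in> Eis" "v' \<in> Eis"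
      unfolding I_def by blast
    ultimately show ?thesis unfolding I_def using that
      by (intro CollectI exI[of _ "u - q * u'"] exI[of _ "v - q * v'"]) (auto simp: algebra_simps)
  qed
  have "a \<in> I \<and> a \<noteq> 0" using a assms by simp
  from ex_has_least_nat[of "\<lambda>z. z \<in> I \<and> z \<noteq> 0", OF this, of enorm]
  obtain d where d': "(d \<in> I \<and> d \<noteq> 0) \<and> (\<forall>z. z \<in> I \<and> z \<noteq> 0 \<longrightarrow> enorm d \<le> enorm z)"
    by (rule exE)
  then have d: "d \<in> I" "d \<noteq> 0" by simp_all
  have dmin: "enorm d \<le> enorm z" if "z \<in> I" "z \<noteq> 0" for z using d' that by simp
  have dv: "edvd d z" if "z \<in> I" for z
  proof -
    from Eis_division[OF IE[OF that] IE[OF d(1)] d(2)]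
    obtain q where q: "q \<in> Eis" "cmod (z - q * d) < cmod d" by metis
    have "z - q * d = 0"
    proof (rule ccontr)
      assume "z - q * d \<noteq> 0"
      then have "enorm d \<le> enorm (z - q * d)" using dmin cl[OF that d(1) q(1)] by blast
      then have "(cmod d)\<^sup>2 \<le> (cmod (z - q * d))\<^sup>2"
        using real_enorm[OF IE[OF d(1)]] real_enorm[OF IE[OF cl[OF that d(1) q(1)]]] by linarith
      then show False using q(2) by (smt (verit) norm_ge_zero power_strict_mono zero_less_numeral)
    qed
    then show ?thesis using q by (intro edvdI[of q]) (auto simp: algebra_simps)
  qed
  from d(1) obtain u v where "d = a * u + b * v" "u \<in> Eis" "v \<in> Eis" unfolding I_def by blast
  then show ?thesis using that[of d u v] IE[OF d(1)] dv[OF a] dv[OF b] d(2) by simp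
qed

lemma edvd_enorm: "edvd a b \<Longrightarrow> a \<in> Eis \<Longrightarrow> enorm a dvd enorm b"
  by (auto simp: edvd_def enorm_mult)

text \<open>A rational number in \<open>Eis\<close> is a rational integer, by comparing coordinates.
  This brings divisibility by \<open>m\<close> back from \<open>Eis\<close> to
  \<open>nat\<close>.\<close>

lemma enorm_dvd_int:
  assumes "a \<in> Eis" "of_nat m * a = of_nat n"
  shows "m dvd n"
proof (cases "m = 0")
  case False
  obtain x y where xy: "a = of_int x + of_int y * omega" using assms(1) by (elim EisE)
  have "of_int (int m * x) + of_int (int m * y) * omega = of_int (int n) + of_int 0 * omega"
    using assms(2) by (simp add: xy algebra_simps)
  from coords_inj[OF this] have "int n = int m * x" by simp
  then have "int m dvd int n" by simp
  then show ?thesis by (simp only: of_nat_dvd_iff)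
qed (use assms in auto)

lemma enorm_cnj: "enorm (cnj z) = enorm z" by (simp add: enorm_def)

text \<open>The greatest common divisor of \<open>z\<close> and \<open>m\<close> is the factor sought.\<close>
lemma Eis_factor:
  assumes "z \<in> Eis" "enorm z = m * n" "coprime m n" "m > 0"
  obtains d b where "d \<in> Eis" "b \<in> Eis" "z = d * b" "enorm d = m" "enorm b = n"
proof -
  have m0: "(of_nat m :: complex) \<noteq> 0" using assms by simp
  obtain d u v where d: "d \<in> Eis" "u \<in> Eis" "v \<in> Eis" "d = of_nat m * u + z * v" 
      "edvd d (of_nat m)" "edvd d z" "d \<noteq> 0"
    using Eis_bezout[OF Eis_of_nat assms(1) m0] by metis
  have zz: "z * cnj z = of_nat m * of_nat n" using complex_enorm[OF assms(1)] assms(2) by simp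
  \<comment> \<open>The cofactor of \<open>m\<close> in \<open>d * cnj d\<close>, expanded from
    \<open>d = m * u + z * v\<close>. The only term without a visible factor \<open>m\<close>
    contains \<open>z * cnj z\<close>, which is \<open>m * n\<close>.\<close>
  define e where "e = u * (of_nat m * cnj u) + u * cnj z * cnj v + z * v * cnj u + of_nat n * (v * cnj v)"
  have "of_nat (enorm d) = d * cnj d" by (rule complex_enorm[OF d(1)])
  also have "\<dots> = of_nat m * (u * (of_nat m * cnj u) + u * cnj z * cnj v + z * v * cnj u) + z * cnj z * (v * cnj v)"
    by (simp add: d(4) algebra_simps)
  also have "\<dots> = of_nat m * e" unfolding zz e_def by (simp add: algebra_simps)
  finally have "of_nat m * e = of_nat (enorm d)" by simp
  moreover have "e \<in> Eis" unfolding e_def using d assms by blast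
  ultimately have 1: "m dvd enorm d" using enorm_dvd_int by blast
  have 2: "enorm d dvd m\<^sup>2" using edvd_enorm[OF d(5,1)] by (simp add: enorm_of_nat)
  have 3: "enorm d dvd m * n" using edvd_enorm[OF d(6,1)] assms by simp
  have "enorm d dvd gcd (m * m) (m * n)" using 2 3 by (simp add: power2_eq_square)
  then have "enorm d dvd m * gcd m n" by (metis gcd_mult_distrib_nat)
  then have dm: "enorm d = m" using 1 assms by (simp add: dvd_antisym)
  obtain b where b: "b \<in> Eis" "z = d * b" using d by (auto simp: edvd_def)
  have "m * enorm b = m * n" using b d dm assms enorm_mult[of d b] by simp
  then have "enorm b = n" using assms by simp
  then show ?thesis using that d b dm by blast
qed

section \<open>Units and the coefficients of the angular characters\<close>

definition units :: "complex set" where "units = lattice_pts 1"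

lemma units_eq: "units = {1, omega, omega - 1, -1, - omega, 1 - omega}"
proof (intro equalityI subsetI)
  fix z assume "z \<in> units"
  then have z: "z \<in> Eis" "enorm z = 1" by (auto simp: units_def mem_lattice_pts)
  obtain a b where ab: "z = of_int a + of_int b * omega" using z by (elim EisE)
  have Q: "Qf a b = 1" using z ab enorm_coords[of a b] by simp
  have *: "\<bar>x\<bar> \<le> 1" if "3 * x\<^sup>2 \<le> 4" for x :: int
  proof (rule ccontr)
    assume "\<not> \<bar>x\<bar> \<le> 1"
    then have "2\<^sup>2 \<le> \<bar>x\<bar>\<^sup>2" by (intro power_mono) auto
    then show False using that by simp
  qed
  have "3 * a\<^sup>2 \<le> 4" "3 * b\<^sup>2 \<le> 4" using Qf_ge[where a = a and b = b] Q by simp_all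
  then have "\<bar>a\<bar> \<le> 1" "\<bar>b\<bar> \<le> 1" using * by blast+
  then have "a \<in> {-1, 0, 1}" "b \<in> {-1, 0, 1}" by auto
  then show "z \<in> {1, omega, omega - 1, -1, - omega, 1 - omega}" using Q ab by (auto simp: Qf_def)
next
  fix z assume "z \<in> {1, omega, omega - 1, -1, - omega, 1 - omega}"
  then have "\<exists>p \<in> {(1, 0), (0, 1), (-1, 1), (-1, 0), (0, -1), (1, -1)}. z = of_int (fst p) + of_int (snd p) * omega \<and> Qf (fst p) (snd p) = 1"
    unfolding bex_simps fst_conv snd_conv by (simp add: Qf_def)
  then obtain a b where "z = of_int a + of_int b * omega" "Qf a b = 1" by blast
  then show "z \<in> units" using enorm_coords[of a b] by (auto simp: units_def mem_lattice_pts EisI)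
qed

lemma omega_pow6: "omega ^ 6 = 1"
proof -
  have "omega ^ 6 = (omega * omega) * (omega * omega) * (omega * omega)" by (simp add: eval_nat_numeral)
  also have "\<dots> = (omega - 1) * (omega - 1) * (omega - 1)" by (simp only: omega_sq)
  also have "\<dots> = (omega * omega) * omega - 3 * (omega * omega) + 3 * omega - 1" by (simp add: algebra_simps)
  also have "\<dots> = (omega - 1) * omega - 3 * (omega - 1) + 3 * omega - 1" by (simp only: omega_sq)
  also have "\<dots> = omega * omega - omega + 2" by (simp add: algebra_simps)
  also have "\<dots> = 1" by (simp add: omega_sq)
  finally show ?thesis .
qed

lemma card_units: "card units = 6"
proof -
  have "Im omega \<noteq> 0" by (simp add: omega_Im)
  then have "omega \<noteq> 0" "omega \<noteq> 1" "omega \<noteq> -1" "2 * omega \<noteq> 0" "2 * omega \<noteq> 1" "omega \<noteq> 2" "2 * omega \<noteq> 2"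
    by (auto simp: complex_eq_iff)
  then have "distinct [1, omega, omega - 1, -1, - omega, 1 - omega]"
    by (auto simp: complex_eq_iff omega_Re omega_Im)
  from distinct_card[OF this] show ?thesis unfolding units_eq by simp
qed

lemma unit_pow6: "u \<in> units \<Longrightarrow> u ^ 6 = 1"
proof -
  assume "u \<in> units"
  moreover have "omega - 1 = omega\<^sup>2" "1 - omega = - (omega\<^sup>2)" 
    using omega_sq by (simp_all add: power2_eq_square)
  ultimately have "u \<in> {1, omega, omega\<^sup>2, -1, - omega, - (omega\<^sup>2)}" unfolding units_eq by simp
  moreover have "(omega\<^sup>2) ^ 6 = 1" by (metis omega_pow6 power_commutes power_mult mult.commute power_one)
  ultimately show ?thesis using omega_pow6 by (elim insertE emptyE) simp_all
qed

lemma units_Eis: "u \<in> units \<Longrightarrow> u \<in> Eis" and units_enorm: "u \<in> units \<Longrightarrow> enorm u = 1"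
  by (auto simp: units_def mem_lattice_pts)

lemma units_cmod: "u \<in> units \<Longrightarrow> cmod u = 1"
  using real_enorm[of u] units_Eis[of u] units_enorm[of u] by (simp add: power2_eq_1_iff) 
    (smt (verit) norm_ge_zero)

lemma unitsI: "u \<in> Eis \<Longrightarrow> enorm u = 1 \<Longrightarrow> u \<in> units"
  by (auto simp: units_def mem_lattice_pts)

lemma units_cnj: "u \<in> units \<Longrightarrow> cnj u \<in> units" and units_mult_cnj: "u \<in> units \<Longrightarrow> u * cnj u = 1"
  using complex_enorm[of u] by (auto simp: units_def mem_lattice_pts enorm_cnj)

text \<open>The powers are multiples of 6 because only these are invariant under the six units.\<close>
definition ang :: "nat \<Rightarrow> complex \<Rightarrow> complex" where "ang k z = sgn z ^ (6 * k)"

text \<open>Six times the \<open>n\<close>-th coefficient of the L-series of the Hecke character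
  sending \<open>z\<close> to \<open>(z / |z|) ^ (6 * k)\<close>: every ideal is counted once for
  each of its six generators.\<close>

definition hecke_sum :: "nat \<Rightarrow> nat \<Rightarrow> complex" where
  "hecke_sum k n = (\<Sum>z\<in>lattice_pts n. ang k z)"

definition hecke :: "nat \<Rightarrow> nat \<Rightarrow> real" where
  "hecke k n = Re (hecke_sum k n) / 6"

lemma ang_mult: "ang k (z * w) = ang k z * ang k w"
  by (simp add: ang_def sgn_mult power_mult_distrib)

lemma ang_unit: "u \<in> units \<Longrightarrow> ang k u = 1"
  by (simp add: ang_def sgn_div_norm units_cmod power_mult unit_pow6)

lemma ang_cnj: "ang k (cnj z) = cnj (ang k z)"
  by (simp add: ang_def sgn_div_norm)

lemma norm_ang: "z \<noteq> 0 \<Longrightarrow> cmod (ang k z) = 1"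
  by (simp add: ang_def norm_power norm_sgn)

lemma norm_ang_le: "cmod (ang k z) \<le> 1"
  by (simp add: ang_def norm_power norm_sgn power_le_one)

lemma lattice_pts_nonzero: "n > 0 \<Longrightarrow> z \<in> lattice_pts n \<Longrightarrow> z \<noteq> 0"
  using enorm_eq_0[of z] by (auto simp: mem_lattice_pts)

text \<open>Conjugation permutes the points of norm \<open>n\<close>. The coefficients are therefore
  real, and \<open>hecke\<close> loses nothing by taking the real part.\<close>

lemma cnj_hecke_sum: "cnj (hecke_sum k n) = hecke_sum k n"
proof -
  have "cnj (hecke_sum k n) = (\<Sum>z\<in>lattice_pts n. ang k (cnj z))" by (simp add: hecke_sum_def ang_cnj)
  also have "\<dots> = hecke_sum k n" unfolding hecke_sum_def
    by (rule sum.reindex_bij_witness[of _ cnj cnj]) (auto simp: mem_lattice_pts Eis_cnj enorm_cnj)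
  finally show ?thesis .
qed

lemma hecke_sum_eq: "hecke_sum k n = of_real (6 * hecke k n)"
  using cnj_hecke_sum[of k n] by (simp add: hecke_def complex_eq_iff)

lemma hecke_0: "n > 0 \<Longrightarrow> hecke 0 n = real (rQ n) / 6"
  by (simp add: hecke_def hecke_sum_def ang_def rQ_eq_card)

lemma hecke_sum_0: "n > 0 \<Longrightarrow> hecke_sum 0 n = of_nat (card (lattice_pts n))"
  by (simp add: hecke_sum_def ang_def)

lemma abs_hecke_le: "n > 0 \<Longrightarrow> \<bar>hecke k n\<bar> \<le> hecke 0 n"
proof -
  assume n: "n > 0"
  have "6 * \<bar>hecke k n\<bar> = cmod (hecke_sum k n)" by (simp add: hecke_sum_eq)
  also have "\<dots> \<le> (\<Sum>z\<in>lattice_pts n. 1)" unfolding hecke_sum_def by (intro sum_norm_le norm_ang_le)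
  also have "\<dots> = 6 * hecke 0 n" using n by (simp add: hecke_0 rQ_eq_card)
  finally show ?thesis by simp
qed

lemma hecke_0_nonneg: "hecke 0 n \<ge> 0" by (simp add: hecke_def hecke_sum_def ang_def)

lemma hecke_1_right: "hecke k 1 = 1"
proof -
  have "hecke_sum k 1 = (\<Sum>z\<in>units. 1)" unfolding hecke_sum_def units_def[symmetric] by (intro sum.cong) (auto simp: ang_unit)
  then show ?thesis by (simp add: hecke_def card_units)
qed

lemma edvd_eq_unit:
  assumes "a \<in> Eis" "b \<in> Eis" "edvd a b" "enorm a = enorm b" "enorm a > 0"
  obtains u where "u \<in> units" "b = a * u"
proof -
  obtain c where c: "c \<in> Eis" "b = a * c" using assms by (auto simp: edvd_def)
  then have "enorm c = 1" using assms enorm_mult[of a c] by simp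
  then show ?thesis using c that[of c] unitsI[of c] by simp
qed

lemma coprime_comb_real:
  assumes "coprime m (n::nat)" obtains x y :: int where "of_nat m * of_int x + of_nat n * of_int y = (1::complex)"
proof -
  have "coprime (int m) (int n)" using assms by simp
  then obtain x y where "int m * x + int n * y = 1" 
    using bezout_int[of "int m" "int n"] by (auto simp: algebra_simps)
  then have "of_int (int m * x + int n * y) = (1::complex)" by simp
  then show ?thesis using that by simp
qed

text \<open>Multiplying \<open>d\<close> by \<open>1 = m * x + n * y\<close> and writing
  \<open>m\<close> and \<open>n\<close> as norms shows that \<open>d'\<close> divides
  \<open>d\<close>, because the second term contains \<open>d * b = d' * b'\<close>. Equal norms
  make the quotient a unit.\<close>

lemma Eis_factor_unique:
  assumes "d \<in> Eis" "b \<in> Eis" "d' \<in> Eis" "b' \<in> Eis" "d * b = d' * b'" 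
    "enorm d = m" "enorm d' = m" "enorm b = n" "enorm b' = n" "coprime m n" "m > 0" "n > 0"
  obtains u where "u \<in> units" "d = d' * u" "b = b' * cnj u"
proof -
  obtain x y where xy: "of_nat m * of_int x + of_nat n * of_int y = (1::complex)"
    using coprime_comb_real assms by metis
  have m: "of_nat m = d' * cnj d'" and n: "of_nat n = b * cnj b" 
    using complex_enorm assms by metis+
  have "d = d * (of_nat m * of_int x + of_nat n * of_int y)" using xy by simp
  also have "\<dots> = d' * (d * cnj d' * of_int x) + (d * b) * (cnj b * of_int y)"
    unfolding m n by (simp add: algebra_simps)
  also have "\<dots> = d' * (d * cnj d' * of_int x + b' * (cnj b * of_int y))"
    unfolding assms(5) by (simp add: algebra_simps)
  finally have dd: "edvd d' d" using assms by (intro edvdI) auto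
  obtain u where u: "u \<in> units" "d = d' * u"
    by (rule edvd_eq_unit[OF assms(3,1) dd]) (use assms(6,7,11) in simp_all)
  have "d' \<noteq> 0" using assms(7,11) enorm_eq_0[OF assms(3)] by simp
  then have "b' = u * b" using assms(5) u by simp
  then have "b' * cnj u = (u * cnj u) * b" by (simp add: algebra_simps)
  then have "b = b' * cnj u" using units_mult_cnj[OF u(1)] by simp
  then show ?thesis using that u by blast
qed

text \<open>Multiplication maps the pairs of points onto the points of norm \<open>m * n\<close>. By
  uniqueness up to units each fibre consists of the six pairs \<open>(d * u, b * cnj u)\<close>,
  whence the factor 6.\<close>

lemma hecke_sum_mult:
  assumes "coprime m n" "m > 0" "n > 0"
  shows "6 * hecke_sum k (m * n) = hecke_sum k m * hecke_sum k n"
proof -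
  define A where "A = lattice_pts m \<times> lattice_pts n"
  have fA: "finite A" by (simp add: A_def)
  have img: "(\<lambda>(d, b). d * b) ` A \<subseteq> lattice_pts (m * n)"
    by (auto simp: A_def mem_lattice_pts Eis_mult enorm_mult)
  have fib: "card {x \<in> A. (case x of (d, b) \<Rightarrow> d * b) = z} = 6" if z: "z \<in> lattice_pts (m * n)" for z
  proof -
    have z': "z \<in> Eis" "enorm z = m * n" using z by (auto simp: mem_lattice_pts)
    obtain d b where db: "d \<in> Eis" "b \<in> Eis" "z = d * b" "enorm d = m" "enorm b = n"
      by (rule Eis_factor[OF z' assms(1,2)])
    have nz: "d \<noteq> 0" "b \<noteq> 0" using db(4,5) assms(2,3) enorm_eq_0[OF db(1)] enorm_eq_0[OF db(2)] by simp_all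
    have "{x \<in> A. (case x of (d, b) \<Rightarrow> d * b) = z} = (\<lambda>u. (d * u, b * cnj u)) ` units"
    proof (intro equalityI subsetI)
      fix x assume x: "x \<in> {x \<in> A. (case x of (d, b) \<Rightarrow> d * b) = z}"
      obtain d' b' where x': "x = (d', b')" by (cases x)
      have *: "d' \<in> Eis" "b' \<in> Eis" "enorm d' = m" "enorm b' = n" "d' * b' = d * b" 
        using x x' db by (auto simp: A_def mem_lattice_pts)
      obtain u where "u \<in> units" "d' = d * u" "b' = b * cnj u"
        by (rule Eis_factor_unique[OF *(1,2) db(1,2) *(5,3) db(4) *(4) db(5) assms])
      then show "x \<in> (\<lambda>u. (d * u, b * cnj u)) ` units" using x' by auto
    next
      fix x assume "x \<in> (\<lambda>u. (d * u, b * cnj u)) ` units"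
      then obtain u where u: "u \<in> units" "x = (d * u, b * cnj u)" by auto
      have "d * u * (b * cnj u) = d * b * (u * cnj u)" by (simp add: algebra_simps)
      then have "d * u * (b * cnj u) = z" using units_mult_cnj[OF u(1)] db by simp
      then show "x \<in> {x \<in> A. (case x of (d, b) \<Rightarrow> d * b) = z}"
        using u db units_Eis[OF u(1)] units_enorm[OF u(1)]
        by (auto simp: A_def mem_lattice_pts Eis_mult enorm_mult Eis_cnj enorm_cnj)
    qed
    moreover have "inj_on (\<lambda>u. (d * u, b * cnj u)) units" by (rule inj_onI) (use nz in simp)
    ultimately show ?thesis by (simp add: card_image card_units)
  qed
  have "hecke_sum k m * hecke_sum k n = (\<Sum>x\<in>A. ang k (case x of (d, b) \<Rightarrow> d * b))"
    unfolding hecke_sum_def A_def sum_product sum.cartesian_product by (intro sum.cong) (auto simp: ang_mult)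
  also have "\<dots> = (\<Sum>z\<in>lattice_pts (m * n). \<Sum>x\<in>{x \<in> A. (case x of (d, b) \<Rightarrow> d * b) = z}. ang k (case x of (d, b) \<Rightarrow> d * b))"
    by (rule sum.group[symmetric]) (use fA img in auto)
  also have "\<dots> = (\<Sum>z\<in>lattice_pts (m * n). \<Sum>x\<in>{x \<in> A. (case x of (d, b) \<Rightarrow> d * b) = z}. ang k z)"
    by (intro sum.cong) auto
  also have "\<dots> = 6 * hecke_sum k (m * n)" using fib by (simp add: hecke_sum_def sum_distrib_left)
  finally show ?thesis by simp
qed

lemma hecke_mult:
  assumes "coprime m n" "m > 0" "n > 0"
  shows "hecke k (m * n) = hecke k m * hecke k n"
proof -
  have "complex_of_real (36 * hecke k (m * n)) = of_real (36 * (hecke k m * hecke k n))"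
    using hecke_sum_mult[OF assms, of k] by (simp add: hecke_sum_eq)
  then show ?thesis by (simp only: of_real_eq_iff)
qed

section \<open>Inert, ramified and split primes\<close>

lemma edvd_trans: "edvd a b \<Longrightarrow> edvd b c \<Longrightarrow> edvd a c"
  unfolding edvd_def by (metis Eis_mult mult.assoc)

text \<open>By the norm computation of \<open>Eis_factor\<close>, the greatest common divisor of
  \<open>p\<close> and \<open>z\<close> has norm \<open>p\<close> or \<open>p ^ 2\<close>. In the
  second case it is \<open>p\<close> up to a unit.\<close>

lemma edvd_norm_prime:
  assumes "prime p" "z \<in> Eis" "p dvd enorm z"
  shows "edvd (of_nat p) z \<or> (\<exists>d\<in>Eis. enorm d = p \<and> edvd d z)"
proof -
  have p0: "(of_nat p :: complex) \<noteq> 0" using assms(1) by (auto simp: prime_gt_0_nat)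
  obtain d u v where d: "d \<in> Eis" "u \<in> Eis" "v \<in> Eis" "d = of_nat p * u + z * v" 
      "edvd d (of_nat p)" "edvd d z" "d \<noteq> 0"
    by (rule Eis_bezout[OF Eis_of_nat assms(2) p0])
  obtain n where n: "enorm z = p * n" using assms(3) by auto
  have zz: "z * cnj z = of_nat p * of_nat n" using complex_enorm[OF assms(2)] n by simp
  define e where "e = u * (of_nat p * cnj u) + u * cnj z * cnj v + z * v * cnj u + of_nat n * (v * cnj v)"
  have "of_nat (enorm d) = d * cnj d" by (rule complex_enorm[OF d(1)])
  also have "\<dots> = of_nat p * (u * (of_nat p * cnj u) + u * cnj z * cnj v + z * v * cnj u) + z * cnj z * (v * cnj v)"
    by (simp add: d(4) algebra_simps)
  also have "\<dots> = of_nat p * e" unfolding zz e_def by (simp add: algebra_simps)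
  finally have "of_nat p * e = of_nat (enorm d)" by simp
  moreover have "e \<in> Eis" unfolding e_def using d(2,3) assms(2) by blast
  ultimately have 1: "p dvd enorm d" using enorm_dvd_int by blast
  have 2: "enorm d dvd p\<^sup>2" using edvd_enorm[OF d(5,1)] by (simp add: enorm_of_nat)
  then obtain i where i: "i \<le> 2" "enorm d = p ^ i" using divides_primepow_nat[OF assms(1)] by blast
  have "i \<noteq> 0" 
  proof
    assume "i = 0"
    then have "p dvd 1" using i(2) 1 by simp
    then show False using assms(1) by (metis not_prime_unit)
  qed
  then consider "i = 1" | "i = 2" using i(1) by linarith
  then show ?thesis
  proof cases
    case 1
    then show ?thesis using i(2) d(1,6) by auto
  next
    case 2
    have e: "enorm d = enorm (of_nat p)" using i(2) 2 by (simp add: enorm_of_nat)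
    have e0: "enorm d > 0" using enorm_eq_0[OF d(1)] d(7) by simp
    obtain u where u: "u \<in> units" "of_nat p = d * u"
      by (rule edvd_eq_unit[OF d(1) Eis_of_nat d(5) e e0])
    have "d = d * (u * cnj u)" using units_mult_cnj[OF u(1)] by simp
    also have "\<dots> = of_nat p * cnj u" unfolding u(2) by (simp add: mult.assoc)
    finally have "edvd (of_nat p) d" by (intro edvdI[OF Eis_cnj[OF units_Eis[OF u(1)]]])
    then show ?thesis using edvd_trans d(6) by blast
  qed
qed

text \<open>Modulo 3 the norm form is the square of \<open>a - b\<close>.\<close>

lemma enorm_mod3:
  assumes "z \<in> Eis" shows "enorm z mod 3 \<noteq> 2"
proof -
  obtain a b where ab: "z = of_int a + of_int b * omega" using assms by (elim EisE)
  have "int (enorm z) mod 3 = (a\<^sup>2 + a * b + b\<^sup>2) mod 3" using enorm_coords[of a b] by (simp add: ab Qf_def)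
  also have "\<dots> = ((a mod 3)\<^sup>2 + (a mod 3) * (b mod 3) + (b mod 3)\<^sup>2) mod 3" 
    unfolding power2_eq_square by (intro mod_add_cong mod_mult_cong) simp_all
  finally have *: "int (enorm z) mod 3 = ((a mod 3)\<^sup>2 + (a mod 3) * (b mod 3) + (b mod 3)\<^sup>2) mod 3" .
  have "a mod 3 \<in> {0, 1, 2}" "b mod 3 \<in> {0, 1, 2}" by auto
  then have "int (enorm z) mod 3 \<noteq> 2" unfolding * by auto
  then show ?thesis by (metis of_nat_mod of_nat_numeral)
qed

lemma lattice_pts_inert: "n mod 3 = 2 \<Longrightarrow> lattice_pts n = {}"
  using enorm_mod3 by (auto simp: mem_lattice_pts)

lemma card_le_image_mult:
  assumes "lattice_pts n \<subseteq> (\<lambda>w. c * w) ` lattice_pts m"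
  shows "card (lattice_pts n) \<le> card (lattice_pts m)"
  using card_mono[OF _ assms] card_image_le[of "lattice_pts m" "\<lambda>w. c * w"] by fastforce

text \<open>As nothing has norm \<open>p\<close>, a point of norm \<open>p ^ (a + 2)\<close> is
  divisible by \<open>p\<close> itself, so division by \<open>p\<close> embeds one set of points
  into the other.\<close>

lemma inert_step:
  assumes "prime p" "p mod 3 = 2"
  shows "card (lattice_pts (p ^ (a + 2))) \<le> card (lattice_pts (p ^ a))"
proof (rule card_le_image_mult, rule subsetI)
  fix z assume z: "z \<in> lattice_pts (p ^ (a + 2))"
  then have z': "z \<in> Eis" "enorm z = p ^ (a + 2)" by (auto simp: mem_lattice_pts)
  have "\<not> (\<exists>d\<in>Eis. enorm d = p \<and> edvd d z)" using enorm_mod3 assms(2) by blast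
  then have "edvd (of_nat p) z" using edvd_norm_prime[OF assms(1) z'(1)] z'(2) by auto
  then obtain w where w: "w \<in> Eis" "z = of_nat p * w" by (auto simp: edvd_def)
  have "p ^ (a + 2) = p\<^sup>2 * enorm w" using z'(2) enorm_mult[OF Eis_of_nat w(1), of p]
    by (simp only: w(2) enorm_of_nat)
  then have "p\<^sup>2 * enorm w = p\<^sup>2 * p ^ a" by (simp only: power_add mult.commute)
  then have "enorm w = p ^ a" using mult_cancel_left[of "p\<^sup>2" "enorm w" "p ^ a"] prime_gt_0_nat[OF assms(1)] by auto
  then show "z \<in> (\<lambda>w. of_nat p * w) ` lattice_pts (p ^ a)" using w by (auto simp: mem_lattice_pts)
qed

lemma card_inert:
  assumes "prime p" "p mod 3 = 2"
  shows "card (lattice_pts (p ^ a)) \<le> (if even a then 6 else 0)"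
proof (induction a rule: nat_less_induct)
  case (1 a)
  consider "a = 0" | "a = 1" | b where "a = b + 2" by (metis One_nat_def Suc_1 add_2_eq_Suc' not0_implies_Suc)
  then show ?case
  proof cases
    case 1
    then show ?thesis using card_units by (simp add: units_def)
  next
    case 2
    then show ?thesis using lattice_pts_inert[OF assms(2)] by simp
  next
    case (3 b)
    then show ?thesis using 1[rule_format, of b] inert_step[OF assms, of b] by auto
  qed
qed

text \<open>The prime above 3 is \<open>1 + omega\<close>. A norm divisible by 3 forces coordinates
  that are congruent modulo 3, hence a multiple of this prime.\<close>

lemma card_ramified: "card (lattice_pts (3 ^ a)) \<le> 6"
proof (induction a)
  case 0
  then show ?case using card_units by (simp add: units_def)
next
  case (Suc a)
  have "lattice_pts (3 ^ Suc a) \<subseteq> (\<lambda>w. (1 + omega) * w) ` lattice_pts (3 ^ a)"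
  proof
    fix z assume z: "z \<in> lattice_pts (3 ^ Suc a)"
    then have z': "z \<in> Eis" "enorm z = 3 ^ Suc a" by (auto simp: mem_lattice_pts)
    obtain x y where xy: "z = of_int x + of_int y * omega" using z'(1) by (elim EisE)
    have "int (enorm z) = (x - y)\<^sup>2 + 3 * (x * y)" using enorm_coords[of x y] 
      by (simp add: xy Qf_def power2_eq_square algebra_simps)
    then have "(x - y)\<^sup>2 = 3 * (3 ^ a - x * y)" using z'(2) by simp
    then have "3 dvd (x - y)\<^sup>2" by simp
    then have "3 dvd x - y" using prime_dvd_power[of 3 "x - y" 2] by (auto simp: prime_int_numeral_eq)
    then obtain c where c: "x = y + 3 * c" by (auto simp: dvd_def algebra_simps) 
    have l3: "(1 + omega) * (2 - omega) = 3" using omega_sq by (simp add: algebra_simps)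
    \<comment> \<open>This is \<open>z / (1 + omega)\<close>: one has
      \<open>z = y * (1 + omega) + 3 * c\<close>, and 3 is \<open>1 + omega\<close> times
      \<open>2 - omega\<close>.\<close>
    define w where "w = of_int (y + 2 * c) + of_int (- c) * omega"
    have w: "w \<in> Eis" unfolding w_def by (rule EisI)
    have zw: "z = (1 + omega) * w" 
    proof -
      have "(1 + omega) * w = of_int y * (1 + omega) + of_int c * ((1 + omega) * (2 - omega))"
        unfolding w_def by (simp add: algebra_simps)
      also have "\<dots> = z" unfolding l3 xy c by (simp add: algebra_simps)
      finally show ?thesis by simp
    qed
    have "int (enorm (1 + omega)) = 3" using enorm_coords[of 1 1] by (simp add: Qf_def)
    then have "enorm (1 + omega) = 3" by linarith
    then have "enorm w = 3 ^ a" using zw z'(2) enorm_mult[OF _ w, of "1 + omega"] by (auto simp: Eis_add)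
    then show "z \<in> (\<lambda>w. (1 + omega) * w) ` lattice_pts (3 ^ a)" using w zw by (auto simp: mem_lattice_pts)
  qed
  from card_le_image_mult[OF this] Suc show ?case by simp
qed

text \<open>A power \<open>c\<close> of a primitive root has order 3, so \<open>p\<close> divides
  \<open>c ^ 2 + c + 1\<close>, the norm of \<open>c + omega\<close>. As \<open>p\<close> does not
  divide \<open>c + omega\<close> itself, this element has a divisor of norm
  \<open>p\<close>.\<close>

lemma exists_norm_prime:
  assumes "prime p" "p mod 3 = 1"
  shows "\<exists>w\<in>Eis. enorm w = p"
proof -
  have p: "p > 1" using assms(1) prime_gt_1_nat by blast
  obtain g where g: "residue_primroot p g" using prime_primitive_root_exists[OF p assms(1)] by blast
  then have og: "ord p g = p - 1" "coprime p g" using totient_prime[OF assms(1)] by (auto simp: residue_primroot_def)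
  obtain e where e: "p = 3 * e + 1" using assms(2) by (metis mult.commute div_mod_decomp)
  define c where "c = g ^ e"
  have e0: "e > 0" using e p by (cases e) auto
  have "c ^ 3 = g ^ (p - 1)" by (simp add: c_def e power_mult[symmetric] mult.commute)
  then have c3: "[c ^ 3 = 1] (mod p)" using ord[of g p] og by simp
  have "\<not> (p - 1 dvd e)" using e e0 by (auto dest: dvd_imp_le)
  then have c1: "\<not> [c = 1] (mod p)" using ord_divides[of g e p] og by (simp add: c_def)
  have "g > 0" using og(2) p by (cases "g = 0") auto
  then have cpos: "c > 0" by (simp add: c_def)
  have "int p dvd int c ^ 3 - 1" using c3 by (metis cong_iff_dvd_diff cong_int_iff of_nat_1 of_nat_power)
  also have "int c ^ 3 - 1 = (int c - 1) * (int c ^ 2 + int c + 1)" by (simp add: eval_nat_numeral algebra_simps)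
  finally have "int p dvd (int c - 1) * (int c ^ 2 + int c + 1)" .
  moreover have "\<not> int p dvd int c - 1" using c1 by (metis cong_iff_dvd_diff cong_int_iff of_nat_1)
  ultimately have pd: "int p dvd int c ^ 2 + int c + 1" using assms(1) by (metis prime_dvd_multD prime_nat_int_transfer)
  define z where "z = of_int (int c) + of_int 1 * omega"
  have z: "z \<in> Eis" unfolding z_def by (rule EisI)
  have "int (enorm z) = int c ^ 2 + int c + 1" using enorm_coords[of "int c" 1] by (simp add: z_def Qf_def)
  then have pz: "p dvd enorm z" using pd by (metis of_nat_dvd_iff)
  have "\<not> edvd (of_nat p) z"
  proof
    assume "edvd (of_nat p) z"
    then obtain w where w: "w \<in> Eis" "z = of_nat p * w" by (auto simp: edvd_def)
    obtain x y where xy: "w = of_int x + of_int y * omega" using w(1) by (elim EisE)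
    have "of_int (int c) + of_int 1 * omega = of_int (int p * x) + of_int (int p * y) * omega"
      using w(2) unfolding z_def xy by (simp add: algebra_simps)
    from coords_inj[OF this] have "int p * y = 1" by simp
    then show False using p by (auto simp: zmult_eq_1_iff)
  qed
  then show ?thesis using edvd_norm_prime[OF assms(1) z pz] by blast
qed

text \<open>Euclid's lemma in \<open>Eis\<close>: the greatest common divisor of \<open>w\<close>
  and \<open>x\<close> has norm 1 or \<open>p\<close>.\<close>

lemma edvd_prime_mult:
  assumes "prime p" "w \<in> Eis" "enorm w = p" "x \<in> Eis" "y \<in> Eis" "edvd w (x * y)"
  shows "edvd w x \<or> edvd w y"
proof -
  have w0: "w \<noteq> 0" using assms(1,3) enorm_eq_0[OF assms(2)] by auto
  obtain d u v where d: "d \<in> Eis" "u \<in> Eis" "v \<in> Eis" "d = w * u + x * v" 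
      "edvd d w" "edvd d x" "d \<noteq> 0"
    by (rule Eis_bezout[OF assms(2,4) w0])
  have "enorm d dvd p" using edvd_enorm[OF d(5,1)] assms(3) by simp
  then consider "enorm d = 1" | "enorm d = p" using assms(1) by (auto simp: prime_nat_iff)
  then show ?thesis
  proof cases
    case 1
    obtain t where t: "t \<in> Eis" "x * y = w * t" using assms(6) by (auto simp: edvd_def)
    have "y = y * (d * cnj d)" using units_mult_cnj[OF unitsI[OF d(1) 1]] by simp
    also have "\<dots> = w * (u * y * cnj d) + x * y * (v * cnj d)" unfolding d(4) by (simp add: algebra_simps)
    also have "\<dots> = w * (u * y * cnj d + t * (v * cnj d))" unfolding t(2) by (simp add: algebra_simps)
    finally have "edvd w y" by (rule edvdI[rotated]) (use d t assms(5) in blast)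
    then show ?thesis ..
  next
    case 2
    obtain u where u: "u \<in> units" "w = d * u"
      by (rule edvd_eq_unit[OF d(1) assms(2) d(5)]) (use 2 assms(1,3) in \<open>auto simp: prime_gt_0_nat\<close>)
    have "d = d * (u * cnj u)" using units_mult_cnj[OF u(1)] by simp
    also have "\<dots> = w * cnj u" unfolding u(2) by (simp add: mult.assoc)
    finally have "edvd w d" by (intro edvdI[OF Eis_cnj[OF units_Eis[OF u(1)]]])
    then show ?thesis using edvd_trans d(6) by blast
  qed
qed

text \<open>As \<open>w\<close> divides \<open>z * cnj z\<close>, either \<open>w\<close> or
  \<open>cnj w\<close> divides \<open>z\<close>. Removing this factor lowers the exponent by
  one.\<close>

lemma lattice_pts_split_subset:
  assumes "prime p" "w \<in> Eis" "enorm w = p"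
  shows "lattice_pts (p ^ a) \<subseteq> (\<lambda>(u, i). u * w ^ i * cnj w ^ (a - i)) ` (units \<times> {..a})"
proof (induction a)
  case 0
  show ?case by (auto simp: units_def image_iff)
next
  case (Suc a)
  have p0: "p > 0" using assms(1) by (simp add: prime_gt_0_nat)
  show ?case
  proof
    fix z assume "z \<in> lattice_pts (p ^ Suc a)"
    then have z: "z \<in> Eis" "enorm z = p ^ Suc a" by (auto simp: mem_lattice_pts)
    have ww: "of_nat p = w * cnj w" using complex_enorm[OF assms(2)] assms(3) by simp
    have "z * cnj z = w * (cnj w * of_nat (p ^ a))" using complex_enorm[OF z(1)] z(2) by (simp add: ww mult_ac)
    then have "edvd w (z * cnj z)" by (rule edvdI[rotated]) (use assms(2) in blast)
    then consider "edvd w z" | "edvd w (cnj z)"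
      using edvd_prime_mult[OF assms z(1) Eis_cnj[OF z(1)]] by blast
    then show "z \<in> (\<lambda>(u, i). u * w ^ i * cnj w ^ (Suc a - i)) ` (units \<times> {..Suc a})"
    proof cases
      case 1
      then obtain t where t: "t \<in> Eis" "z = w * t" by (auto simp: edvd_def)
      have "p * enorm t = p * p ^ a" using z(2) enorm_mult[OF assms(2) t(1)] assms(3) t(2) by simp
      then have "t \<in> lattice_pts (p ^ a)" using t(1) p0 by (simp add: mem_lattice_pts)
      then obtain u i where ui: "u \<in> units" "i \<le> a" "t = u * w ^ i * cnj w ^ (a - i)" using Suc by auto
      have "z = u * w ^ Suc i * cnj w ^ (Suc a - Suc i)" unfolding t(2) ui(3) by simp
      then show ?thesis using ui by (intro image_eqI[of _ _ "(u, Suc i)"]) auto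
    next
      case 2
      then obtain t' where t': "t' \<in> Eis" "cnj z = w * t'" by (auto simp: edvd_def)
      define t where "t = cnj t'"
      have t: "t \<in> Eis" "z = cnj w * t" using t' unfolding t_def by (auto, metis complex_cnj_cnj complex_cnj_mult)
      have "p * enorm t = p * p ^ a" 
        using z(2) enorm_mult[OF Eis_cnj[OF assms(2)] t(1)] assms(3) t(2) by (simp add: enorm_cnj)
      then have "t \<in> lattice_pts (p ^ a)" using t(1) p0 by (simp add: mem_lattice_pts)
      then obtain u i where ui: "u \<in> units" "i \<le> a" "t = u * w ^ i * cnj w ^ (a - i)" using Suc by auto
      have "z = u * w ^ i * cnj w ^ (Suc a - i)" unfolding t(2) ui(3) using ui(2) by (simp add: Suc_diff_le)
      then show ?thesis using ui by (intro image_eqI[of _ _ "(u, i)"]) auto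
    qed
  qed
qed

lemma finite_units [simp]: "finite units" by (simp add: units_def)

lemma card_split:
  assumes "prime p" "w \<in> Eis" "enorm w = p"
  shows "card (lattice_pts (p ^ a)) \<le> 6 * (a + 1)"
proof -
  have "card (lattice_pts (p ^ a)) \<le> card ((\<lambda>(u, i). u * w ^ i * cnj w ^ (a - i)) ` (units \<times> {..a}))"
    by (rule card_mono[OF _ lattice_pts_split_subset[OF assms]]) simp
  also have "\<dots> \<le> card (units \<times> {..a})" by (rule card_image_le) simp
  also have "\<dots> = 6 * (a + 1)" by (simp add: card_cartesian_product card_units)
  finally show ?thesis .
qed

lemma hecke_0_card: "n > 0 \<Longrightarrow> hecke 0 n = real (card (lattice_pts n)) / 6"
  by (simp add: hecke_0 rQ_eq_card)

lemma prime_mod3_cases: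
  assumes "prime (p::nat)"
  obtains "p = 3" | "p mod 3 = 1" | "p mod 3 = 2"
proof -
  have "p mod 3 = 0 \<or> p mod 3 = 1 \<or> p mod 3 = 2" by linarith
  moreover have "p = 3" if "p mod 3 = 0" 
  proof -
    have "3 dvd p" using that by presburger
    then show ?thesis using primes_dvd_imp_eq[of 3 p] assms by simp
  qed
  ultimately show ?thesis using that(1-3) by argo
qed

lemma hecke_0_prime_power_le:
  assumes "prime p" shows "hecke 0 (p ^ a) \<le> real (a + 1)"
proof -
  have "card (lattice_pts (p ^ a)) \<le> 6 * (a + 1)"
  proof (rule prime_mod3_cases[OF assms])
    assume "p = 3" then show ?thesis using card_ramified[of a] by simp
  next
    assume "p mod 3 = 1" then show ?thesis using exists_norm_prime[OF assms] card_split[OF assms] by blast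
  next
    assume "p mod 3 = 2" then show ?thesis using card_inert[OF assms, of a] by (auto split: if_splits)
  qed
  then have "real (card (lattice_pts (p ^ a))) \<le> real (6 * (a + 1))" by (rule of_nat_mono)
  then show ?thesis using prime_gt_0_nat[OF assms] by (simp add: hecke_0_card)
qed

lemma hecke_0_inert: 
  assumes "prime p" "p mod 3 = 2" shows "hecke 0 (p ^ a) \<le> (if even a then 1 else 0)"
  using card_inert[OF assms, of a] prime_gt_0_nat[OF assms(1)] by (auto simp: hecke_0_card split: if_splits)

lemma hecke_0_ramified: "hecke 0 (3 ^ a) \<le> 1"
  using card_ramified[of a] by (simp add: hecke_0_card)

lemma hecke_inert_prime: "prime p \<Longrightarrow> p mod 3 = 2 \<Longrightarrow> hecke k p = 0"
  by (simp add: hecke_def hecke_sum_def lattice_pts_inert)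

lemma lattice_pts_split_prime:
  assumes "prime p" "w \<in> Eis" "enorm w = p"
  shows "lattice_pts p = (\<lambda>u. u * w) ` units \<union> (\<lambda>u. u * cnj w) ` units"
proof
  show "lattice_pts p \<subseteq> (\<lambda>u. u * w) ` units \<union> (\<lambda>u. u * cnj w) ` units"
  proof
    fix z assume "z \<in> lattice_pts p"
    then obtain u i where ui: "u \<in> units" "i \<le> 1" "z = u * w ^ i * cnj w ^ (1 - i)"
      using lattice_pts_split_subset[OF assms, of 1] by auto
    then have "i = 0 \<or> i = 1" by linarith
    then show "z \<in> (\<lambda>u. u * w) ` units \<union> (\<lambda>u. u * cnj w) ` units" using ui by auto
  qed
  show "(\<lambda>u. u * w) ` units \<union> (\<lambda>u. u * cnj w) ` units \<subseteq> lattice_pts p"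
    using assms(2,3) by (auto simp: mem_lattice_pts enorm_mult units_Eis units_enorm Eis_cnj enorm_cnj Eis_mult)
qed

text \<open>The two primes above \<open>p\<close> are not associated. Otherwise \<open>w\<close>
  would divide its trace \<open>2 * a + b\<close>, so \<open>p\<close> would divide the trace and
  then \<open>b\<close>, and \<open>4 * p = (2 * a + b) ^ 2 + 3 * b ^ 2\<close> would be divisible
  by \<open>p ^ 2\<close>.\<close>

lemma split_disjoint:
  assumes "prime p" "p mod 3 = 1" "w \<in> Eis" "enorm w = p"
  shows "(\<lambda>u. u * w) ` units \<inter> (\<lambda>u. u * cnj w) ` units = {}"
proof (rule ccontr)
  assume "\<not> ?thesis"
  then obtain u v where uv: "u \<in> units" "v \<in> units" "u * w = v * cnj w" by auto
  obtain a b where ab: "w = of_int a + of_int b * omega" using assms(3) by (elim EisE)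
  have "cnj w = (v * cnj v) * cnj w" using units_mult_cnj[OF uv(2)] by simp
  also have "\<dots> = w * (u * cnj v)" using uv(3) by (simp add: algebra_simps)
  finally have cw: "cnj w = w * (u * cnj v)" .
  have "w + cnj w = w * (1 + u * cnj v)" unfolding cw by (simp add: algebra_simps)
  moreover have "w + cnj w = of_int (2 * a + b)" by (simp add: ab cnj_omega algebra_simps)
  ultimately have "of_int (2 * a + b) = w * (1 + u * cnj v)" by simp
  then have "edvd w (of_int (2 * a + b))"
    by (rule edvdI[OF Eis_add[OF Eis_1 Eis_mult[OF units_Eis[OF uv(1)] Eis_cnj[OF units_Eis[OF uv(2)]]]]])
  from edvd_enorm[OF this assms(3)] have "p dvd enorm (of_int (2 * a + b))" using assms(4) by simp
  then have "int p dvd (2 * a + b)\<^sup>2" using enorm_of_int[of "2 * a + b"] by (metis of_nat_dvd_iff)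
  then have d1: "int p dvd 2 * a + b" using assms(1) prime_dvd_power[of "int p"] by auto
  have Q: "int p = a\<^sup>2 + a * b + b\<^sup>2" using enorm_coords[of a b] assms(4) by (simp add: ab Qf_def)
  have eq: "4 * int p = (2 * a + b)\<^sup>2 + 3 * b\<^sup>2" unfolding Q by (simp add: power2_eq_square algebra_simps)
  have "3 * b\<^sup>2 = 4 * int p - (2 * a + b) * (2 * a + b)" using eq by (simp add: power2_eq_square)
  then have "int p dvd 3 * b\<^sup>2" using d1 by (simp add: dvd_diff)
  moreover have "\<not> int p dvd 3" 
  proof
    assume "int p dvd 3"
    then have "p dvd 3" by (metis of_nat_dvd_iff of_nat_numeral)
    then have "p = 3" using assms(1) primes_dvd_imp_eq[of p 3] by simp
    then show False using assms(2) by simp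
  qed
  ultimately have "int p dvd b\<^sup>2" using assms(1) by (metis prime_dvd_multD prime_nat_int_transfer)
  then have d2: "int p dvd b" using assms(1) prime_dvd_power[of "int p"] by auto
  have "int p * int p dvd (2 * a + b)\<^sup>2 + 3 * b\<^sup>2"
    using mult_dvd_mono[OF d1 d1] mult_dvd_mono[OF d2 d2] by (simp add: power2_eq_square)
  then have "int p * int p dvd int p * 4" using eq by (simp add: mult.commute)
  then have "int p dvd 4" using prime_gt_0_nat[OF assms(1)] by (subst (asm) dvd_mult_cancel_left) auto
  then have "p dvd 4" by (metis of_nat_dvd_iff of_nat_numeral)
  then have "p dvd 2 * 2" by simp
  then have "p dvd 2" using assms(1) prime_dvd_multD by blast
  then have "p = 2" using assms(1) primes_dvd_imp_eq[of p 2] by simp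
  then show False using assms(2) by simp
qed

text \<open>The points of norm \<open>p\<close> are the associates of \<open>w\<close> and of
  \<open>cnj w\<close>, so the single angle \<open>6 * Arg w\<close> serves all \<open>k\<close> at
  once.\<close>

lemma hecke_split_prime:
  assumes "prime p" "p mod 3 = 1"
  obtains \<phi> where "\<And>k. hecke k p = 2 * cos (real k * \<phi>)"
proof -
  obtain w where w: "w \<in> Eis" "enorm w = p" using exists_norm_prime[OF assms] by blast
  have w0: "w \<noteq> 0" using assms(1) enorm_eq_0[OF w(1)] w(2) by auto
  have "hecke k p = 2 * cos (real k * (6 * Arg w))" for k
  proof -
    have i: "inj_on (\<lambda>u. u * w) units" "inj_on (\<lambda>u. u * cnj w) units" using w0 by (auto intro!: inj_onI)
    have "hecke_sum k p = (\<Sum>z\<in>(\<lambda>u. u * w) ` units. ang k z) + (\<Sum>z\<in>(\<lambda>u. u * cnj w) ` units. ang k z)"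
      unfolding hecke_sum_def lattice_pts_split_prime[OF assms(1) w]
      by (rule sum.union_disjoint) (use split_disjoint[OF assms w] in auto)
    also have "\<dots> = (\<Sum>u\<in>units. ang k w) + (\<Sum>u\<in>units. ang k (cnj w))"
      by (simp add: sum.reindex[OF i(1)] sum.reindex[OF i(2)] ang_mult ang_unit)
    also have "\<dots> = 6 * (ang k w + cnj (ang k w))" by (simp add: card_units ang_cnj)
    finally have "hecke k p = 2 * Re (ang k w)" by (simp add: hecke_def)
    moreover have "ang k w = cis (real (6 * k) * Arg w)" 
      using cis_Arg[OF w0] by (simp add: ang_def Complex.DeMoivre flip: \<open>cis (Arg w) = sgn w\<close>)
    ultimately show ?thesis by (simp add: mult_ac)
  qed
  then show ?thesis using that by blast
qed

text \<open>Holds for each point separately, as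
  \<open>3 + 4 * cos x + cos (2 * x) = 2 * (1 + cos x) ^ 2\<close>.\<close>

lemma hecke_3_4_1:
  assumes "n > 0" shows "3 * hecke 0 n + 4 * hecke k n + hecke (2 * k) n \<ge> 0"
proof -
  have S0: "Re (hecke_sum 0 n) = real (card (lattice_pts n))" using assms by (simp add: hecke_sum_0)
  have "6 * (3 * hecke 0 n + 4 * hecke k n + hecke (2 * k) n) = (\<Sum>z\<in>lattice_pts n. 3 + 4 * Re (ang k z) + Re (ang (2 * k) z))"
    unfolding hecke_def S0 by (simp add: hecke_sum_def sum.distrib flip: sum_distrib_left)
  also have "\<dots> \<ge> 0"
  proof (rule sum_nonneg)
    fix z assume "z \<in> lattice_pts n"
    then have "cmod (ang k z) = 1" using lattice_pts_nonzero[OF assms] norm_ang by blast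
    then have 1: "(Re (ang k z))\<^sup>2 + (Im (ang k z))\<^sup>2 = 1" by (metis cmod_power2 one_power2)
    have "ang (2 * k) z = (ang k z)\<^sup>2" by (simp add: ang_def mult_ac flip: power_mult)
    then have "3 + 4 * Re (ang k z) + Re (ang (2 * k) z) = 2 * (1 + Re (ang k z))\<^sup>2"
      using 1 by (simp add: power2_eq_square algebra_simps)
    then show "3 + 4 * Re (ang k z) + Re (ang (2 * k) z) \<ge> 0" by simp
  qed
  finally show ?thesis by simp
qed

section \<open>Mean values of multiplicative functions\<close>

text \<open>The value at 0 is left free, which is why \<open>euler_product\<close> asks for
  \<open>F 0 = 0\<close>.\<close>

definition mult_fn :: "(nat \<Rightarrow> real) \<Rightarrow> bool" where
  "mult_fn F \<longleftrightarrow> F 1 = 1 \<and> (\<forall>m n. coprime m n \<longrightarrow> m > 0 \<longrightarrow> n > 0 \<longrightarrow> F (m * n) = F m * F n)"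

lemma mult_fnD: "mult_fn F \<Longrightarrow> coprime m n \<Longrightarrow> m > 0 \<Longrightarrow> n > 0 \<Longrightarrow> F (m * n) = F m * F n"
  by (auto simp: mult_fn_def)

lemma mult_fn_1: "mult_fn F \<Longrightarrow> F 1 = 1"
  by (auto simp: mult_fn_def)

lemma mult_fn_powr:
  assumes "mult_fn f" shows "mult_fn (\<lambda>n. f n * real n powr - x)"
  using assms by (auto simp: mult_fn_def powr_mult)

section \<open>Euler products\<close>

definition smooth :: "nat set \<Rightarrow> nat set" where
  "smooth A = {n. n > 0 \<and> prime_factors n \<subseteq> A}"

lemma smooth_pos: "n \<in> smooth A \<Longrightarrow> n > 0" by (simp add: smooth_def)

lemma smooth_empty: "smooth {} = {1}"
  by (auto simp: smooth_def prime_factorization_empty_iff dest: )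

lemma smooth_coprime:
  assumes "prime p" "p \<notin> A" "n \<in> smooth A" shows "coprime (p ^ a) n"
proof -
  have "\<not> p dvd n" using assms by (auto simp: smooth_def in_prime_factors_iff subset_eq)
  then show ?thesis using assms(1) by (simp add: prime_imp_coprime)
qed

text \<open>Splitting off the exact power of \<open>p\<close>: the induction step of the finite
  Euler product.\<close>

lemma smooth_insert_bij:
  assumes "prime p" "p \<notin> A"
  shows "bij_betw (\<lambda>(a, n). p ^ a * n) (UNIV \<times> smooth A) (smooth (insert p A))"
proof (rule bij_betwI')
  fix x y :: "nat \<times> nat" assume xy: "x \<in> UNIV \<times> smooth A" "y \<in> UNIV \<times> smooth A"
  obtain a n b m where x: "x = (a, n)" "y = (b, m)" by (cases x, cases y)
  have nm: "\<not> p dvd n" "\<not> p dvd m" "n > 0" "m > 0" 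
    using xy x assms by (auto simp: smooth_def in_prime_factors_iff subset_eq)
  have mu: "multiplicity p (p ^ a * n) = a" "multiplicity p (p ^ b * m) = b"
    using assms(1) nm by (simp_all add: multiplicity_times_same prime_elem_multiplicity_mult_distrib not_dvd_imp_multiplicity_0)
  show "((case x of (a, n) \<Rightarrow> p ^ a * n) = (case y of (a, n) \<Rightarrow> p ^ a * n)) = (x = y)"
    using mu prime_gt_0_nat[OF assms(1)] by (auto simp: x)
next
  fix x :: "nat \<times> nat" assume x: "x \<in> UNIV \<times> smooth A"
  obtain a n where xe: "x = (a, n)" by (cases x)
  have n: "n > 0" "prime_factors n \<subseteq> A" using x by (auto simp: xe smooth_def)
  have "q \<in> insert p A" if "q \<in> prime_factors (p ^ a * n)" for q
  proof -
    have q: "prime q" "q dvd p ^ a * n" using that by (auto simp: in_prime_factors_iff)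
    then consider "q dvd p ^ a" | "q dvd n" using prime_dvd_multD by blast
    then show ?thesis
    proof cases
      case 1
      then have "q dvd p" using q(1) prime_dvd_power by blast
      then show ?thesis using primes_dvd_imp_eq[OF q(1) assms(1)] by simp
    next
      case 2
      then have "q \<in> prime_factors n" using q(1) n(1) by (simp add: in_prime_factors_iff)
      then show ?thesis using n(2) by blast
    qed
  qed
  then show "(case x of (a, n) \<Rightarrow> p ^ a * n) \<in> smooth (insert p A)" 
    using n(1) prime_gt_0_nat[OF assms(1)] by (auto simp: xe smooth_def)
next
  fix n assume n: "n \<in> smooth (insert p A)"
  have n0: "n \<noteq> 0" using n by (auto simp: smooth_def)
  obtain m where m: "n = p ^ multiplicity p n * m" "\<not> p dvd m" 
    using multiplicity_decompose'[of n p] n0 assms(1) by (metis not_prime_unit)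
  have "m > 0" using m n0 by (cases m) auto
  moreover have "prime_factors m \<subseteq> A"
  proof
    fix q assume q: "q \<in> prime_factors m"
    then have "q \<in> prime_factors n" using m(1) n0 by (metis dvd_mult in_prime_factors_iff)
    then have "q \<in> insert p A" using n by (auto simp: smooth_def)
    then show "q \<in> A" using q m(2) by (auto simp: in_prime_factors_iff)
  qed
  ultimately show "\<exists>x\<in>UNIV \<times> smooth A. n = (case x of (a, n) \<Rightarrow> p ^ a * n)"
    using m(1) by (intro bexI[of _ "(multiplicity p n, m)"]) (auto simp: smooth_def)
qed

lemma euler_finite:
  fixes F :: "nat \<Rightarrow> real"
  assumes "mult_fn F" "(\<lambda>n. \<bar>F n\<bar>) summable_on UNIV" "finite A" "\<And>p. p \<in> A \<Longrightarrow> prime p"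
  shows "infsum F (smooth A) = (\<Prod>p\<in>A. \<Sum>\<^sub>\<infinity>a. F (p ^ a))"
  using assms(3,4)
proof (induction A rule: finite_induct)
  case empty
  then show ?case using mult_fn_1[OF assms(1)] by (simp add: smooth_empty)
next
  case (insert p A)
  have p: "prime p" using insert by simp
  note bij = smooth_insert_bij[OF p insert(2)]
  have Fs: "F summable_on smooth (insert p A)"
    by (rule summable_on_subset_banach[OF abs_summable_summable]) (use assms(2) in auto)
  have eq: "F (case x of (a, n) \<Rightarrow> p ^ a * n) = (\<lambda>(a, n). F (p ^ a) * F n) x" if "x \<in> UNIV \<times> smooth A" for x
    using that mult_fnD[OF assms(1) smooth_coprime[OF p insert(2)]] prime_gt_0_nat[OF p] smooth_pos by auto
  have "infsum F (smooth (insert p A)) = (\<Sum>\<^sub>\<infinity>x\<in>UNIV \<times> smooth A. F (case x of (a, n) \<Rightarrow> p ^ a * n))"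
    using infsum_reindex_bij_betw[OF bij, of F] by simp
  also have "\<dots> = (\<Sum>\<^sub>\<infinity>x\<in>UNIV \<times> smooth A. (\<lambda>(a, n). F (p ^ a) * F n) x)"
    using eq by (intro infsum_cong) auto
  also have "\<dots> = (\<Sum>\<^sub>\<infinity>a. \<Sum>\<^sub>\<infinity>n\<in>smooth A. F (p ^ a) * F n)"
  proof (rule infsum_Sigma'_banach[symmetric])
    have "(\<lambda>x. F (case x of (a, n) \<Rightarrow> p ^ a * n)) summable_on UNIV \<times> smooth A"
      using summable_on_reindex_bij_betw[OF bij, of F] Fs by simp
    then show "(\<lambda>(a, n). F (p ^ a) * F n) summable_on UNIV \<times> smooth A"
      by (subst (asm) summable_on_cong[where g = "\<lambda>(a, n). F (p ^ a) * F n"]) (rule eq)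
  qed
  also have "\<dots> = (\<Sum>\<^sub>\<infinity>a. F (p ^ a)) * infsum F (smooth A)"
    by (simp add: infsum_cmult_right' infsum_cmult_left')
  finally show ?case using insert by simp
qed

text \<open>Every positive number up to \<open>N\<close> has only prime factors up to
  \<open>N\<close>, so the finite product differs from the full sum by at most a tail of the series
  of absolute values.\<close>

lemma euler_product:
  fixes F :: "nat \<Rightarrow> real"
  assumes "mult_fn F" "(\<lambda>n. \<bar>F n\<bar>) summable_on UNIV" "F 0 = 0"
  shows "(\<lambda>N. \<Prod>p | prime p \<and> p \<le> N. \<Sum>\<^sub>\<infinity>a. F (p ^ a)) \<longlonglongrightarrow> infsum F UNIV"
proof -
  have Fs: "F summable_on A" for A
    by (rule summable_on_subset_banach[OF abs_summable_summable]) (use assms(2) in auto)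
  have Fa: "(\<lambda>n. \<bar>F n\<bar>) summable_on A" for A
    by (rule summable_on_subset_banach[OF assms(2)]) auto
  define P where "P N = {p::nat. prime p \<and> p \<le> N}" for N
  have fin: "finite (P N)" for N unfolding P_def by (rule finite_subset[of _ "{..N}"]) auto
  have sub: "{0<..N} \<subseteq> smooth (P N)" for N
    by (auto simp: smooth_def P_def in_prime_factors_iff intro: le_trans[OF dvd_imp_le])
  have lim: "(\<lambda>N. \<Sum>n\<le>N. \<bar>F n\<bar>) \<longlonglongrightarrow> (\<Sum>\<^sub>\<infinity>n. \<bar>F n\<bar>)"
    using has_sum_imp_sums[OF has_sum_infsum[OF assms(2)]] sums_def_le by blast
  have le: "norm (infsum F UNIV - infsum F (smooth (P N))) \<le> (\<Sum>\<^sub>\<infinity>n. \<bar>F n\<bar>) - (\<Sum>n\<le>N. \<bar>F n\<bar>)" for N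
  proof -
    have "infsum F UNIV - infsum F (smooth (P N)) = infsum F (UNIV - smooth (P N))"
      by (rule infsum_Diff[symmetric]) (use Fs in auto)
    also have "norm \<dots> \<le> infsum (\<lambda>n. norm (F n)) (UNIV - smooth (P N))"
      by (rule norm_infsum_bound) (use Fa in simp)
    also have "\<dots> \<le> infsum (\<lambda>n. norm (F n)) (UNIV - {..N})"
    proof (rule infsum_mono_neutral)
      fix n assume "n \<in> (UNIV - smooth (P N)) - (UNIV - {..N})"
      then have "n = 0" using sub[of N] by (cases n) auto
      then show "norm (F n) \<le> 0" using assms(3) by simp
    qed (use Fa in auto)
    also have "\<dots> = (\<Sum>\<^sub>\<infinity>n. \<bar>F n\<bar>) - (\<Sum>n\<le>N. \<bar>F n\<bar>)"
      using Fa by (subst infsum_Diff) auto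
    finally show ?thesis .
  qed
  have to0: "(\<lambda>N. (\<Sum>\<^sub>\<infinity>n. \<bar>F n\<bar>) - (\<Sum>n\<le>N. \<bar>F n\<bar>)) \<longlonglongrightarrow> 0"
    using tendsto_diff[OF tendsto_const lim, of "\<Sum>\<^sub>\<infinity>n. \<bar>F n\<bar>"] by simp
  have "(\<lambda>N. infsum F UNIV - infsum F (smooth (P N))) \<longlonglongrightarrow> 0"
    by (rule Lim_null_comparison[OF always_eventually[OF allI[OF le]] to0])
  then have "(\<lambda>N. infsum F (smooth (P N))) \<longlonglongrightarrow> infsum F UNIV"
    using tendsto_diff[OF tendsto_const[of "infsum F UNIV"], of "\<lambda>N. infsum F UNIV - infsum F (smooth (P N))" 0 sequentially] by simp
  moreover have "infsum F (smooth (P N)) = (\<Prod>p\<in>P N. \<Sum>\<^sub>\<infinity>a. F (p ^ a))" for N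
    by (rule euler_finite[OF assms(1,2) fin]) (auto simp: P_def)
  ultimately show ?thesis by (simp add: P_def)
qed

definition primesum :: "(nat \<Rightarrow> real) \<Rightarrow> real" where
  "primesum F = (\<Sum>\<^sub>\<infinity>p\<in>{p. prime p}. F p)"

lemma sum_inverse_squares_le: "(\<Sum>n=1..N. 1 / real n ^ 2) \<le> 2 - 1 / real N" if "N > 0"
  using that
proof (induction N rule: nat_induct_non_zero)
  case 1
  show ?case by simp
next
  case (Suc N)
  have "(\<Sum>n=1..Suc N. 1 / real n ^ 2) \<le> 2 - 1 / real N + 1 / real (Suc N) ^ 2"
    using Suc by simp
  also have "\<dots> \<le> 2 - 1 / real (Suc N)"
  proof -
    have "1 / real (Suc N) ^ 2 \<le> 1 / (real N * real (Suc N))" 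
      using Suc(1) by (intro divide_left_mono) (auto simp: power2_eq_square)
    also have "\<dots> = 1 / real N - 1 / real (Suc N)" using Suc(1) by (simp add: field_simps)
    finally show ?thesis by simp
  qed
  finally show ?case .
qed

lemma sum_prime_squares_le: "(\<Sum>p | prime p \<and> p \<le> N. 1 / real p ^ 2) \<le> 2"
proof (cases "N = 0")
  case True
  then have "{p. prime p \<and> p \<le> N} = {}" by auto
  then show ?thesis by (simp only: sum.empty)
next
  case False
  have "(\<Sum>p | prime p \<and> p \<le> N. 1 / real p ^ 2) \<le> (\<Sum>n=1..N. 1 / real n ^ 2)"
    by (rule sum_mono2) (auto simp: Suc_le_eq prime_gt_0_nat)
  also have "\<dots> \<le> 2 - 1 / real N" using False sum_inverse_squares_le by simp
  also have "\<dots> \<le> 2" by simp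
  finally show ?thesis .
qed

lemma primesum_tendsto:
  fixes F :: "nat \<Rightarrow> real"
  assumes "(\<lambda>n. \<bar>F n\<bar>) summable_on UNIV"
  shows "(\<lambda>N. \<Sum>p | prime p \<and> p \<le> N. F p) \<longlonglongrightarrow> primesum F"
proof -
  define G where "G n = (if prime n then F n else 0)" for n
  have "F summable_on {p. prime p}" 
    by (rule summable_on_subset_banach[OF abs_summable_summable]) (use assms in auto)
  then have "(F has_sum primesum F) {p. prime p}" unfolding primesum_def by (rule has_sum_infsum)
  then have "(G has_sum primesum F) UNIV"
    by (rule has_sum_cong_neutral[THEN iffD1, rotated -1]) (auto simp: G_def)
  then have "(\<lambda>N. \<Sum>n\<le>N. G n) \<longlonglongrightarrow> primesum F" using has_sum_imp_sums sums_def_le by blast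
  moreover have "(\<Sum>n\<le>N. G n) = (\<Sum>p | prime p \<and> p \<le> N. F p)" for N
    unfolding G_def sum.If_cases[OF finite_atMost] by (simp, intro sum.cong) auto
  ultimately show ?thesis by simp
qed

text \<open>Passes from a Dirichlet series to the sum of its terms at primes without taking the
  logarithm of a series. The 2 in the conclusion bounds the sum of \<open>1 / p ^ 2\<close>.\<close>

lemma euler_upper:
  fixes F :: "nat \<Rightarrow> real"
  assumes "mult_fn F" "(\<lambda>n. \<bar>F n\<bar>) summable_on UNIV" "F 0 = 0" "K \<ge> 0"
  and "\<And>p. prime p \<Longrightarrow> 0 \<le> (\<Sum>\<^sub>\<infinity>a. F (p ^ a))"
  and "\<And>p. prime p \<Longrightarrow> (\<Sum>\<^sub>\<infinity>a. F (p ^ a)) \<le> exp (F p + K / real p ^ 2)"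
  shows "infsum F UNIV \<le> exp (primesum F + 2 * K)"
proof (rule LIMSEQ_le[OF euler_product[OF assms(1-3)]])
  show "(\<lambda>N. exp ((\<Sum>p | prime p \<and> p \<le> N. F p) + 2 * K)) \<longlonglongrightarrow> exp (primesum F + 2 * K)"
    by (intro tendsto_intros primesum_tendsto assms)
  have "(\<Prod>p | prime p \<and> p \<le> N. \<Sum>\<^sub>\<infinity>a. F (p ^ a)) \<le> exp ((\<Sum>p | prime p \<and> p \<le> N. F p) + 2 * K)" for N
  proof -
    have "(\<Prod>p | prime p \<and> p \<le> N. \<Sum>\<^sub>\<infinity>a. F (p ^ a)) \<le> (\<Prod>p | prime p \<and> p \<le> N. exp (F p + K / real p ^ 2))"
      by (intro prod_mono) (use assms in auto)
    also have "\<dots> = exp ((\<Sum>p | prime p \<and> p \<le> N. F p) + K * (\<Sum>p | prime p \<and> p \<le> N. 1 / real p ^ 2))"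
      by (simp add: exp_sum[symmetric] sum.distrib sum_distrib_left)
    also have "\<dots> \<le> exp ((\<Sum>p | prime p \<and> p \<le> N. F p) + 2 * K)"
      using mult_left_mono[OF sum_prime_squares_le[of N] assms(4)] by simp
    finally show ?thesis .
  qed
  then show "\<exists>N. \<forall>n\<ge>N. (\<Prod>p | prime p \<and> p \<le> n. \<Sum>\<^sub>\<infinity>a. F (p ^ a)) \<le> exp ((\<Sum>p | prime p \<and> p \<le> n. F p) + 2 * K)"
    by blast
qed

lemma euler_lower:
  fixes F :: "nat \<Rightarrow> real"
  assumes "mult_fn F" "(\<lambda>n. \<bar>F n\<bar>) summable_on UNIV" "F 0 = 0" "K \<ge> 0"
  and "\<And>p. prime p \<Longrightarrow> (\<Sum>\<^sub>\<infinity>a. F (p ^ a)) \<ge> exp (F p - K / real p ^ 2)"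
  shows "infsum F UNIV \<ge> exp (primesum F - 2 * K)"
proof (rule LIMSEQ_le[OF _ euler_product[OF assms(1-3)]])
  show "(\<lambda>N. exp ((\<Sum>p | prime p \<and> p \<le> N. F p) - 2 * K)) \<longlonglongrightarrow> exp (primesum F - 2 * K)"
    by (intro tendsto_intros primesum_tendsto assms)
  have "(\<Prod>p | prime p \<and> p \<le> N. \<Sum>\<^sub>\<infinity>a. F (p ^ a)) \<ge> exp ((\<Sum>p | prime p \<and> p \<le> N. F p) - 2 * K)" for N
  proof -
    have "exp ((\<Sum>p | prime p \<and> p \<le> N. F p) - 2 * K) \<le> exp ((\<Sum>p | prime p \<and> p \<le> N. F p) - K * (\<Sum>p | prime p \<and> p \<le> N. 1 / real p ^ 2))"
      using mult_left_mono[OF sum_prime_squares_le[of N] assms(4)] by simp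
    also have "\<dots> = (\<Prod>p | prime p \<and> p \<le> N. exp (F p - K / real p ^ 2))"
      by (simp add: exp_sum[symmetric] sum_subtractf sum_distrib_left)
    also have "\<dots> \<le> (\<Prod>p | prime p \<and> p \<le> N. \<Sum>\<^sub>\<infinity>a. F (p ^ a))"
      by (intro prod_mono) (use assms in auto)
    finally show ?thesis .
  qed
  then show "\<exists>N. \<forall>n\<ge>N. exp ((\<Sum>p | prime p \<and> p \<le> n. F p) - 2 * K) \<le> (\<Prod>p | prime p \<and> p \<le> n. \<Sum>\<^sub>\<infinity>a. F (p ^ a))"
    by blast
qed

lemma ln_prime_nonneg: "prime p \<Longrightarrow> ln (real p) \<ge> 0"
  using prime_gt_0_nat[of p] by simp

lemma geom2_sums: 
  fixes x :: real assumes "0 \<le> x" "x < 1"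
  shows "(\<lambda>a. real (a + 1) * x ^ a) sums (1 / (1 - x)\<^sup>2)"
  using geometric_deriv_sums[of x] assms by simp

lemma infsum_sums_shift2:
  fixes G :: "nat \<Rightarrow> real"
  assumes "G sums E"
  shows "(\<lambda>a. G (a + 2)) sums (E - G 0 - G 1)"
  using assms sums_iff_shift[of G 2 "E - G 0 - G 1"] by (simp add: numeral_2_eq_2)

text \<open>With \<open>x = 1 / p\<close> the terms are dominated by those of
  \<open>1 / (1 - x) ^ 2\<close>, and the part from the second power on is at most
  \<open>3 * x ^ 2 / (1 - x) ^ 2\<close>; the 12 comes from \<open>x \<le> 1/2\<close>. From 7 on
  the same majorant keeps the factor away from 0.\<close>

lemma local_factor_bounds:
  fixes F :: "nat \<Rightarrow> real"
  assumes "prime p" "F 1 = 1" "\<And>a. \<bar>F (p ^ a)\<bar> \<le> real (a + 1) / real p ^ a"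
  shows "\<bar>(\<Sum>\<^sub>\<infinity>a. F (p ^ a)) - 1 - F p\<bar> \<le> 12 / real p ^ 2"
    and "p \<ge> 7 \<Longrightarrow> (\<Sum>\<^sub>\<infinity>a. F (p ^ a)) \<ge> 1/2"
proof -
  define x where "x = 1 / real p"
  have x: "0 < x" "x \<le> 1/2" using prime_ge_2_nat[OF assms(1)] by (auto simp: x_def field_simps)
  have b: "\<bar>F (p ^ a)\<bar> \<le> real (a + 1) * x ^ a" for a
    using assms(3)[of a] by (simp add: x_def power_divide)
  have S: "(\<lambda>a. real (a + 1) * x ^ a) sums (1 / (1 - x)\<^sup>2)" using geom2_sums[of x] x by simp
  have "summable (\<lambda>a. norm (F (p ^ a)))"
    by (rule summable_comparison_test'[OF sums_summable[OF S], of 0]) (use b in simp)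
  then have E: "(\<lambda>a. F (p ^ a)) sums (\<Sum>\<^sub>\<infinity>a. F (p ^ a))"
    by (intro has_sum_imp_sums has_sum_infsum norm_summable_imp_summable_on)
  define E where "E = (\<Sum>\<^sub>\<infinity>a. F (p ^ a))"
  have "norm (E - F (p ^ 0) - F (p ^ 1)) \<le> 1 / (1 - x)\<^sup>2 - real (0 + 1) * x ^ 0 - real (1 + 1) * x ^ 1"
    unfolding E_def
    by (rule norm_sums_le[OF infsum_sums_shift2[OF E] infsum_sums_shift2[OF S]]) (simp only: real_norm_def b)
  then have 1: "\<bar>E - 1 - F p\<bar> \<le> 1 / (1 - x)\<^sup>2 - 1 - 2 * x" using assms(2) by simp
  have "1 / (1 - x)\<^sup>2 - 1 - 2 * x = x\<^sup>2 * (3 - 2 * x) / (1 - x)\<^sup>2" 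

  proof -
    have "1 = (1 - x)\<^sup>2 * (1 + 2 * x) + x\<^sup>2 * (3 - 2 * x)" by (simp add: power2_eq_square algebra_simps)
    moreover have "(1 - x)\<^sup>2 \<noteq> 0" using x by simp
    ultimately show ?thesis by (smt (verit, ccfv_threshold) add_divide_distrib nonzero_mult_div_cancel_left)
  qed
  also have "\<dots> \<le> x\<^sup>2 * 3 / (1/2)\<^sup>2"
    using x by (intro frac_le mult_left_mono power_mono) auto
  also have "\<dots> = 12 / real p ^ 2" by (simp add: x_def power2_eq_square)
  finally show "\<bar>(\<Sum>\<^sub>\<infinity>a. F (p ^ a)) - 1 - F p\<bar> \<le> 12 / real p ^ 2" using 1 by (simp add: E_def)
  assume "p \<ge> 7"
  then have x7: "x \<le> 1/7" by (auto simp: x_def field_simps)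
  have "\<bar>F p\<bar> \<le> 2 * x" using b[of 1] by simp
  then have "\<bar>E - 1\<bar> \<le> 1 / (1 - x)\<^sup>2 - 1" using 1 by linarith
  also have "\<dots> \<le> 1 / (6/7)\<^sup>2 - 1" using x x7 by (intro diff_right_mono frac_le power_mono) auto
  finally have "\<bar>E - 1\<bar> \<le> 1/2" by (simp add: power2_eq_square)
  then show "(\<Sum>\<^sub>\<infinity>a. F (p ^ a)) \<ge> 1/2" unfolding E_def by linarith
qed

text \<open>At the primes below 7 the bound \<open>a + 1\<close> for the coefficients does not
  exclude a vanishing local factor. These primes do not split, so coefficients at most 1 in absolute
  value may be assumed; at 2 the linear term has to vanish as well.\<close>

lemma local_factor_bound_geometric:
  fixes F :: "nat \<Rightarrow> real"
  assumes "prime p" "F 1 = 1" "\<And>a. \<bar>F (p ^ a)\<bar> \<le> 1 / real p ^ a" "p \<ge> 3 \<or> F p = 0"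
  shows "(\<Sum>\<^sub>\<infinity>a. F (p ^ a)) \<ge> 1/2"
proof -
  define x where "x = 1 / real p"
  have x: "0 < x" "x \<le> 1/2" using prime_ge_2_nat[OF assms(1)] by (auto simp: x_def field_simps)
  have b: "\<bar>F (p ^ a)\<bar> \<le> x ^ a" for a
    using assms(3)[of a] by (simp add: x_def power_divide)
  have S: "(\<lambda>a. x ^ a) sums (1 / (1 - x))" using geometric_sums[of x] x by simp
  have "summable (\<lambda>a. norm (F (p ^ a)))"
    by (rule summable_comparison_test'[OF sums_summable[OF S], of 0]) (use b in simp)
  then have E: "(\<lambda>a. F (p ^ a)) sums (\<Sum>\<^sub>\<infinity>a. F (p ^ a))"
    by (intro has_sum_imp_sums has_sum_infsum norm_summable_imp_summable_on)
  define E where "E = (\<Sum>\<^sub>\<infinity>a. F (p ^ a))"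
  have "norm (E - F (p ^ 0) - F (p ^ 1)) \<le> 1 / (1 - x) - x ^ 0 - x ^ 1"
    unfolding E_def
    by (rule norm_sums_le[OF infsum_sums_shift2[OF E] infsum_sums_shift2[OF S]]) (simp only: real_norm_def b)
  then have 1: "\<bar>E - 1 - F p\<bar> \<le> 1 / (1 - x) - 1 - x" using assms(2) by simp
  have Fp: "\<bar>F p\<bar> \<le> x" using b[of 1] by simp
  show ?thesis
  proof (cases "F p = 0")
    case True
    have "1 / (1 - x) - 1 - x = x * x / (1 - x)" using x by (simp add: field_simps)
    also have "\<dots> \<le> (1/2 * (1/2)) / (1/2)" using x by (intro frac_le mult_mono) auto
    finally have "\<bar>E - 1 - F p\<bar> \<le> 1/2" using 1 by simp
    then show ?thesis using True unfolding E_def by linarith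
  next
    case False
    then have "x \<le> 1/3" using assms(4) by (auto simp: x_def field_simps)
    then have "1 / (1 - x) \<le> 1 / (2/3)" by (intro frac_le) auto
    then have "1 / (1 - x) \<le> 3/2" by simp
    then show ?thesis using 1 Fp unfolding E_def by linarith
  qed
qed

lemma local_factor_upper:
  fixes F :: "nat \<Rightarrow> real"
  assumes "prime p" "F 1 = 1" "\<And>a. \<bar>F (p ^ a)\<bar> \<le> real (a + 1) / real p ^ a"
  shows "(\<Sum>\<^sub>\<infinity>a. F (p ^ a)) \<le> exp (F p + 12 / real p ^ 2)"
proof -
  have "(\<Sum>\<^sub>\<infinity>a. F (p ^ a)) \<le> 1 + (F p + 12 / real p ^ 2)" using local_factor_bounds(1)[OF assms] by linarith
  then show ?thesis using exp_ge_add_one_self order_trans by blast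
qed

text \<open>Two ranges. For \<open>p < 12\<close> the constant 300 pushes the exponent below -1, so
  that the lower bound 1/2 for the factor suffices. From 12 on, \<open>F p\<close> is small enough
  for the second-order estimate of \<open>ln (1 + u)\<close>.\<close>

lemma local_factor_lower:
  fixes F :: "nat \<Rightarrow> real"
  assumes "prime p" "F 1 = 1" "\<And>a. \<bar>F (p ^ a)\<bar> \<le> real (a + 1) / real p ^ a"
    and "p < 7 \<Longrightarrow> (\<Sum>\<^sub>\<infinity>a. F (p ^ a)) \<ge> 1/2"
  shows "(\<Sum>\<^sub>\<infinity>a. F (p ^ a)) \<ge> exp (F p - 300 / real p ^ 2)"
proof -
  define E where "E = (\<Sum>\<^sub>\<infinity>a. F (p ^ a))"
  have p2: "p \<ge> 2" using prime_ge_2_nat[OF assms(1)] .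
  have Eh: "E \<ge> 1/2" using assms(4) local_factor_bounds(2)[OF assms(1-3)] unfolding E_def by force
  have E1: "\<bar>E - 1 - F p\<bar> \<le> 12 / real p ^ 2" unfolding E_def by (rule local_factor_bounds(1)[OF assms(1-3)])
  have Fp: "\<bar>F p\<bar> \<le> 2 / real p" using assms(3)[of 1] by simp
  show ?thesis
  proof (cases "p < 12")
    case True
    have "2 / real p \<le> 1" using p2 by simp
    moreover have "real p ^ 2 \<le> 12 ^ 2" using True by (intro power_mono) auto
    then have "300 / real p ^ 2 \<ge> 300 / 12 ^ 2" using p2 by (intro divide_left_mono) auto
    ultimately have "F p - 300 / real p ^ 2 \<le> -1" using Fp by (simp add: power2_eq_square)
    then have "exp (F p - 300 / real p ^ 2) \<le> exp (-1)" by simp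
    also have "exp (-1) \<le> (1/2 :: real)" 
      using exp_ge_add_one_self[of "1::real"] by (simp add: exp_minus field_simps)
    finally show ?thesis using Eh by (simp add: E_def)
  next
    case False
    define u where "u = F p - 12 / real p ^ 2"
    have "12 / real p ^ 2 \<le> 1 / real p" using False by (simp add: power2_eq_square field_simps)
    then have u: "\<bar>u\<bar> \<le> 3 / real p" 
    proof -
      have "\<bar>F p\<bar> \<le> 2 * (1 / real p)" "12 / real p ^ 2 \<ge> 0" using Fp by simp_all
      then have "\<bar>u\<bar> \<le> 3 * (1 / real p)" using \<open>12 / real p ^ 2 \<le> 1 / real p\<close> unfolding u_def by linarith
      then show ?thesis by simp
    qed
    also have "3 / real p \<le> 1/2" using False by (simp add: field_simps)
    finally have uh: "\<bar>u\<bar> \<le> 1/2" .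
    have "u\<^sup>2 \<le> (3 / real p)\<^sup>2" using u power_mono[OF u, of 2] by simp
    then have u2: "2 * u\<^sup>2 \<le> 18 / real p ^ 2" by (simp add: power_divide)
    have "ln (1 + u) \<ge> u - 2 * u\<^sup>2" using abs_ln_one_plus_x_minus_x_bound[OF uh] by linarith
    moreover have "F p - 300 / real p ^ 2 \<le> u - 18 / real p ^ 2" unfolding u_def by (simp add: field_simps)
    ultimately have "F p - 300 / real p ^ 2 \<le> ln (1 + u)" using u2 by linarith
    then have "exp (F p - 300 / real p ^ 2) \<le> exp (ln (1 + u))" by simp
    also have "\<dots> = 1 + u" using uh by simp
    also have "\<dots> \<le> E" using E1 unfolding u_def by linarith
    finally show ?thesis by (simp add: E_def)
  qed
qed

section \<open>Chebyshev's bound and weighted sums over prime powers\<close>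

lemma prod_primes_dvd:
  assumes "finite A" "\<And>p. p \<in> A \<Longrightarrow> prime p" "\<And>p. p \<in> A \<Longrightarrow> p dvd (n::nat)"
  shows "\<Prod>A dvd n"
  using assms
proof (induction A rule: finite_induct)
  case (insert p A)
  have "coprime p (\<Prod>A)"
  proof (rule prod_coprime_right)
    fix q assume "q \<in> A"
    then show "coprime p q" using insert by (intro primes_coprime) auto
  qed
  then show ?case using insert by (simp add: divides_mult)
qed simp

definition theta :: "nat \<Rightarrow> real" where "theta N = (\<Sum>p | prime p \<and> p \<le> N. ln (real p))"

lemma finite_primes_le [simp]: "finite {p::nat. prime p \<and> p \<le> N}"
  by (rule finite_subset[of _ "{..N}"]) auto

text \<open>The two middle coefficients are equal, and together they are at most
  \<open>2 ^ (2 * m + 1)\<close>.\<close>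

lemma binomial_odd_le: "(2 * m + 1) choose m \<le> 4 ^ m"
proof -
  have "2 * ((2 * m + 1) choose m) = ((2 * m + 1) choose m) + ((2 * m + 1) choose (m + 1))"
    using binomial_symmetric[of m "2 * m + 1"] by simp
  also have "\<dots> = (\<Sum>k\<in>{m, m + 1}. (2 * m + 1) choose k)" by simp
  also have "\<dots> \<le> (\<Sum>k\<le>2 * m + 1. (2 * m + 1) choose k)" by (rule sum_mono2) auto
  also have "\<dots> = 2 * 4 ^ m" unfolding choose_row_sum by (simp add: power_mult)
  finally show ?thesis by simp
qed

text \<open>Erdos's argument: the primes with \<open>m + 1 < p \<le> 2 * m + 1\<close> all divide
  the binomial coefficient \<open>(2 * m + 1) choose m\<close>, which is at most
  \<open>4 ^ m\<close>. An even \<open>N > 2\<close> adds no prime.\<close>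

lemma theta_le: "theta N \<le> real N * ln 4"
proof (induction N rule: less_induct)
  case (less N)
  consider "N \<le> 1" | "N = 2" | "N > 2" "even N" | "N > 2" "odd N"
  proof -
    have "N \<le> 1 \<or> N = 2 \<or> N > 2" by linarith
    then show ?thesis using that by blast
  qed
  then show ?case
  proof cases
    case 1
    have "\<not> (prime p \<and> p \<le> N)" for p using 1 prime_ge_2_nat[of p] by linarith
    then have "{p. prime p \<and> p \<le> N} = {}" by blast
    then show ?thesis unfolding theta_def by (simp only: sum.empty) simp
  next
    case 2
    have "{p::nat. prime p \<and> p \<le> 2} = {2}"
    proof (intro equalityI subsetI)
      fix p :: nat assume "p \<in> {p. prime p \<and> p \<le> 2}"
      then show "p \<in> {2}" using prime_ge_2_nat[of p] by simp
    qed simp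
    moreover have "ln 2 \<le> ln (4::real)" "ln (4::real) \<ge> 0" by simp_all
    then have "ln 2 \<le> 2 * ln (4::real)" by linarith
    ultimately show ?thesis using 2 by (simp add: theta_def)
  next
    case 3
    have "{p. prime p \<and> p \<le> N} = {p. prime p \<and> p \<le> N - 1}"
    proof (intro Collect_cong conj_cong refl)
      fix p :: nat assume "prime p"
      then have "p \<noteq> N" using 3 prime_odd_nat[of p] by auto
      then show "p \<le> N \<longleftrightarrow> p \<le> N - 1" by auto
    qed
    then have "theta N = theta (N - 1)" by (simp add: theta_def)
    also have "\<dots> \<le> real (N - 1) * ln 4" using 3 by (intro less) simp
    also have "\<dots> \<le> real N * ln 4" by (intro mult_right_mono) auto
    finally show ?thesis .
  next
    case 4
    then obtain m where m: "N = 2 * m + 1" by (elim oddE)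
    have m1: "m \<ge> 1" using 4 m by simp
    define A where "A = {p. prime p \<and> m + 1 < p \<and> p \<le> 2 * m + 1}"
    have fA: "finite A" unfolding A_def by (rule finite_subset[of _ "{..2 * m + 1}"]) auto
    have "\<Prod>A dvd ((2 * m + 1) choose m)"
    proof (rule prod_primes_dvd[OF fA])
      fix p assume p: "p \<in> A"
      then show pr: "prime p" by (simp add: A_def)
      have "p dvd fact (2 * m + 1)" using p unfolding prime_dvd_fact_iff[OF pr] by (auto simp only: A_def)
      also have "fact (2 * m + 1) = fact m * fact (m + 1) * ((2 * m + 1) choose m)"
        using binomial_fact_lemma[of m "2 * m + 1"] by (simp add: mult_ac)
      finally have "p dvd fact m * fact (m + 1) * ((2 * m + 1) choose m)" .
      moreover have "\<not> p dvd fact m" "\<not> p dvd fact (m + 1)" 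
        using p unfolding prime_dvd_fact_iff[OF pr] by (auto simp only: A_def)
      ultimately show "p dvd ((2 * m + 1) choose m)" using pr prime_dvd_multD by blast
    qed
    then have "\<Prod>A \<le> ((2 * m + 1) choose m)" by (rule dvd_imp_le) (simp add: zero_less_binomial)
    also have "\<dots> \<le> 4 ^ m" by (rule binomial_odd_le)
    finally have le: "real (\<Prod>A) \<le> 4 ^ m" by (metis of_nat_le_iff of_nat_numeral of_nat_power)
    have pos: "real p > 0" if "p \<in> A" for p using that by (auto simp: A_def)
    have "(\<Sum>p\<in>A. ln (real p)) = ln (real (\<Prod>A))" using pos fA by (simp add: ln_prod)
    also have "\<dots> \<le> ln (4 ^ m)" using le pos by (intro ln_mono) (auto simp: intro: prod_pos)
    also have "\<dots> = real m * ln 4" by (simp add: ln_realpow)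
    finally have 1: "(\<Sum>p\<in>A. ln (real p)) \<le> real m * ln 4" .
    have "{p. prime p \<and> p \<le> N} = {p. prime p \<and> p \<le> m + 1} \<union> A" unfolding A_def m by auto
    moreover have "{p. prime p \<and> p \<le> m + 1} \<inter> A = {}" unfolding A_def by auto
    ultimately have "theta N = theta (m + 1) + (\<Sum>p\<in>A. ln (real p))"
      unfolding theta_def by (simp only: sum.union_disjoint[OF finite_primes_le fA])
    also have "\<dots> \<le> real (m + 1) * ln 4 + real m * ln 4" using 1 less[of "m + 1"] m m1 by simp
    also have "\<dots> = real N * ln 4" by (simp add: m algebra_simps)
    finally show ?thesis .
  qed
qed

lemma sum_quadratic_geometric: "(\<Sum>a\<le>M. real (a + 1) * real a / 2 ^ a) = 8 - (real M ^ 2 + 5 * real M + 8) / 2 ^ M"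
  by (induction M) (simp_all add: field_simps power2_eq_square)

text \<open>For \<open>a \<ge> 2\<close> one has \<open>p ^ a \<ge> p ^ 2 * 2 ^ (a - 2)\<close>.
  This reduces the sum to the base 2, where the complete series has the value 8.\<close>

lemma sum_quadratic_geometric_le: 
  assumes "p \<ge> 2"
  shows "(\<Sum>a=2..M. real (a + 1) * real a / real p ^ a) \<le> 32 / real p ^ 2"
proof -
  have "(\<Sum>a=2..M. real (a + 1) * real a / real p ^ a) \<le> (\<Sum>a=2..M. 4 / real p ^ 2 * (real (a + 1) * real a / 2 ^ a))"
  proof (rule sum_mono)
    fix a assume a: "a \<in> {2..M}"
    define b where "b = a - 2"
    have ab: "a = b + 2" using a unfolding b_def by (simp del: add_2_eq_Suc')
    have "(2::real) ^ b \<le> real p ^ b" using assms by (intro power_mono) auto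
    then have "real p ^ 2 * 2 ^ b \<le> real p ^ 2 * real p ^ b" by (intro mult_left_mono) auto
    then have "real p ^ a \<ge> real p ^ 2 * 2 ^ b" by (simp only: ab power_add mult.commute)
    moreover have "real p ^ 2 * 2 ^ b > 0" using assms by simp
    ultimately have "real (a + 1) * real a / real p ^ a \<le> real (a + 1) * real a / (real p ^ 2 * 2 ^ b)"
      using assms by (intro divide_left_mono mult_pos_pos) auto
    also have "\<dots> = 4 / real p ^ 2 * (real (a + 1) * real a / 2 ^ a)" by (simp add: ab power_add)
    finally show "real (a + 1) * real a / real p ^ a \<le> 4 / real p ^ 2 * (real (a + 1) * real a / 2 ^ a)" .
  qed
  also have "\<dots> = 4 / real p ^ 2 * (\<Sum>a=2..M. real (a + 1) * real a / 2 ^ a)"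
    by (simp only: sum_distrib_left)
  also have "\<dots> \<le> 4 / real p ^ 2 * 8"
  proof (rule mult_left_mono)
    have "(\<Sum>a=2..M. real (a + 1) * real a / 2 ^ a) \<le> (\<Sum>a\<le>M. real (a + 1) * real a / 2 ^ a)"
      by (rule sum_mono2) auto
    also have "\<dots> \<le> 8" unfolding sum_quadratic_geometric by simp
    finally show "(\<Sum>a=2..M. real (a + 1) * real a / 2 ^ a) \<le> 8" .
  qed simp
  finally show ?thesis by simp
qed

lemma sum_ln_over_square_bounded: "\<exists>C>0. \<forall>N. (\<Sum>p | prime p \<and> p \<le> N. ln (real p) / real p ^ 2) \<le> C"
proof -
  define C where "C = (\<Sum>n. 2 * real n powr (-1.5))"
  have sm: "summable (\<lambda>n. 2 * real n powr (-1.5))" 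
    using summable_mult[of "\<lambda>n. real n powr (-1.5)" 2] summable_real_powr_iff[of "-1.5"] by simp
  have "(\<Sum>p | prime p \<and> p \<le> N. ln (real p) / real p ^ 2) \<le> C" for N
  proof -
    have "(\<Sum>p | prime p \<and> p \<le> N. ln (real p) / real p ^ 2) \<le> (\<Sum>p | prime p \<and> p \<le> N. 2 * real p powr (-1.5))"
    proof (rule sum_mono)
      fix p assume "p \<in> {p. prime p \<and> p \<le> N}"
      then have p: "real p > 0" by (simp add: prime_gt_0_nat)
      have "ln (real p) \<le> real p powr (1/2) / (1/2)" using p by (intro ln_powr_bound) (auto simp: Suc_le_eq)
      then have "ln (real p) / real p ^ 2 \<le> 2 * real p powr (1/2) / real p powr 2"
        using p by (simp add: powr_numeral divide_right_mono)
      also have "\<dots> = 2 * real p powr (-1.5)" 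
      proof -
        have "2 * real p powr (1/2) / real p powr 2 = 2 * (real p powr (1/2) / real p powr 2)" by (simp only: times_divide_eq_right)
        also have "real p powr (1/2) / real p powr 2 = real p powr (1/2 - 2)" by (simp only: powr_diff)
        finally show ?thesis by simp
      qed
      finally show "ln (real p) / real p ^ 2 \<le> 2 * real p powr (-1.5)" .
    qed
    also have "\<dots> \<le> C" unfolding C_def by (rule sum_le_suminf[OF sm]) auto
    finally show ?thesis .
  qed
  then show ?thesis by (intro exI[of _ "max 1 C"]) (simp add: le_max_iff_disj)
qed

text \<open>Prime powers up to \<open>N\<close> as pairs, so that the exponent remains at
  hand.\<close>

definition ppairs :: "nat \<Rightarrow> (nat \<times> nat) set" where
  "ppairs N = {(p, a). prime p \<and> a \<ge> 1 \<and> p ^ a \<le> N}"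

lemma ppairs_bound:
  assumes "(p, a) \<in> ppairs N" shows "p \<le> N" "a \<le> N"
proof -
  have p: "prime p" "a \<ge> 1" "p ^ a \<le> N" using assms by (auto simp: ppairs_def)
  have p2: "p \<ge> 2" using p(1) by (rule prime_ge_2_nat)
  have "p ^ 1 \<le> p ^ a" using p2 p(2) by (intro power_increasing) auto
  then show "p \<le> N" using p(3) by simp
  have "a < p ^ a" using p2 by (intro power_gt_expt) simp 
  then show "a \<le> N" using p(3) by simp
qed

lemma finite_ppairs [simp]: "finite (ppairs N)"
proof (rule finite_subset)
  show "ppairs N \<subseteq> {..N} \<times> {..N}" using ppairs_bound by auto
qed simp

text \<open>The weight majorises \<open>f (p ^ a) * ln (p ^ a)\<close> for every \<open>f\<close>
  with \<open>f (p ^ a) \<le> a + 1\<close>. Primes are covered by \<open>theta_le\<close>. A term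
  with \<open>a \<ge> 2\<close> is enlarged by the factor \<open>N / p ^ a \<ge> 1\<close>, after
  which the sum over the exponents converges.\<close>

lemma prime_power_weight_le:
  "\<exists>C>0. \<forall>N. (\<Sum>(p, a)\<in>ppairs N. real (a + 1) * real a * ln (real p)) \<le> C * real N"
proof -
  obtain C where C: "C > 0" "\<And>N. (\<Sum>p | prime p \<and> p \<le> N. ln (real p) / real p ^ 2) \<le> C"
    using sum_ln_over_square_bounded by blast
  define h where "h = (\<lambda>(p, a). real (a + 1) * real a * ln (real p))"
  have "(\<Sum>x\<in>ppairs N. h x) \<le> (2 * ln 4 + 32 * C) * real N" for N
  proof -
    define P where "P = {p::nat. prime p \<and> p \<le> N}"
    have lnp: "ln (real p) \<ge> 0" if "p \<in> P" for p using that by (simp add: P_def ln_prime_nonneg)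
    have "(\<Sum>x\<in>ppairs N. h x) \<le> (\<Sum>x\<in>P \<times> {1} \<union> P \<times> {2..N}. h x * (if snd x = 1 then 1 else real N / real (fst x) ^ snd x))"
    proof (rule sum_le_included[where i = id])
      show "\<forall>x\<in>ppairs N. \<exists>y\<in>P \<times> {1} \<union> P \<times> {2..N}. id y = x \<and> h x \<le> h y * (if snd y = 1 then 1 else real N / real (fst y) ^ snd y)"
      proof
        fix x assume x: "x \<in> ppairs N"
        obtain p a where xe: "x = (p, a)" by (cases x)
        have pa: "prime p" "a \<ge> 1" "p ^ a \<le> N" "p \<le> N" "a \<le> N" using x ppairs_bound[of p a N] by (auto simp: xe ppairs_def)
        have "h x * 1 \<le> h x * (if snd x = 1 then 1 else real N / real (fst x) ^ snd x)"
        proof (rule mult_left_mono)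
          have "real (p ^ a) \<le> real N" using pa(3) by (rule of_nat_mono)
          then show "1 \<le> (if snd x = 1 then 1 else real N / real (fst x) ^ snd x)"
            using prime_gt_0_nat[OF pa(1)] by (simp add: xe)
          show "h x \<ge> 0" using lnp[of p] pa by (simp add: xe h_def P_def)
        qed
        moreover have "x \<in> P \<times> {1} \<union> P \<times> {2..N}" using pa by (auto simp: xe P_def)
        ultimately show "\<exists>y\<in>P \<times> {1} \<union> P \<times> {2..N}. id y = x \<and> h x \<le> h y * (if snd y = 1 then 1 else real N / real (fst y) ^ snd y)"
          by (intro bexI[of _ x]) simp_all
      qed
      show "\<forall>y\<in>P \<times> {1} \<union> P \<times> {2..N}. 0 \<le> h y * (if snd y = 1 then 1 else real N / real (fst y) ^ snd y)"
        using lnp by (auto simp: h_def)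
    qed (auto simp: P_def)
    also have "\<dots> = (\<Sum>p\<in>P. 2 * ln (real p)) + (\<Sum>p\<in>P. \<Sum>a=2..N. real (a + 1) * real a * ln (real p) * (real N / real p ^ a))"
    proof -
      have "(\<Sum>x\<in>P \<times> {1} \<union> P \<times> {2..N}. h x * (if snd x = 1 then 1 else real N / real (fst x) ^ snd x))
        = (\<Sum>x\<in>P \<times> {1}. h x * (if snd x = 1 then 1 else real N / real (fst x) ^ snd x)) 
        + (\<Sum>x\<in>P \<times> {2..N}. h x * (if snd x = 1 then 1 else real N / real (fst x) ^ snd x))"
        by (rule sum.union_disjoint) (auto simp: P_def)
      moreover have "(\<Sum>x\<in>P \<times> {1::nat}. h x * (if snd x = 1 then 1 else real N / real (fst x) ^ snd x)) = (\<Sum>p\<in>P. 2 * ln (real p))"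
        by (rule sum.reindex_bij_witness[of _ "\<lambda>p. (p, 1)" fst]) (auto simp: h_def)
      moreover have "(\<Sum>x\<in>P \<times> {2..N}. h x * (if snd x = 1 then 1 else real N / real (fst x) ^ snd x))
        = (\<Sum>p\<in>P. \<Sum>a=2..N. real (a + 1) * real a * ln (real p) * (real N / real p ^ a))"
        unfolding sum.cartesian_product by (intro sum.cong) (auto simp: h_def)
      ultimately show ?thesis by simp
    qed
    also have "(\<Sum>p\<in>P. 2 * ln (real p)) = 2 * theta N" by (simp add: theta_def P_def sum_distrib_left)
    also have "(\<Sum>p\<in>P. \<Sum>a=2..N. real (a + 1) * real a * ln (real p) * (real N / real p ^ a))
        \<le> (\<Sum>p\<in>P. ln (real p) * real N * (32 / real p ^ 2))"
    proof (rule sum_mono)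
      fix p assume p: "p \<in> P"
      have "(\<Sum>a=2..N. real (a + 1) * real a * ln (real p) * (real N / real p ^ a)) 
         = ln (real p) * real N * (\<Sum>a=2..N. real (a + 1) * real a / real p ^ a)"
        by (simp add: sum_distrib_left mult_ac)
      also have "\<dots> \<le> ln (real p) * real N * (32 / real p ^ 2)"
        using lnp[OF p] p by (intro mult_left_mono sum_quadratic_geometric_le) (auto simp: P_def prime_ge_2_nat)
      finally show "(\<Sum>a=2..N. real (a + 1) * real a * ln (real p) * (real N / real p ^ a)) \<le> ln (real p) * real N * (32 / real p ^ 2)" .
    qed
    also have "(\<Sum>p\<in>P. ln (real p) * real N * (32 / real p ^ 2)) = 32 * real N * (\<Sum>p\<in>P. ln (real p) / real p ^ 2)"
      by (simp add: sum_distrib_left mult_ac)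
    also have "\<dots> \<le> 32 * real N * C" using C(2)[of N] by (intro mult_left_mono) (auto simp: P_def)
    finally have "(\<Sum>x\<in>ppairs N. h x) \<le> 2 * theta N + 32 * real N * C" by simp
    also have "\<dots> \<le> 2 * (real N * ln 4) + 32 * real N * C" using theta_le[of N] by simp
    finally show ?thesis by (simp add: algebra_simps)
  qed
  moreover have "2 * ln 4 + 32 * C > 0" using C(1) by (intro add_pos_pos) auto
  ultimately show ?thesis unfolding h_def by blast
qed

section \<open>Mean values by way of the logarithmic weight\<close>

lemma ln_eq_sum_prime_factors:
  assumes "n > 0" shows "ln (real n) = (\<Sum>p\<in>prime_factors n. real (multiplicity p n) * ln (real p))"
proof -
  have "ln (real n) = ln (real (\<Prod>p\<in>prime_factors n. p ^ multiplicity p n))"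
    by (subst prime_factorization_nat[OF assms, symmetric]) (rule refl)
  also have "\<dots> = (\<Sum>p\<in>prime_factors n. ln (real p ^ multiplicity p n))"
    unfolding of_nat_prod of_nat_power by (rule ln_prod) (auto simp: in_prime_factors_iff prime_gt_0_nat)
  also have "\<dots> = (\<Sum>p\<in>prime_factors n. real (multiplicity p n) * ln (real p))"
    by (simp add: ln_realpow)
  finally show ?thesis .
qed

text \<open>Expand \<open>ln n\<close> over the primes dividing \<open>n\<close> and write
  \<open>n = m * p ^ a\<close> with \<open>p\<close> not dividing \<open>m\<close>, so that
  \<open>f n\<close> splits. Forgetting that \<open>p\<close> does not divide \<open>m\<close> only
  enlarges the sum, as \<open>f\<close> is nonnegative.\<close>

lemma mult_fn_log_sum_le:
  assumes "mult_fn f" "\<And>n. f n \<ge> 0"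
  shows "(\<Sum>n=1..N. f n * ln (real n)) 
     \<le> (\<Sum>m=1..N. f m * (\<Sum>(p, a)\<in>ppairs (N div m). f (p ^ a) * real a * ln (real p)))"
proof -
  define I where "I = (SIGMA n:{1..N}. prime_factors n)"
  define J where "J = (SIGMA m:{1..N}. ppairs (N div m))"
  define g where "g = (\<lambda>(m, p, a). f m * (f (p ^ a) * real a * ln (real p)))"
  have "(\<Sum>n=1..N. f n * ln (real n)) = (\<Sum>n=1..N. \<Sum>p\<in>prime_factors n. f n * (real (multiplicity p n) * ln (real p)))"
    using ln_eq_sum_prime_factors by (simp add: sum_distrib_left)
  also have "\<dots> = (\<Sum>(n, p)\<in>I. f n * (real (multiplicity p n) * ln (real p)))"
    unfolding I_def by (rule sum.Sigma) auto
  also have "\<dots> \<le> (\<Sum>x\<in>J. g x)"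
  proof (rule sum_le_included[where i = "\<lambda>(m, p, a). (m * p ^ a, p)"])
    show "finite I" "finite J" by (auto simp: I_def J_def)
    show "\<forall>x\<in>J. 0 \<le> g x" 
      using assms(2) by (auto simp: J_def g_def ppairs_def ln_prime_nonneg intro!: mult_nonneg_nonneg)
    show "\<forall>x\<in>I. \<exists>y\<in>J. (case y of (m, p, a) \<Rightarrow> (m * p ^ a, p)) = x \<and>
        (case x of (n, p) \<Rightarrow> f n * (real (multiplicity p n) * ln (real p))) \<le> g y"
    proof
      fix x assume x: "x \<in> I"
      obtain n p where xe: "x = (n, p)" by (cases x)
      have n: "n \<ge> 1" "n \<le> N" and p: "prime p" "p dvd n" using x by (auto simp: xe I_def in_prime_factors_iff)
      define a where "a = multiplicity p n"
      have n0: "n \<noteq> 0" using n(1) by simp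
      have nu: "\<not> is_unit p" using p(1) not_prime_unit by blast
      obtain m where m: "n = p ^ a * m" "\<not> p dvd m"
        using multiplicity_decompose'[OF n0 nu] unfolding a_def by metis
      have a1: "a \<ge> 1" using p(2) n0 nu unfolding a_def by (simp add: multiplicity_gt_zero_iff Suc_le_eq)
      have m0: "m > 0" using m(1) n0 by (cases m) auto
      have pa0: "p ^ a > 0" using prime_gt_0_nat[OF p(1)] by simp
      have cop: "coprime (p ^ a) m" using m(2) p(1) by (simp add: prime_imp_coprime)
      have fn: "f n = f (p ^ a) * f m" unfolding m(1) by (rule mult_fnD[OF assms(1) cop pa0 m0])
      have "p ^ a \<le> N div m" using n(2) m(1) m0 by (simp add: less_eq_div_iff_mult_less_eq)
      moreover have "m \<le> N" using n(2) m(1) pa0 by (metis dual_order.trans dvd_imp_le dvd_triv_right n0 neq0_conv)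
      ultimately have "(m, p, a) \<in> J" using m0 p(1) a1 by (auto simp: J_def ppairs_def)
      moreover have "f n * (real (multiplicity p n) * ln (real p)) = g (m, p, a)"
        by (simp add: fn g_def a_def[symmetric])
      ultimately show "\<exists>y\<in>J. (case y of (m, p, a) \<Rightarrow> (m * p ^ a, p)) = x \<and>
        (case x of (n, p) \<Rightarrow> f n * (real (multiplicity p n) * ln (real p))) \<le> g y"
        by (intro bexI[of _ "(m, p, a)"]) (simp_all add: xe m(1)[symmetric] mult.commute[of m])
    qed
  qed
  also have "\<dots> = (\<Sum>m=1..N. \<Sum>x\<in>ppairs (N div m). g (m, x))"
    unfolding J_def by (subst sum.Sigma) auto
  also have "\<dots> = (\<Sum>m=1..N. f m * (\<Sum>(p, a)\<in>ppairs (N div m). f (p ^ a) * real a * ln (real p)))"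
    by (simp add: g_def sum_distrib_left case_prod_unfold)
  finally show ?thesis .
qed

text \<open>Write \<open>ln N = ln n + ln (N / n)\<close>. The first part is controlled by
  \<open>mult_fn_log_sum_le\<close> with the Chebyshev-type bound for prime powers, the second by
  \<open>ln y < y\<close>. The constant is the same for all \<open>f\<close>, which later gives
  uniformity in the harmonic.\<close>

lemma mult_fn_mean_le:
  "\<exists>C>0. \<forall>f N. mult_fn f \<longrightarrow> (\<forall>n. f n \<ge> 0) \<longrightarrow> (\<forall>p a. prime p \<longrightarrow> f (p ^ a) \<le> real (a + 1)) \<longrightarrow>
     ln (real N) * (\<Sum>n=1..N. f n) \<le> C * real N * (\<Sum>n=1..N. f n / real n)"
proof -
  obtain C where C: "C > 0" "\<And>N. (\<Sum>(p, a)\<in>ppairs N. real (a + 1) * real a * ln (real p)) \<le> C * real N"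
    using prime_power_weight_le by blast
  have "ln (real N) * (\<Sum>n=1..N. f n) \<le> (C + 1) * real N * (\<Sum>n=1..N. f n / real n)"
    if f: "mult_fn f" "\<And>n. f n \<ge> 0" "\<And>p a. prime p \<Longrightarrow> f (p ^ a) \<le> real (a + 1)" for f N
  proof -
    have 1: "(\<Sum>(p, a)\<in>ppairs M. f (p ^ a) * real a * ln (real p)) \<le> C * real M" for M
    proof -
      have "(\<Sum>(p, a)\<in>ppairs M. f (p ^ a) * real a * ln (real p)) \<le> (\<Sum>(p, a)\<in>ppairs M. real (a + 1) * real a * ln (real p))"
      proof (rule sum_mono)
        fix x assume "x \<in> ppairs M"
        then show "(case x of (p, a) \<Rightarrow> f (p ^ a) * real a * ln (real p)) \<le> (case x of (p, a) \<Rightarrow> real (a + 1) * real a * ln (real p))"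
          using f(3) by (cases x) (auto simp: ppairs_def ln_prime_nonneg intro!: mult_right_mono)
      qed
      then show ?thesis using C(2)[of M] by linarith
    qed
    have "(\<Sum>n=1..N. f n * ln (real n)) \<le> (\<Sum>m=1..N. f m * (C * real (N div m)))"
      by (rule order_trans[OF mult_fn_log_sum_le[OF f(1,2)]]) (intro sum_mono mult_left_mono 1 f(2))
    also have "\<dots> \<le> (\<Sum>m=1..N. C * real N * (f m / real m))"
    proof (rule sum_mono)
      fix m assume "m \<in> {1..N}"
      have "real (N div m) \<le> real N / real m" by (rule of_nat_div_le_of_nat)
      then have "f m * (C * real (N div m)) \<le> f m * (C * (real N / real m))" 
        using C(1) f(2) by (intro mult_left_mono) auto
      then show "f m * (C * real (N div m)) \<le> C * real N * (f m / real m)" by (simp add: mult_ac)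
    qed
    finally have A: "(\<Sum>n=1..N. f n * ln (real n)) \<le> C * real N * (\<Sum>n=1..N. f n / real n)"
      by (simp only: sum_distrib_left)
    have "(\<Sum>n=1..N. f n * (ln (real N) - ln (real n))) \<le> (\<Sum>n=1..N. real N * (f n / real n))"
    proof (rule sum_mono)
      fix n assume n: "n \<in> {1..N}"
      have "ln (real N) - ln (real n) = ln (real N / real n)" using n by (simp add: ln_div)
      also have "\<dots> \<le> real N / real n" using n by (intro less_imp_le ln_less_self) auto
      finally have "f n * (ln (real N) - ln (real n)) \<le> f n * (real N / real n)" using f(2) by (rule mult_left_mono)
      then show "f n * (ln (real N) - ln (real n)) \<le> real N * (f n / real n)" by (simp add: mult_ac)
    qed
    then have B: "(\<Sum>n=1..N. f n * (ln (real N) - ln (real n))) \<le> real N * (\<Sum>n=1..N. f n / real n)"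
      by (simp only: sum_distrib_left)
    have "ln (real N) * (\<Sum>n=1..N. f n) = (\<Sum>n=1..N. f n * ln (real n)) + (\<Sum>n=1..N. f n * (ln (real N) - ln (real n)))"
      by (simp add: sum_distrib_left sum.distrib[symmetric] algebra_simps)
    also have "\<dots> \<le> C * real N * (\<Sum>n=1..N. f n / real n) + real N * (\<Sum>n=1..N. f n / real n)"
      using A B by linarith
    finally show ?thesis by (simp add: algebra_simps)
  qed
  then show ?thesis using C(1) by (intro exI[of _ "C + 1"]) auto
qed

section \<open>Dirichlet series at real arguments and their sums over primes\<close>

text \<open>As \<open>0 powr y = 0\<close>, the term at 0 vanishes and sums may run over all natural
  numbers.\<close>

definition dterm :: "(nat \<Rightarrow> real) \<Rightarrow> real \<Rightarrow> nat \<Rightarrow> real" where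
  "dterm f x n = f n * real n powr - x"

lemma dterm_0 [simp]: "dterm f x 0 = 0" and dterm_1: "dterm f x 1 = f 1"
  by (simp_all add: dterm_def)

lemma mult_fn_dterm: "mult_fn f \<Longrightarrow> mult_fn (dterm f x)"
  using mult_fn_powr[of f x] unfolding dterm_def .

lemma prime_power_powr_le:
  assumes "prime p" "x \<ge> 1" shows "real (p ^ a) powr - x \<le> 1 / real p ^ a"
proof -
  have "real (p ^ a) \<ge> 1" using prime_gt_0_nat[OF assms(1)] by (simp add: Suc_le_eq)
  then have "real (p ^ a) powr - x \<le> real (p ^ a) powr - 1" using assms(2) by (intro powr_mono) auto
  also have "\<dots> = 1 / real p ^ a" using prime_gt_0_nat[OF assms(1)] by (simp add: powr_minus divide_inverse)
  finally show ?thesis .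
qed

lemma dterm_prime_power_le:
  assumes "prime p" "x \<ge> 1" "\<bar>f (p ^ a)\<bar> \<le> c"
  shows "\<bar>dterm f x (p ^ a)\<bar> \<le> c / real p ^ a"
proof -
  have "\<bar>dterm f x (p ^ a)\<bar> = \<bar>f (p ^ a)\<bar> * real (p ^ a) powr - x" by (simp add: dterm_def abs_mult)
  also have "\<dots> \<le> c * (1 / real p ^ a)"
    using assms(3) prime_power_powr_le[OF assms(1,2), of a] by (intro mult_mono) auto
  finally show ?thesis by simp
qed

lemma dirichlet_le_exp:
  assumes "mult_fn f" "\<And>n. f n \<ge> 0" "\<And>p a. prime p \<Longrightarrow> f (p ^ a) \<le> real (a + 1)" "x \<ge> 1"
    "dterm f x summable_on UNIV"
  shows "infsum (dterm f x) UNIV \<le> exp (primesum (dterm f x) + 24)"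
proof -
  have nn: "dterm f x n \<ge> 0" for n using assms(2) by (simp add: dterm_def)
  have "infsum (dterm f x) UNIV \<le> exp (primesum (dterm f x) + 2 * 12)"
  proof (rule euler_upper[OF mult_fn_dterm[OF assms(1)]])
    show "(\<lambda>n. \<bar>dterm f x n\<bar>) summable_on UNIV" using assms(5) nn by simp
    fix p :: nat assume p: "prime p"
    show "0 \<le> (\<Sum>\<^sub>\<infinity>a. dterm f x (p ^ a))" by (rule infsum_nonneg) (rule nn)
    show "(\<Sum>\<^sub>\<infinity>a. dterm f x (p ^ a)) \<le> exp (dterm f x p + 12 / real p ^ 2)"
    proof (rule local_factor_upper[OF p])
      show "dterm f x 1 = 1" using mult_fn_1[OF assms(1)] by (simp only: dterm_1)
      show "\<bar>dterm f x (p ^ a)\<bar> \<le> real (a + 1) / real p ^ a" for a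
        by (rule dterm_prime_power_le[OF p assms(4)]) (use assms(2,3) p in simp)
    qed
  qed simp_all
  then show ?thesis by simp
qed

text \<open>Here \<open>f\<close> may change sign, so the local factors at 2, 3 and 5 are kept away
  from 0 by hypothesis. From 7 on this follows from the bound on the coefficients.\<close>

lemma dirichlet_ge_exp:
  assumes "mult_fn f" "\<And>p a. prime p \<Longrightarrow> \<bar>f (p ^ a)\<bar> \<le> real (a + 1)" "x \<ge> 1"
    "(\<lambda>n. \<bar>dterm f x n\<bar>) summable_on UNIV"
    "\<And>p. prime p \<Longrightarrow> p < 7 \<Longrightarrow> (\<Sum>\<^sub>\<infinity>a. dterm f x (p ^ a)) \<ge> 1/2"
  shows "infsum (dterm f x) UNIV \<ge> exp (primesum (dterm f x) - 600)"
proof -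
  have "infsum (dterm f x) UNIV \<ge> exp (primesum (dterm f x) - 2 * 300)"
  proof (rule euler_lower[OF mult_fn_dterm[OF assms(1)] assms(4)])
    fix p :: nat assume p: "prime p"
    show "exp (dterm f x p - 300 / real p ^ 2) \<le> (\<Sum>\<^sub>\<infinity>a. dterm f x (p ^ a))"
    proof (rule local_factor_lower[OF p])
      show "dterm f x 1 = 1" using mult_fn_1[OF assms(1)] by (simp only: dterm_1)
      show "\<bar>dterm f x (p ^ a)\<bar> \<le> real (a + 1) / real p ^ a" for a
        by (rule dterm_prime_power_le[OF p assms(3)]) (rule assms(2)[OF p])
      show "(\<Sum>\<^sub>\<infinity>a. dterm f x (p ^ a)) \<ge> 1/2" if "p < 7" by (rule assms(5)[OF p that])
    qed
  qed simp_all
  then show ?thesis by simp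
qed

text \<open>The factorwise comparison of products in \<open>euler_upper\<close> needs nonnegative
  local factors; for \<open>f\<close> of varying sign the condition at the small primes provides
  this.\<close>

lemma dirichlet_abs_le_exp:
  assumes "mult_fn f" "\<And>p a. prime p \<Longrightarrow> \<bar>f (p ^ a)\<bar> \<le> real (a + 1)" "x \<ge> 1"
    "(\<lambda>n. \<bar>dterm f x n\<bar>) summable_on UNIV"
    "\<And>p. prime p \<Longrightarrow> p < 7 \<Longrightarrow> (\<Sum>\<^sub>\<infinity>a. dterm f x (p ^ a)) \<ge> 1/2"
  shows "infsum (dterm f x) UNIV \<le> exp (primesum (dterm f x) + 24)"
proof -
  have "infsum (dterm f x) UNIV \<le> exp (primesum (dterm f x) + 2 * 12)"
  proof (rule euler_upper[OF mult_fn_dterm[OF assms(1)] assms(4)])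
    fix p :: nat assume p: "prime p"
    have 1: "dterm f x 1 = 1" using mult_fn_1[OF assms(1)] by (simp only: dterm_1)
    have 2: "\<bar>dterm f x (p ^ a)\<bar> \<le> real (a + 1) / real p ^ a" for a
      by (rule dterm_prime_power_le[OF p assms(3)]) (rule assms(2)[OF p])
    have "(\<Sum>\<^sub>\<infinity>a. dterm f x (p ^ a)) \<ge> 1/2"
      by (cases "p < 7") (use assms(5)[OF p] local_factor_bounds(2)[OF p 1 2] in auto)
    then show "0 \<le> (\<Sum>\<^sub>\<infinity>a. dterm f x (p ^ a))" by simp
    show "(\<Sum>\<^sub>\<infinity>a. dterm f x (p ^ a)) \<le> exp (dterm f x p + 12 / real p ^ 2)"
      by (rule local_factor_upper[OF p 1 2])
  qed simp_all
  then show ?thesis by simp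
qed

text \<open>Rankin's trick: up to a factor \<open>exp 1\<close>, the weight \<open>1 / n\<close> is at most
  \<open>n powr - x\<close> with \<open>x = 1 + 1 / ln N\<close>.\<close>
lemma mult_fn_mean_le_exp:
  "\<exists>C>0. \<forall>f N. mult_fn f \<longrightarrow> (\<forall>n. f n \<ge> 0) \<longrightarrow> (\<forall>p a. prime p \<longrightarrow> f (p ^ a) \<le> real (a + 1)) \<longrightarrow>
     N \<ge> 2 \<longrightarrow> dterm f (1 + 1 / ln (real N)) summable_on UNIV \<longrightarrow>
     (\<Sum>n=1..N. f n) \<le> C * (real N / ln (real N)) * exp (primesum (dterm f (1 + 1 / ln (real N))))"
proof -
  obtain C where C: "C > 0" "\<And>f N. mult_fn f \<Longrightarrow> (\<forall>n. f n \<ge> 0) \<Longrightarrow> (\<forall>p a. prime p \<longrightarrow> f (p ^ a) \<le> real (a + 1)) \<Longrightarrow>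
     ln (real N) * (\<Sum>n=1..N. f n) \<le> C * real N * (\<Sum>n=1..N. f n / real n)"
    using mult_fn_mean_le by blast
  have "(\<Sum>n=1..N. f n) \<le> (C * exp 25) * (real N / ln (real N)) * exp (primesum (dterm f (1 + 1 / ln (real N))))"
    if f: "mult_fn f" "\<forall>n. f n \<ge> 0" "\<forall>p a. prime p \<longrightarrow> f (p ^ a) \<le> real (a + 1)" "N \<ge> 2" 
      "dterm f (1 + 1 / ln (real N)) summable_on UNIV" for f N
  proof -
    define x where "x = 1 + 1 / ln (real N)"
    have L: "ln (real N) > 0" using f(4) by simp
    have x1: "x \<ge> 1" using L by (simp add: x_def)
    have nn: "dterm f x n \<ge> 0" for n using f(2) by (simp add: dterm_def)
    have "(\<Sum>n=1..N. f n / real n) \<le> (\<Sum>n=1..N. exp 1 * dterm f x n)"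
    proof (rule sum_mono)
      fix n assume n: "n \<in> {1..N}"
      have "real n powr (1 / ln (real N)) = exp (ln (real n) / ln (real N))" using n by (simp add: powr_def)
      also have "\<dots> \<le> exp 1" using n L by (simp add: divide_le_eq)
      finally have *: "real n powr (1 / ln (real N)) \<le> exp 1" .
      have "f n / real n = f n * real n powr - x * real n powr (1 / ln (real N))"
        using n by (simp add: x_def powr_diff powr_minus divide_inverse mult.assoc flip: powr_add)
      also have "\<dots> \<le> f n * real n powr - x * exp 1" using * f(2) by (intro mult_left_mono) auto
      finally show "f n / real n \<le> exp 1 * dterm f x n" by (simp add: dterm_def mult_ac)
    qed
    also have "\<dots> = exp 1 * (\<Sum>n=1..N. dterm f x n)" by (simp only: sum_distrib_left)
    also have "\<dots> \<le> exp 1 * infsum (dterm f x) UNIV"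
      using f(5) nn unfolding x_def[symmetric] by (intro mult_left_mono finite_sum_le_infsum) auto
    also have "\<dots> \<le> exp 1 * exp (primesum (dterm f x) + 24)"
      using f(5) unfolding x_def[symmetric]
      by (intro mult_left_mono dirichlet_le_exp) (use f x1 in auto)
    also have "\<dots> = exp 25 * exp (primesum (dterm f x))" by (simp add: exp_add[symmetric])
    finally have 1: "(\<Sum>n=1..N. f n / real n) \<le> exp 25 * exp (primesum (dterm f x))" .
    have "ln (real N) * (\<Sum>n=1..N. f n) \<le> C * real N * (\<Sum>n=1..N. f n / real n)" by (rule C(2)[OF f(1-3)])
    also have "\<dots> \<le> C * real N * (exp 25 * exp (primesum (dterm f x)))" using 1 C(1) by (intro mult_left_mono) auto
    finally show ?thesis using L by (simp add: x_def field_simps)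
  qed
  then show ?thesis using C(1) by (intro exI[of _ "C * exp 25"]) auto
qed

section \<open>Primes congruent to 1 modulo 3\<close>

definition chi :: "nat \<Rightarrow> real" where
  "chi n = (if n mod 3 = 1 then 1 else if n mod 3 = 2 then -1 else 0)"

lemma chi_mult: "chi (m * n) = chi m * chi n"
proof -
  have e: "(m * n) mod 3 = ((m mod 3) * (n mod 3)) mod 3" by (simp add: mod_mult_eq)
  have "m mod 3 = 0 \<or> m mod 3 = 1 \<or> m mod 3 = 2" "n mod 3 = 0 \<or> n mod 3 = 1 \<or> n mod 3 = 2" by linarith+
  then show ?thesis unfolding chi_def e by (elim disjE) simp_all
qed

lemma abs_chi_le: "\<bar>chi n\<bar> \<le> 1" by (simp add: chi_def)

text \<open>The partial sum \<open>chi 1 + ... + chi n\<close> in closed form.\<close>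

definition chi_partial :: "nat \<Rightarrow> real" where "chi_partial n = (if n mod 3 = 1 then 1 else 0)"

lemma chi_chi_partial: "chi (Suc n) = chi_partial (Suc n) - chi_partial n"
proof -
  have "n mod 3 = 0 \<or> n mod 3 = 1 \<or> n mod 3 = 2" by linarith
  then show ?thesis by (elim disjE) (simp_all add: chi_def chi_partial_def mod_Suc)
qed

text \<open>Summation by parts in the form of an induction. The boundary terms with
  \<open>a N\<close> are kept because they make both inequalities inductive.\<close>

lemma chi_sum_bounds:
  assumes "\<And>n. m \<le> n \<Longrightarrow> a (Suc n) \<le> a n" "\<And>n. m \<le> n \<Longrightarrow> a n \<ge> (0::real)" "m \<le> N" "m \<ge> 1"
  shows "chi_partial N * a N - a m \<le> (\<Sum>n=m..N. chi n * a n) \<and> (\<Sum>n=m..N. chi n * a n) \<le> a m - (1 - chi_partial N) * a N"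
  using assms(3)
proof (induction N rule: dec_induct)
  case base
  have c: "chi m = chi_partial m - chi_partial (m - 1)" using chi_chi_partial[of "m - 1"] assms(4) by simp
  have "0 \<le> chi_partial (m - 1)" "chi_partial (m - 1) \<le> 1" by (simp_all add: chi_partial_def)
  then have "0 \<le> chi_partial (m - 1) * a m" "chi_partial (m - 1) * a m \<le> 1 * a m"
    using assms(2)[of m] by (intro mult_nonneg_nonneg mult_right_mono; simp)+
  then show ?case by (simp add: c algebra_simps)
next
  case (step N)
  have h: "0 \<le> chi_partial N" "chi_partial N \<le> 1" by (simp_all add: chi_partial_def)
  have "chi_partial N * a (Suc N) \<le> chi_partial N * a N" "(1 - chi_partial N) * a (Suc N) \<le> (1 - chi_partial N) * a N"
    using assms(1)[of N] step h by (auto intro: mult_left_mono)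
  moreover have "(\<Sum>n=m..Suc N. chi n * a n) = (\<Sum>n=m..N. chi n * a n) + (chi_partial (Suc N) - chi_partial N) * a (Suc N)"
    using step by (simp add: chi_chi_partial)
  ultimately show ?case using step.IH by (simp add: algebra_simps)
qed

lemma chi_sum_abs_le:
  assumes "\<And>n. m \<le> n \<Longrightarrow> a (Suc n) \<le> a n" "\<And>n. m \<le> n \<Longrightarrow> a n \<ge> (0::real)" "m \<ge> 1"
  shows "\<bar>\<Sum>n=m..N. chi n * a n\<bar> \<le> a m"
proof (cases "m \<le> N")
  case True
  have "0 \<le> chi_partial N * a N" "0 \<le> (1 - chi_partial N) * a N" using assms(2)[OF True] by (simp_all add: chi_partial_def)
  moreover have "chi_partial N * a N - a m \<le> (\<Sum>n=m..N. chi n * a n) \<and> (\<Sum>n=m..N. chi n * a n) \<le> a m - (1 - chi_partial N) * a N"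
    by (rule chi_sum_bounds[where a = a]) (use assms True in auto)
  ultimately show ?thesis by (simp add: abs_le_iff)
qed (use assms(2)[of m] in simp)

text \<open>Partial sums of the L-series of \<open>chi\<close> at 1.\<close>

definition L1_partial :: "nat \<Rightarrow> real" where "L1_partial N = (\<Sum>n=1..N. chi n / real n)"

lemma L1_partial_sum_split:
  fixes f :: "nat \<Rightarrow> real" assumes "M \<le> N"
  shows "(\<Sum>n=1..N. f n) = (\<Sum>n=1..M. f n) + (\<Sum>n=M+1..N. f n)"
proof -
  have "{1..N} = {1..M} \<union> {M + 1..N}" using assms by auto
  moreover have "(\<Sum>n\<in>{1..M} \<union> {M + 1..N}. f n) = (\<Sum>n=1..M. f n) + (\<Sum>n=M+1..N. f n)"
    by (rule sum.union_disjoint) auto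
  ultimately show ?thesis by simp
qed

lemma L1_partial_diff:
  assumes "M \<le> N" shows "\<bar>L1_partial N - L1_partial M\<bar> \<le> 1 / real (M + 1)"
proof -
  have "L1_partial N = L1_partial M + (\<Sum>n=M+1..N. chi n / real n)"
    unfolding L1_partial_def by (rule L1_partial_sum_split[OF assms])
  moreover have "\<bar>\<Sum>n=M+1..N. chi n * (1 / real n)\<bar> \<le> 1 / real (M + 1)"
    by (rule chi_sum_abs_le) (auto simp: field_simps)
  ultimately show ?thesis by simp
qed

text \<open>The nonvanishing of the L-series at 1, which for this modulus is a numerical fact: the
  first three terms give 1/2, and the remaining ones change this by at most 1/4.\<close>

lemma L1_partial_ge: "N \<ge> 1 \<Longrightarrow> L1_partial N \<ge> 1/4"
proof (cases "N \<ge> 3")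
  case True
  have "{1..3::nat} = {1, 2, 3}" by auto
  then have "L1_partial 3 = 1/2" by (simp add: L1_partial_def chi_def)
  moreover have "\<bar>L1_partial N - L1_partial 3\<bar> \<le> 1/4" using L1_partial_diff[OF True] by simp
  ultimately show ?thesis by linarith
next
  case False
  assume "N \<ge> 1"
  then have "N = 1 \<or> N = 2" using False by linarith
  moreover have "{1..2::nat} = {1, 2}" by auto
  ultimately show ?thesis by (elim disjE) (simp_all add: L1_partial_def chi_def)
qed

lemma ln_Suc_eq: "n \<ge> 1 \<Longrightarrow> ln (real (Suc n)) = ln (real n) + ln (1 + 1 / real n)"
proof -
  assume n: "n \<ge> 1"
  have "real (Suc n) = real n * (1 + 1 / real n)" using n by (simp add: distrib_left)
  moreover have "1 + 1 / real n > 0" by (intro add_pos_nonneg) auto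
  then have "ln (real n * (1 + 1 / real n)) = ln (real n) + ln (1 + 1 / real n)" using n by (subst ln_mult) auto
  ultimately show ?thesis by (simp only:)
qed

text \<open>Since \<open>ln n / n\<close> decreases only beyond \<open>exp 1\<close>, the
  alternating estimate starts at 3 and the first two terms are treated separately.\<close>

lemma chi_ln_sum_bounded: "\<exists>K. \<forall>N. \<bar>\<Sum>n=1..N. chi n * (ln (real n) / real n)\<bar> \<le> K"
proof -
  have dec: "ln (real (Suc n)) / real (Suc n) \<le> ln (real n) / real n" if n: "3 \<le> n" for n
  proof -
    have "exp 1 \<le> real n" using n exp_le by linarith
    then have "ln (exp 1) \<le> ln (real n)" by (intro ln_mono) auto
    then have l: "ln (real n) \<ge> 1" by simp
    have "ln (real (Suc n)) = ln (real n) + ln (1 + 1 / real n)"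
      using n by (intro ln_Suc_eq) simp
    also have "ln (1 + 1 / real n) \<le> 1 / real n" by (rule ln_add_one_self_le_self) simp
    also have "1 / real n \<le> ln (real n) / real n" using l by (intro divide_right_mono) auto
    finally have "ln (real (Suc n)) * real n \<le> ln (real n) * real (Suc n)" using n by (simp add: field_simps)
    then show ?thesis using n by (simp add: field_simps)
  qed
  have t: "\<bar>\<Sum>n=3..N. chi n * (ln (real n) / real n)\<bar> \<le> ln (real 3) / real 3" for N
    by (rule chi_sum_abs_le[where a = "\<lambda>n. ln (real n) / real n" and m = 3]) (use dec in auto)
  have "\<bar>\<Sum>n=1..N. chi n * (ln (real n) / real n)\<bar> \<le> 1 + ln (real 3) / real 3" for N
  proof (cases "N \<ge> 2")
    case True
    then have "(\<Sum>n=1..N. chi n * (ln (real n) / real n)) = (\<Sum>n=1..2. chi n * (ln (real n) / real n)) + (\<Sum>n=3..N. chi n * (ln (real n) / real n))"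
      using L1_partial_sum_split[of 2 N "\<lambda>n. chi n * (ln (real n) / real n)"] by simp
    also have "(\<Sum>n=1..2::nat. chi n * (ln (real n) / real n)) = - (ln 2 / 2)"
    proof -
      have "{1..2::nat} = {1, 2}" by auto
      then show ?thesis by (simp add: chi_def)
    qed
    finally have e: "(\<Sum>n=1..N. chi n * (ln (real n) / real n)) = - (ln 2 / 2) + (\<Sum>n=3..N. chi n * (ln (real n) / real n))" .
    have "ln (2::real) \<le> 1" "ln (2::real) \<ge> 0" using ln_le_minus_one[of 2] by simp_all
    then show ?thesis using t[of N] unfolding e by linarith
  next
    case False
    then have "N = 0 \<or> N = 1" by linarith
    then show ?thesis by (elim disjE) simp_all
  qed
  then show ?thesis by blast
qed

lemma sum_divisors_swap:
  "(\<Sum>n=1..N. \<Sum>d | d dvd n. f d (n div d)) = (\<Sum>d=1..N. \<Sum>m=1..N div d. f d (m::nat) :: real)"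
proof -
  have "(\<Sum>n=1..N. \<Sum>d | d dvd n. f d (n div d)) = (\<Sum>(n, d)\<in>(SIGMA n:{1..N}. {d. d dvd n}). f d (n div d))"
    by (rule sum.Sigma) auto
  also have "\<dots> = (\<Sum>(d, m)\<in>(SIGMA d:{1..N}. {1..N div d}). f d m)"
  proof (rule sum.reindex_bij_witness[of _ "\<lambda>(d, m). (d * m, d)" "\<lambda>(n, d). (d, n div d)"])
    fix x assume "x \<in> (SIGMA n:{1..N}. {d. d dvd n})"
    then obtain n d where x: "x = (n, d)" "1 \<le> n" "n \<le> N" "d dvd n" by auto
    have d: "1 \<le> d" "d \<le> n" using x dvd_imp_le[of d n] by (auto simp: Suc_le_eq dvd_pos_nat)
    have "1 \<le> n div d" using d by (simp add: div_greater_zero_iff Suc_le_eq)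
    moreover have "n div d \<le> N div d" using x by (intro div_le_mono)
    ultimately show "(case x of (n, d) \<Rightarrow> (d, n div d)) \<in> (SIGMA d:{1..N}. {1..N div d})" using x d by auto
  next
    fix y assume "y \<in> (SIGMA d:{1..N}. {1..N div d})"
    then obtain d m where y: "y = (d, m)" "1 \<le> d" "d \<le> N" "1 \<le> m" "m \<le> N div d" by auto
    have "d * m \<le> d * (N div d)" using y by (intro mult_left_mono) auto
    also have "\<dots> \<le> N" by simp
    finally show "(case y of (d, m) \<Rightarrow> (d * m, d)) \<in> (SIGMA n:{1..N}. {d. d dvd n})" using y by auto
  qed auto
  also have "\<dots> = (\<Sum>d=1..N. \<Sum>m=1..N div d. f d m)" by (rule sum.Sigma[symmetric]) auto
  finally show ?thesis .
qed

lemma mangoldt_ppairs: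
  "(\<Sum>d=1..N. (mangoldt d :: real) * g d) = (\<Sum>(p, a)\<in>ppairs N. ln (real p) * g (p ^ a))"
proof -
  have inj: "inj_on (\<lambda>(p, a). p ^ a) (ppairs N)"
    by (auto simp: inj_on_def ppairs_def prime_power_inj'' Suc_le_eq)
  have img: "(\<lambda>(p, a). p ^ a) ` ppairs N = {d\<in>{1..N}. primepow d}"
  proof (intro equalityI subsetI)
    fix d assume "d \<in> (\<lambda>(p, a). p ^ a) ` ppairs N"
    then obtain p a where "d = p ^ a" "prime p" "a \<ge> 1" "p ^ a \<le> N" by (auto simp: ppairs_def)
    then show "d \<in> {d\<in>{1..N}. primepow d}"
      using prime_gt_0_nat[of p] by (auto simp: primepow_def Suc_le_eq)
  next
    fix d assume "d \<in> {d\<in>{1..N}. primepow d}"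
    then obtain p a where "d = p ^ a" "prime p" "a > 0" "d \<le> N" by (auto simp: primepow_def)
    then show "d \<in> (\<lambda>(p, a). p ^ a) ` ppairs N"
      by (intro image_eqI[of _ _ "(p, a)"]) (auto simp: ppairs_def)
  qed
  have "(\<Sum>d=1..N. (mangoldt d :: real) * g d) = (\<Sum>d\<in>{d\<in>{1..N}. primepow d}. mangoldt d * g d)"
    by (rule sum.mono_neutral_right) (auto simp: mangoldt_def)
  also have "\<dots> = (\<Sum>x\<in>ppairs N. mangoldt (case x of (p, a) \<Rightarrow> p ^ a) * g (case x of (p, a) \<Rightarrow> p ^ a))"
    unfolding img[symmetric] by (rule sum.reindex[OF inj, unfolded o_def])
  also have "\<dots> = (\<Sum>(p, a)\<in>ppairs N. ln (real p) * g (p ^ a))"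
    by (intro sum.cong refl) (auto simp: ppairs_def)
  finally show ?thesis .
qed

section \<open>Mertens-type estimates\<close>

lemma mangoldt_sum_le: "\<exists>C>0. \<forall>N. (\<Sum>d=1..N. (mangoldt d :: real)) \<le> C * real N"
proof -
  obtain C where C: "C > 0" "\<And>N. (\<Sum>(p, a)\<in>ppairs N. real (a + 1) * real a * ln (real p)) \<le> C * real N"
    using prime_power_weight_le by blast
  have "(\<Sum>d=1..N. (mangoldt d :: real)) \<le> C * real N" for N
  proof -
    have "(\<Sum>d=1..N. (mangoldt d :: real)) = (\<Sum>(p, a)\<in>ppairs N. ln (real p) * 1)"
      using mangoldt_ppairs[of "\<lambda>_. 1" N] by simp
    also have "\<dots> \<le> (\<Sum>(p, a)\<in>ppairs N. real (a + 1) * real a * ln (real p))"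
    proof (rule sum_mono)
      fix x assume x: "x \<in> ppairs N"
      obtain p a where xe: "x = (p, a)" by (cases x)
      have pa: "prime p" "a \<ge> 1" using x by (auto simp: xe ppairs_def)
      have "1 * 1 \<le> real (a + 1) * real a" using pa by (intro mult_mono) auto
      then have "1 * ln (real p) \<le> real (a + 1) * real a * ln (real p)"
        using ln_prime_nonneg[OF pa(1)] by (intro mult_right_mono) auto
      then show "(case x of (p, a) \<Rightarrow> ln (real p) * 1) \<le> (case x of (p, a) \<Rightarrow> real (a + 1) * real a * ln (real p))"
        by (simp add: xe)
    qed
    finally show ?thesis using C(2)[of N] by linarith
  qed
  then show ?thesis using C(1) by blast
qed

lemma sum_ln_bounds:
  "(\<Sum>n=1..N. ln (real n)) \<le> real N * ln (real N)" "N \<ge> 1 \<Longrightarrow> (\<Sum>n=1..N. ln (real n)) \<ge> real N * ln (real N) - real N"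
proof -
  have "(\<Sum>n=1..N. ln (real n)) \<le> (\<Sum>n=1..N. ln (real N))" by (intro sum_mono ln_mono) auto
  then show "(\<Sum>n=1..N. ln (real n)) \<le> real N * ln (real N)" by simp
  assume "N \<ge> 1"
  then show "(\<Sum>n=1..N. ln (real n)) \<ge> real N * ln (real N) - real N"
  proof (induction N rule: dec_induct)
    case (step N)
    have "ln (real (Suc N)) = ln (real N) + ln (1 + 1 / real N)"
      using step by (intro ln_Suc_eq) simp
    moreover have "real N * ln (1 + 1 / real N) \<le> real N * (1 / real N)"
      by (intro mult_left_mono ln_add_one_self_le_self) auto
    ultimately have "real N * ln (real (Suc N)) \<le> real N * ln (real N) + 1" using step by (simp add: distrib_left)
    then show ?case using step.IH by (simp add: distrib_right)
  qed simp
qed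

text \<open>The sum of \<open>ln n\<close> up to \<open>N\<close> is evaluated by expanding
  \<open>ln n\<close> over divisors. Replacing \<open>N div d\<close> by \<open>N / d\<close> costs
  at most the sum of \<open>mangoldt\<close>, which is of order \<open>N\<close>; division by
  \<open>N\<close> leaves a bounded error.\<close>

lemma mangoldt_mertens: "\<exists>C. \<forall>N\<ge>1. \<bar>(\<Sum>d=1..N. mangoldt d / real d) - ln (real N)\<bar> \<le> C"
proof -
  obtain C where C: "C > 0" "\<And>N. (\<Sum>d=1..N. (mangoldt d :: real)) \<le> C * real N" using mangoldt_sum_le by blast
  have "\<bar>(\<Sum>d=1..N. mangoldt d / real d) - ln (real N)\<bar> \<le> C + 1" if N: "N \<ge> 1" for N
  proof -
    have "(\<Sum>n=1..N. ln (real n)) = (\<Sum>n=1..N. \<Sum>d | d dvd n. (mangoldt d :: real))"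
      by (intro sum.cong refl) (simp add: mangoldt_sum)
    also have "\<dots> = (\<Sum>d=1..N. \<Sum>m=1..N div d. mangoldt d)" by (rule sum_divisors_swap)
    also have "\<dots> = (\<Sum>d=1..N. mangoldt d * real (N div d))" by (simp add: mult.commute)
    finally have e: "(\<Sum>n=1..N. ln (real n)) = (\<Sum>d=1..N. mangoldt d * real (N div d))" .
    have "(\<Sum>d=1..N. mangoldt d * real (N div d)) \<le> (\<Sum>d=1..N. mangoldt d * (real N / real d))"
      by (intro sum_mono mult_left_mono of_nat_div_le_of_nat mangoldt_nonneg)
    also have "\<dots> = real N * (\<Sum>d=1..N. mangoldt d / real d)" by (simp add: sum_distrib_left mult_ac)
    finally have 1: "real N * ln (real N) - real N \<le> real N * (\<Sum>d=1..N. mangoldt d / real d)"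
      using sum_ln_bounds(2)[OF N] unfolding e by linarith
    have "(\<Sum>d=1..N. mangoldt d * (real N / real d - 1)) \<le> (\<Sum>d=1..N. mangoldt d * real (N div d))"
    proof (intro sum_mono mult_left_mono mangoldt_nonneg)
      fix d assume "d \<in> {1..N}"
      then have "N < d * (N div d) + d" using dividend_less_times_div[of d N] by simp
      then have "real N \<le> real d * real (N div d) + real d" by (metis less_imp_le of_nat_add of_nat_mono of_nat_mult)
      then show "real N / real d - 1 \<le> real (N div d)" using \<open>d \<in> {1..N}\<close> by (simp add: field_simps)
    qed
    also have "\<dots> \<le> real N * ln (real N)" using sum_ln_bounds(1)[of N] unfolding e .
    finally have "real N * (\<Sum>d=1..N. mangoldt d / real d) - (\<Sum>d=1..N. mangoldt d) \<le> real N * ln (real N)"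
      by (simp add: right_diff_distrib sum_subtractf sum_distrib_left mult_ac)
    then have 2: "real N * (\<Sum>d=1..N. mangoldt d / real d) \<le> real N * ln (real N) + C * real N" using C(2)[of N] by linarith
    have N0: "real N > 0" using N by simp
    have "real N * (ln (real N) - 1) \<le> real N * (\<Sum>d=1..N. mangoldt d / real d)" using 1 by (simp add: right_diff_distrib)
    then have "ln (real N) - 1 \<le> (\<Sum>d=1..N. mangoldt d / real d)" using N0 by (simp only: mult_le_cancel_left_pos)
    moreover have "real N * (\<Sum>d=1..N. mangoldt d / real d) \<le> real N * (ln (real N) + C)" using 2 by (simp add: distrib_left mult.commute)
    then have "(\<Sum>d=1..N. mangoldt d / real d) \<le> ln (real N) + C" using N0 by (simp only: mult_le_cancel_left_pos)
    ultimately show ?thesis using C(1) by (simp add: abs_le_iff)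
  qed
  then show ?thesis by blast
qed

text \<open>Expanding \<open>ln n\<close> over divisors in the bounded sum of
  \<open>chi n * ln n / n\<close> gives the terms \<open>mangoldt d * chi d / d\<close> multiplied
  by \<open>L1_partial (N div d)\<close>. Replacing the latter by \<open>L1_partial N\<close> costs
  \<open>d / N\<close> each, in total a bounded amount, and \<open>L1_partial N\<close> can then be
  divided out.\<close>

lemma mangoldt_chi_bounded: "\<exists>C. \<forall>N\<ge>1. \<bar>\<Sum>d=1..N. mangoldt d * (chi d / real d)\<bar> \<le> C"
proof -
  obtain C where C: "C > 0" "\<And>N. (\<Sum>d=1..N. (mangoldt d :: real)) \<le> C * real N" using mangoldt_sum_le by blast
  obtain K where K: "\<And>N. \<bar>\<Sum>n=1..N. chi n * (ln (real n) / real n)\<bar> \<le> K" using chi_ln_sum_bounded by blast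
  have "\<bar>\<Sum>d=1..N. mangoldt d * (chi d / real d)\<bar> \<le> 4 * (K + C)" if N: "N \<ge> 1" for N
  proof -
    define T where "T = (\<Sum>d=1..N. mangoldt d * (chi d / real d))"
    have N0: "real N > 0" using N by simp
    have "(\<Sum>n=1..N. chi n * (ln (real n) / real n)) = (\<Sum>n=1..N. \<Sum>d | d dvd n. mangoldt d * (chi d / real d) * (chi (n div d) / real (n div d)))"
    proof (intro sum.cong refl)
      fix n assume n: "n \<in> {1..N}"
      have "(\<Sum>d | d dvd n. mangoldt d * (chi d / real d) * (chi (n div d) / real (n div d))) = (\<Sum>d | d dvd n. mangoldt d * (chi n / real n))"
      proof (intro sum.cong refl)
        fix d assume "d \<in> {d. d dvd n}"
        then have "n = d * (n div d)" by simp
        then have "chi n = chi d * chi (n div d)" "real n = real d * real (n div d)" by (metis chi_mult, metis of_nat_mult)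
        then show "mangoldt d * (chi d / real d) * (chi (n div d) / real (n div d)) = mangoldt d * (chi n / real n)" by simp
      qed
      also have "\<dots> = (\<Sum>d | d dvd n. mangoldt d) * (chi n / real n)" by (rule sum_distrib_right[symmetric])
      also have "(\<Sum>d | d dvd n. mangoldt d) = ln (real n)" using n mangoldt_sum[of n, where 'a = real] by simp
      finally show "chi n * (ln (real n) / real n) = (\<Sum>d | d dvd n. mangoldt d * (chi d / real d) * (chi (n div d) / real (n div d)))"
        by (simp add: mult_ac)
    qed
    also have "\<dots> = (\<Sum>d=1..N. \<Sum>m=1..N div d. mangoldt d * (chi d / real d) * (chi m / real m))" by (rule sum_divisors_swap)
    also have "\<dots> = (\<Sum>d=1..N. mangoldt d * (chi d / real d) * L1_partial (N div d))" by (simp add: L1_partial_def sum_distrib_left)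
    finally have e: "(\<Sum>n=1..N. chi n * (ln (real n) / real n)) = (\<Sum>d=1..N. mangoldt d * (chi d / real d) * L1_partial (N div d))" .
    have "L1_partial N * T = (\<Sum>d=1..N. mangoldt d * (chi d / real d) * L1_partial (N div d)) + (\<Sum>d=1..N. mangoldt d * (chi d / real d) * (L1_partial N - L1_partial (N div d)))"
      unfolding T_def sum_distrib_left sum.distrib[symmetric]
      by (intro sum.cong refl) (simp only: right_diff_distrib, simp add: mult_ac)
    moreover have "\<bar>\<Sum>d=1..N. mangoldt d * (chi d / real d) * (L1_partial N - L1_partial (N div d))\<bar> \<le> (\<Sum>d=1..N. mangoldt d * (1 / real N))"
    proof (rule sum_abs[THEN order_trans], rule sum_mono)
      fix d assume d: "d \<in> {1..N}"
      \<comment> \<open>The summand 1 in the denominator of \<open>L1_partial_diff\<close> makes the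
        bound \<open>d / N\<close> valid although \<open>N div d\<close> rounds down.\<close>
      have "real N / real d \<le> real (N div d + 1)"
      proof -
        have "N < d * (N div d) + d" using d dividend_less_times_div[of d N] by simp
        then have "real N < real (d * (N div d) + d)" by (rule of_nat_less_iff[THEN iffD2])
        then show ?thesis using d by (simp add: field_simps)
      qed
      then have "1 / real (N div d + 1) \<le> 1 / (real N / real d)" using d N0 by (intro divide_left_mono) auto
      then have "\<bar>L1_partial N - L1_partial (N div d)\<bar> \<le> real d / real N" using L1_partial_diff[of "N div d" N] by simp
      moreover have "\<bar>chi d / real d\<bar> \<le> 1 / real d" using abs_chi_le[of d] d by (simp add: divide_right_mono)
      ultimately have "\<bar>chi d / real d\<bar> * \<bar>L1_partial N - L1_partial (N div d)\<bar> \<le> 1 / real d * (real d / real N)" by (intro mult_mono) auto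
      also have "\<dots> = 1 / real N" using d by simp
      finally have "mangoldt d * (\<bar>chi d / real d\<bar> * \<bar>L1_partial N - L1_partial (N div d)\<bar>) \<le> mangoldt d * (1 / real N)"
        by (intro mult_left_mono mangoldt_nonneg)
      then show "\<bar>mangoldt d * (chi d / real d) * (L1_partial N - L1_partial (N div d))\<bar> \<le> mangoldt d * (1 / real N)"
        by (simp add: abs_mult mult.assoc)
    qed
    moreover have "(\<Sum>d=1..N. mangoldt d * (1 / real N)) \<le> C"
      using C(2)[of N] N0 by (simp add: sum_distrib_right[symmetric] sum_divide_distrib[symmetric] divide_le_eq)
    ultimately have "\<bar>L1_partial N * T\<bar> \<le> K + C" using K[of N] unfolding e by linarith
    then have "\<bar>L1_partial N\<bar> * \<bar>T\<bar> \<le> K + C" by (simp add: abs_mult)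
    moreover have "1/4 * \<bar>T\<bar> \<le> \<bar>L1_partial N\<bar> * \<bar>T\<bar>" using L1_partial_ge[OF N] by (intro mult_right_mono) auto
    ultimately show ?thesis by (simp add: T_def)
  qed
  then show ?thesis by blast
qed

definition prime1_sum :: "nat \<Rightarrow> real" where
  "prime1_sum N = (\<Sum>p | prime p \<and> p mod 3 = 1 \<and> p \<le> N. ln (real p) / real p)"

text \<open>The sum of \<open>mangoldt_mertens\<close> and \<open>mangoldt_chi_bounded\<close>:
  \<open>1 + chi\<close> is 2 on the residue class of 1 and 0 on that of 2. The prime 3 and the
  proper prime powers contribute a bounded amount.\<close>

lemma prime1_mertens: "\<exists>K. \<forall>N\<ge>1. \<bar>2 * prime1_sum N - ln (real N)\<bar> \<le> K"
proof -
  obtain C1 where C1: "\<And>N. N \<ge> 1 \<Longrightarrow> \<bar>(\<Sum>d=1..N. mangoldt d / real d) - ln (real N)\<bar> \<le> C1"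
    using mangoldt_mertens by blast
  obtain C2 where C2: "\<And>N. N \<ge> 1 \<Longrightarrow> \<bar>\<Sum>d=1..N. mangoldt d * (chi d / real d)\<bar> \<le> C2"
    using mangoldt_chi_bounded by blast
  obtain C3 where C3: "\<And>N. (\<Sum>p | prime p \<and> p \<le> N. ln (real p) / real p ^ 2) \<le> C3"
    using sum_ln_over_square_bounded by blast
  have "\<bar>2 * prime1_sum N - ln (real N)\<bar> \<le> C1 + C2 + 64 * C3 + 2" if N: "N \<ge> 1" for N
  proof -
    define P where "P = {p::nat. prime p \<and> p \<le> N}"
    have fP: "finite P" by (simp add: P_def)
    have C30: "C3 \<ge> 0" using C3[of 0] by (rule order_trans[rotated]) (intro sum_nonneg, simp add: ln_prime_nonneg)
    define g where "g d = (1 + chi d) / real d" for d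
    have g: "0 \<le> g d" "g d \<le> 2 / real d" for d using abs_chi_le[of d] by (auto simp: g_def abs_le_iff intro!: divide_right_mono)
    have A: "(\<Sum>d=1..N. mangoldt d * g d) = (\<Sum>d=1..N. mangoldt d / real d) + (\<Sum>d=1..N. mangoldt d * (chi d / real d))"
      by (simp add: g_def sum.distrib[symmetric] add_divide_distrib distrib_left)
    have split: "ppairs N = P \<times> {1} \<union> {x\<in>ppairs N. snd x \<ge> 2}"
    proof (intro equalityI subsetI)
      fix x assume x: "x \<in> ppairs N"
      obtain p a where xe: "x = (p, a)" by (cases x)
      have pa: "prime p" "a \<ge> 1" "p \<le> N" using x ppairs_bound[of p a N] by (auto simp: xe ppairs_def)
      show "x \<in> P \<times> {1} \<union> {x\<in>ppairs N. snd x \<ge> 2}"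
      proof (cases "a = 1")
        case True
        then show ?thesis using pa by (simp add: xe P_def)
      next
        case False
        then have "a \<ge> 2" using pa(2) by linarith
        then show ?thesis using x by (simp add: xe)
      qed
    next
      fix x assume "x \<in> P \<times> {1} \<union> {x\<in>ppairs N. snd x \<ge> 2}"
      then show "x \<in> ppairs N" by (cases x) (auto simp: P_def ppairs_def)
    qed
    define R where "R = (\<Sum>(p, a)\<in>{x\<in>ppairs N. snd x \<ge> 2}. ln (real p) * g (p ^ a))"
    have "(\<Sum>d=1..N. mangoldt d * g d) = (\<Sum>(p, a)\<in>P \<times> {1} \<union> {x\<in>ppairs N. snd x \<ge> 2}. ln (real p) * g (p ^ a))"
      unfolding mangoldt_ppairs by (subst split) (rule refl)
    also have "\<dots> = (\<Sum>(p, a)\<in>P \<times> {1}. ln (real p) * g (p ^ a)) + R"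
      unfolding R_def by (rule sum.union_disjoint) (use fP in auto)
    also have "(\<Sum>(p, a)\<in>P \<times> {1}. ln (real p) * g (p ^ a)) = (\<Sum>p\<in>P. ln (real p) * g p)"
      by (rule sum.reindex_bij_witness[of _ "\<lambda>p. (p, 1)" fst]) auto
    finally have B: "(\<Sum>d=1..N. mangoldt d * g d) = (\<Sum>p\<in>P. ln (real p) * g p) + R" .
    have R0: "R \<ge> 0" unfolding R_def using g(1) by (intro sum_nonneg) (auto simp: ppairs_def ln_prime_nonneg)
    have "R \<le> (\<Sum>(p, a)\<in>P \<times> {2..N}. ln (real p) * (2 * (real (a + 1) * real a / real p ^ a)))"
      unfolding R_def
    proof (rule sum_le_included[where i = id])
      show "\<forall>x\<in>{x \<in> ppairs N. 2 \<le> snd x}. \<exists>y\<in>P \<times> {2..N}. id y = x \<and> (case x of (p, a) \<Rightarrow> ln (real p) * g (p ^ a)) \<le> (case y of (p, a) \<Rightarrow> ln (real p) * (2 * (real (a + 1) * real a / real p ^ a)))"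
      proof
        fix x assume x: "x \<in> {x \<in> ppairs N. 2 \<le> snd x}"
        obtain p a where xe: "x = (p, a)" by (cases x)
        have pa: "prime p" "a \<ge> 2" "p \<le> N" "a \<le> N" using x ppairs_bound[of p a N] by (auto simp: xe ppairs_def)
        have "1 * 1 \<le> real (a + 1) * real a" using pa by (intro mult_mono) auto
        then have "2 / real p ^ a \<le> 2 * (real (a + 1) * real a / real p ^ a)" by (simp add: divide_right_mono)
        then have "g (p ^ a) \<le> 2 * (real (a + 1) * real a / real p ^ a)" using g(2)[of "p ^ a"] by simp
        then have "ln (real p) * g (p ^ a) \<le> ln (real p) * (2 * (real (a + 1) * real a / real p ^ a))"
          by (intro mult_left_mono ln_prime_nonneg pa)
        then show "\<exists>y\<in>P \<times> {2..N}. id y = x \<and> (case x of (p, a) \<Rightarrow> ln (real p) * g (p ^ a)) \<le> (case y of (p, a) \<Rightarrow> ln (real p) * (2 * (real (a + 1) * real a / real p ^ a)))"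
          using pa by (intro bexI[of _ x]) (auto simp: xe P_def)
      qed
    qed (use fP in \<open>auto simp: P_def ln_prime_nonneg\<close>)
    also have "\<dots> = (\<Sum>p\<in>P. 2 * ln (real p) * (\<Sum>a=2..N. real (a + 1) * real a / real p ^ a))"
      unfolding sum.cartesian_product[symmetric] sum_distrib_left by (intro sum.cong refl) simp
    also have "\<dots> \<le> (\<Sum>p\<in>P. 2 * ln (real p) * (32 / real p ^ 2))"
      by (intro sum_mono mult_left_mono sum_quadratic_geometric_le) (auto simp: P_def ln_prime_nonneg prime_ge_2_nat)
    also have "\<dots> = 64 * (\<Sum>p\<in>P. ln (real p) / real p ^ 2)" by (simp add: sum_distrib_left)
    also have "\<dots> \<le> 64 * C3" using C3[of N] by (simp add: P_def)
    finally have R1: "R \<le> 64 * C3" .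
    have "(\<Sum>p\<in>P. ln (real p) * g p) = (\<Sum>p\<in>P. (if p mod 3 = 1 then 2 * (ln (real p) / real p) else 0) + (if p = 3 then ln 3 / 3 else 0))"
    proof (intro sum.cong refl)
      fix p assume "p \<in> P"
      then have p: "prime p" by (simp add: P_def)
      have "p mod 3 = 0 \<or> p mod 3 = 1 \<or> p mod 3 = 2" by linarith
      moreover have "p = 3" if "p mod 3 = 0"
        using that p primes_dvd_imp_eq[of 3 p] by (simp add: dvd_eq_mod_eq_0)
      ultimately show "ln (real p) * g p = (if p mod 3 = 1 then 2 * (ln (real p) / real p) else 0) + (if p = 3 then ln 3 / 3 else 0)"
        by (auto simp: g_def chi_def)
    qed
    also have "\<dots> = 2 * prime1_sum N + (if 3 \<in> P then ln 3 / 3 else 0)"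
    proof -
      have "(\<Sum>p\<in>P. if p mod 3 = 1 then 2 * (ln (real p) / real p) else 0) = (\<Sum>p\<in>{p\<in>P. p mod 3 = 1}. 2 * (ln (real p) / real p))"
        by (rule sum.inter_filter[symmetric, OF fP])
      also have "{p\<in>P. p mod 3 = 1} = {p. prime p \<and> p mod 3 = 1 \<and> p \<le> N}" by (auto simp: P_def)
      finally show ?thesis by (simp add: sum.distrib sum.delta[OF fP] prime1_sum_def sum_distrib_left)
    qed
    finally have D: "(\<Sum>p\<in>P. ln (real p) * g p) = 2 * prime1_sum N + (if 3 \<in> P then ln 3 / 3 else 0)" .
    have "ln (3::real) \<le> 2" "ln (3::real) \<ge> 0" using ln_le_minus_one[of 3] by simp_all
    then have "0 \<le> (if 3 \<in> P then ln 3 / 3 else 0 :: real)" "(if 3 \<in> P then ln 3 / 3 else 0 :: real) \<le> 1" by auto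
    then show ?thesis using A B D R0 R1 C30 C1[OF N] C2[OF N] by (simp add: abs_le_iff)
  qed
  then show ?thesis by blast
qed

text \<open>The error in \<open>prime1_mertens\<close> is bounded, so a long enough multiplicative
  interval carries a total weight \<open>ln p / p\<close> of at least 1, while each of its primes
  contributes at most \<open>ln (B * y) / y\<close>.\<close>

lemma primes_1_mod_3_short_interval:
  "\<exists>B\<ge>2. \<forall>y\<ge>1. real y / ln (real (B * y)) \<le> real (card {p. prime p \<and> p mod 3 = 1 \<and> y < p \<and> p \<le> B * y})"
proof -
  obtain K where K: "\<And>N. N \<ge> 1 \<Longrightarrow> \<bar>2 * prime1_sum N - ln (real N)\<bar> \<le> K" using prime1_mertens by blast
  \<comment> \<open>The two errors at the ends of the interval add up to at most
    \<open>2 * K\<close>; the excess 2 leaves a weight of at least 1, since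
    \<open>prime1_sum\<close> enters doubled.\<close>
  define B where "B = nat \<lceil>exp (2 * K + 2)\<rceil> + 2"
  have B: "real B \<ge> exp (2 * K + 2)" "B \<ge> 2" unfolding B_def by (auto intro: order_trans[OF real_nat_ceiling_ge])
  have "real y / ln (real (B * y)) \<le> real (card {p. prime p \<and> p mod 3 = 1 \<and> y < p \<and> p \<le> B * y})" if y: "y \<ge> 1" for y
  proof -
    define Q where "Q = {p. prime p \<and> p mod 3 = 1 \<and> y < p \<and> p \<le> B * y}"
    have fQ: "finite Q" unfolding Q_def by (rule finite_subset[of _ "{..B * y}"]) auto
    have By: "y \<le> B * y" "B * y \<ge> 1" "real (B * y) > 1" 
    proof -
      have "1 * y \<le> B * y" "2 * 1 \<le> B * y" using B y by (intro mult_le_mono; simp)+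
      then show "y \<le> B * y" "B * y \<ge> 1" "real (B * y) > 1" by linarith+
    qed
    have lB: "ln (real (B * y)) > 0" using By(3) by simp
    have "{p. prime p \<and> p mod 3 = 1 \<and> p \<le> B * y} = {p. prime p \<and> p mod 3 = 1 \<and> p \<le> y} \<union> Q" 
      unfolding Q_def by (auto intro: le_trans[OF _ By(1)])
    then have s: "prime1_sum (B * y) = prime1_sum y + (\<Sum>p\<in>Q. ln (real p) / real p)"
      unfolding prime1_sum_def
    proof (simp only:)
      show "(\<Sum>p\<in>{p. prime p \<and> p mod 3 = 1 \<and> p \<le> y} \<union> Q. ln (real p) / real p) = (\<Sum>p | prime p \<and> p mod 3 = 1 \<and> p \<le> y. ln (real p) / real p) + (\<Sum>p\<in>Q. ln (real p) / real p)"
        by (rule sum.union_disjoint) (use fQ in \<open>auto simp: Q_def\<close>)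
    qed
    have "ln (real (B * y)) - ln (real y) = ln (real B)" using B(2) y by (simp add: ln_mult)
    moreover have "ln (exp (2 * K + 2)) \<le> ln (real B)" using B by (intro ln_mono) auto
    then have "2 * K + 2 \<le> ln (real B)" by simp
    ultimately have "1 \<le> (\<Sum>p\<in>Q. ln (real p) / real p)" using K[OF y] K[OF By(2)] s by (simp add: abs_le_iff)
    also have "\<dots> \<le> (\<Sum>p\<in>Q. ln (real (B * y)) / real y)"
      using y lB by (intro sum_mono frac_le ln_mono) (auto simp: Q_def intro: of_nat_mono[of _ "B * y", unfolded of_nat_mult])
    also have "\<dots> = real (card Q) * (ln (real (B * y)) / real y)" by simp
    finally show ?thesis using lB y by (simp add: Q_def field_simps)
  qed
  then show ?thesis using B(2) by blast
qed

section \<open>Lattice sums with angular characters\<close>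

lemma powr_via_square: "(r::real) > 0 \<Longrightarrow> (r\<^sup>2) powr (- t / 2) = r powr - t"
  using powr_powr[of r 2 "- t / 2"] by (simp add: powr_numeral)

text \<open>With \<open>powr_telescope_lower\<close>, the comparison of a zeta sum with its integral
  in telescoping form. Both rest on \<open>1 + u \<le> exp u\<close>.\<close>

lemma powr_telescope_upper:
  fixes x d :: real assumes "x \<ge> 1" "d > 0"
  shows "d * (x + 1) powr (-1 - d) \<le> x powr - d - (x + 1) powr - d"
proof -
  have "1 + d / (x + 1) \<le> exp (d / (x + 1))" by (rule exp_ge_add_one_self)
  also have "\<dots> \<le> ((x + 1) / x) powr d"
  proof -
    have "ln (x / (x + 1)) \<le> x / (x + 1) - 1" using assms by (intro ln_le_minus_one) auto
    then have "1 / (x + 1) \<le> ln ((x + 1) / x)" using assms by (simp add: ln_div field_simps)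
    then have "d * (1 / (x + 1)) \<le> d * ln ((x + 1) / x)" using assms by (intro mult_left_mono) auto
    then show ?thesis using assms by (simp add: powr_def)
  qed
  finally have "(x + 1) powr - d * (1 + d / (x + 1)) \<le> (x + 1) powr - d * ((x + 1) / x) powr d"
    by (intro mult_left_mono) auto
  moreover have "(x + 1) powr - d * ((x + 1) / x) powr d = x powr - d"
    using assms by (simp add: powr_divide powr_minus field_simps)
  moreover have "(x + 1) powr (-1 - d) = (x + 1) powr - d / (x + 1)"
    using assms by (simp add: powr_diff powr_minus field_simps)
  ultimately show ?thesis by (simp add: algebra_simps)
qed

lemma powr_telescope_lower:
  fixes x d :: real assumes "x \<ge> 1" "d > 0"
  shows "x powr - d - (x + 1) powr - d \<le> d * x powr (-1 - d)"
proof -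
  have "1 + (- d / x) \<le> exp (- d / x)" by (rule exp_ge_add_one_self)
  also have "\<dots> \<le> ((x + 1) / x) powr - d"
  proof -
    have "ln ((x + 1) / x) \<le> (x + 1) / x - 1" using assms by (intro ln_le_minus_one) auto
    then have "ln ((x + 1) / x) \<le> 1 / x" using assms by (simp add: field_simps)
    then have "d * ln ((x + 1) / x) \<le> d * (1 / x)" using assms by (intro mult_left_mono) auto
    then show ?thesis using assms by (simp add: powr_def)
  qed
  finally have "x powr - d * (1 + (- d / x)) \<le> x powr - d * ((x + 1) / x) powr - d"
    by (intro mult_left_mono) auto
  moreover have "x powr - d * ((x + 1) / x) powr - d = (x + 1) powr - d"
    using assms by (simp add: powr_divide)
  moreover have "x powr (-1 - d) = x powr - d / x"
    using assms by (simp add: powr_diff powr_minus field_simps)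
  ultimately show ?thesis by (simp add: algebra_simps)
qed

lemma zeta_partial_upper:
  assumes "d > 0" "N \<ge> 1"
  shows "(\<Sum>m=1..N. real m powr (-1 - d)) \<le> 1 + (1 - real N powr - d) / d"
  using assms(2)
proof (induction N rule: dec_induct)
  case base
  show ?case by simp
next
  case (step N)
  have "d * real (Suc N) powr (-1 - d) \<le> real N powr - d - real (Suc N) powr - d"
    using powr_telescope_upper[of "real N" d] step assms by (simp add: add.commute)
  then have "real (Suc N) powr (-1 - d) \<le> (real N powr - d - real (Suc N) powr - d) / d"
    using assms(1) by (simp add: field_simps)
  then have "(\<Sum>m=1..Suc N. real m powr (-1 - d)) \<le> 1 + (1 - real N powr - d) / d + (real N powr - d - real (Suc N) powr - d) / d"
    using step.IH by simp
  also have "\<dots> = 1 + (1 - real (Suc N) powr - d) / d" by (simp add: add_divide_distrib diff_divide_distrib)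
  finally show ?case .
qed

lemma zeta_partial_lower:
  assumes "d > 0"
  shows "(\<Sum>m=1..N. real m powr (-1 - d)) \<ge> (1 - real (N + 1) powr - d) / d"
proof (induction N)
  case (Suc N)
  have "real (Suc N) powr - d - real (Suc (Suc N)) powr - d \<le> d * real (Suc N) powr (-1 - d)"
    using powr_telescope_lower[of "real (Suc N)" d] assms by (simp add: add.commute)
  then have "(real (Suc N) powr - d - real (Suc (Suc N)) powr - d) / d \<le> real (Suc N) powr (-1 - d)"
    using assms by (simp add: field_simps)
  moreover have "(1 - real (Suc N + 1) powr - d) / d = (1 - real (N + 1) powr - d) / d + (real (Suc N) powr - d - real (Suc (Suc N)) powr - d) / d"
    by (simp add: add_divide_distrib diff_divide_distrib)
  ultimately show ?case using Suc by simp
qed simp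

definition eis_pt :: "int \<times> int \<Rightarrow> complex" where
  "eis_pt x = of_int (fst x) + of_int (snd x) * omega"

lemma bij_eis_pt: "bij_betw eis_pt UNIV Eis"
proof (rule bij_betwI')
  fix x y show "(eis_pt x = eis_pt y) = (x = y)"
    using coords_inj[of "fst x" "snd x" "fst y" "snd y"] by (auto simp: eis_pt_def prod_eq_iff)
next
  fix x show "eis_pt x \<in> Eis" unfolding eis_pt_def by (rule EisI)
next
  fix z assume "z \<in> Eis"
  then obtain a b where "z = of_int a + of_int b * omega" by (elim EisE)
  then show "\<exists>x\<in>UNIV. z = eis_pt x" by (intro bexI[of _ "(a, b)"]) (auto simp: eis_pt_def)
qed

lemma cmod_eis_pt_sq: "(cmod (eis_pt x))\<^sup>2 = real_of_int (Qf (fst x) (snd x))"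
  unfolding eis_pt_def by (rule cmod_sq_Eis)

definition coord_box :: "nat \<Rightarrow> (int \<times> int) set" where
  "coord_box N = {- int N..int N} \<times> {- int N..int N}"

lemma card_coord_box: "card (coord_box N) = (2 * N + 1)\<^sup>2"
  by (simp add: coord_box_def card_cartesian_product power2_eq_square nat_add_distrib nat_mult_distrib)
     (simp add: algebra_simps)?

lemma coord_box_mono: "N \<le> M \<Longrightarrow> coord_box N \<subseteq> coord_box M"
  by (auto simp: coord_box_def)

lemma finite_coord_box [simp]: "finite (coord_box N)" by (simp add: coord_box_def)

lemma cmod_eis_pt_ge:
  assumes "x \<notin> coord_box N" shows "(cmod (eis_pt x))\<^sup>2 \<ge> 3 / 4 * (real N + 1)\<^sup>2"
proof -
  have *: "(int N + 1)\<^sup>2 \<le> c\<^sup>2" if "c < - int N \<or> c > int N" for c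
  proof -
    have "\<bar>int N + 1\<bar> \<le> \<bar>c\<bar>" using that by linarith
    then show ?thesis using power_mono[of "int N + 1" "\<bar>c\<bar>" 2] by simp
  qed
  have "(int N + 1)\<^sup>2 \<le> (fst x)\<^sup>2 \<or> (int N + 1)\<^sup>2 \<le> (snd x)\<^sup>2"
    using assms *[of "fst x"] *[of "snd x"] by (cases x) (auto simp: coord_box_def)
  then have "3 * (int N + 1)\<^sup>2 \<le> 4 * Qf (fst x) (snd x)"
    using Qf_ge[of "fst x" "snd x"] Qf_ge(2)[where a = "fst x" and b = "snd x"] by linarith
  then have "real_of_int (3 * (int N + 1)\<^sup>2) \<le> real_of_int (4 * Qf (fst x) (snd x))" by (rule of_int_le_iff[THEN iffD2])
  then show ?thesis by (simp add: cmod_eis_pt_sq)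
qed

lemma cmod_eis_pt_powr_le:
  assumes "x \<notin> coord_box N" "0 < t" "t \<le> 4"
  shows "cmod (eis_pt x) powr - t \<le> 2 * real (N + 1) powr - t"
proof -
  define r where "r = real (N + 1)"
  have r: "r > 0" by (simp add: r_def)
  have sq: "(cmod (eis_pt x))\<^sup>2 \<ge> 3 / 4 * r\<^sup>2" using cmod_eis_pt_ge[OF assms(1)] by (simp add: r_def add.commute)
  have c0: "cmod (eis_pt x) > 0"
  proof (rule ccontr)
    assume "\<not> cmod (eis_pt x) > 0"
    then have "(cmod (eis_pt x))\<^sup>2 = 0" by simp
    then show False using sq r by (simp add: power2_eq_square mult_le_0_iff)
  qed
  have "cmod (eis_pt x) powr - t = ((cmod (eis_pt x))\<^sup>2) powr (- t / 2)"
    by (rule powr_via_square[OF c0, symmetric])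
  also have "\<dots> \<le> (3 / 4 * r\<^sup>2) powr (- t / 2)" using sq r assms by (intro powr_mono2') auto
  also have "\<dots> = (3 / 4) powr (- t / 2) * r powr - t" 
  proof -
    have "(3 / 4 * r\<^sup>2) powr (- t / 2) = (3 / 4) powr (- t / 2) * (r\<^sup>2) powr (- t / 2)"
      by (rule powr_mult)
    then show ?thesis by (simp only: powr_via_square[OF r])
  qed
  \<comment> \<open>As \<open>t \<le> 4\<close>, the constant is at most
    \<open>(3/4) powr -2 = 16/9\<close>.\<close>
  also have "(3 / 4) powr (- t / 2) \<le> (3 / 4 :: real) powr (- 2)" using assms by (intro powr_mono') auto
  also have "(3 / 4 :: real) powr (- 2) \<le> 2" by (simp add: powr_minus powr_numeral power2_eq_square)
  finally show ?thesis by (simp add: r_def mult_right_mono)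
qed

text \<open>The layer between consecutive boxes has \<open>8 * (N + 1)\<close> points, whose
  absolute values are at least of order \<open>N + 1\<close>. This turns the lattice sum into a zeta
  sum with exponent \<open>t - 1\<close>.\<close>

lemma sum_coord_box_le:
  assumes "2 < t" "t \<le> 4"
  shows "(\<Sum>x\<in>coord_box N. cmod (eis_pt x) powr - t) \<le> 16 * (\<Sum>m=1..N. real m powr (1 - t))"
proof (induction N)
  case 0
  have "coord_box 0 = {(0, 0)}" by (auto simp: coord_box_def)
  then show ?case by (simp add: eis_pt_def)
next
  case (Suc N)
  have "(\<Sum>x\<in>coord_box (Suc N). cmod (eis_pt x) powr - t) = (\<Sum>x\<in>coord_box (Suc N) - coord_box N. cmod (eis_pt x) powr - t) + (\<Sum>x\<in>coord_box N. cmod (eis_pt x) powr - t)"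
    by (rule sum.subset_diff) (auto simp: coord_box_mono)
  also have "(\<Sum>x\<in>coord_box (Suc N) - coord_box N. cmod (eis_pt x) powr - t) \<le> (\<Sum>x\<in>coord_box (Suc N) - coord_box N. 2 * real (N + 1) powr - t)"
    by (intro sum_mono cmod_eis_pt_powr_le) (use assms in auto)
  also have "\<dots> = real (card (coord_box (Suc N) - coord_box N)) * (2 * real (N + 1) powr - t)" by simp
  also have "card (coord_box (Suc N) - coord_box N) = 8 * (N + 1)"
    by (subst card_Diff_subset) (auto simp: coord_box_mono card_coord_box power2_eq_square)
  also have "real (8 * (N + 1)) * (2 * real (N + 1) powr - t) = 16 * (real (N + 1) powr 1 * real (N + 1) powr - t)"
    by simp
  also have "real (N + 1) powr 1 * real (N + 1) powr - t = real (N + 1) powr (1 - t)"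
    by (simp only: powr_add[symmetric]) simp
  finally show ?case using Suc by simp
qed

lemma lattice_powr_upper:
  assumes "2 < t" "t \<le> 4"
  shows "(\<lambda>z. cmod z powr - t) summable_on Eis" "(\<Sum>\<^sub>\<infinity>z\<in>Eis. cmod z powr - t) \<le> 48 / (t - 2)"
proof -
  have bd: "(\<Sum>x\<in>F. cmod (eis_pt x) powr - t) \<le> 48 / (t - 2)" if F: "finite F" for F
  proof -
    have "\<exists>N\<ge>1. F \<subseteq> coord_box N"
      using F
    proof (induction F rule: finite_induct)
      case empty
      then show ?case by auto
    next
      case (insert x F)
      then obtain N where N: "N \<ge> 1" "F \<subseteq> coord_box N" by blast
      define M where "M = max N (nat (max \<bar>fst x\<bar> \<bar>snd x\<bar>))"
      have "x \<in> coord_box M" by (cases x) (auto simp: coord_box_def M_def)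
      moreover have "F \<subseteq> coord_box M" using N(2) coord_box_mono[of N M] by (auto simp: M_def)
      ultimately show ?case using N(1) by (intro exI[of _ M]) (auto simp: M_def)
    qed
    then obtain N where N: "N \<ge> 1" "F \<subseteq> coord_box N" by blast
    have "(\<Sum>x\<in>F. cmod (eis_pt x) powr - t) \<le> (\<Sum>x\<in>coord_box N. cmod (eis_pt x) powr - t)"
      using N by (intro sum_mono2) auto
    also have "\<dots> \<le> 16 * (\<Sum>m=1..N. real m powr (1 - t))" by (rule sum_coord_box_le[OF assms])
    also have "\<dots> \<le> 16 * (1 + 1 / (t - 2))"
    proof -
      have "(\<Sum>m=1..N. real m powr (-1 - (t - 2))) \<le> 1 + (1 - real N powr - (t - 2)) / (t - 2)"
        by (rule zeta_partial_upper) (use assms N in auto)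
      also have "\<dots> \<le> 1 + 1 / (t - 2)" using assms by (intro add_left_mono divide_right_mono) auto
      finally show ?thesis by simp
    qed
    \<comment> \<open>As \<open>t \<le> 4\<close>, the constant 1 is at most
      \<open>2 / (t - 2)\<close>, so the whole bound takes the shape of the simple pole at
      2.\<close>
    also have "\<dots> \<le> 16 * (2 / (t - 2) + 1 / (t - 2))" 
      using assms by (intro mult_left_mono add_right_mono) auto
    also have "\<dots> = 48 / (t - 2)" by (simp flip: add_divide_distrib)
    finally show ?thesis .
  qed
  have s: "(\<lambda>x. cmod (eis_pt x) powr - t) summable_on UNIV"
  proof (rule nonneg_bdd_above_summable_on)
    show "bdd_above (sum (\<lambda>x. cmod (eis_pt x) powr - t) ` {F. F \<subseteq> UNIV \<and> finite F})"
      by (rule bdd_aboveI[of _ "48 / (t - 2)"]) (use bd in blast)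
  qed simp
  then show "(\<lambda>z. cmod z powr - t) summable_on Eis"
    using summable_on_reindex_bij_betw[OF bij_eis_pt, of "\<lambda>z. cmod z powr - t"] by simp
  have "(\<Sum>\<^sub>\<infinity>x. cmod (eis_pt x) powr - t) \<le> 48 / (t - 2)"
    by (rule infsum_le_finite_sums[OF s]) (use bd in auto)
  then show "(\<Sum>\<^sub>\<infinity>z\<in>Eis. cmod z powr - t) \<le> 48 / (t - 2)"
    using infsum_reindex_bij_betw[OF bij_eis_pt, of "\<lambda>z. cmod z powr - t"] by simp
qed

text \<open>Only the points \<open>m + b * omega\<close> with \<open>0 \<le> b < m\<close> are kept.
  Their norm is at most \<open>3 * m ^ 2\<close>, which costs the factor
  \<open>3 powr -2 = 1/9\<close>, and the cut at \<open>N\<close> keeps at least half of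
  \<open>1 / d\<close> in the zeta sum.\<close>

lemma lattice_powr_lower:
  assumes "2 < t" "t \<le> 4"
  shows "(\<Sum>\<^sub>\<infinity>z\<in>Eis. cmod z powr - t) \<ge> 1 / (18 * (t - 2))"
proof -
  define d where "d = t - 2"
  have d: "d > 0" using assms by (simp add: d_def)
  have "(\<lambda>N. real (N + 1) powr - d) \<longlonglongrightarrow> 0" using d by real_asymp
  then have "eventually (\<lambda>N. real (N + 1) powr - d < 1/2) sequentially"
    by (rule order_tendstoD) simp
  then obtain N where N: "real (N + 1) powr - d < 1/2" by (auto simp: eventually_sequentially)
  define F where "F = (SIGMA m:{1..N}. {..<m})"
  define e where "e = (\<lambda>(m, b). (int m, int b))"
  have inj: "inj_on e F" by (auto simp: e_def inj_on_def)
  have s: "(\<lambda>x. cmod (eis_pt x) powr - t) summable_on UNIV"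
    using summable_on_reindex_bij_betw[OF bij_eis_pt, of "\<lambda>z. cmod z powr - t"] lattice_powr_upper(1)[OF assms] by simp
  have "1 / (18 * (t - 2)) = 1 / 9 * ((1 - 1/2) / d)" using d by (simp add: d_def field_simps)
  also have "\<dots> \<le> 1 / 9 * ((1 - real (N + 1) powr - d) / d)"
    using N d by (intro mult_left_mono divide_right_mono) auto
  also have "\<dots> \<le> 1 / 9 * (\<Sum>m=1..N. real m powr (-1 - d))"
    by (intro mult_left_mono zeta_partial_lower d) auto
  also have "\<dots> = (\<Sum>m=1..N. \<Sum>b<m. 1 / 9 * real m powr - t)"
  proof -
    have "real m powr (-1 - d) = real m * real m powr - t" if "m \<ge> 1" for m
    proof -
      have "real m * real m powr - t = real m powr 1 * real m powr - t" using that by simp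
      also have "\<dots> = real m powr (-1 - d)" by (simp only: powr_add[symmetric]) (simp add: d_def)
      finally show ?thesis by simp
    qed
    then show ?thesis by (simp add: sum_distrib_left mult.assoc mult.left_commute)
  qed
  also have "\<dots> = (\<Sum>(m, b)\<in>F. 1 / 9 * real m powr - t)" unfolding F_def by (rule sum.Sigma) auto
  also have "\<dots> \<le> (\<Sum>x\<in>F. cmod (eis_pt (e x)) powr - t)"
  proof (rule sum_mono)
    fix x assume x: "x \<in> F"
    obtain m b where xe: "x = (m, b)" by (cases x)
    have mb: "m \<ge> 1" "b < m" using x by (auto simp: xe F_def)
    have m0: "real m > 0" using mb by simp
    have "(cmod (eis_pt (e x)))\<^sup>2 = real m ^ 2 + real m * real b + real b ^ 2" by (simp add: cmod_eis_pt_sq xe e_def Qf_def)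
    also have "\<dots> \<le> real m ^ 2 + real m * real m + real m ^ 2" using mb by (intro add_mono mult_mono power_mono) auto
    finally have le: "(cmod (eis_pt (e x)))\<^sup>2 \<le> 3 * real m ^ 2" by (simp add: power2_eq_square)
    have "(cmod (eis_pt (e x)))\<^sup>2 \<ge> real m ^ 2" by (simp add: cmod_eis_pt_sq xe e_def Qf_def)
    then have c0: "cmod (eis_pt (e x)) > 0" using m0 by (cases "cmod (eis_pt (e x)) = 0") auto
    have "1 / 9 * real m powr - t \<le> 3 powr (- t / 2) * real m powr - t"
    proof (rule mult_right_mono)
      have "(3::real) powr (-2) \<le> 3 powr (- t / 2)" using assms by (intro powr_mono) auto
      then show "1 / 9 \<le> (3::real) powr (- t / 2)" by (simp add: powr_minus powr_numeral)
    qed simp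
    also have "\<dots> = (3 * real m ^ 2) powr (- t / 2)" using m0 powr_via_square[OF m0, of t] by (simp add: powr_mult)
    also have "\<dots> \<le> ((cmod (eis_pt (e x)))\<^sup>2) powr (- t / 2)" using le c0 assms by (intro powr_mono2') auto
    also have "\<dots> = cmod (eis_pt (e x)) powr - t" by (rule powr_via_square[OF c0])
    finally show "(case x of (m, b) \<Rightarrow> 1 / 9 * real m powr - t) \<le> cmod (eis_pt (e x)) powr - t" by (simp add: xe)
  qed
  also have "\<dots> = (\<Sum>x\<in>e ` F. cmod (eis_pt x) powr - t)" by (simp add: sum.reindex[OF inj])
  also have "\<dots> \<le> (\<Sum>\<^sub>\<infinity>x. cmod (eis_pt x) powr - t)" 
    by (rule finite_sum_le_infsum[OF s]) (auto simp: F_def)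
  also have "\<dots> = (\<Sum>\<^sub>\<infinity>z\<in>Eis. cmod z powr - t)"
    using infsum_reindex_bij_betw[OF bij_eis_pt, of "\<lambda>z. cmod z powr - t"] by simp
  finally show ?thesis .
qed

text \<open>The residues modulo \<open>alpha k\<close> are \<open>0, \<dots>, alpha_norm k - 1\<close>. Since they are small compared with
  \<open>alpha k * z\<close>, a sum over \<open>Eis\<close> of \<open>ang k\<close> times a radial function nearly reproduces itself
  with a factor whose phase is \<open>ang k (alpha k)\<close>. That phase stays away from 1 for every \<open>k\<close>
  (\<open>phase_Im\<close>), so the sum is small. This replaces the functional equation.\<close>
definition alpha :: "nat \<Rightarrow> complex" where "alpha k = of_nat (6 * k) + omega"
definition alpha_norm :: "nat \<Rightarrow> nat" where "alpha_norm k = (6 * k)\<^sup>2 + 6 * k + 1"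

lemma alpha_Eis [simp, intro]: "alpha k \<in> Eis"
  unfolding alpha_def by (intro Eis_add Eis_of_nat Eis_omega)

lemma alpha_cnj: "alpha k * cnj (alpha k) = of_nat (alpha_norm k)" and alpha_sq: "(cmod (alpha k))\<^sup>2 = real (alpha_norm k)"
proof -
  have "(cmod (of_int (int (6 * k)) + of_int 1 * omega))\<^sup>2 = real_of_int (Qf (int (6 * k)) 1)" by (rule cmod_sq_Eis)
  then show 1: "(cmod (alpha k))\<^sup>2 = real (alpha_norm k)" by (simp add: alpha_def alpha_norm_def Qf_def)
  show "alpha k * cnj (alpha k) = of_nat (alpha_norm k)"
    using 1 complex_norm_square[of "alpha k"] by (metis of_real_of_nat_eq)
qed

lemma alpha_norm_pos: "alpha_norm k > 0" by (simp add: alpha_norm_def)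

lemma alpha_nz: "alpha k \<noteq> 0" using alpha_sq[of k] alpha_norm_pos[of k] by auto

text \<open>As the \<open>omega\<close>-coordinate of \<open>alpha k\<close> is 1, subtracting a
  multiple of it makes any point rational, and \<open>alpha_norm k\<close> itself is a multiple. For
  uniqueness, multiply by \<open>cnj (alpha k)\<close> and compare the
  \<open>omega\<close>-coordinates.\<close>

lemma residues_bij: "bij_betw (\<lambda>(z, r). alpha k * z + of_nat r) (Eis \<times> {..<alpha_norm k}) Eis"
proof (rule bij_betwI')
  fix x y assume xy: "x \<in> Eis \<times> {..<alpha_norm k}" "y \<in> Eis \<times> {..<alpha_norm k}"
  obtain z r w t where e: "x = (z, r)" "y = (w, t)" by (cases x, cases y)
  have m: "z \<in> Eis" "w \<in> Eis" "r < alpha_norm k" "t < alpha_norm k" using xy by (auto simp: e)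
  have "z = w \<and> r = t" if eq: "alpha k * z + of_nat r = alpha k * w + of_nat t"
  proof -
    define d where "d = int t - int r"
    have "alpha k * (z - w) = of_int d" using eq by (simp add: d_def algebra_simps)
    then have "cnj (alpha k) * (alpha k * (z - w)) = cnj (alpha k) * of_int d" by simp
    then have *: "of_nat (alpha_norm k) * (z - w) = cnj (alpha k) * of_int d" 
      by (simp add: mult.assoc[symmetric] mult.commute[of "cnj (alpha k)" "alpha k"] alpha_cnj)
    have "z - w \<in> Eis" using m by blast
    then obtain a b where ab: "z - w = of_int a + of_int b * omega" by (elim EisE)
    have "of_int (int (alpha_norm k) * a) + of_int (int (alpha_norm k) * b) * omega = of_int ((6 * int k + 1) * d) + of_int (- d) * omega"
      using * unfolding ab by (simp add: alpha_def cnj_omega algebra_simps)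
    from coords_inj[OF this] have "int (alpha_norm k) * b = - d" by simp
    then have "int (alpha_norm k) dvd d" by (metis dvd_minus_iff dvd_triv_left)
    moreover have "\<bar>d\<bar> < int (alpha_norm k)" using m by (auto simp: d_def)
    ultimately have "d = 0" using zdvd_not_zless[of "\<bar>d\<bar>" "int (alpha_norm k)"] by auto
    then have "r = t" by (simp add: d_def)
    then show ?thesis using eq alpha_nz by simp
  qed
  then show "((case x of (z, r) \<Rightarrow> alpha k * z + of_nat r) = (case y of (z, r) \<Rightarrow> alpha k * z + of_nat r)) = (x = y)"
    by (auto simp: e)
next
  fix x assume "x \<in> Eis \<times> {..<alpha_norm k}"
  then show "(case x of (z, r) \<Rightarrow> alpha k * z + of_nat r) \<in> Eis" by (cases x) (auto intro!: Eis_add Eis_mult)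
next
  fix z assume "z \<in> Eis"
  then obtain a b where ab: "z = of_int a + of_int b * omega" by (elim EisE)
  define c where "c = a - b * int (6 * k)"
  define j where "j = c div int (alpha_norm k)"
  define r where "r = nat (c mod int (alpha_norm k))"
  have r: "r < alpha_norm k" "int r = c mod int (alpha_norm k)" using alpha_norm_pos[of k] by (auto simp: r_def nat_less_iff)
  have c: "c = int (alpha_norm k) * j + int r" unfolding r(2) j_def by simp
  have "alpha k * (of_int b + of_int j * cnj (alpha k)) + of_nat r
     = of_int b * alpha k + of_int j * (alpha k * cnj (alpha k)) + of_nat r" by (simp add: algebra_simps)
  also have "\<dots> = of_int b * alpha k + of_int c" unfolding alpha_cnj c by (simp add: algebra_simps)
  also have "\<dots> = z" by (simp add: ab c_def alpha_def algebra_simps)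
  finally show "\<exists>x\<in>Eis \<times> {..<alpha_norm k}. z = (case x of (z, r) \<Rightarrow> alpha k * z + of_nat r)"
    using r(1) by (intro bexI[of _ "(of_int b + of_int j * cnj (alpha k), r)"]) (auto intro!: Eis_add Eis_mult Eis_cnj)
qed

lemma Eis_cmod_ge_1: "z \<in> Eis \<Longrightarrow> z \<noteq> 0 \<Longrightarrow> cmod z \<ge> 1"
proof -
  assume z: "z \<in> Eis" "z \<noteq> 0"
  then have "enorm z \<ge> 1" using enorm_eq_0[of z] by simp
  then have "(cmod z)\<^sup>2 \<ge> 1" using real_enorm[OF z(1)] by linarith
  then show ?thesis using power2_le_imp_le[of 1 "cmod z"] by simp
qed

section \<open>Approximate self-similarity of twisted lattice sums\<close>

definition twisted :: "nat \<Rightarrow> (real \<Rightarrow> real) \<Rightarrow> complex \<Rightarrow> complex" where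
  "twisted k u z = ang k z * of_real (u (cmod z))"

lemma ang_0: "k \<ge> 1 \<Longrightarrow> ang k 0 = 0" by (simp add: ang_def)

lemma twisted_0: "k \<ge> 1 \<Longrightarrow> twisted k u 0 = 0" by (simp add: twisted_def ang_0)

lemma norm_twisted_le: "cmod (twisted k u z) \<le> \<bar>u (cmod z)\<bar>"
  using norm_ang_le[of k z] by (simp add: twisted_def norm_mult mult_left_le_one_le)

lemma sgn_diff_le:
  fixes z w :: complex assumes "z \<noteq> 0" "w \<noteq> 0"
  shows "cmod (sgn w - sgn z) \<le> 2 * cmod (w - z) / cmod z"
proof -
  have e: "sgn w - sgn z = (w - z) / cmod z + w * of_real (1 / cmod w - 1 / cmod z)"
    using assms by (simp add: sgn_div_norm scaleR_conv_of_real field_simps)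
  have d: "1 / cmod w - 1 / cmod z = (cmod z - cmod w) / (cmod w * cmod z)" using assms by (simp add: field_simps)
  have "cmod (w * of_real (1 / cmod w - 1 / cmod z)) = cmod w * \<bar>(cmod z - cmod w) / (cmod w * cmod z)\<bar>" 
    by (simp only: norm_mult norm_of_real d)
  also have "cmod w * \<bar>(cmod z - cmod w) / (cmod w * cmod z)\<bar> = \<bar>cmod z - cmod w\<bar> / cmod z" 
    using assms by (simp add: abs_mult)
  also have "\<dots> \<le> cmod (w - z) / cmod z" 
    using norm_triangle_ineq3[of z w] by (intro divide_right_mono) (auto simp: norm_minus_commute)
  finally have "cmod (w * of_real (1 / cmod w - 1 / cmod z)) \<le> cmod (w - z) / cmod z" .
  moreover have "cmod ((w - z) / cmod z) = cmod (w - z) / cmod z" by (simp add: norm_divide)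
  ultimately show ?thesis unfolding e using norm_triangle_ineq[of "(w - z) / cmod z" "w * of_real (1 / cmod w - 1 / cmod z)"]
    by simp
qed

lemma ang_diff_le:
  fixes z w :: complex assumes "z \<noteq> 0" "w \<noteq> 0"
  shows "cmod (ang k w - ang k z) \<le> 12 * real k * cmod (w - z) / cmod z"
proof -
  have "cmod (ang k w - ang k z) \<le> real (6 * k) * cmod (sgn w - sgn z)"
    unfolding ang_def by (rule norm_power_diff) (auto simp: norm_sgn)
  also have "\<dots> \<le> real (6 * k) * (2 * cmod (w - z) / cmod z)"
    by (intro mult_left_mono sgn_diff_le assms) auto
  finally show ?thesis by simp
qed

text \<open>These bounds hold for \<open>r powr - (2 * x)\<close> and, with a constant proportional
  to \<open>y - x\<close>, for the difference of two such functions. The logarithms account for the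
  latter.\<close>

definition tame :: "real \<Rightarrow> (real \<Rightarrow> real) \<Rightarrow> bool" where
  "tame A u \<longleftrightarrow> A \<ge> 0 \<and> (\<forall>r\<ge>1. \<bar>u r\<bar> \<le> A * (1 + ln r) / r ^ 2) \<and>
     (\<forall>r r'. 1 \<le> r \<longrightarrow> r \<le> r' \<longrightarrow> \<bar>u r - u r'\<bar> \<le> A * (1 + ln r') / r ^ 3 * (r' - r))"

lemma tame_diff_le:
  assumes "tame A u" "a \<ge> 1" "b \<ge> 1" "a \<ge> m" "b \<ge> m" "a \<le> M" "b \<le> M" "m > 0"
  shows "\<bar>u a - u b\<bar> \<le> A * (1 + ln M) / m ^ 3 * \<bar>a - b\<bar>"
proof -
  have *: "\<bar>u r - u r'\<bar> \<le> A * (1 + ln M) / m ^ 3 * (r' - r)" if "1 \<le> r" "r \<le> r'" "m \<le> r" "r' \<le> M" for r r'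
  proof -
    have "\<bar>u r - u r'\<bar> \<le> A * (1 + ln r') / r ^ 3 * (r' - r)" using assms(1) that by (simp add: tame_def)
    also have "\<dots> \<le> A * (1 + ln M) / m ^ 3 * (r' - r)"
      using that assms(1,8) by (intro mult_right_mono frac_le mult_left_mono power_mono add_left_mono) (auto simp: tame_def)
    finally show ?thesis .
  qed
  show ?thesis
  proof (cases "a \<le> b")
    case True
    then show ?thesis using *[of a b] assms by simp
  next
    case False
    then show ?thesis using *[of b a] assms by (simp add: abs_minus_commute)
  qed
qed

lemma ln_sqrt_bound: "r \<ge> 1 \<Longrightarrow> 1 + ln (2 * r) \<le> 4 * r powr (1/2)" for r :: real
proof -
  assume r: "r \<ge> 1"
  have "ln (2 * r) \<le> (2 * r) powr (1/2) / (1/2)" using r by (intro ln_powr_bound) auto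
  also have "(2 * r) powr (1/2) = sqrt 2 * r powr (1/2)" using r by (simp add: powr_mult powr_half_sqrt)
  finally have 1: "ln (2 * r) \<le> 2 * sqrt 2 * r powr (1/2)" by simp
  have "sqrt 2 \<le> sqrt ((3/2)^2)" by (intro real_sqrt_le_mono) (simp add: power2_eq_square)
  then have "sqrt 2 \<le> 3/2" by simp
  then have "2 * sqrt 2 * r powr (1/2) \<le> 3 * r powr (1/2)" by (intro mult_right_mono) auto
  moreover have "r powr (1/2) \<ge> 1" using r by (intro ge_one_powr_ge_zero) auto
  ultimately show ?thesis using 1 by linarith
qed

text \<open>Moving a distant point by at most \<open>q\<close> changes the radial factor relatively
  by about \<open>q / r\<close> and the phase by \<open>k * q / r\<close>. The power of
  \<open>r\<close> gained makes the lattice sum converge even at the critical exponent 2; the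
  logarithm is paid for with \<open>r powr (1/2)\<close>, hence the exponent 5/2.\<close>

lemma twisted_diff_tail:
  assumes "k \<ge> 1" "tame A u" "z \<in> Eis" "w \<in> Eis" "cmod (w - z) \<le> q" "2 * q \<le> cmod z" "q \<ge> 1"
  shows "cmod (twisted k u w - twisted k u z) \<le> 80 * real k * q * A * cmod z powr (- 5 / 2)"
proof -
  define r where "r = cmod z"
  have A: "A \<ge> 0" using assms(2) by (simp add: tame_def)
  have r2: "r \<ge> 2" using assms by (simp add: r_def)
  have z0: "z \<noteq> 0" using r2 by (auto simp: r_def)
  have w1: "cmod w \<ge> r / 2" using norm_triangle_ineq2[of z w] assms by (simp add: r_def norm_minus_commute)
  have w2: "cmod w \<le> 2 * r" using norm_triangle_ineq2[of w z] assms by (simp add: r_def)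
  have w0: "w \<noteq> 0" using w1 r2 by auto
  have lnpos: "ln (2 * r) \<ge> 0" using r2 by simp
  have "\<bar>u (cmod w) - u r\<bar> \<le> A * (1 + ln (2 * r)) / (r / 2) ^ 3 * \<bar>cmod w - r\<bar>"
    by (rule tame_diff_le[OF assms(2)]) (use w1 w2 r2 Eis_cmod_ge_1[OF assms(4) w0] in auto)
  also have "\<dots> \<le> A * (1 + ln (2 * r)) / (r / 2) ^ 3 * q"
    using norm_triangle_ineq3[of w z] assms A r2 lnpos by (intro mult_left_mono) (auto simp: r_def)
  finally have 1: "\<bar>u (cmod w) - u r\<bar> \<le> A * (1 + ln (2 * r)) / r ^ 3 * (8 * q)" by (simp add: power_divide field_simps)
  have "\<bar>u r\<bar> \<le> A * (1 + ln r) / r ^ 2" using assms(2) r2 by (simp add: tame_def)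
  also have "\<dots> \<le> A * (1 + ln (2 * r)) / r ^ 2" using A r2 by (intro divide_right_mono mult_left_mono) auto
  finally have ur: "\<bar>u r\<bar> \<le> A * (1 + ln (2 * r)) / r ^ 2" .
  have "cmod (ang k w - ang k z) \<le> 12 * real k * cmod (w - z) / r" unfolding r_def by (rule ang_diff_le[OF z0 w0])
  also have "\<dots> \<le> 12 * real k * q / r" using assms r2 by (intro divide_right_mono mult_left_mono) auto
  finally have "\<bar>u r\<bar> * cmod (ang k w - ang k z) \<le> A * (1 + ln (2 * r)) / r ^ 2 * (12 * real k * q / r)"
    using ur A lnpos r2 by (intro mult_mono) auto
  then have 2: "\<bar>u r\<bar> * cmod (ang k w - ang k z) \<le> A * (1 + ln (2 * r)) / r ^ 3 * (12 * real k * q)" 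
    by (simp add: power3_eq_cube power2_eq_square)
  have "twisted k u w - twisted k u z = ang k w * of_real (u (cmod w) - u r) + of_real (u r) * (ang k w - ang k z)"
    by (simp add: twisted_def r_def algebra_simps)
  then have "cmod (twisted k u w - twisted k u z) \<le> cmod (ang k w * of_real (u (cmod w) - u r)) + cmod (of_real (u r) * (ang k w - ang k z))"
    using norm_triangle_ineq by metis
  also have "\<dots> \<le> \<bar>u (cmod w) - u r\<bar> + \<bar>u r\<bar> * cmod (ang k w - ang k z)"
    unfolding norm_mult norm_of_real using norm_ang_le[of k w] by (intro add_mono mult_left_le_one_le) auto
  also have "\<dots> \<le> A * (1 + ln (2 * r)) / r ^ 3 * (8 * q) + A * (1 + ln (2 * r)) / r ^ 3 * (12 * real k * q)"
    using 1 2 by linarith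
  also have "\<dots> = A * (1 + ln (2 * r)) / r ^ 3 * (8 * q + 12 * real k * q)" by (simp only: distrib_left)
  also have "\<dots> \<le> A * (4 * r powr (1/2)) / r ^ 3 * (20 * real k * q)"
  proof (intro mult_mono divide_right_mono mult_left_mono)
    show "1 + ln (2 * r) \<le> 4 * r powr (1/2)" using r2 by (intro ln_sqrt_bound) auto
    have "1 * q \<le> real k * q" using assms by (intro mult_right_mono) auto
    then show "8 * q + 12 * real k * q \<le> 20 * real k * q" by linarith
  qed (use A r2 assms in auto)
  also have "\<dots> = 80 * real k * q * A * (r powr (1/2) / r ^ 3)" by simp
  also have "r powr (1/2) / r ^ 3 = r powr (1/2) / r powr 3" using r2 by simp
  also have "\<dots> = r powr (- 5 / 2)" by (simp only: powr_diff[symmetric]) simp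
  finally show ?thesis by (simp add: r_def)
qed

lemma alpha_norm_bounds:
  assumes "k \<ge> 1" 
  shows "real (alpha_norm k) \<ge> 43" "real k \<le> real (alpha_norm k)" "ln (real (alpha_norm k)) \<le> 4 * (1 + ln (real k))"
proof -
  have k1: "real k \<ge> 1" using assms by simp
  have q: "real (alpha_norm k) = 36 * real k ^ 2 + 6 * real k + 1" by (simp add: alpha_norm_def power_mult_distrib)
  have kk: "real k \<le> real k ^ 2" using k1 self_le_power[of "real k" 2] by simp
  show 1: "real (alpha_norm k) \<ge> 43" "real k \<le> real (alpha_norm k)" using k1 kk unfolding q by linarith+
  have "real (alpha_norm k) \<le> 49 * real k ^ 2" using k1 kk unfolding q by linarith
  then have "ln (real (alpha_norm k)) \<le> ln (49 * real k ^ 2)" using 1 by (intro ln_mono) auto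
  also have "\<dots> = ln 49 + 2 * ln (real k)" using k1 by (simp add: ln_mult ln_realpow)
  also have "ln (49::real) \<le> 4"
  proof -
    have "(49::real) \<le> (1 + 1) ^ 6" by simp
    have "exp (4::real) = (exp 1) ^ 4" by (simp flip: exp_of_nat_mult)
    also have "\<dots> \<ge> 2.7 ^ 4" using e_less_272 exp_ge_add_one_self[of 1] e_approx_32 by (intro power_mono) (auto simp: abs_if split: if_splits)
    finally have "(49::real) \<le> exp 4" by (simp add: eval_nat_numeral)
    then show ?thesis using ln_le_cancel_iff[of 49 "exp 4"] by simp
  qed
  finally show "ln (real (alpha_norm k)) \<le> 4 * (1 + ln (real k))" using ln_ge_zero[OF k1] by simp
qed

text \<open>For \<open>r \<le> M\<close> the exponent may be raised by \<open>1 / ln M\<close> at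
  the cost of a factor \<open>exp 1\<close>. The resulting lattice sum converges and has size
  \<open>ln M\<close>.\<close>

lemma twisted_head_le:
  assumes "k \<ge> 1" "tame A u" "z \<in> Eis" "cmod z \<le> M" "M \<ge> 2"
  shows "cmod (twisted k u z) \<le> exp 1 * A * (1 + ln M) * cmod z powr - (2 + 1 / ln M)"
proof (cases "z = 0")
  case True
  then show ?thesis using twisted_0[OF assms(1), of u] by simp
next
  case False
  define r where "r = cmod z"
  have r: "r \<ge> 1" unfolding r_def by (rule Eis_cmod_ge_1[OF assms(3) False])
  have A: "A \<ge> 0" using assms(2) by (simp add: tame_def)
  have lM: "ln M > 0" using assms by simp
  have "ln r \<le> ln M" using r assms by (intro ln_mono) (auto simp: r_def)
  have "cmod (twisted k u z) \<le> \<bar>u r\<bar>" using norm_twisted_le[of k u z] by (simp add: r_def)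
  also have "\<dots> \<le> A * (1 + ln r) / r ^ 2" using assms(2) r by (simp add: tame_def)
  also have "\<dots> \<le> A * (1 + ln M) / r ^ 2" using A \<open>ln r \<le> ln M\<close> r by (intro divide_right_mono mult_left_mono) auto
  also have "\<dots> = A * (1 + ln M) * (r powr - (2 + 1 / ln M) * r powr (1 / ln M))"
  proof -
    have "r powr - (2 + 1 / ln M) * r powr (1 / ln M) = r powr - 2" by (simp only: powr_add[symmetric]) simp
    also have "\<dots> = 1 / r ^ 2" using r by (simp add: powr_minus powr_numeral divide_inverse)
    finally show ?thesis by simp
  qed
  also have "\<dots> \<le> A * (1 + ln M) * (r powr - (2 + 1 / ln M) * exp 1)"
  proof -
    have "r powr (1 / ln M) = exp (ln r / ln M)" using r by (simp add: powr_def)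
    also have "\<dots> \<le> exp 1" using lM \<open>ln r \<le> ln M\<close> by (simp add: divide_le_eq)
    finally show ?thesis using A lM by (intro mult_left_mono) auto
  qed
  finally show ?thesis by (simp add: r_def mult_ac)
qed

text \<open>Below \<open>cutoff k\<close> in absolute value each term is estimated trivially, beyond it by comparison
  with the neighbouring multiple of \<open>alpha k\<close>.\<close>
definition cutoff :: "nat \<Rightarrow> real" where "cutoff k = real (alpha_norm k) ^ 12"

text \<open>The power 12 is taken so that \<open>cutoff k powr (-1/4)\<close> saves
  \<open>alpha_norm k ^ 3\<close>: two of these factors absorb \<open>k\<close> and \<open>q\<close>
  in \<open>twisted_diff_tail\<close>, the third pays for the sum over the
  \<open>alpha_norm k\<close> residues.\<close>

lemma cutoff_bounds:
  assumes "k \<ge> 1"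
  shows "cutoff k \<ge> 2 * real (alpha_norm k)" "ln (2 * cutoff k) \<le> 52 * (1 + ln (real k))" "2 * cutoff k \<ge> 2" "ln (2 * cutoff k) \<ge> 1/2"
    "cutoff k powr (-1/4) = 1 / real (alpha_norm k) ^ 3"
proof -
  have q: "real (alpha_norm k) \<ge> 43" by (rule alpha_norm_bounds(1)[OF assms])
  have "real (alpha_norm k) ^ 1 \<le> real (alpha_norm k) ^ 11" using q by (intro power_increasing) auto
  then have "real (alpha_norm k) ^ 11 \<ge> 2" using q unfolding power_one_right by linarith
  then have "real (alpha_norm k) ^ 11 * real (alpha_norm k) \<ge> 2 * real (alpha_norm k)" using q by (intro mult_right_mono) auto
  then show Y: "cutoff k \<ge> 2 * real (alpha_norm k)" by (simp add: cutoff_def eval_nat_numeral mult_ac)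
  then show Y2: "2 * cutoff k \<ge> 2" using q by simp
  have "2 * cutoff k \<le> real (alpha_norm k) ^ 13"
  proof -
    have "2 * real (alpha_norm k) ^ 12 \<le> real (alpha_norm k) * real (alpha_norm k) ^ 12" using q by (intro mult_right_mono) auto
    then show ?thesis by (simp add: cutoff_def eval_nat_numeral)
  qed
  then have "ln (2 * cutoff k) \<le> ln (real (alpha_norm k) ^ 13)" using Y2 by (intro ln_mono) auto
  also have "\<dots> = 13 * ln (real (alpha_norm k))" using q by (simp add: ln_realpow)
  also have "\<dots> \<le> 13 * (4 * (1 + ln (real k)))" using alpha_norm_bounds(3)[OF assms] by simp
  finally show "ln (2 * cutoff k) \<le> 52 * (1 + ln (real k))" by simp
  have "1 - 1 / 2 \<le> ln (2::real)" using ln_le_minus_one[of "1/2"] by (simp add: ln_div)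
  also have "ln 2 \<le> ln (2 * cutoff k)" using Y2 by (intro ln_mono) auto
  finally show "ln (2 * cutoff k) \<ge> 1/2" by simp
  have "cutoff k = real (alpha_norm k) powr 12" using q by (simp add: cutoff_def)
  then have "cutoff k powr (-1/4) = real (alpha_norm k) powr (12 * (-1/4))" by (simp only: powr_powr)
  also have "12 * (-1/4) = - (3::real)" by simp
  also have "real (alpha_norm k) powr - 3 = 1 / real (alpha_norm k) powr 3" by (simp only: powr_minus divide_inverse mult_1)
  also have "real (alpha_norm k) powr 3 = real (alpha_norm k) ^ 3" using q by (intro powr_numeral) simp
  finally show "cutoff k powr (-1/4) = 1 / real (alpha_norm k) ^ 3" .
qed

lemma twisted_diff_le:
  assumes "k \<ge> 1" "tame A u" "z \<in> Eis" "r < alpha_norm k"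
  defines "t \<equiv> 2 + 1 / ln (2 * cutoff k)"
  shows "cmod (twisted k u (alpha k * z + of_nat r) - twisted k u (alpha k * z)) 
    \<le> exp 1 * A * (1 + ln (2 * cutoff k)) * (cmod (alpha k * z + of_nat r) powr - t + cmod (alpha k * z) powr - t)
      + 80 * A / real (alpha_norm k) * cmod z powr - (9/4)"
proof -
  define x where "x = alpha k * z"
  define w where "w = alpha k * z + of_nat r"
  define q where "q = real (alpha_norm k)"
  have A: "A \<ge> 0" using assms(2) by (simp add: tame_def)
  have xE: "x \<in> Eis" "w \<in> Eis" using assms(3) by (auto simp: x_def w_def intro!: Eis_add Eis_mult)
  have q: "q \<ge> 43" "real k \<le> q" using alpha_norm_bounds[OF assms(1)] by (auto simp: q_def)
  note Y = cutoff_bounds[OF assms(1), folded q_def]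
  have wx: "cmod (w - x) \<le> q" using assms(4) by (simp add: w_def x_def q_def)
  show ?thesis
  proof (cases "cmod x \<le> cutoff k")
    case True
    have w: "cmod w \<le> 2 * cutoff k" using norm_triangle_ineq2[of w x] wx True Y(1) q by linarith
    have x: "cmod x \<le> 2 * cutoff k" using True Y(3) by linarith
    have "cmod (twisted k u w - twisted k u x) \<le> cmod (twisted k u w) + cmod (twisted k u x)" by (rule norm_triangle_ineq4)
    also have "\<dots> \<le> exp 1 * A * (1 + ln (2 * cutoff k)) * cmod w powr - t + exp 1 * A * (1 + ln (2 * cutoff k)) * cmod x powr - t"
      unfolding t_def by (intro add_mono twisted_head_le assms(1,2) xE w x Y(3))
    also have "\<dots> = exp 1 * A * (1 + ln (2 * cutoff k)) * (cmod w powr - t + cmod x powr - t)" by (simp only: distrib_left)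
    also have "\<dots> \<le> exp 1 * A * (1 + ln (2 * cutoff k)) * (cmod w powr - t + cmod x powr - t) + 80 * A / q * cmod z powr - (9/4)"
      using A q by simp
    finally show ?thesis by (simp only: w_def x_def q_def)
  next
    case False
    then have xY: "cmod x \<ge> cutoff k" by simp
    have Ypos: "cutoff k > 0" using Y(3) by simp
    have z0: "z \<noteq> 0" using xY Ypos by (auto simp: x_def)
    have "cmod (twisted k u w - twisted k u x) \<le> 80 * real k * q * A * cmod x powr (- 5 / 2)"
      by (rule twisted_diff_tail[OF assms(1,2) xE wx]) (use xY Y(1) q in auto)
    also have "\<dots> \<le> 80 * real k * q * A * (1 / q ^ 3 * cmod z powr - (9/4))"
    proof (rule mult_left_mono)
      \<comment> \<open>The part 1/4 of the exponent is traded for the size of \<open>x\<close>; the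
        remaining 9/4 still exceeds the critical value 2.\<close>
      have "cmod x powr (- 5 / 2) = cmod x powr (-1/4) * cmod x powr - (9/4)" by (simp only: powr_add[symmetric]) simp
      also have "\<dots> \<le> cutoff k powr (-1/4) * cmod z powr - (9/4)"
      proof (rule mult_mono)
        show "cmod x powr (-1/4) \<le> cutoff k powr (-1/4)" using xY Ypos by (intro powr_mono2') auto
        have "1 \<le> cmod (alpha k)" using Eis_cmod_ge_1[OF alpha_Eis alpha_nz] .
        then have "1 * cmod z \<le> cmod (alpha k) * cmod z" by (intro mult_right_mono) auto
        then have "cmod z \<le> cmod x" by (simp add: x_def norm_mult)
        then show "cmod x powr - (9/4) \<le> cmod z powr - (9/4)" using z0 by (intro powr_mono2') auto
      qed auto
      also have "cutoff k powr (-1/4) = 1 / q ^ 3" by (rule Y(5))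
      finally show "cmod x powr (- 5 / 2) \<le> 1 / q ^ 3 * cmod z powr - (9/4)" .
    qed (use A q in auto)
    also have "\<dots> = 80 * A / q * cmod z powr - (9/4) * (real k / q)" using q by (simp add: power3_eq_cube field_simps)
    also have "\<dots> \<le> 80 * A / q * cmod z powr - (9/4) * 1" using A q by (intro mult_left_mono) auto
    also have "\<dots> \<le> exp 1 * A * (1 + ln (2 * cutoff k)) * (cmod w powr - t + cmod x powr - t) + 80 * A / q * cmod z powr - (9/4)"
      using A Y(4) by simp
    finally show ?thesis by (simp only: w_def x_def q_def)
  qed
qed

lemma alpha_mult_summable:
  fixes f :: "complex \<Rightarrow> 'a :: banach"
  assumes "(\<lambda>z. norm (f z)) summable_on Eis" "r < alpha_norm k"
  shows "(\<lambda>z. norm (f (alpha k * z + of_nat r))) summable_on Eis"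
proof -
  have inj: "inj_on (\<lambda>z. alpha k * z + of_nat r) Eis" using alpha_nz by (auto simp: inj_on_def)
  have "(\<lambda>z. norm (f z)) summable_on (\<lambda>z. alpha k * z + of_nat r) ` Eis"
    by (rule summable_on_subset_banach[OF assms(1)]) (auto intro!: Eis_add Eis_mult)
  then show ?thesis using summable_on_reindex[OF inj, of "\<lambda>z. norm (f z)"] by (simp add: o_def)
qed

lemma infsum_residue_classes:
  fixes f :: "complex \<Rightarrow> 'a :: banach"
  assumes "(\<lambda>z. norm (f z)) summable_on Eis"
  shows "infsum f Eis = (\<Sum>r<alpha_norm k. \<Sum>\<^sub>\<infinity>z\<in>Eis. f (alpha k * z + of_nat r))"
proof -
  have fs: "f summable_on Eis" using assms by (rule abs_summable_summable)
  have bij: "bij_betw (\<lambda>(r, z). alpha k * z + of_nat r) ({..<alpha_norm k} \<times> Eis) Eis"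
  proof -
    have "bij_betw prod.swap ({..<alpha_norm k} \<times> Eis) (Eis \<times> {..<alpha_norm k})"
      by (rule bij_betw_byWitness[where f' = prod.swap]) auto
    from bij_betw_trans[OF this residues_bij[of k]] show ?thesis by (simp add: o_def case_prod_unfold)
  qed
  have "infsum f Eis = (\<Sum>\<^sub>\<infinity>x\<in>{..<alpha_norm k} \<times> Eis. f (case x of (r, z) \<Rightarrow> alpha k * z + of_nat r))"
    using infsum_reindex_bij_betw[OF bij, of f] by simp
  also have "\<dots> = (\<Sum>\<^sub>\<infinity>x\<in>{..<alpha_norm k} \<times> Eis. case x of (r, z) \<Rightarrow> f (alpha k * z + of_nat r))"
    by (intro infsum_cong) auto
  also have "\<dots> = (\<Sum>\<^sub>\<infinity>r\<in>{..<alpha_norm k}. \<Sum>\<^sub>\<infinity>z\<in>Eis. f (alpha k * z + of_nat r))"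
  proof (rule infsum_Sigma'_banach[symmetric])
    have "(\<lambda>x. f (case x of (r, z) \<Rightarrow> alpha k * z + of_nat r)) summable_on {..<alpha_norm k} \<times> Eis"
      using summable_on_reindex_bij_betw[OF bij, of f] fs by simp
    then show "(\<lambda>(r, z). f (alpha k * z + of_nat r)) summable_on {..<alpha_norm k} \<times> Eis"
      by (subst (asm) summable_on_cong[where g = "\<lambda>(r, z). f (alpha k * z + of_nat r)"]) auto
  qed
  finally show ?thesis by simp
qed

lemma infsum_minus_distrib:
  fixes f g :: "'b \<Rightarrow> 'a :: banach"
  assumes "f summable_on X" "g summable_on X"
  shows "(\<Sum>\<^sub>\<infinity>x\<in>X. f x - g x) = infsum f X - infsum g X"
  using infsum_add[of f X "\<lambda>x. - g x"] assms by (simp add: summable_on_uminus infsum_uminus)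

text \<open>Every residue class is compared with the class of 0 term by term. One factor
  \<open>1 + ln k\<close> comes from the weight \<open>1 + l\<close> of the near terms, the other
  from their lattice sum, which has \<open>t - 2 = 1 / l\<close> and therefore size
  \<open>48 * l\<close>.\<close>

lemma class_difference_bound:
  assumes "k \<ge> 1" "tame A u" "(\<lambda>z. norm (twisted k u z)) summable_on Eis"
  shows "cmod (infsum (twisted k u) Eis - of_nat (alpha_norm k) * (\<Sum>\<^sub>\<infinity>z\<in>Eis. twisted k u (alpha k * z)))
    \<le> 10 ^ 6 * A * (1 + ln (real k)) ^ 2"
proof -
  define q where "q = real (alpha_norm k)"
  define L where "L = 1 + ln (real k)"
  define l where "l = ln (2 * cutoff k)"
  define t where "t = 2 + 1 / l"
  define M where "M = exp 1 * A * (1 + l)"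
  define N where "N = 80 * A / q"
  have L1: "L \<ge> 1" using assms(1) by (simp add: L_def)
  have A: "A \<ge> 0" using assms(2) by (simp add: tame_def)
  have q: "q \<ge> 43" using alpha_norm_bounds[OF assms(1)] by (simp add: q_def)
  have l: "l \<le> 52 * L" "l \<ge> 1/2" using cutoff_bounds[OF assms(1)] by (auto simp: l_def L_def)
  have t: "2 < t" "t \<le> 4" using l by (auto simp: t_def field_simps)
  have M0: "M \<ge> 0" using A l by (simp add: M_def)
  have N0: "N \<ge> 0" using A q by (simp add: N_def)
  define S where "S = (\<Sum>\<^sub>\<infinity>z\<in>Eis. cmod z powr - t)"
  define T where "T = (\<Sum>\<^sub>\<infinity>z\<in>Eis. cmod z powr - (9/4))"
  have Ss: "(\<lambda>z. norm (cmod z powr - t)) summable_on Eis" using lattice_powr_upper(1)[OF t] by simp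
  have S: "S \<le> 48 * l" "S \<ge> 0" using lattice_powr_upper(2)[OF t] l unfolding S_def by (auto simp: t_def intro: infsum_nonneg)
  have Ts: "(\<lambda>z. cmod z powr - (9/4)) summable_on Eis" using lattice_powr_upper(1)[of "9/4"] by simp
  have T: "T \<le> 192" using lattice_powr_upper(2)[of "9/4"] unfolding T_def by simp
  have Gr: "(\<lambda>z. norm (twisted k u (alpha k * z + of_nat r))) summable_on Eis" if "r < alpha_norm k" for r
    by (rule alpha_mult_summable[OF assms(3) that])
  have G0: "(\<lambda>z. norm (twisted k u (alpha k * z))) summable_on Eis" using Gr[of 0] alpha_norm_pos by simp
  have Sr: "(\<lambda>z. cmod (alpha k * z + of_nat r) powr - t) summable_on Eis" if "r < alpha_norm k" for r
    using alpha_mult_summable[OF Ss that] by simp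
  have S0: "(\<lambda>z. cmod (alpha k * z) powr - t) summable_on Eis" using Sr[of 0] alpha_norm_pos by simp
  have tm: "cmod (\<Sum>\<^sub>\<infinity>z\<in>Eis. twisted k u (alpha k * z + of_nat r) - twisted k u (alpha k * z))
     \<le> M * ((\<Sum>\<^sub>\<infinity>z\<in>Eis. cmod (alpha k * z + of_nat r) powr - t) + (\<Sum>\<^sub>\<infinity>z\<in>Eis. cmod (alpha k * z) powr - t)) + N * T"
    if r: "r < alpha_norm k" for r
  proof -
    let ?B = "\<lambda>z. M * (cmod (alpha k * z + of_nat r) powr - t + cmod (alpha k * z) powr - t) + N * cmod z powr - (9/4)"
    have Bs: "?B summable_on Eis"
      by (intro summable_on_add summable_on_cmult_right Sr[OF r] S0 Ts)
    have pw: "norm (twisted k u (alpha k * z + of_nat r) - twisted k u (alpha k * z)) \<le> ?B z" if "z \<in> Eis" for z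
      using twisted_diff_le[OF assms(1,2) that r] by (simp only: M_def N_def t_def l_def q_def)
    have ds: "(\<lambda>z. norm (twisted k u (alpha k * z + of_nat r) - twisted k u (alpha k * z))) summable_on Eis"
      by (rule summable_on_comparison_test[OF Bs]) (use pw in auto)
    have "cmod (\<Sum>\<^sub>\<infinity>z\<in>Eis. twisted k u (alpha k * z + of_nat r) - twisted k u (alpha k * z))
       \<le> (\<Sum>\<^sub>\<infinity>z\<in>Eis. norm (twisted k u (alpha k * z + of_nat r) - twisted k u (alpha k * z)))"
      by (rule norm_infsum_bound[OF ds])
    also have "\<dots> \<le> infsum ?B Eis" by (rule infsum_mono[OF ds Bs pw])
    also have "\<dots> = M * ((\<Sum>\<^sub>\<infinity>z\<in>Eis. cmod (alpha k * z + of_nat r) powr - t) + (\<Sum>\<^sub>\<infinity>z\<in>Eis. cmod (alpha k * z) powr - t)) + N * T"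
      unfolding T_def
      by (subst infsum_add) (auto intro!: summable_on_add summable_on_cmult_right Sr[OF r] S0 Ts simp: infsum_cmult_right' infsum_add[OF Sr[OF r] S0])
    finally show ?thesis .
  qed
  have A1: "(\<Sum>\<^sub>\<infinity>z\<in>Eis. cmod (alpha k * z) powr - t) = q powr (- t / 2) * S"
  proof -
    have "cmod (alpha k * z) powr - t = q powr (- t / 2) * cmod z powr - t" for z
    proof -
      have "cmod (alpha k) powr - t = q powr (- t / 2)"
        using powr_via_square[of "cmod (alpha k)" t] alpha_nz[of k] by (simp add: alpha_sq q_def)
      then show ?thesis by (simp add: norm_mult powr_mult)
    qed
    then show ?thesis unfolding S_def by (simp add: infsum_cmult_right')
  qed
  \<comment> \<open>As \<open>t > 2\<close>, the \<open>q\<close> copies of the class of 0 together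
    cost no more than the full lattice sum.\<close>
  have qA: "q * (q powr (- t / 2) * S) \<le> S"
  proof -
    have "q * q powr (- t / 2) = q powr 1 * q powr (- t / 2)" using q by simp
    also have "\<dots> = q powr (1 + - t / 2)" by (simp only: powr_add)
    also have "\<dots> \<le> q powr 0" using q t by (intro powr_mono) auto
    finally have "q * q powr (- t / 2) \<le> 1" using q by simp
    then have "(q * q powr (- t / 2)) * S \<le> 1 * S" using S(2) by (intro mult_right_mono)
    then show ?thesis by (simp add: mult.assoc)
  qed
  have "infsum (twisted k u) Eis - of_nat (alpha_norm k) * (\<Sum>\<^sub>\<infinity>z\<in>Eis. twisted k u (alpha k * z))
     = (\<Sum>r<alpha_norm k. (\<Sum>\<^sub>\<infinity>z\<in>Eis. twisted k u (alpha k * z + of_nat r)) - (\<Sum>\<^sub>\<infinity>z\<in>Eis. twisted k u (alpha k * z)))"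
    unfolding infsum_residue_classes[OF assms(3), of k] by (simp add: sum_subtractf)
  also have "\<dots> = (\<Sum>r<alpha_norm k. \<Sum>\<^sub>\<infinity>z\<in>Eis. twisted k u (alpha k * z + of_nat r) - twisted k u (alpha k * z))"
    by (intro sum.cong refl infsum_minus_distrib[symmetric] abs_summable_summable[OF Gr] abs_summable_summable[OF G0]) simp
  finally have "cmod (infsum (twisted k u) Eis - of_nat (alpha_norm k) * (\<Sum>\<^sub>\<infinity>z\<in>Eis. twisted k u (alpha k * z)))
     \<le> (\<Sum>r<alpha_norm k. M * ((\<Sum>\<^sub>\<infinity>z\<in>Eis. cmod (alpha k * z + of_nat r) powr - t) + q powr (- t / 2) * S) + N * T)"
    unfolding A1[symmetric] by (simp only:) (rule sum_norm_le, rule tm, simp)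
  also have "\<dots> = M * (\<Sum>r<alpha_norm k. \<Sum>\<^sub>\<infinity>z\<in>Eis. cmod (alpha k * z + of_nat r) powr - t) + M * (q * (q powr (- t / 2) * S)) + q * N * T"
    by (simp add: sum.distrib sum_distrib_left[symmetric] q_def algebra_simps)
  also have "(\<Sum>r<alpha_norm k. \<Sum>\<^sub>\<infinity>z\<in>Eis. cmod (alpha k * z + of_nat r) powr - t) = S"
    unfolding S_def by (rule infsum_residue_classes[OF Ss, symmetric])
  also have "M * S + M * (q * (q powr (- t / 2) * S)) + q * N * T \<le> M * (48 * l) + M * (48 * l) + 80 * A * 192"
  proof (intro add_mono mult_left_mono)
    show "q * (q powr (- t / 2) * S) \<le> 48 * l" using qA S by linarith
    have "q * N = 80 * A" using q by (simp add: N_def)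
    then have "q * N * T = 80 * A * T" by simp
    also have "\<dots> \<le> 80 * A * 192" using T A by (intro mult_left_mono) auto
    finally show "q * N * T \<le> 80 * A * 192" .
  qed (use S M0 in auto)
  also have "\<dots> = M * (96 * l) + 15360 * A" by simp
  also have "\<dots> \<le> (3 * A * (53 * L)) * (96 * (52 * L)) + 15360 * A * L ^ 2"
  proof (rule add_mono)
    have "exp 1 * A * (1 + l) \<le> 3 * A * (53 * L)" using exp_le A l L1 by (intro mult_mono) auto
    then have "M \<le> 3 * A * (53 * L)" by (simp add: M_def)
    then show "M * (96 * l) \<le> (3 * A * (53 * L)) * (96 * (52 * L))" using A L1 l by (intro mult_mono) auto
    have "1 \<le> L ^ 2" using L1 by simp
    then have "15360 * A * 1 \<le> 15360 * A * L ^ 2" using A by (intro mult_left_mono) auto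
    then show "15360 * A \<le> 15360 * A * L ^ 2" by simp
  qed
  also have "\<dots> = 809088 * (A * L ^ 2)" by (simp add: power2_eq_square)
  also have "\<dots> \<le> 10 ^ 6 * (A * L ^ 2)" using A by (intro mult_right_mono) auto
  finally show ?thesis by (simp add: L_def mult.assoc)
qed

text \<open>The choice of \<open>alpha k\<close> gives it an argument of order \<open>1 / k\<close>,
  which after multiplication by \<open>6 * k\<close> lies between 24/35 and 1 for every
  \<open>k\<close>. There the sine is at least \<open>sin (pi / 6)\<close>.\<close>

lemma phase_Im:
  assumes "k \<ge> 1" shows "\<bar>Im (ang k (alpha k))\<bar> \<ge> 1/2"
proof -
  define x where "x = 6 * real k + 1/2"
  define y where "y = sqrt 3 / 2"
  have xy: "Re (alpha k) = x" "Im (alpha k) = y" by (simp_all add: alpha_def x_def y_def omega_Re omega_Im)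
  have k1: "real k \<ge> 1" using assms by simp
  have x0: "x > 0" "y > 0" using k1 by (auto simp: x_def y_def)
  define th where "th = arctan (y / x)"
  define c where "c = cmod (alpha k)"
  have c2: "c\<^sup>2 = x\<^sup>2 + y\<^sup>2" by (simp add: c_def cmod_power2 xy)
  have c0: "c > 0" using alpha_nz[of k] by (simp add: c_def)
  have sq: "sqrt (1 + (y / x)\<^sup>2) = c / x"
  proof (rule real_sqrt_unique)
    show "(c / x)\<^sup>2 = 1 + (y / x)\<^sup>2" using x0 by (simp add: power_divide c2 field_simps)
  qed (use c0 x0 in auto)
  have sc: "cos th = x / c" "sin th = y / c" 
    using x0 c0 by (simp_all add: th_def cos_arctan sin_arctan sq)
  have "sgn (alpha k) = cis th"
    using c0 by (simp add: complex_eq_iff sgn_div_norm sc xy c_def[symmetric] divide_inverse mult.commute)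
  then have a: "ang k (alpha k) = cis (real (6 * k) * th)" by (simp only: ang_def Complex.DeMoivre)
  have th0: "th \<ge> 0" "th \<le> y / x" using x0 by (auto simp: th_def intro: arctan_le_self)
  have y1: "y \<le> 1" "y \<ge> 4/5"
  proof -
    have "sqrt 3 \<le> sqrt (2\<^sup>2)" by (intro real_sqrt_le_mono) simp
    then show "y \<le> 1" by (simp add: y_def)
    have "sqrt ((8/5)\<^sup>2) \<le> sqrt (3::real)" by (intro real_sqrt_le_mono) (simp add: power2_eq_square)
    then show "y \<ge> 4/5" by (simp add: y_def)
  qed
  have "real (6 * k) * th \<le> real (6 * k) * (y / x)" using th0 by (intro mult_left_mono) auto
  also have "\<dots> \<le> 1"
  proof -
    have "real (6 * k) * y \<le> real (6 * k) * 1" using y1 by (intro mult_left_mono) auto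
    also have "\<dots> \<le> x" by (simp add: x_def)
    finally show ?thesis using x0 by (simp add: divide_le_eq)
  qed
  finally have up: "real (6 * k) * th \<le> pi / 2" using pi_ge_two by linarith
  have "c\<^sup>2 \<le> (7 * real k)\<^sup>2"
  proof -
    have "y\<^sup>2 = 3/4" by (simp add: y_def power_divide)
    then have "c\<^sup>2 = 36 * (real k * real k) + 6 * real k + 1" unfolding c2 by (simp add: x_def power2_eq_square algebra_simps)
    moreover have "1 * real k \<le> real k * real k" using k1 by (intro mult_right_mono) auto
    moreover have "(7 * real k)\<^sup>2 = 49 * (real k * real k)" by (simp add: power2_eq_square)
    ultimately show ?thesis using k1 by linarith
  qed
  then have c7: "c \<le> 7 * real k" by (rule power2_le_imp_le) simp
  have "sin th \<le> th" using th0 by (intro sin_x_le_x)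
  then have "real (6 * k) * (y / c) \<le> real (6 * k) * th" unfolding sc by (intro mult_left_mono) auto
  moreover have "real (6 * k) * (y / c) \<ge> real (6 * k) * ((4/5) / (7 * real k))"
    using c7 c0 y1 k1 by (intro mult_left_mono frac_le) auto
  moreover have "real (6 * k) * ((4/5) / (7 * real k)) = 24/35" using k1 by simp
  ultimately have lo: "real (6 * k) * th \<ge> 24/35" by linarith
  have "pi / 6 \<le> 24/35" using pi_approx by simp
  then have "sin (pi / 6) \<le> sin (real (6 * k) * th)" using lo up pi_gt_zero by (intro sin_monotone_2pi_le) linarith+
  then show ?thesis by (simp add: a sin_30)
qed

text \<open>Rotating by the conjugate phase makes the term with \<open>t\<close> real, so the
  imaginary part of the phase survives whatever \<open>t\<close> is. In particular nothing
  degenerates as the weight tends to 1.\<close>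

lemma one_minus_phase:
  assumes "k \<ge> 1" "t \<ge> 0" shows "cmod (1 - of_real t * ang k (alpha k)) \<ge> 1/2"
proof -
  define g where "g = ang k (alpha k)"
  have g: "cmod g = 1" unfolding g_def by (rule norm_ang[OF alpha_nz])
  have "1/2 \<le> \<bar>Im g\<bar>" unfolding g_def by (rule phase_Im[OF assms(1)])
  also have "\<bar>Im g\<bar> = \<bar>Im (cnj g * (1 - of_real t * g))\<bar>" by (simp add: algebra_simps)
  also have "\<dots> \<le> cmod (cnj g * (1 - of_real t * g))" by (rule abs_Im_le_cmod)
  also have "\<dots> = cmod (1 - of_real t * g)" by (simp add: norm_mult g)
  finally show ?thesis by (simp add: g_def)
qed

lemma powr_ratio_bound:
  fixes r r' a :: real assumes "1 \<le> r" "r \<le> r'" "a \<ge> 0"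
  shows "r powr - a - r' powr - a \<le> a * r powr (- a - 1) * (r' - r)"
proof -
  have "1 + (- (a * (r' / r - 1))) \<le> exp (- (a * (r' / r - 1)))" by (rule exp_ge_add_one_self)
  also have "\<dots> \<le> exp (- a * ln (r' / r))"
    using ln_le_minus_one[of "r' / r"] assms by (simp add: mult_left_mono)
  also have "\<dots> = (r' / r) powr - a" using assms by (simp add: powr_def)
  also have "\<dots> = r' powr - a / r powr - a" using assms by (simp add: powr_divide)
  finally have "1 - a * (r' / r - 1) \<le> r' powr - a / r powr - a" by simp
  then have "(1 - a * (r' / r - 1)) * r powr - a \<le> r' powr - a" using assms by (simp add: pos_le_divide_eq)
  then have "r powr - a - r' powr - a \<le> a * (r' / r - 1) * r powr - a" unfolding left_diff_distrib mult_1 by linarith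
  also have "a * (r' / r - 1) * r powr - a = a * r powr (- a - 1) * (r' - r)"
  proof -
    have "r powr (- a - 1) = r powr - a / r" using assms by (simp add: powr_diff)
    then show ?thesis using assms by (simp only:) (simp add: field_simps)
  qed
  finally show ?thesis .
qed

section \<open>Bounds for the twisted series up to the point 1\<close>

text \<open>The exponent is doubled because the norm is the square of the modulus.\<close>

definition radial :: "real \<Rightarrow> real \<Rightarrow> real" where "radial x r = r powr - (2 * x)"

lemma powr_le_inverse_power:
  fixes r b :: real
  assumes "r \<ge> 1" "real n \<le> b" shows "r powr - b \<le> 1 / r ^ n"
proof -
  have "r powr - b \<le> r powr - real n" using assms by (intro powr_mono) auto
  also have "\<dots> = 1 / r ^ n" using assms by (simp add: powr_minus powr_realpow divide_inverse)
  finally show ?thesis .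
qed

lemma tame_radial:
  assumes "1 \<le> x" "x \<le> 2" shows "tame 4 (radial x)"
  unfolding tame_def
proof (intro conjI allI impI)
  fix r :: real assume r: "1 \<le> r"
  have "\<bar>radial x r\<bar> \<le> 1 / r ^ 2" unfolding radial_def using powr_le_inverse_power[of r 2 "2 * x"] r assms by simp
  also have "\<dots> \<le> 4 * (1 + ln r) / r ^ 2" using r ln_ge_zero[of r] by (intro divide_right_mono) auto
  finally show "\<bar>radial x r\<bar> \<le> 4 * (1 + ln r) / r ^ 2" .
next
  fix r r' :: real assume r: "1 \<le> r" "r \<le> r'"
  have "radial x r' \<le> radial x r" unfolding radial_def using r assms by (intro powr_mono2') auto
  then have "\<bar>radial x r - radial x r'\<bar> = radial x r - radial x r'" by simp
  also have "\<dots> \<le> 2 * x * r powr (- (2 * x) - 1) * (r' - r)"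
    unfolding radial_def using r assms by (intro powr_ratio_bound) auto
  also have "\<dots> \<le> 4 * (1 + ln r') / r ^ 3 * (r' - r)"
  proof (rule mult_right_mono)
    have "r powr (- (2 * x) - 1) \<le> 1 / r ^ 3" using powr_le_inverse_power[of r 3 "2 * x + 1"] r assms by simp
    then have "2 * x * r powr (- (2 * x) - 1) \<le> 4 * (1 / r ^ 3)" using assms r by (intro mult_mono) auto
    also have "\<dots> \<le> 4 * (1 + ln r') / r ^ 3" using r ln_ge_zero[of r'] by (simp add: divide_right_mono)
    finally show "2 * x * r powr (- (2 * x) - 1) \<le> 4 * (1 + ln r') / r ^ 3" .
  qed (use r in auto)
  finally show "\<bar>radial x r - radial x r'\<bar> \<le> 4 * (1 + ln r') / r ^ 3 * (r' - r)" .
qed simp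

lemma powr_exponent_diff:
  fixes r a b :: real assumes "r \<ge> 1" "a \<le> b"
  shows "0 \<le> r powr - a - r powr - b" "r powr - a - r powr - b \<le> (b - a) * ln r * r powr - a"
proof -
  show "0 \<le> r powr - a - r powr - b" using assms by (simp add: powr_mono)
  have "1 + (- ((b - a) * ln r)) \<le> exp (- ((b - a) * ln r))" by (rule exp_ge_add_one_self)
  also have "\<dots> = r powr - (b - a)" using assms by (simp add: powr_def algebra_simps)
  finally have "(1 - (b - a) * ln r) * r powr - a \<le> r powr - (b - a) * r powr - a" by (intro mult_right_mono) auto
  also have "\<dots> = r powr - b" by (simp only: powr_add[symmetric]) simp
  finally show "r powr - a - r powr - b \<le> (b - a) * ln r * r powr - a" by (simp add: algebra_simps)
qed

lemma tame_radial_diff: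
  assumes "1 \<le> x" "x \<le> y" "y \<le> 2" shows "tame (8 * (y - x)) (\<lambda>r. radial x r - radial y r)"
  unfolding tame_def
proof (intro conjI allI impI)
  show "8 * (y - x) \<ge> 0" using assms by simp
  fix r :: real assume r: "1 \<le> r"
  have "\<bar>radial x r - radial y r\<bar> \<le> (2 * y - 2 * x) * ln r * r powr - (2 * x)"
    unfolding radial_def using powr_exponent_diff[of r "2 * x" "2 * y"] r assms by simp
  also have "\<dots> \<le> (8 * (y - x)) * (1 + ln r) * (1 / r ^ 2)"
    using r assms powr_le_inverse_power[of r 2 "2 * x"] ln_ge_zero[of r] by (intro mult_mono) auto
  finally show "\<bar>radial x r - radial y r\<bar> \<le> 8 * (y - x) * (1 + ln r) / r ^ 2" by simp
next
  fix r r' :: real assume r: "1 \<le> r" "r \<le> r'"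
  define v where "v s = s powr - (2 * x) - s powr - (2 * y)" for s :: real
  define v' where "v' s = - (2 * x) * s powr (- (2 * x) - 1) + (2 * y) * s powr (- (2 * y) - 1)" for s :: real
  have der: "DERIV v s :> v' s" if "s > 0" for s
    unfolding v_def v'_def using that by (auto intro!: derivative_eq_intros)
  have bound: "\<bar>v' s\<bar> \<le> 8 * (y - x) * (1 + ln r') / r ^ 3" if s: "r \<le> s" "s \<le> r'" for s
  proof -
    have s1: "s \<ge> 1" using s r by simp
    \<comment> \<open>Regrouped so that both summands carry a factor \<open>y - x\<close>.\<close>
    have "v' s = (2 * y - 2 * x) * s powr (- (2 * y) - 1) - (2 * x) * (s powr - (2 * x + 1) - s powr - (2 * y + 1))"
    proof -
      have e: "- (2 * x + 1) = - (2 * x) - 1" "- (2 * y + 1) = - (2 * y) - 1" by simp_all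
      show ?thesis unfolding v'_def e by (simp add: left_diff_distrib right_diff_distrib)
    qed
    also have "\<bar>\<dots>\<bar> \<le> (2 * y - 2 * x) * s powr (- (2 * y) - 1) + (2 * x) * ((2 * y - 2 * x) * ln s * s powr - (2 * x + 1))"
    proof -
      have "0 \<le> s powr - (2 * x + 1) - s powr - (2 * y + 1)" 
        "s powr - (2 * x + 1) - s powr - (2 * y + 1) \<le> (2 * y - 2 * x) * ln s * s powr - (2 * x + 1)"
        using powr_exponent_diff[of s "2 * x + 1" "2 * y + 1"] s1 assms by simp_all
      then have "0 \<le> 2 * x * (s powr - (2 * x + 1) - s powr - (2 * y + 1))"
        "2 * x * (s powr - (2 * x + 1) - s powr - (2 * y + 1)) \<le> 2 * x * ((2 * y - 2 * x) * ln s * s powr - (2 * x + 1))"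
        using assms by (auto intro!: mult_left_mono)
      moreover have "0 \<le> (2 * y - 2 * x) * s powr (- (2 * y) - 1)" using assms by simp
      ultimately show ?thesis by linarith
    qed
    also have "\<dots> \<le> (2 * y - 2 * x) * (1 / r ^ 3) + 4 * ((2 * y - 2 * x) * ln r' * (1 / r ^ 3))"
    proof (rule add_mono)
      have rs: "1 / s ^ 3 \<le> 1 / r ^ 3" using s r by (intro divide_left_mono power_mono mult_pos_pos) auto
      have "s powr (- (2 * y) - 1) \<le> 1 / s ^ 3" using powr_le_inverse_power[of s 3 "2 * y + 1"] s1 assms by simp
      then show "(2 * y - 2 * x) * s powr (- (2 * y) - 1) \<le> (2 * y - 2 * x) * (1 / r ^ 3)"
        using rs assms by (intro mult_left_mono) auto
      have "s powr - (2 * x + 1) \<le> 1 / s ^ 3" using powr_le_inverse_power[of s 3 "2 * x + 1"] s1 assms by simp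
      then have "s powr - (2 * x + 1) \<le> 1 / r ^ 3" using rs by linarith
      then show "(2 * x) * ((2 * y - 2 * x) * ln s * s powr - (2 * x + 1)) \<le> 4 * ((2 * y - 2 * x) * ln r' * (1 / r ^ 3))"
        using assms s s1 by (intro mult_mono) (auto intro!: mult_nonneg_nonneg)
    qed
    also have "\<dots> = (y - x) * (2 + 8 * ln r') / r ^ 3"
      by (simp add: algebra_simps add_divide_distrib diff_divide_distrib)
    also have "\<dots> \<le> (y - x) * (8 * (1 + ln r')) / r ^ 3"
      using assms r by (intro divide_right_mono mult_left_mono) auto
    finally show ?thesis by (simp only: mult_ac)
  qed
  show "\<bar>radial x r - radial y r - (radial x r' - radial y r')\<bar> \<le> 8 * (y - x) * (1 + ln r') / r ^ 3 * (r' - r)"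
  proof (cases "r = r'")
    case False
    then have rr: "r < r'" using r by simp
    obtain s where s: "r < s" "s < r'" "v r' - v r = (r' - r) * v' s"
      using MVT2[OF rr, of v v'] der r by force
    have "radial x r - radial y r - (radial x r' - radial y r') = - ((r' - r) * v' s)" using s(3) by (simp add: v_def radial_def)
    then have "\<bar>radial x r - radial y r - (radial x r' - radial y r')\<bar> = \<bar>v' s\<bar> * (r' - r)" using rr by (simp add: abs_mult)
    also have "\<dots> \<le> 8 * (y - x) * (1 + ln r') / r ^ 3 * (r' - r)" using bound[of s] s rr by (intro mult_right_mono) auto
    finally show ?thesis .
  qed simp
qed

definition twisted_series :: "nat \<Rightarrow> real \<Rightarrow> complex" where
  "twisted_series k x = infsum (twisted k (radial x)) Eis"

lemma twisted_radial_summable: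
  assumes "1 < x" "x \<le> 2" shows "(\<lambda>z. norm (twisted k (radial x) z)) summable_on Eis"
proof (rule summable_on_comparison_test)
  show "(\<lambda>z. cmod z powr - (2 * x)) summable_on Eis" using lattice_powr_upper(1)[of "2 * x"] assms by simp
  show "norm (twisted k (radial x) z) \<le> cmod z powr - (2 * x)" for z using norm_twisted_le[of k "radial x" z] by (simp add: radial_def)
qed simp

definition alpha_weight :: "nat \<Rightarrow> real \<Rightarrow> real" where "alpha_weight k x = real (alpha_norm k) powr (1 - x)"

lemma alpha_scaling:
  "of_nat (alpha_norm k) * (\<Sum>\<^sub>\<infinity>z\<in>Eis. twisted k (radial x) (alpha k * z)) = of_real (alpha_weight k x) * ang k (alpha k) * twisted_series k x"
proof -
  have q: "real (alpha_norm k) > 0" using alpha_norm_pos by simp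
  have ca: "cmod (alpha k) powr - (2 * x) = real (alpha_norm k) powr - x"
    using powr_via_square[of "cmod (alpha k)" "2 * x"] alpha_nz[of k] by (simp add: alpha_sq)
  have "twisted k (radial x) (alpha k * z) = (ang k (alpha k) * of_real (real (alpha_norm k) powr - x)) * twisted k (radial x) z" for z
    by (simp add: twisted_def radial_def ang_mult norm_mult powr_mult ca)
  then have "(\<Sum>\<^sub>\<infinity>z\<in>Eis. twisted k (radial x) (alpha k * z)) = (ang k (alpha k) * of_real (real (alpha_norm k) powr - x)) * twisted_series k x"
    unfolding twisted_series_def by (simp add: infsum_cmult_right')
  moreover have "of_nat (alpha_norm k) * complex_of_real (real (alpha_norm k) powr - x) = of_real (alpha_weight k x)"
  proof -
    have "alpha_weight k x = real (alpha_norm k) powr 1 * real (alpha_norm k) powr - x" unfolding alpha_weight_def by (simp only: powr_add[symmetric]) simp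
    also have "\<dots> = real (alpha_norm k) * real (alpha_norm k) powr - x" using q by simp
    finally show ?thesis by simp
  qed
  ultimately show ?thesis by (simp add: mult_ac)
qed

text \<open>By \<open>alpha_scaling\<close> the quantity in \<open>class_difference_bound\<close> is
  the series multiplied by \<open>1 - alpha_weight k x * ang k (alpha k)\<close>, a factor of
  modulus at least 1/2. The result is uniform as \<open>x\<close> tends to 1.\<close>

lemma twisted_series_bound:
  assumes "k \<ge> 1" "1 < x" "x \<le> 2"
  shows "cmod (twisted_series k x) \<le> 10 ^ 7 * (1 + ln (real k)) ^ 2"
proof -
  have "cmod (twisted_series k x - of_real (alpha_weight k x) * ang k (alpha k) * twisted_series k x) \<le> 10 ^ 6 * 4 * (1 + ln (real k)) ^ 2"
    unfolding alpha_scaling[symmetric] unfolding twisted_series_def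
    by (rule class_difference_bound[OF assms(1) tame_radial twisted_radial_summable]) (use assms in auto)
  also have "twisted_series k x - of_real (alpha_weight k x) * ang k (alpha k) * twisted_series k x = (1 - of_real (alpha_weight k x) * ang k (alpha k)) * twisted_series k x"
    by (simp add: algebra_simps)
  finally have 1: "cmod (1 - of_real (alpha_weight k x) * ang k (alpha k)) * cmod (twisted_series k x) \<le> 10 ^ 6 * 4 * (1 + ln (real k)) ^ 2"
    by (simp only: norm_mult)
  have "1/2 * cmod (twisted_series k x) \<le> cmod (1 - of_real (alpha_weight k x) * ang k (alpha k)) * cmod (twisted_series k x)"
    by (intro mult_right_mono one_minus_phase assms) (auto simp: alpha_weight_def)
  then have "cmod (twisted_series k x) \<le> 8 * 10 ^ 6 * (1 + ln (real k)) ^ 2" using 1 by linarith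
  also have "\<dots> \<le> 10 ^ 7 * (1 + ln (real k)) ^ 2" by (intro mult_right_mono) auto
  finally show ?thesis .
qed

text \<open>The argument of \<open>twisted_series_bound\<close> for the difference of two radial
  functions. The scaled copies now carry different weights, whose difference costs
  \<open>(y - x) * ln (alpha_norm k)\<close> and thereby a third factor
  \<open>1 + ln k\<close>.\<close>

lemma twisted_series_lipschitz:
  assumes "k \<ge> 1" "1 < x" "x \<le> y" "y \<le> 2"
  shows "cmod (twisted_series k x - twisted_series k y) \<le> 10 ^ 9 * (y - x) * (1 + ln (real k)) ^ 3"
proof -
  define L where "L = 1 + ln (real k)"
  define g where "g = ang k (alpha k)"
  have L1: "L \<ge> 1" using assms(1) by (simp add: L_def)
  have sx: "(\<lambda>z. norm (twisted k (radial x) z)) summable_on Eis" "(\<lambda>z. norm (twisted k (radial y) z)) summable_on Eis"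
    using assms by (auto intro!: twisted_radial_summable)
  note s = sx[THEN abs_summable_summable]
  have a0: "(\<lambda>z. norm (twisted k (radial x) (alpha k * z))) summable_on Eis" "(\<lambda>z. norm (twisted k (radial y) (alpha k * z))) summable_on Eis"
    using alpha_mult_summable[OF sx(1), of 0] alpha_mult_summable[OF sx(2), of 0] alpha_norm_pos by simp_all
  note a = a0[THEN abs_summable_summable]
  have G2: "twisted k (\<lambda>r. radial x r - radial y r) = (\<lambda>z. twisted k (radial x) z - twisted k (radial y) z)" by (simp add: fun_eq_iff twisted_def algebra_simps)
  have s2: "(\<lambda>z. norm (twisted k (\<lambda>r. radial x r - radial y r) z)) summable_on Eis"
    by (rule summable_on_comparison_test[OF summable_on_add[OF sx]]) (auto simp: G2 intro: norm_triangle_ineq4)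
  have i1: "infsum (twisted k (\<lambda>r. radial x r - radial y r)) Eis = twisted_series k x - twisted_series k y"
    unfolding G2 twisted_series_def by (rule infsum_minus_distrib[OF s])
  have "(\<Sum>\<^sub>\<infinity>z\<in>Eis. twisted k (\<lambda>r. radial x r - radial y r) (alpha k * z)) = (\<Sum>\<^sub>\<infinity>z\<in>Eis. twisted k (radial x) (alpha k * z)) - (\<Sum>\<^sub>\<infinity>z\<in>Eis. twisted k (radial y) (alpha k * z))"
    unfolding G2 by (rule infsum_minus_distrib[OF a])
  then have i2: "of_nat (alpha_norm k) * (\<Sum>\<^sub>\<infinity>z\<in>Eis. twisted k (\<lambda>r. radial x r - radial y r) (alpha k * z)) = of_real (alpha_weight k x) * g * twisted_series k x - of_real (alpha_weight k y) * g * twisted_series k y"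
    unfolding g_def alpha_scaling[symmetric] by (simp add: right_diff_distrib)
  have "cmod ((twisted_series k x - twisted_series k y) - (of_real (alpha_weight k x) * g * twisted_series k x - of_real (alpha_weight k y) * g * twisted_series k y)) \<le> 10 ^ 6 * (8 * (y - x)) * L ^ 2"
    unfolding i1[symmetric] i2[symmetric] L_def
    by (rule class_difference_bound[OF assms(1) tame_radial_diff s2]) (use assms in auto)
  \<comment> \<open>Separates the difference of the series, multiplied by a factor of modulus at
    least 1/2, from the effect of the two different weights.\<close>
  also have "(twisted_series k x - twisted_series k y) - (of_real (alpha_weight k x) * g * twisted_series k x - of_real (alpha_weight k y) * g * twisted_series k y)
    = (1 - of_real (alpha_weight k x) * g) * (twisted_series k x - twisted_series k y) - of_real (alpha_weight k x - alpha_weight k y) * g * twisted_series k y"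
    by (simp add: algebra_simps)
  finally have E: "cmod ((1 - of_real (alpha_weight k x) * g) * (twisted_series k x - twisted_series k y) - of_real (alpha_weight k x - alpha_weight k y) * g * twisted_series k y) \<le> 10 ^ 6 * (8 * (y - x)) * L ^ 2" .
  have q1: "real (alpha_norm k) \<ge> 1" using alpha_norm_bounds(1)[OF assms(1)] by simp
  have "\<bar>alpha_weight k x - alpha_weight k y\<bar> \<le> (y - x) * ln (real (alpha_norm k)) * real (alpha_norm k) powr - (x - 1)"
    using powr_exponent_diff[OF q1, of "x - 1" "y - 1"] assms by (simp add: alpha_weight_def)
  also have "\<dots> \<le> (y - x) * (4 * L) * 1"
  proof (intro mult_mono)
    have "real (alpha_norm k) powr - (x - 1) \<le> real (alpha_norm k) powr 0" using q1 assms by (intro powr_mono) auto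
    then show "real (alpha_norm k) powr - (x - 1) \<le> 1" using q1 by simp
  qed (use assms q1 L1 alpha_norm_bounds(3)[OF assms(1)] in \<open>auto simp: L_def\<close>)
  finally have w: "\<bar>alpha_weight k x - alpha_weight k y\<bar> \<le> (y - x) * (4 * L)" by simp
  have "cmod (of_real (alpha_weight k x - alpha_weight k y) * g * twisted_series k y) \<le> \<bar>alpha_weight k x - alpha_weight k y\<bar> * cmod (twisted_series k y)"
    unfolding norm_mult norm_of_real using norm_ang[OF alpha_nz, of k] by (simp add: g_def)
  also have "\<dots> \<le> ((y - x) * (4 * L)) * (10 ^ 7 * L ^ 2)"
    using w twisted_series_bound[OF assms(1), of y] assms by (intro mult_mono) (auto simp: L_def)
  finally have F: "cmod (of_real (alpha_weight k x - alpha_weight k y) * g * twisted_series k y) \<le> 4 * 10 ^ 7 * (y - x) * L ^ 3"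
    by (simp add: power2_eq_square power3_eq_cube mult_ac)
  have "L ^ 2 \<le> L ^ 3" using L1 by (intro power_increasing) auto
  then have E2: "10 ^ 6 * (8 * (y - x)) * L ^ 2 \<le> 10 ^ 6 * (8 * (y - x)) * L ^ 3" using assms by (intro mult_left_mono) auto
  have "1/2 * cmod (twisted_series k x - twisted_series k y) \<le> cmod (1 - of_real (alpha_weight k x) * g) * cmod (twisted_series k x - twisted_series k y)"
    unfolding g_def by (intro mult_right_mono one_minus_phase assms) (auto simp: alpha_weight_def)
  also have "\<dots> = cmod ((1 - of_real (alpha_weight k x) * g) * (twisted_series k x - twisted_series k y))" by (simp only: norm_mult)
  also have "\<dots> \<le> cmod ((1 - of_real (alpha_weight k x) * g) * (twisted_series k x - twisted_series k y) - of_real (alpha_weight k x - alpha_weight k y) * g * twisted_series k y) + cmod (of_real (alpha_weight k x - alpha_weight k y) * g * twisted_series k y)"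
    using norm_triangle_sub[of "(1 - of_real (alpha_weight k x) * g) * (twisted_series k x - twisted_series k y)" "of_real (alpha_weight k x - alpha_weight k y) * g * twisted_series k y"] by linarith
  also have "\<dots> \<le> 10 ^ 6 * (8 * (y - x)) * L ^ 3 + 4 * 10 ^ 7 * (y - x) * L ^ 3" using E E2 F by linarith
  also have "\<dots> = 48000000 * ((y - x) * L ^ 3)" by (simp add: algebra_simps)
  finally have "cmod (twisted_series k x - twisted_series k y) \<le> 96000000 * ((y - x) * L ^ 3)" by simp
  also have "\<dots> \<le> 10 ^ 9 * ((y - x) * L ^ 3)" using assms L1 by (intro mult_right_mono) auto
  finally show ?thesis by (simp only: L_def mult.assoc)
qed

section \<open>The Dirichlet series with coefficients \<open>hecke k\<close>\<close>

definition hecke_series :: "nat \<Rightarrow> real \<Rightarrow> real" where "hecke_series k x = infsum (dterm (hecke k) x) UNIV"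
text \<open>Up to a bounded error this is the logarithm of \<open>hecke_series k x\<close>; see
  \<open>hecke_series_hecke_prime_series\<close>.\<close>

definition hecke_prime_series :: "nat \<Rightarrow> real \<Rightarrow> real" where "hecke_prime_series k x = primesum (dterm (hecke k) x)"

lemma bij_lattice_pts: "bij_betw snd (SIGMA n:UNIV. lattice_pts n) Eis"
proof (rule bij_betwI')
  fix x y :: "nat \<times> complex" assume "x \<in> (SIGMA n:UNIV. lattice_pts n)" "y \<in> (SIGMA n:UNIV. lattice_pts n)"
  then show "(snd x = snd y) = (x = y)" by (cases x, cases y) (auto simp: mem_lattice_pts)
next
  fix x assume "x \<in> (SIGMA n:UNIV. lattice_pts n)"
  then show "snd x \<in> Eis" by (auto simp: mem_lattice_pts)
next
  fix z assume "z \<in> Eis"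
  then show "\<exists>x\<in>(SIGMA n:UNIV. lattice_pts n). z = snd x"
    by (intro bexI[of _ "(enorm z, z)"]) (auto simp: mem_lattice_pts)
qed

lemma infsum_lattice_pts:
  fixes f :: "complex \<Rightarrow> 'a :: banach"
  assumes "f summable_on Eis"
  shows "infsum f Eis = (\<Sum>\<^sub>\<infinity>n. \<Sum>z\<in>lattice_pts n. f z)" "(\<lambda>n. \<Sum>z\<in>lattice_pts n. f z) summable_on UNIV"
proof -
  have s: "(\<lambda>x. f (snd x)) summable_on (SIGMA n:UNIV. lattice_pts n)"
    using summable_on_reindex_bij_betw[OF bij_lattice_pts, of f] assms by simp
  then have s': "(\<lambda>(n, z). f z) summable_on (SIGMA n:UNIV. lattice_pts n)" by (simp add: case_prod_unfold)
  have "infsum f Eis = (\<Sum>\<^sub>\<infinity>x\<in>(SIGMA n:UNIV. lattice_pts n). f (snd x))"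
    using infsum_reindex_bij_betw[OF bij_lattice_pts, of f] by simp
  also have "\<dots> = (\<Sum>\<^sub>\<infinity>(n, z)\<in>(SIGMA n:UNIV. lattice_pts n). f z)" by (simp add: case_prod_unfold)
  also have "\<dots> = (\<Sum>\<^sub>\<infinity>n. infsum f (lattice_pts n))" using infsum_Sigma'_banach[OF s'] by simp
  finally show "infsum f Eis = (\<Sum>\<^sub>\<infinity>n. \<Sum>z\<in>lattice_pts n. f z)" by simp
  have "(\<lambda>n. infsum (\<lambda>z. f z) (lattice_pts n)) summable_on UNIV"
    using summable_on_Sigma_banach[OF s'] by simp
  then show "(\<lambda>n. \<Sum>z\<in>lattice_pts n. f z) summable_on UNIV" by simp
qed

lemma lattice_pts_cmod_powr:
  assumes "z \<in> lattice_pts n" shows "cmod z powr - (2 * x) = real n powr - x"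
proof (cases "n = 0")
  case True
  then show ?thesis using assms enorm_eq_0[of z] by (simp add: mem_lattice_pts)
next
  case False
  then have "z \<noteq> 0" using assms lattice_pts_nonzero[of n z] by simp
  then have "((cmod z)\<^sup>2) powr - x = cmod z powr - (2 * x)" using powr_via_square[of "cmod z" "2 * x"] by simp
  moreover have "(cmod z)\<^sup>2 = real n" using assms real_enorm[of z] by (simp add: mem_lattice_pts)
  ultimately show ?thesis by simp
qed

lemma sum_lattice_pts_twisted: "(\<Sum>z\<in>lattice_pts n. twisted k (radial x) z) = of_real (6 * dterm (hecke k) x n)"
proof -
  have "(\<Sum>z\<in>lattice_pts n. twisted k (radial x) z) = (\<Sum>z\<in>lattice_pts n. ang k z * of_real (real n powr - x))"
    by (intro sum.cong refl) (simp only: twisted_def radial_def lattice_pts_cmod_powr)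
  also have "\<dots> = hecke_sum k n * of_real (real n powr - x)" by (simp only: hecke_sum_def sum_distrib_right)
  also have "\<dots> = of_real (6 * dterm (hecke k) x n)" unfolding hecke_sum_eq dterm_def by simp
  finally show ?thesis .
qed

lemma sum_lattice_pts_powr: "(\<Sum>z\<in>lattice_pts n. cmod z powr - (2 * x)) = 6 * dterm (hecke 0) x n"
proof (cases "n = 0")
  case True
  have "lattice_pts 0 = {0}" by (auto simp: mem_lattice_pts enorm_eq_0) 
  then show ?thesis using True by simp
next
  case False
  have "(\<Sum>z\<in>lattice_pts n. cmod z powr - (2 * x)) = (\<Sum>z\<in>lattice_pts n. real n powr - x)"
    by (intro sum.cong refl lattice_pts_cmod_powr)
  then show ?thesis using False by (simp add: dterm_def hecke_0_card)
qed

lemma dterm_hecke_0_nonneg: "dterm (hecke 0) x n \<ge> 0" by (simp add: dterm_def hecke_0_nonneg)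

lemma dterm_hecke_abs_le: "\<bar>dterm (hecke k) x n\<bar> \<le> dterm (hecke 0) x n"
  using abs_hecke_le[of n k] by (cases "n = 0") (auto simp: dterm_def abs_mult intro!: mult_right_mono)

lemma dterm_hecke_0_summable: 
  assumes "1 < x" "x \<le> 2" shows "dterm (hecke 0) x summable_on UNIV"
proof -
  have "(\<lambda>z. cmod z powr - (2 * x)) summable_on Eis" using lattice_powr_upper(1)[of "2 * x"] assms by simp
  from infsum_lattice_pts(2)[OF this] have "(\<lambda>n. 6 * dterm (hecke 0) x n) summable_on UNIV" 
    by (simp only: sum_lattice_pts_powr)
  from summable_on_cmult_right[OF this, of "1/6"] show ?thesis by simp
qed

lemma dterm_hecke_summable: 
  assumes "1 < x" "x \<le> 2" shows "(\<lambda>n. \<bar>dterm (hecke k) x n\<bar>) summable_on UNIV"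
  by (rule summable_on_comparison_test[OF dterm_hecke_0_summable[OF assms]]) (auto intro: dterm_hecke_abs_le)

lemma twisted_series_eq: 
  assumes "1 < x" "x \<le> 2" shows "twisted_series k x = of_real (6 * hecke_series k x)"
proof -
  have s: "(\<lambda>n. dterm (hecke k) x n) summable_on UNIV"
    by (rule abs_summable_summable) (use dterm_hecke_summable[OF assms, of k] in simp)
  have "twisted_series k x = (\<Sum>\<^sub>\<infinity>n. of_real (6 * dterm (hecke k) x n))"
    unfolding twisted_series_def infsum_lattice_pts(1)[OF abs_summable_summable[OF twisted_radial_summable[OF assms]]] sum_lattice_pts_twisted ..
  also have "\<dots> = of_real (\<Sum>\<^sub>\<infinity>n. 6 * dterm (hecke k) x n)"
    by (rule infsumI, rule has_sum_of_real_iff[THEN iffD2], rule has_sum_infsum, rule summable_on_cmult_right[OF s])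
  also have "(\<Sum>\<^sub>\<infinity>n. 6 * dterm (hecke k) x n) = 6 * hecke_series k x" unfolding hecke_series_def by (rule infsum_cmult_right')
  finally show ?thesis .
qed

text \<open>The series for \<open>k = 0\<close> is the only one with a pole at 1, inherited from the
  untwisted lattice sum.\<close>

lemma hecke_series_0_bounds:
  assumes "1 < x" "x \<le> 2" 
  shows "hecke_series 0 x \<le> 4 / (x - 1)" "hecke_series 0 x \<ge> 1 / (216 * (x - 1))"
proof -
  have t: "2 < 2 * x" "2 * x \<le> 4" using assms by auto
  have "(\<Sum>\<^sub>\<infinity>z\<in>Eis. cmod z powr - (2 * x)) = (\<Sum>\<^sub>\<infinity>n. 6 * dterm (hecke 0) x n)"
    unfolding infsum_lattice_pts(1)[OF lattice_powr_upper(1)[OF t]] sum_lattice_pts_powr ..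
  also have "\<dots> = 6 * hecke_series 0 x" unfolding hecke_series_def by (rule infsum_cmult_right')
  finally have e: "(\<Sum>\<^sub>\<infinity>z\<in>Eis. cmod z powr - (2 * x)) = 6 * hecke_series 0 x" .
  have "6 * hecke_series 0 x \<le> 48 / (2 * x - 2)" "6 * hecke_series 0 x \<ge> 1 / (18 * (2 * x - 2))"
    using lattice_powr_upper(2)[OF t] lattice_powr_lower[OF t] unfolding e by simp_all
  then show "hecke_series 0 x \<le> 4 / (x - 1)" "hecke_series 0 x \<ge> 1 / (216 * (x - 1))" using assms by (simp_all add: field_simps)
qed

lemma mult_fn_hecke: "mult_fn (hecke k)"
  unfolding mult_fn_def using hecke_1_right hecke_mult by blast

lemma abs_hecke_prime_power_le: "prime p \<Longrightarrow> \<bar>hecke k (p ^ a)\<bar> \<le> real (a + 1)"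
  using abs_hecke_le[of "p ^ a" k] hecke_0_prime_power_le[of p a] prime_gt_0_nat[of p] by fastforce

lemma primes_less_7: "prime p \<Longrightarrow> p < 7 \<Longrightarrow> p = 2 \<or> p = 3 \<or> p = (5::nat)"
proof -
  assume p: "prime p" "p < 7"
  have "\<not> prime (0::nat)" "\<not> prime (1::nat)" "\<not> prime (4::nat)" "\<not> prime (6::nat)" by simp_all
  moreover have "p = 0 \<or> p = 1 \<or> p = 2 \<or> p = 3 \<or> p = 4 \<or> p = 5 \<or> p = 6" using p(2) by linarith
  ultimately show ?thesis using p(1) by metis
qed

text \<open>The primes below 7 are the inert 2 and 5 and the ramified 3. There the coefficients are
  at most 1 in absolute value, and at 2 the linear term vanishes.\<close>

lemma hecke_local_factor:
  assumes "prime p" "p < 7" "x \<ge> 1" shows "(\<Sum>\<^sub>\<infinity>a. dterm (hecke k) x (p ^ a)) \<ge> 1/2"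
proof (rule local_factor_bound_geometric[OF assms(1)])
  show "dterm (hecke k) x 1 = 1" using hecke_1_right by (simp only: dterm_1)
  have p: "p = 2 \<or> p = 3 \<or> p = 5" using primes_less_7[OF assms(1,2)] .
  show "\<bar>dterm (hecke k) x (p ^ a)\<bar> \<le> 1 / real p ^ a" for a
  proof (rule dterm_prime_power_le[OF assms(1,3)])
    have pa: "p ^ a > 0" using prime_gt_0_nat[OF assms(1)] by simp
    have "hecke 0 (p ^ a) \<le> 1"
    proof (cases "p = 3")
      case True
      then show ?thesis using hecke_0_ramified by simp
    next
      case False
      then have "p mod 3 = 2" using p by auto
      then show ?thesis using hecke_0_inert[OF assms(1), of a] by (auto split: if_splits)
    qed
    then show "\<bar>hecke k (p ^ a)\<bar> \<le> 1" using abs_hecke_le[OF pa, of k] by linarith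
  qed
  show "p \<ge> 3 \<or> dterm (hecke k) x p = 0"
    using p hecke_inert_prime[of 2 k] by (auto simp: dterm_def)
qed

lemma hecke_series_hecke_prime_series:
  assumes "1 < x" "x \<le> 2"
  shows "exp (hecke_prime_series k x - 600) \<le> hecke_series k x" "hecke_series k x \<le> exp (hecke_prime_series k x + 24)"
  unfolding hecke_series_def hecke_prime_series_def
  by (rule dirichlet_ge_exp[OF mult_fn_hecke] dirichlet_abs_le_exp[OF mult_fn_hecke];
      use assms dterm_hecke_summable hecke_local_factor abs_hecke_prime_power_le in simp)+

lemma primesum_341:
  assumes "1 < x" "x \<le> 2"
  shows "3 * hecke_prime_series 0 x + 4 * hecke_prime_series k x + hecke_prime_series (2 * k) x \<ge> 0"
proof -
  have sm: "dterm (hecke j) x summable_on {p. prime p}" for j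
  proof (rule summable_on_subset_banach)
    show "dterm (hecke j) x summable_on UNIV" 
      by (rule abs_summable_summable) (use dterm_hecke_summable[OF assms, of j] in simp)
  qed simp
  have "3 * hecke_prime_series 0 x + 4 * hecke_prime_series k x + hecke_prime_series (2 * k) x = (\<Sum>\<^sub>\<infinity>p\<in>{p. prime p}. 3 * dterm (hecke 0) x p + 4 * dterm (hecke k) x p + dterm (hecke (2 * k)) x p)"
    unfolding hecke_prime_series_def primesum_def
    by (simp add: infsum_add summable_on_add summable_on_cmult_right sm infsum_cmult_right')
  also have "\<dots> \<ge> 0"
  proof (rule infsum_nonneg)
    fix p :: nat assume "p \<in> {p. prime p}"
    then have "p > 0" by (simp add: prime_gt_0_nat)
    from hecke_3_4_1[OF this, of k] have "0 \<le> (3 * hecke 0 p + 4 * hecke k p + hecke (2 * k) p) * real p powr - x" by (rule mult_nonneg_nonneg) simp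
    then show "0 \<le> 3 * dterm (hecke 0) x p + 4 * dterm (hecke k) x p + dterm (hecke (2 * k)) x p"
      by (simp add: dterm_def algebra_simps)
  qed
  finally show ?thesis .
qed

lemma hecke_prime_series_0_bounds:
  assumes "1 < x" "x \<le> 2"
  shows "hecke_prime_series 0 x \<le> ln (1 / (x - 1)) + 604" "hecke_prime_series 0 x \<ge> ln (1 / (x - 1)) - 240"
proof -
  have x: "x - 1 > 0" using assms by simp
  have "exp (hecke_prime_series 0 x - 600) \<le> 4 * (1 / (x - 1))" using hecke_series_hecke_prime_series(1)[OF assms, of 0] hecke_series_0_bounds(1)[OF assms] by simp
  then have "ln (exp (hecke_prime_series 0 x - 600)) \<le> ln (4 * (1 / (x - 1)))" by (intro ln_mono) auto
  also have "\<dots> = ln 4 + ln (1 / (x - 1))" using x by (subst ln_mult) auto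
  also have "ln (4::real) \<le> 4" using ln_le_minus_one[of 4] by simp
  finally show "hecke_prime_series 0 x \<le> ln (1 / (x - 1)) + 604" by simp
  have "1 / 216 * (1 / (x - 1)) \<le> exp (hecke_prime_series 0 x + 24)" using hecke_series_hecke_prime_series(2)[OF assms, of 0] hecke_series_0_bounds(2)[OF assms] by simp
  then have "ln (1 / 216 * (1 / (x - 1))) \<le> ln (exp (hecke_prime_series 0 x + 24))" using x by (intro ln_mono) auto
  moreover have "ln (1 / 216 * (1 / (x - 1))) = ln (1 / (x - 1)) - ln 216" using x by (subst ln_mult) (auto simp: ln_div)
  moreover have "ln (216::real) \<le> 216" using ln_le_minus_one[of 216] by simp
  ultimately show "hecke_prime_series 0 x \<ge> ln (1 / (x - 1)) - 240" by simp
qed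

lemma hecke_prime_series_upper:
  assumes "k \<ge> 1" "1 < x" "x \<le> 2"
  shows "hecke_prime_series k x \<le> 10 ^ 8 + 2 * ln (1 + ln (real k))"
proof -
  define L where "L = 1 + ln (real k)"
  have L1: "L \<ge> 1" using assms(1) by (simp add: L_def)
  have "6 * hecke_series k x \<le> cmod (twisted_series k x)" unfolding twisted_series_eq[OF assms(2,3)] by simp
  also have "\<dots> \<le> 10 ^ 7 * L ^ 2" unfolding L_def by (rule twisted_series_bound[OF assms])
  finally have "exp (hecke_prime_series k x - 600) \<le> 10 ^ 7 * L ^ 2" using hecke_series_hecke_prime_series(1)[OF assms(2,3), of k] exp_gt_zero[of "hecke_prime_series k x - 600"] by linarith
  then have "ln (exp (hecke_prime_series k x - 600)) \<le> ln (10 ^ 7 * L ^ 2)" by (intro ln_mono) auto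
  also have "\<dots> = ln (10 ^ 7) + 2 * ln L" using L1 by (subst ln_mult) (auto simp: ln_realpow)
  also have "ln (10 ^ 7 :: real) \<le> 10 ^ 7" using ln_le_minus_one[of "10 ^ 7"] by simp
  finally show ?thesis by (simp add: L_def)
qed

lemma hecke_series_lipschitz:
  assumes "k \<ge> 1" "1 < x" "x \<le> y" "y \<le> 2"
  shows "hecke_series k y - hecke_series k x \<le> 10 ^ 9 * (y - x) * (1 + ln (real k)) ^ 3"
proof -
  have x: "1 < x" "x \<le> 2" "1 < y" "y \<le> 2" using assms by auto
  have "6 * \<bar>hecke_series k x - hecke_series k y\<bar> = cmod (twisted_series k x - twisted_series k y)"
    unfolding twisted_series_eq[OF x(1,2)] twisted_series_eq[OF x(3,4)] by (simp flip: of_real_diff right_diff_distrib)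
  also have "\<dots> \<le> 10 ^ 9 * (y - x) * (1 + ln (real k)) ^ 3" by (rule twisted_series_lipschitz[OF assms])
  finally have "6 * \<bar>hecke_series k x - hecke_series k y\<bar> \<le> 10 ^ 9 * (y - x) * (1 + ln (real k)) ^ 3" .
  moreover have "hecke_series k y - hecke_series k x \<le> 6 * \<bar>hecke_series k x - hecke_series k y\<bar>" by (simp add: abs_if)
  ultimately show ?thesis by (rule order_trans[rotated])
qed

text \<open>The inequality \<open>3 + 4 cos t + cos 2 t \<ge> 0\<close> bounds \<open>hecke_series k\<close> from below at a distance
  \<open>d\<close> from 1, and the Lipschitz bound carries this to all points closer to 1; the exponent 14
  balances the two.\<close>
lemma hecke_series_lower:
  "\<exists>c>0. \<forall>k\<ge>1. \<forall>x. 1 < x \<longrightarrow> x \<le> 2 \<longrightarrow> hecke_series k x \<ge> c * (1 + ln (real k)) powr - 11"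
proof -
  define C1 where "C1 = (3 * 604 + 10 ^ 8 + 4) / 4 + (600::real)"
  define c1 where "c1 = exp (- C1)"
  define c2 where "c2 = min 1 ((c1 / (2 * 10 ^ 9)) powr 4)"
  have c1: "c1 > 0" by (simp add: c1_def)
  have c2: "c2 > 0" "c2 \<le> 1" "c2 \<le> (c1 / (2 * 10 ^ 9)) powr 4" using c1 by (auto simp: c2_def)
  have main: "hecke_series k x \<ge> (c1 / 2 * c2 powr (3/4)) * (1 + ln (real k)) powr - 11"
    if k: "k \<ge> 1" and x: "1 < x" "x \<le> 2" for k x
  proof -
    define L where "L = 1 + ln (real k)"
    \<comment> \<open>At this distance the bound \<open>A\<close> is of order
      \<open>L powr - 11\<close>. The Lipschitz loss \<open>d * L ^ 3\<close> is
      \<open>d powr (3/4)\<close> times \<open>d powr (1/4) * L ^ 3\<close>, where the second factor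
      is of order \<open>L powr (-1/2)\<close>, the same as in \<open>A\<close>; \<open>c2\<close>
      is small enough to make the loss at most half of the bound.\<close>
    define d where "d = c2 * L powr - 14"
    have L1: "L \<ge> 1" using k by (simp add: L_def)
    have "L powr - 14 \<le> L powr 0" using L1 by (intro powr_mono) auto
    then have "L powr - 14 \<le> 1" using L1 by simp
    then have d: "d > 0" "d \<le> 1" using c2 L1 by (auto simp: d_def intro: mult_le_one)
    \<comment> \<open>From \<open>primesum_341\<close>: the exponent 3/4 is the share of the
      logarithmic pole of \<open>hecke_prime_series 0\<close>, and 1/2 is a quarter of the term
      \<open>2 * ln L\<close> bounding \<open>hecke_prime_series (2 * k)\<close>.\<close>
    have A: "hecke_series k y \<ge> c1 * ((y - 1) powr (3/4) * L powr (-1/2))" if y: "1 < y" "y \<le> 2" for y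
    proof -
      have "ln (1 + ln (real (2 * k))) \<le> ln (2 * L)"
      proof (rule ln_mono)
        have "ln (real (2 * k)) = ln 2 + ln (real k)" using k by (simp add: ln_mult)
        moreover have "ln (2::real) \<le> 1" using ln_le_minus_one[of 2] by simp
        ultimately show "1 + ln (real (2 * k)) \<le> 2 * L" using L1 by (simp add: L_def)
        show "0 < 1 + ln (real (2 * k))" using k by (intro add_pos_nonneg) auto
      qed
      also have "\<dots> = ln 2 + ln L" using L1 by (simp add: ln_mult)
      also have "ln (2::real) \<le> 2" using ln_le_minus_one[of 2] by simp
      finally have "hecke_prime_series (2 * k) y \<le> 10 ^ 8 + 2 * (2 + ln L)" using hecke_prime_series_upper[of "2 * k" y] k y by simp
      then have "4 * hecke_prime_series k y \<ge> - 3 * (ln (1 / (y - 1)) + 604) - (10 ^ 8 + 2 * (2 + ln L))"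
        using primesum_341[OF y, of k] hecke_prime_series_0_bounds(1)[OF y] by argo
      moreover have "ln (1 / (y - 1)) = - ln (y - 1)" using y by (simp add: ln_div)
      ultimately have "hecke_prime_series k y - 600 \<ge> 3/4 * ln (y - 1) - 1/2 * ln L - C1" unfolding C1_def by simp
      then have "exp (3/4 * ln (y - 1) - 1/2 * ln L - C1) \<le> exp (hecke_prime_series k y - 600)" by simp
      also have "\<dots> \<le> hecke_series k y" by (rule hecke_series_hecke_prime_series(1)[OF y])
      also have "exp (3/4 * ln (y - 1) - 1/2 * ln L - C1) = c1 * ((y - 1) powr (3/4) * L powr (-1/2))"
        using y L1 by (simp add: c1_def powr_def exp_diff exp_minus field_simps exp_add[symmetric])
      finally show ?thesis .
    qed
    have d34: "d powr (3/4) * L powr (-1/2) = c2 powr (3/4) * L powr - 11"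
    proof -
      have "d powr (3/4) = c2 powr (3/4) * (L powr - 14) powr (3/4)" unfolding d_def by (rule powr_mult)
      also have "(L powr - 14) powr (3/4) = L powr (- 14 * (3/4))" by (simp only: powr_powr)
      finally have "d powr (3/4) * L powr (-1/2) = c2 powr (3/4) * (L powr (- 14 * (3/4)) * L powr (-1/2))" by simp
      also have "L powr (- 14 * (3/4)) * L powr (-1/2) = L powr - 11" by (simp only: powr_add[symmetric]) simp
      finally show ?thesis .
    qed
    show ?thesis
    proof (cases "x \<ge> 1 + d")
      case True
      have "d powr (3/4) \<le> (x - 1) powr (3/4)" using True d by (intro powr_mono2) auto
      then have "c1 / 2 * (d powr (3/4) * L powr (-1/2)) \<le> c1 * ((x - 1) powr (3/4) * L powr (-1/2))"
        using c1 by (intro mult_mono) auto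
      then show ?thesis using A[OF x] d34 by (simp add: L_def)
    next
      case False
      have y: "1 < 1 + d" "1 + d \<le> 2" using d by auto
      have "hecke_series k (1 + d) - hecke_series k x \<le> 10 ^ 9 * ((1 + d) - x) * L ^ 3" unfolding L_def
        by (rule hecke_series_lipschitz[OF k]) (use False x d in auto)
      also have "\<dots> \<le> 10 ^ 9 * d * L ^ 3" using x L1 by (intro mult_right_mono) auto
      also have "\<dots> = 10 ^ 9 * (d powr (3/4) * (d powr (1/4) * L powr 3))"
      proof -
        have "d powr (3/4) * d powr (1/4) = d" using d by (simp flip: powr_add)
        then have "10 ^ 9 * d * L ^ 3 = 10 ^ 9 * (d powr (3/4) * d powr (1/4)) * L powr 3" using L1 by simp
        then show ?thesis by (simp add: mult.assoc)
      qed
      also have "\<dots> \<le> 10 ^ 9 * (d powr (3/4) * (c1 / (2 * 10 ^ 9) * L powr (-1/2)))"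
      proof (intro mult_left_mono)
        have "d powr (1/4) = c2 powr (1/4) * (L powr - 14) powr (1/4)" unfolding d_def by (rule powr_mult)
        also have "(L powr - 14) powr (1/4) = L powr (- 14 * (1/4))" by (simp only: powr_powr)
        finally have "d powr (1/4) * L powr 3 = c2 powr (1/4) * (L powr (- 14 * (1/4)) * L powr 3)" by simp
        also have "L powr (- 14 * (1/4)) * L powr 3 = L powr (-1/2)" by (simp only: powr_add[symmetric]) simp
        also have "c2 powr (1/4) \<le> ((c1 / (2 * 10 ^ 9)) powr 4) powr (1/4)" using c2 by (intro powr_mono2) auto
        also have "\<dots> = (c1 / (2 * 10 ^ 9)) powr (4 * (1/4))" by (simp only: powr_powr)
        also have "\<dots> = c1 / (2 * 10 ^ 9)" using c1 by simp
        finally show "d powr (1/4) * L powr 3 \<le> c1 / (2 * 10 ^ 9) * L powr (-1/2)" by (simp add: mult_right_mono)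
      qed auto
      also have "\<dots> = c1 / 2 * (d powr (3/4) * L powr (-1/2))" by simp
      finally have "hecke_series k (1 + d) - hecke_series k x \<le> c1 / 2 * (d powr (3/4) * L powr (-1/2))" .
      moreover have "hecke_series k (1 + d) \<ge> c1 * (d powr (3/4) * L powr (-1/2))" using A[OF y] by simp
      ultimately have "hecke_series k x \<ge> c1 / 2 * (d powr (3/4) * L powr (-1/2))" by linarith
      then show ?thesis using d34 by (simp add: L_def)
    qed
  qed
  show ?thesis
    using c1 c2 main by (intro exI[of _ "c1 / 2 * c2 powr (3/4)"]) auto
qed

text \<open>For \<open>k\<close> up to a power of \<open>1 / d\<close>, this double logarithm makes
  the prime sum at \<open>1 + d\<close> negligible against \<open>ln (1 / d)\<close>, which is all
  that equidistribution requires.\<close>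

lemma hecke_prime_series_bound:
  "\<exists>C>0. \<forall>k\<ge>1. \<forall>x. 1 < x \<longrightarrow> x \<le> 2 \<longrightarrow> \<bar>hecke_prime_series k x\<bar> \<le> C * (1 + ln (1 + ln (real k)))"
proof -
  obtain c where c: "c > 0" "\<And>k x. k \<ge> 1 \<Longrightarrow> 1 < x \<Longrightarrow> x \<le> 2 \<Longrightarrow> hecke_series k x \<ge> c * (1 + ln (real k)) powr - 11"
    using hecke_series_lower by blast
  define C where "C = 10 ^ 8 + 11 + \<bar>ln c\<bar> + 24"
  have "\<bar>hecke_prime_series k x\<bar> \<le> C * (1 + ln (1 + ln (real k)))" if k: "k \<ge> 1" and x: "1 < x" "x \<le> 2" for k x
  proof -
    define l where "l = ln (1 + ln (real k))"
    have L1: "1 + ln (real k) \<ge> 1" using k by simp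
    have l: "l \<ge> 0" using L1 by (simp add: l_def)
    have "c * (1 + ln (real k)) powr - 11 \<le> exp (hecke_prime_series k x + 24)" using c(2)[OF k x] hecke_series_hecke_prime_series(2)[OF x, of k] by linarith
    then have "ln (c * (1 + ln (real k)) powr - 11) \<le> ln (exp (hecke_prime_series k x + 24))" using c(1) L1 by (intro ln_mono) auto
    moreover have "ln (c * (1 + ln (real k)) powr - 11) = ln c - 11 * l" using c(1) L1 by (subst ln_mult) (auto simp: ln_powr l_def)
    ultimately have lo: "hecke_prime_series k x \<ge> ln c - 11 * l - 24" by simp
    have up: "hecke_prime_series k x \<le> 10 ^ 8 + 2 * l" unfolding l_def by (rule hecke_prime_series_upper[OF k x])
    have "C * (1 + l) = C + C * l" by (simp add: algebra_simps)
    moreover have "11 * l \<le> C * l" using l by (intro mult_right_mono) (auto simp: C_def)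
    moreover have "C \<ge> 10 ^ 8" "C \<ge> \<bar>ln c\<bar> + 24" by (simp_all add: C_def)
    ultimately have "\<bar>hecke_prime_series k x\<bar> \<le> C * (1 + l)" using lo up l by linarith
    then show ?thesis by (simp add: l_def)
  qed
  moreover have "C > 0" by (simp add: C_def)
  ultimately show ?thesis by blast
qed

section \<open>The angles at split primes\<close>

text \<open>Only cosines occur, because the values at split primes are even in the angle. The
  inductive form allows mean values to be established term by term.\<close>

inductive trigpoly :: "(real \<Rightarrow> real) \<Rightarrow> bool" where
  cos: "trigpoly (\<lambda>t. c * cos (real m * t))"
| add: "trigpoly f \<Longrightarrow> trigpoly g \<Longrightarrow> trigpoly (\<lambda>t. f t + g t)"

lemma trigpoly_eq: "trigpoly f \<Longrightarrow> (\<And>t. g t = f t) \<Longrightarrow> trigpoly g"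
  by (metis ext)

lemma trigpoly_cmult: "trigpoly f \<Longrightarrow> trigpoly (\<lambda>t. c * f t)"
proof (induction rule: trigpoly.induct)
  case (cos d m)
  show ?case by (rule trigpoly_eq[OF trigpoly.cos[of "c * d" m]]) simp
next
  case (add f g)
  show ?case by (rule trigpoly_eq[OF trigpoly.add[OF add.IH]]) (simp add: distrib_left)
qed

lemma trigpoly_mult_cos: "trigpoly f \<Longrightarrow> trigpoly (\<lambda>t. f t * cos t)"
proof (induction rule: trigpoly.induct)
  case (cos c m)
  show ?case
  proof (cases m)
    case 0
    show ?thesis by (rule trigpoly_eq[OF trigpoly.cos[of c 1]]) (simp add: 0)
  next
    case (Suc n)
    show ?thesis
    proof (rule trigpoly_eq[OF trigpoly.add[OF trigpoly.cos[of "c / 2" "Suc m"] trigpoly.cos[of "c / 2" n]]])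
      fix t
      have "cos (real (Suc m) * t) + cos (real n * t) = cos (real m * t + t) + cos (real m * t - t)"
        by (simp add: Suc algebra_simps)
      also have "\<dots> = 2 * (cos (real m * t) * cos t)" by (simp add: cos_add cos_diff)
      finally have e: "cos (real (Suc m) * t) + cos (real n * t) = 2 * (cos (real m * t) * cos t)" .
      have "c / 2 * cos (real (Suc m) * t) + c / 2 * cos (real n * t) = c / 2 * (cos (real (Suc m) * t) + cos (real n * t))"
        by (simp only: distrib_left)
      then show "c * cos (real m * t) * cos t = c / 2 * cos (real (Suc m) * t) + c / 2 * cos (real n * t)"
        unfolding e by simp
    qed
  qed
next
  case (add f g)
  show ?case by (rule trigpoly_eq[OF trigpoly.add[OF add.IH]]) (simp add: distrib_right)
qed

lemma trigpoly_cos_power: "trigpoly (\<lambda>t. cos t ^ i)"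
proof (induction i)
  case 0
  show ?case by (rule trigpoly_eq[OF trigpoly.cos[of 1 0]]) simp
next
  case (Suc i)
  show ?case by (rule trigpoly_eq[OF trigpoly_mult_cos[OF Suc]]) simp
qed

lemma trigpoly_polynomial: "trigpoly (\<lambda>t. \<Sum>i\<le>n. a i * cos t ^ i)"
proof (induction n)
  case 0
  show ?case by (rule trigpoly_eq[OF trigpoly_cmult[OF trigpoly_cos_power[of 0], of "a 0"]]) simp
next
  case (Suc n)
  show ?case
    by (rule trigpoly_eq[OF trigpoly.add[OF Suc trigpoly_cmult[OF trigpoly_cos_power[of "Suc n"], of "a (Suc n)"]]]) simp
qed

lemma abs_cos_half: "\<bar>cos (t / 2)\<bar> = sqrt ((1 + cos t) / 2)"
proof -
  have "cos t = 2 * (cos (t / 2))\<^sup>2 - 1" using cos_double_cos[of "t / 2"] by simp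
  then have "(1 + cos t) / 2 = (cos (t / 2))\<^sup>2" by simp
  then show ?thesis by simp
qed

text \<open>As a function of \<open>v = cos t\<close> this is \<open>sqrt ((1 + v) / 2)\<close>,
  continuous on \<open>[-1, 1]\<close>. The Weierstrass theorem therefore gives a polynomial in
  \<open>cos t\<close>.\<close>

lemma abs_cos_half_approx:
  assumes "e > 0" shows "\<exists>g. trigpoly g \<and> (\<forall>t. \<bar>\<bar>cos (t / 2)\<bar> - g t\<bar> \<le> e)"
proof -
  have "continuous_on {-1..1} (\<lambda>v::real. sqrt ((1 + v) / 2))" by (intro continuous_intros) auto
  then obtain P where P: "real_polynomial_function P" "\<And>x. x \<in> {-1..1} \<Longrightarrow> \<bar>sqrt ((1 + x) / 2) - P x\<bar> < e"
    using Stone_Weierstrass_real_polynomial_function[of "{-1..1::real}" "\<lambda>v. sqrt ((1 + v) / 2)" e] assms by auto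
  obtain a n where an: "P = (\<lambda>x. \<Sum>i\<le>n. a i * x ^ i)" using P(1) by (auto simp: real_polynomial_function_iff_sum)
  have "\<bar>\<bar>cos (t / 2)\<bar> - P (cos t)\<bar> \<le> e" for t
    using P(2)[of "cos t"] unfolding abs_cos_half by simp
  moreover have "trigpoly (\<lambda>t. P (cos t))" unfolding an by (rule trigpoly_polynomial)
  ultimately show ?thesis by blast
qed

section \<open>Equidistribution in logarithmic mean, uniformly in the harmonic\<close>

definition split_primes :: "nat set" where "split_primes = {p. prime p \<and> p mod 3 = 1}"

text \<open>Fixed only up to sign and multiples of \<open>2 * pi\<close>; any choice that is valid
  for all \<open>k\<close> at once will do.\<close>

definition split_angle :: "nat \<Rightarrow> real" where "split_angle p = (SOME t. \<forall>k. hecke k p = 2 * cos (real k * t))"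

lemma hecke_split_angle: "p \<in> split_primes \<Longrightarrow> hecke k p = 2 * cos (real k * split_angle p)"
proof -
  assume "p \<in> split_primes"
  then have p: "prime p" "p mod 3 = 1" by (auto simp: split_primes_def)
  have "\<exists>t. \<forall>k. hecke k p = 2 * cos (real k * t)"
    by (rule hecke_split_prime[OF p]) blast
  from someI_ex[OF this] show ?thesis unfolding split_angle_def by blast
qed

lemma hecke_prime_series_split_primes:
  assumes "1 < x" "x \<le> 2"
  shows "hecke_prime_series j x = (\<Sum>\<^sub>\<infinity>p\<in>split_primes. hecke j p * real p powr - x) + hecke j 3 * 3 powr - x"
proof -
  have sm: "(\<lambda>p. hecke j p * real p powr - x) summable_on A" for A
  proof (rule summable_on_subset_banach)
    show "(\<lambda>p. hecke j p * real p powr - x) summable_on UNIV"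
      by (rule abs_summable_summable) (use dterm_hecke_summable[OF assms, of j] in \<open>simp add: dterm_def\<close>)
  qed simp
  have "hecke_prime_series j x = (\<Sum>\<^sub>\<infinity>p\<in>{p. prime p}. hecke j p * real p powr - x)" by (simp add: hecke_prime_series_def primesum_def dterm_def)
  also have "\<dots> = (\<Sum>\<^sub>\<infinity>p\<in>split_primes \<union> {3}. hecke j p * real p powr - x)"
  proof (rule infsum_cong_neutral)
    fix p assume "p \<in> {p. prime p} - (split_primes \<union> {3})"
    then have p: "prime p" "p mod 3 \<noteq> 1" "p \<noteq> 3" by (auto simp: split_primes_def)
    from p(1) have "p mod 3 = 2" by (rule prime_mod3_cases) (use p in auto)
    then show "hecke j p * real p powr - x = 0" using hecke_inert_prime[OF p(1)] by simp
  next
    fix p assume "p \<in> (split_primes \<union> {3}) - {p. prime p}"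
    then show "hecke j p * real p powr - x = 0" by (auto simp: split_primes_def)
  qed simp
  also have "\<dots> = (\<Sum>\<^sub>\<infinity>p\<in>split_primes. hecke j p * real p powr - x) + (\<Sum>\<^sub>\<infinity>p\<in>{3}. hecke j p * real p powr - x)"
    by (rule infsum_Un_disjoint[OF sm sm]) (simp add: split_primes_def)
  finally show ?thesis by simp
qed

lemma split_primes_summable:
  assumes "1 < x" "x \<le> 2" shows "(\<lambda>p. real p powr - x) summable_on split_primes"
proof -
  have "(\<lambda>p. 1/2 * dterm (hecke 0) x p) summable_on split_primes"
    by (intro summable_on_cmult_right summable_on_subset_banach[OF dterm_hecke_0_summable[OF assms]]) simp
  then show ?thesis
    by (rule summable_on_cong[THEN iffD1, rotated]) (simp add: dterm_def hecke_split_angle)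
qed

text \<open>The angle is doubled so that \<open>|hecke k p|\<close> becomes
  \<open>2 * |cos (t / 2)|\<close>, which is a continuous function of \<open>cos t\<close>.\<close>

definition angle_series :: "nat \<Rightarrow> (real \<Rightarrow> real) \<Rightarrow> real \<Rightarrow> real" where
  "angle_series k g x = (\<Sum>\<^sub>\<infinity>p\<in>split_primes. g (2 * real k * split_angle p) * real p powr - x)"

lemma angle_series_summable:
  assumes "1 < x" "x \<le> 2" "\<And>t. \<bar>g t\<bar> \<le> B"
  shows "(\<lambda>p. g (2 * real k * split_angle p) * real p powr - x) summable_on split_primes"
proof (rule abs_summable_summable, rule summable_on_comparison_test)
  show "(\<lambda>p. B * real p powr - x) summable_on split_primes" by (intro summable_on_cmult_right split_primes_summable assms)
  show "norm (g (2 * real k * split_angle p) * real p powr - x) \<le> B * real p powr - x" for p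
    using assms(3) by (simp add: abs_mult mult_right_mono)
qed simp

text \<open>The two sides differ only at the prime 3, which \<open>hecke_prime_series\<close>
  contains and \<open>angle_series\<close> does not.\<close>

lemma angle_series_cos:
  assumes "1 < x" "x \<le> 2"
  shows "\<bar>angle_series k (\<lambda>t. c * cos (real m * t)) x - c / 2 * hecke_prime_series (2 * k * m) x\<bar> \<le> \<bar>c\<bar>"
proof -
  have "angle_series k (\<lambda>t. c * cos (real m * t)) x = (\<Sum>\<^sub>\<infinity>p\<in>split_primes. c / 2 * (hecke (2 * k * m) p * real p powr - x))"
    unfolding angle_series_def by (rule infsum_cong) (simp add: hecke_split_angle mult_ac)
  also have "\<dots> = c / 2 * (\<Sum>\<^sub>\<infinity>p\<in>split_primes. hecke (2 * k * m) p * real p powr - x)" by (rule infsum_cmult_right')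
  finally have e: "angle_series k (\<lambda>t. c * cos (real m * t)) x - c / 2 * hecke_prime_series (2 * k * m) x = - (c / 2 * (hecke (2 * k * m) 3 * 3 powr - x))"
    unfolding hecke_prime_series_split_primes[OF assms] by (simp add: algebra_simps)
  have "\<bar>hecke (2 * k * m) 3\<bar> \<le> hecke 0 3" using abs_hecke_le[of 3] by simp
  also have "hecke 0 3 \<le> 1" using hecke_0_ramified[of 1] by simp
  finally have s3: "\<bar>hecke (2 * k * m) 3\<bar> \<le> 1" .
  have "(3::real) powr - x \<le> 3 powr 0" using assms by (intro powr_mono) auto
  then have "\<bar>3 powr - x\<bar> \<le> (1::real)" by simp
  with s3 have "\<bar>hecke (2 * k * m) 3 * 3 powr - x\<bar> \<le> 1 * 1"
    unfolding abs_mult by (intro mult_mono) auto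
  then have "\<bar>c / 2\<bar> * \<bar>hecke (2 * k * m) 3 * 3 powr - x\<bar> \<le> \<bar>c / 2\<bar> * 1" by (intro mult_left_mono) auto
  then show ?thesis unfolding e abs_minus_cancel abs_mult[of "c / 2"] by simp
qed

text \<open>The mean is halved because split primes have density one half. The range
  \<open>k \<le> d powr - 4\<close> is what the Fejer sum needs: for \<open>d = 1 / ln N\<close> it
  covers all harmonics up to \<open>ln N powr 4\<close>.\<close>

definition good_mean :: "(real \<Rightarrow> real) \<Rightarrow> real \<Rightarrow> bool" where
  "good_mean g \<mu> \<longleftrightarrow> (g has_integral (2 * pi * \<mu>)) {- pi..pi} \<and> (\<exists>B. \<forall>t. \<bar>g t\<bar> \<le> B) \<and>
     (\<forall>e>0. \<forall>\<^sub>F d in at_right 0. \<forall>k\<ge>1. real k \<le> d powr - 4 \<longrightarrow>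
        \<bar>angle_series k g (1 + d) - \<mu> / 2 * ln (1 / d)\<bar> \<le> e * ln (1 / d))"

lemma eventually_small: "\<forall>\<^sub>F d::real in at_right 0. 0 < d \<and> d \<le> 1"
  by (auto simp: eventually_at_right_field intro!: exI[of _ 1])

lemma eventually_ln_large: "\<forall>\<^sub>F d::real in at_right 0. ln (1 / d) \<ge> C"
proof -
  have "filterlim (\<lambda>d::real. ln (1 / d)) at_top (at_right 0)" by real_asymp
  then show ?thesis by (auto simp: filterlim_at_top)
qed

lemma eventually_const_le:
  assumes "e > 0" shows "\<forall>\<^sub>F d::real in at_right 0. C \<le> e * ln (1 / d)"
  using eventually_ln_large[of "C / e"] by eventually_elim (use assms in \<open>simp add: field_simps\<close>)

lemma eventually_lnln_le:
  assumes "e > 0" "a \<ge> 0" shows "\<forall>\<^sub>F d::real in at_right 0. ln (1 + (a + 4 * ln (1 / d))) \<le> e * ln (1 / d)"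
proof -
  have "((\<lambda>l::real. ln (1 + (a + 4 * l)) / l) \<longlongrightarrow> 0) at_top" by real_asymp
  then have "\<forall>\<^sub>F l in at_top. ln (1 + (a + 4 * l)) / l < e" using assms(1) by (rule order_tendstoD(2))
  moreover have "filterlim (\<lambda>d::real. ln (1 / d)) at_top (at_right 0)" by real_asymp
  ultimately have "\<forall>\<^sub>F d::real in at_right 0. ln (1 + (a + 4 * ln (1 / d))) / ln (1 / d) < e"
    by (rule eventually_compose_filterlim)
  with eventually_ln_large[of 1] show ?thesis by eventually_elim (simp add: field_simps)
qed

lemma good_mean_const: "good_mean (\<lambda>t. c * cos (real 0 * t)) c"
  unfolding good_mean_def
proof (intro conjI allI impI)
  show "((\<lambda>t. c * cos (real 0 * t)) has_integral (2 * pi * c)) {- pi..pi}"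
    using has_integral_const_real[of c "- pi" pi] by simp
  show "\<exists>B. \<forall>t. \<bar>c * cos (real 0 * t)\<bar> \<le> B" by auto
  fix e :: real assume e: "e > 0"
  show "\<forall>\<^sub>F d in at_right 0. \<forall>k\<ge>1. real k \<le> d powr - 4 \<longrightarrow>
        \<bar>angle_series k (\<lambda>t. c * cos (real 0 * t)) (1 + d) - c / 2 * ln (1 / d)\<bar> \<le> e * ln (1 / d)"
    using eventually_small eventually_const_le[OF e, of "\<bar>c\<bar> + \<bar>c\<bar> / 2 * 604"]
  proof eventually_elim
    case (elim d)
    have x: "1 < 1 + d" "1 + d \<le> 2" using elim by auto
    have "\<bar>hecke_prime_series 0 (1 + d) - ln (1 / d)\<bar> \<le> 604" using hecke_prime_series_0_bounds[OF x] by (simp add: abs_le_iff)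
    then have "\<bar>c / 2\<bar> * \<bar>hecke_prime_series 0 (1 + d) - ln (1 / d)\<bar> \<le> \<bar>c / 2\<bar> * 604" by (intro mult_left_mono) auto
    then have 1: "\<bar>c / 2 * hecke_prime_series 0 (1 + d) - c / 2 * ln (1 / d)\<bar> \<le> \<bar>c\<bar> / 2 * 604" by (simp add: right_diff_distrib flip: abs_mult)
    show ?case
    proof (intro allI impI)
      fix k :: nat
      have "\<bar>angle_series k (\<lambda>t. c * cos (real 0 * t)) (1 + d) - c / 2 * hecke_prime_series 0 (1 + d)\<bar> \<le> \<bar>c\<bar>" using angle_series_cos[OF x, of k c 0] by simp
      then show "\<bar>angle_series k (\<lambda>t. c * cos (real 0 * t)) (1 + d) - c / 2 * ln (1 / d)\<bar> \<le> e * ln (1 / d)" using 1 elim by argo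
    qed
  qed
qed

text \<open>For \<open>m \<ge> 1\<close> the series reduces to
  \<open>hecke_prime_series (2 * k * m)\<close>, whose index is positive. In the given range of
  \<open>k\<close> it grows like \<open>ln (ln (1 / d))\<close> at most.\<close>

lemma good_mean_cos: 
  assumes "m \<ge> 1" shows "good_mean (\<lambda>t. c * cos (real m * t)) 0"
  unfolding good_mean_def
proof (intro conjI allI impI)
  have "((\<lambda>t. c * cos (real m * t)) has_integral (c * sin (real m * pi) / real m - c * sin (real m * (- pi)) / real m)) {- pi..pi}"
  proof (rule fundamental_theorem_of_calculus)
    fix t :: real
    have "((\<lambda>t. c * sin (real m * t) / real m) has_real_derivative c * cos (real m * t)) (at t within {- pi..pi})"
      using assms by (auto intro!: derivative_eq_intros)
    then show "((\<lambda>t. c * sin (real m * t) / real m) has_vector_derivative c * cos (real m * t)) (at t within {- pi..pi})"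
      by (simp add: has_real_derivative_iff_has_vector_derivative)
  qed (use pi_gt_zero in simp)
  then show "((\<lambda>t. c * cos (real m * t)) has_integral (2 * pi * 0)) {- pi..pi}" by simp
  have "\<bar>c * cos (real m * t)\<bar> \<le> \<bar>c\<bar> * 1" for t unfolding abs_mult by (intro mult_left_mono abs_cos_le_one) simp
  then show "\<exists>B. \<forall>t. \<bar>c * cos (real m * t)\<bar> \<le> B" by blast
  fix e :: real assume e: "e > 0"
  obtain C where C: "C > 0" "\<And>k x. k \<ge> 1 \<Longrightarrow> 1 < x \<Longrightarrow> x \<le> 2 \<Longrightarrow> \<bar>hecke_prime_series k x\<bar> \<le> C * (1 + ln (1 + ln (real k)))"
    using hecke_prime_series_bound by blast
  define D where "D = \<bar>c\<bar> / 2 * C + 1"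
  have D: "D > 0" "\<bar>c\<bar> / 2 * C \<le> D" using C(1) by (auto simp: D_def intro: add_nonneg_pos)
  have a0: "ln (2 * real m) \<ge> 0" using assms by simp
  have e2: "e / (2 * D) > 0" using e D by simp
  show "\<forall>\<^sub>F d in at_right 0. \<forall>k\<ge>1. real k \<le> d powr - 4 \<longrightarrow>
        \<bar>angle_series k (\<lambda>t. c * cos (real m * t)) (1 + d) - 0 / 2 * ln (1 / d)\<bar> \<le> e * ln (1 / d)"
    using eventually_small eventually_const_le[of "e / 2" "\<bar>c\<bar> + D", OF half_gt_zero[OF e]] eventually_lnln_le[OF e2 a0]
  proof eventually_elim
    case (elim d)
    have x: "1 < 1 + d" "1 + d \<le> 2" using elim by auto
    show ?case
    proof (intro allI impI)
      fix k :: nat assume k: "k \<ge> 1" "real k \<le> d powr - 4"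
      have km: "2 * k * m \<ge> 1" using k assms by simp
      have lk: "ln (real k) \<le> 4 * ln (1 / d)"
      proof -
        have "ln (real k) \<le> ln (d powr - 4)" using k by (intro ln_mono) auto
        then show ?thesis using elim by (simp add: ln_powr ln_div)
      qed
      have "ln (real (2 * k * m)) = ln (2 * real m) + ln (real k)" using k assms by (simp add: ln_mult)
      then have l0: "ln (real (2 * k * m)) \<le> ln (2 * real m) + 4 * ln (1 / d)" using lk by simp
      have l1: "ln (real (2 * k * m)) \<ge> 0" using km by (intro ln_ge_zero) (metis of_nat_1 of_nat_le_iff)
      have "ln (1 + ln (real (2 * k * m))) \<le> ln (1 + (ln (2 * real m) + 4 * ln (1 / d)))"
        using l0 l1 by (intro ln_mono) auto
      also have "\<dots> \<le> e / (2 * D) * ln (1 / d)" using elim by simp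
      finally have l2: "ln (1 + ln (real (2 * k * m))) \<le> e / (2 * D) * ln (1 / d)" .
      have l3: "1 + ln (1 + ln (real (2 * k * m))) \<ge> 0" using l1 by simp
      have "\<bar>c / 2 * hecke_prime_series (2 * k * m) (1 + d)\<bar> \<le> \<bar>c\<bar> / 2 * (C * (1 + ln (1 + ln (real (2 * k * m)))))"
        unfolding abs_mult using C(2)[OF km x] by (intro mult_mono) auto
      also have "\<dots> = \<bar>c\<bar> / 2 * C * (1 + ln (1 + ln (real (2 * k * m))))" by simp
      also have "\<dots> \<le> D * (1 + e / (2 * D) * ln (1 / d))" using D l2 l3 by (intro mult_mono) auto
      also have "\<dots> = D + e / 2 * ln (1 / d)" using D by (simp add: distrib_left)
      finally have "\<bar>c / 2 * hecke_prime_series (2 * k * m) (1 + d)\<bar> \<le> D + e / 2 * ln (1 / d)" .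
      then show "\<bar>angle_series k (\<lambda>t. c * cos (real m * t)) (1 + d) - 0 / 2 * ln (1 / d)\<bar> \<le> e * ln (1 / d)"
        using angle_series_cos[OF x, of k c m] elim by argo
    qed
  qed
qed

lemma trigpoly_good_mean: "trigpoly g \<Longrightarrow> \<exists>\<mu>. good_mean g \<mu>"
proof (induction rule: trigpoly.induct)
  case (cos c m)
  show ?case
  proof (cases "m = 0")
    case True
    then show ?thesis using good_mean_const by blast
  next
    case False
    then have "m \<ge> 1" by simp
    then show ?thesis using good_mean_cos by blast
  qed
next
  case (add f g)
  then obtain a b where ab: "good_mean f a" "good_mean g b" by blast
  obtain A where A: "\<And>t. \<bar>f t\<bar> \<le> A" using ab by (auto simp: good_mean_def)
  obtain B where B: "\<And>t. \<bar>g t\<bar> \<le> B" using ab by (auto simp: good_mean_def)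
  have "good_mean (\<lambda>t. f t + g t) (a + b)"
    unfolding good_mean_def
  proof (intro conjI allI impI)
    have "((\<lambda>t. f t + g t) has_integral (2 * pi * a + 2 * pi * b)) {- pi..pi}"
      using ab by (intro has_integral_add) (auto simp: good_mean_def)
    then show "((\<lambda>t. f t + g t) has_integral (2 * pi * (a + b))) {- pi..pi}" by (simp add: distrib_left)
    show "\<exists>B. \<forall>t. \<bar>f t + g t\<bar> \<le> B" by (rule exI[of _ "A + B"]) (meson A B abs_triangle_ineq add_mono order_trans)
    fix e :: real assume e: "e > 0"
    have "\<forall>\<^sub>F d in at_right 0. \<forall>k\<ge>1. real k \<le> d powr - 4 \<longrightarrow> \<bar>angle_series k f (1 + d) - a / 2 * ln (1 / d)\<bar> \<le> e / 2 * ln (1 / d)"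
      "\<forall>\<^sub>F d in at_right 0. \<forall>k\<ge>1. real k \<le> d powr - 4 \<longrightarrow> \<bar>angle_series k g (1 + d) - b / 2 * ln (1 / d)\<bar> \<le> e / 2 * ln (1 / d)"
      using ab half_gt_zero[OF e] unfolding good_mean_def by blast+
    with eventually_small show "\<forall>\<^sub>F d in at_right 0. \<forall>k\<ge>1. real k \<le> d powr - 4 \<longrightarrow>
      \<bar>angle_series k (\<lambda>t. f t + g t) (1 + d) - (a + b) / 2 * ln (1 / d)\<bar> \<le> e * ln (1 / d)"
    proof eventually_elim
      case (elim d)
      have x: "1 < 1 + d" "1 + d \<le> 2" using elim by auto
      show ?case
      proof (intro allI impI)
        fix k :: nat assume k: "k \<ge> 1" "real k \<le> d powr - 4"
        have "angle_series k (\<lambda>t. f t + g t) (1 + d) = angle_series k f (1 + d) + angle_series k g (1 + d)"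
          unfolding angle_series_def distrib_right by (rule infsum_add[OF angle_series_summable[OF x A] angle_series_summable[OF x B]])
        moreover have "(a + b) / 2 * ln (1 / d) = a / 2 * ln (1 / d) + b / 2 * ln (1 / d)" "e * ln (1 / d) = e / 2 * ln (1 / d) + e / 2 * ln (1 / d)"
          by (simp_all add: add_divide_distrib distrib_right)
        ultimately show "\<bar>angle_series k (\<lambda>t. f t + g t) (1 + d) - (a + b) / 2 * ln (1 / d)\<bar> \<le> e * ln (1 / d)"
          using elim(2,3) k by (smt (verit))
      qed
    qed
  qed
  then show ?case by blast
qed

text \<open>The constant is the mean \<open>4 / pi\<close> of \<open>2 * |cos (t / 2)|\<close> times
  the density one half of the split primes.\<close>

lemma abs_hecke_prime_series_bound:
  assumes "e > 0"
  shows "\<forall>\<^sub>F d in at_right 0. \<forall>k\<ge>1. real k \<le> d powr - 4 \<longrightarrow>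
     (\<Sum>\<^sub>\<infinity>p\<in>split_primes. \<bar>hecke k p\<bar> * real p powr - (1 + d)) \<le> (2 / pi + e) * ln (1 / d)"
proof -
  \<comment> \<open>The losses add up to \<open>5 * h\<close>: one from comparing the mean of
    \<open>g\<close> with \<open>2 / pi\<close>, the others from the pointwise approximation and
    from \<open>angle_series\<close>.\<close>
  define h where "h = e / 8"
  have h: "h > 0" using assms by (simp add: h_def)
  obtain g where g: "trigpoly g" "\<And>t. \<bar>\<bar>cos (t / 2)\<bar> - g t\<bar> \<le> h" using abs_cos_half_approx[OF h] by blast
  obtain \<mu> where mu: "good_mean g \<mu>" using trigpoly_good_mean[OF g(1)] by blast
  obtain B where B: "\<And>t. \<bar>g t\<bar> \<le> B" using mu by (auto simp: good_mean_def)
  have "2 * pi * \<mu> \<le> 4 + 2 * pi * h"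
  proof -
    have "((\<lambda>t. cos (t / 2)) has_integral (2 * sin (pi / 2) - 2 * sin (- pi / 2))) {- pi..pi}"
    proof (rule fundamental_theorem_of_calculus)
      fix t :: real
      have "((\<lambda>t. 2 * sin (t / 2)) has_real_derivative cos (t / 2)) (at t within {- pi..pi})"
        by (auto intro!: derivative_eq_intros)
      then show "((\<lambda>t. 2 * sin (t / 2)) has_vector_derivative cos (t / 2)) (at t within {- pi..pi})"
        by (simp add: has_real_derivative_iff_has_vector_derivative)
    qed (use pi_gt_zero in simp)
    then have 1: "((\<lambda>t. cos (t / 2)) has_integral 4) {- pi..pi}" by simp
    have 2: "((\<lambda>t. h) has_integral (2 * pi * h)) {- pi..pi}" using has_integral_const_real[of h "- pi" pi] by simp
    have "(g has_integral (2 * pi * \<mu>)) {- pi..pi}" using mu by (simp add: good_mean_def)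
    from this has_integral_add[OF 1 2] show ?thesis
    proof (rule has_integral_le)
      fix t assume "t \<in> {- pi..pi}"
      then have "cos (t / 2) \<ge> 0" by (intro cos_ge_zero) auto
      then show "g t \<le> cos (t / 2) + h" using g(2)[of t] by linarith
    qed
  qed
  then have "pi * (2 * \<mu>) \<le> pi * (4 / pi + 2 * h)" by (simp add: distrib_left)
  then have m: "\<mu> \<le> 2 / pi + h" using pi_gt_zero by (simp add: mult_le_cancel_left_pos)
  have "\<forall>\<^sub>F d in at_right 0. \<forall>k\<ge>1. real k \<le> d powr - 4 \<longrightarrow> \<bar>angle_series k g (1 + d) - \<mu> / 2 * ln (1 / d)\<bar> \<le> h * ln (1 / d)"
    using mu h unfolding good_mean_def by blast
  with eventually_small eventually_ln_large[of "604 + 1"] show ?thesis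
  proof eventually_elim
    case (elim d)
    define l where "l = ln (1 / d)"
    have l: "l \<ge> 605" using elim by (simp add: l_def)
    have x: "1 < 1 + d" "1 + d \<le> 2" using elim by auto
    define Q where "Q = (\<Sum>\<^sub>\<infinity>p\<in>split_primes. real p powr - (1 + d))"
    have Qs: "(\<lambda>p. real p powr - (1 + d)) summable_on split_primes" by (rule split_primes_summable[OF x])
    have "2 * Q = (\<Sum>\<^sub>\<infinity>p\<in>split_primes. hecke 0 p * real p powr - (1 + d))"
      unfolding Q_def infsum_cmult_right'[symmetric] by (rule infsum_cong) (simp add: hecke_split_angle)
    also have "\<dots> = hecke_prime_series 0 (1 + d) - hecke 0 3 * 3 powr - (1 + d)" unfolding hecke_prime_series_split_primes[OF x] by simp
    also have "\<dots> \<le> hecke_prime_series 0 (1 + d)" using hecke_0_nonneg[of 3] by simp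
    also have "\<dots> \<le> l + 604" using hecke_prime_series_0_bounds(1)[OF x] by (simp add: l_def)
    finally have Q: "Q \<le> l" using l by linarith
    show ?case
    proof (intro allI impI)
      fix k :: nat assume k: "k \<ge> 1" "real k \<le> d powr - 4"
      have Es: "(\<lambda>p. g (2 * real k * split_angle p) * real p powr - (1 + d)) summable_on split_primes" by (rule angle_series_summable[OF x B])
      have "(\<Sum>\<^sub>\<infinity>p\<in>split_primes. \<bar>hecke k p\<bar> * real p powr - (1 + d)) \<le> (\<Sum>\<^sub>\<infinity>p\<in>split_primes. 2 * (g (2 * real k * split_angle p) * real p powr - (1 + d)) + 2 * h * real p powr - (1 + d))"
      proof (rule infsum_mono)
        show "(\<lambda>p. 2 * (g (2 * real k * split_angle p) * real p powr - (1 + d)) + 2 * h * real p powr - (1 + d)) summable_on split_primes"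
          by (intro summable_on_add summable_on_cmult_right Es Qs)
        show "(\<lambda>p. \<bar>hecke k p\<bar> * real p powr - (1 + d)) summable_on split_primes"
          using summable_on_subset_banach[OF dterm_hecke_summable[OF x, of k], of split_primes] by (simp add: dterm_def abs_mult)
        fix p assume p: "p \<in> split_primes"
        have "\<bar>cos (2 * real k * split_angle p / 2)\<bar> \<le> g (2 * real k * split_angle p) + h" using g(2)[of "2 * real k * split_angle p"] by linarith
        then have "\<bar>hecke k p\<bar> \<le> 2 * (g (2 * real k * split_angle p) + h)" unfolding hecke_split_angle[OF p] by (simp add: abs_mult)
        then have "\<bar>hecke k p\<bar> * real p powr - (1 + d) \<le> 2 * (g (2 * real k * split_angle p) + h) * real p powr - (1 + d)" by (intro mult_right_mono) auto
        then show "\<bar>hecke k p\<bar> * real p powr - (1 + d) \<le> 2 * (g (2 * real k * split_angle p) * real p powr - (1 + d)) + 2 * h * real p powr - (1 + d)"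
          by (simp add: algebra_simps)
      qed
      also have "\<dots> = 2 * angle_series k g (1 + d) + 2 * h * Q"
        unfolding angle_series_def Q_def infsum_cmult_right'[symmetric] by (intro infsum_add summable_on_cmult_right Es Qs)
      also have "\<dots> \<le> 2 * (\<mu> / 2 * l + h * l) + 2 * h * l"
      proof (rule add_mono)
        have "\<bar>angle_series k g (1 + d) - \<mu> / 2 * l\<bar> \<le> h * l" using elim k by (simp add: l_def)
        then show "2 * angle_series k g (1 + d) \<le> 2 * (\<mu> / 2 * l + h * l)" by argo
        show "2 * h * Q \<le> 2 * h * l" using Q h by (intro mult_left_mono) auto
      qed
      also have "\<dots> = (\<mu> + 4 * h) * l" by (simp add: algebra_simps)
      also have "\<dots> \<le> (2 / pi + e) * l" using m l h by (intro mult_right_mono) (auto simp: h_def)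
      finally show "(\<Sum>\<^sub>\<infinity>p\<in>split_primes. \<bar>hecke k p\<bar> * real p powr - (1 + d)) \<le> (2 / pi + e) * ln (1 / d)" by (simp add: l_def)
    qed
  qed
qed

section \<open>Discrepancy and exponential sums\<close>

lemma sin_ge_half:
  assumes "0 \<le> x" "x \<le> pi / 2" shows "sin x \<ge> x / 2"
proof (cases "x \<le> pi / 3")
  case True
  have "sin 0 - 0 / 2 \<le> sin x - x / 2"
  proof (rule DERIV_nonneg_imp_nondecreasing[OF assms(1)])
    fix y assume y: "0 \<le> y" "y \<le> x"
    have "cos (pi / 3) \<le> cos y" using y True pi_gt_zero by (intro cos_monotone_0_pi_le) auto
    then have "0 \<le> cos y - 1 / 2" by (simp add: cos_60)
    moreover have "((\<lambda>x. sin x - x / 2) has_real_derivative cos y - 1 / 2) (at y)"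
      by (auto intro!: derivative_eq_intros)
    ultimately show "\<exists>d. ((\<lambda>x. sin x - x / 2) has_real_derivative d) (at y) \<and> 0 \<le> d" by blast
  qed
  then show ?thesis by simp
next
  case False
  have "sin (pi / 3) \<le> sin x" using False assms pi_gt_zero by (intro sin_monotone_2pi_le) auto
  moreover have "sin (pi / 3) = sqrt 3 / 2" by (rule sin_60)
  moreover have "(8/5)\<^sup>2 \<le> (3::real)" by (simp add: power2_eq_square)
  then have "8/5 \<le> sqrt 3" by (rule real_le_rsqrt)
  moreover have "pi < 3.2" using pi_approx by simp
  ultimately show ?thesis using assms by linarith
qed

lemma abs_sin_ge_half:
  assumes "\<bar>x\<bar> \<le> pi / 2" shows "\<bar>sin x\<bar> \<ge> \<bar>x\<bar> / 2"
proof (cases "x \<ge> 0")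
  case True
  then show ?thesis using sin_ge_half[of x] assms by simp
next
  case False
  then show ?thesis using sin_ge_half[of "- x"] assms by simp
qed

lemma norm_one_minus_cis: "cmod (1 - cis t) = 2 * \<bar>sin (t / 2)\<bar>"
  using dist_exp_i_1[of t] by (simp add: cis_conv_exp norm_minus_commute)

lemma geometric_cis:
  fixes A B :: int
  shows "cmod (1 - cis t) * cmod (\<Sum>j\<in>{A..B}. cis (of_int j * t)) \<le> 2"
proof (cases "A \<le> B")
  case True
  define n where "n = nat (B - A + 1)"
  have "{A..B} = (\<lambda>i. A + int i) ` {..<n}"
  proof (intro equalityI subsetI)
    fix j assume "j \<in> {A..B}"
    then show "j \<in> (\<lambda>i. A + int i) ` {..<n}" by (intro image_eqI[of _ _ "nat (j - A)"]) (auto simp: n_def)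
  qed (auto simp: n_def)
  then have "(\<Sum>j\<in>{A..B}. cis (of_int j * t)) = (\<Sum>i<n. cis (of_int (A + int i) * t))"
    by (simp add: sum.reindex inj_on_def)
  also have "\<dots> = cis (of_int A * t) * (\<Sum>i<n. cis t ^ i)"
    by (simp add: sum_distrib_left Complex.DeMoivre cis_mult distrib_right)
  finally have "(1 - cis t) * (\<Sum>j\<in>{A..B}. cis (of_int j * t)) = cis (of_int A * t) * ((1 - cis t) * (\<Sum>i<n. cis t ^ i))"
    by (simp add: mult_ac)
  also have "\<dots> = cis (of_int A * t) * (1 - cis t ^ n)" by (simp only: one_diff_power_eq)
  finally have "cmod (1 - cis t) * cmod (\<Sum>j\<in>{A..B}. cis (of_int j * t)) = cmod (1 - cis t ^ n)"
    by (simp flip: norm_mult) (simp add: norm_mult)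
  also have "\<dots> \<le> 2" using norm_triangle_ineq4[of 1 "cis t ^ n"] by (simp add: norm_power)
  finally show ?thesis .
qed simp

section \<open>The Fejer kernel on a finite grid\<close>

text \<open>Normalised to have mean value 1, see \<open>fejer_grid_sum\<close>.\<close>

definition fejer :: "nat \<Rightarrow> real \<Rightarrow> real" where
  "fejer N t = (cmod (\<Sum>a<N. cis (real a * t)))\<^sup>2 / real N"

lemma fejer_nonneg: "fejer N t \<ge> 0" by (simp add: fejer_def)

lemma fejer_expand:
  "complex_of_real (fejer N t) = (\<Sum>a<N. \<Sum>b<N. cis ((real a - real b) * t)) / of_nat N"
proof -
  have "complex_of_real ((cmod (\<Sum>a<N. cis (real a * t)))\<^sup>2) = (\<Sum>a<N. cis (real a * t)) * cnj (\<Sum>a<N. cis (real a * t))"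
    by (simp only: complex_norm_square)
  also have "\<dots> = (\<Sum>a<N. \<Sum>b<N. cis (real a * t) * cis (- (real b * t)))"
    by (simp add: sum_product cis_cnj)
  also have "\<dots> = (\<Sum>a<N. \<Sum>b<N. cis ((real a - real b) * t))"
    by (simp add: cis_mult left_diff_distrib)
  finally show ?thesis by (simp add: fejer_def)
qed

lemma fejer_le:
  assumes "N > 0" "0 < d" "d \<le> \<bar>t\<bar>" "\<bar>t\<bar> \<le> pi"
  shows "fejer N t \<le> 16 / (real N * d\<^sup>2)"
proof -
  have "\<bar>t / 2\<bar> / 2 \<le> \<bar>sin (t / 2)\<bar>" using assms by (intro abs_sin_ge_half) auto
  then have s: "d / 4 \<le> \<bar>sin (t / 2)\<bar>" using assms by (simp add: abs_divide)
  have e: "(\<Sum>a<N. cis (real a * t)) = (\<Sum>j\<in>{0..int N - 1}. cis (of_int j * t))"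
    by (rule sum.reindex_bij_witness[of _ nat int]) auto
  have "2 * \<bar>sin (t / 2)\<bar> * cmod (\<Sum>a<N. cis (real a * t)) \<le> 2"
    using geometric_cis[of t 0 "int N - 1"] by (simp only: e norm_one_minus_cis)
  moreover have "2 * (d / 4) * cmod (\<Sum>a<N. cis (real a * t)) \<le> 2 * \<bar>sin (t / 2)\<bar> * cmod (\<Sum>a<N. cis (real a * t))"
    using s by (intro mult_right_mono mult_left_mono) auto
  ultimately have "cmod (\<Sum>a<N. cis (real a * t)) \<le> 4 / d" using assms by (simp add: field_simps)
  then have "(cmod (\<Sum>a<N. cis (real a * t)))\<^sup>2 \<le> (4 / d)\<^sup>2" by (intro power_mono) auto
  then have "fejer N t \<le> (4 / d)\<^sup>2 / real N" unfolding fejer_def by (intro divide_right_mono) auto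
  also have "\<dots> = 16 / (real N * d\<^sup>2)" by (simp add: power_divide)
  finally show ?thesis .
qed

text \<open>Averages over the grid of mesh \<open>2 pi / M\<close>, where \<open>M\<close> exceeds the degree of the kernel, are exact
  and take the place of convolution integrals.\<close>
definition grid :: "nat \<Rightarrow> int \<Rightarrow> real" where "grid M j = 2 * pi / real M * of_int j"

text \<open>A complete geometric sum in an \<open>M\<close>-th root of unity, which differs from 1
  because \<open>M\<close> does not divide \<open>m\<close>.\<close>

lemma grid_full_sum:
  assumes "M > 0" "m \<noteq> 0" "\<bar>m\<bar> < int M"
  shows "(\<Sum>j\<in>{j0..j0 + int M - 1}. cis (of_int m * (x - grid M j))) = 0"
proof -
  define t where "t = - (2 * pi / real M * of_int m)"
  have "t / 2 = - (pi * of_int m / real M)" by (simp add: t_def)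
  have sn: "sin (t / 2) \<noteq> 0"
  proof
    assume "sin (t / 2) = 0"
    then obtain i :: int where i: "t / 2 = of_int i * pi" by (auto simp: sin_zero_iff_int2)
    have "pi * real_of_int m = pi * - (of_int i * real M)" using i assms(1) by (simp add: t_def field_simps)
    then have "real_of_int m = - (of_int i * real M)" using pi_gt_zero by (subst (asm) mult_left_cancel) auto
    then have "m = - (i * int M)" by (metis of_int_eq_iff of_int_minus of_int_mult of_int_of_nat_eq)
    then have "int M dvd m" by simp
    then show False using assms zdvd_imp_le[of "int M" "\<bar>m\<bar>"] by simp
  qed
  have c1: "cis t \<noteq> 1" using norm_one_minus_cis[of t] sn by auto
  have per: "cis t ^ M = 1"
  proof -
    have "real M * t = 2 * pi * of_int (- m)" using assms(1) by (simp add: t_def)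
    then show ?thesis unfolding Complex.DeMoivre by (simp only: cis_multiple_2pi Ints_of_int)
  qed
  have "(\<Sum>j\<in>{j0..j0 + int M - 1}. cis (of_int m * (x - grid M j))) = (\<Sum>i<M. cis (of_int m * x + of_int j0 * t) * cis t ^ i)"
  proof (rule sum.reindex_bij_witness[of _ "\<lambda>i. j0 + int i" "\<lambda>j. nat (j - j0)"])
    fix j assume j: "j \<in> {j0..j0 + int M - 1}"
    have "of_int m * (x - grid M j) = of_int m * x + of_int j * t" by (simp add: grid_def t_def algebra_simps)
    also have "of_int j = of_int j0 + real (nat (j - j0))" using j by simp
    finally have "of_int m * (x - grid M j) = (of_int m * x + of_int j0 * t) + real (nat (j - j0)) * t"
      by (simp only: distrib_right add.assoc)
    then show "cis (of_int m * x + of_int j0 * t) * cis t ^ nat (j - j0) = cis (of_int m * (x - grid M j))"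
      by (simp only: Complex.DeMoivre cis_mult)
  qed auto
  also have "\<dots> = cis (of_int m * x + of_int j0 * t) * (\<Sum>i<M. cis t ^ i)" by (simp only: sum_distrib_left)
  also have "(\<Sum>i<M. cis t ^ i) = 0"
  proof -
    have "(1 - cis t) * (\<Sum>i<M. cis t ^ i) = 0" using one_diff_power_eq[of "cis t" M] per by simp
    then show ?thesis using c1 by simp
  qed
  finally show ?thesis by simp
qed

text \<open>All frequencies \<open>a - b\<close> are smaller than \<open>M\<close> in absolute
  value, so only the diagonal survives.\<close>

lemma fejer_grid_sum:
  assumes "N > 0" "N \<le> M"
  shows "(\<Sum>j\<in>{j0..j0 + int M - 1}. fejer N (x - grid M j)) = real M"
proof -
  have inner: "(\<Sum>j\<in>{j0..j0 + int M - 1}. cis ((real a - real b) * (x - grid M j))) = (if a = b then of_nat M else 0)"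
    if "a < N" "b < N" for a b
  proof (cases "a = b")
    case False
    have "(\<Sum>j\<in>{j0..j0 + int M - 1}. cis (of_int (int a - int b) * (x - grid M j))) = 0"
      by (rule grid_full_sum) (use assms that False in auto)
    then show ?thesis using False by simp
  qed simp
  have "complex_of_real (\<Sum>j\<in>{j0..j0 + int M - 1}. fejer N (x - grid M j))
     = (\<Sum>j\<in>{j0..j0 + int M - 1}. \<Sum>a<N. \<Sum>b<N. cis ((real a - real b) * (x - grid M j))) / of_nat N"
    by (simp add: fejer_expand sum_divide_distrib)
  also have "(\<Sum>j\<in>{j0..j0 + int M - 1}. \<Sum>a<N. \<Sum>b<N. cis ((real a - real b) * (x - grid M j)))
     = (\<Sum>a<N. \<Sum>b<N. \<Sum>j\<in>{j0..j0 + int M - 1}. cis ((real a - real b) * (x - grid M j)))"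
    by (subst sum.swap, intro sum.cong refl, subst sum.swap, rule refl)
  also have "\<dots> = (\<Sum>a<N. \<Sum>b<N. if a = b then of_nat M else 0)" using inner by (intro sum.cong refl) auto
  also have "\<dots> = of_nat N * of_nat M" by simp
  also have "of_nat N * of_nat M / of_nat N = complex_of_real (real M)" using assms(1) by simp
  finally show ?thesis by (simp only: of_real_eq_iff)
qed

text \<open>The smoothed indicator of the enlarged arc is nearly 1 on the arc. Among
  \<open>M\<close> consecutive grid points around \<open>x\<close>, those outside the enlarged arc
  are at distance at least \<open>d\<close> from \<open>x\<close>, where the kernel is
  small.\<close>

lemma fejer_partial_cover:
  assumes "N > 0" "N \<le> M" "0 < d" "a \<le> x" "x \<le> b"
  shows "real M - real M * (16 / (real N * d\<^sup>2)) \<le> (\<Sum>j\<in>{j. a - d \<le> grid M j \<and> grid M j \<le> b + d}. fejer N (x - grid M j))"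
proof -
  \<comment> \<open>Start of a run of \<open>M\<close> consecutive grid points, all within
    \<open>pi\<close> of \<open>x\<close>, as \<open>fejer_le\<close> requires.\<close>
  define j0 where "j0 = \<lceil>real M * (x - pi) / (2 * pi)\<rceil>"
  define W where "W = {j0..j0 + int M - 1}"
  define J where "J = {j. a - d \<le> grid M j \<and> grid M j \<le> b + d}"
  define T where "T = 16 / (real N * d\<^sup>2)"
  have M0: "real M > 0" using assms by simp
  have win: "\<bar>x - grid M j\<bar> \<le> pi" if "j \<in> W" for j
  proof -
    have "real M * (x - pi) / (2 * pi) \<le> of_int j0" unfolding j0_def by (rule le_of_int_ceiling)
    also have "\<dots> \<le> of_int j" using that by (simp add: W_def)
    finally have "x - pi \<le> grid M j" using M0 pi_gt_zero by (simp add: grid_def field_simps)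
    moreover have "of_int j0 \<le> real M * (x - pi) / (2 * pi) + 1" unfolding j0_def by linarith
    then have "of_int j \<le> real M * (x - pi) / (2 * pi) + real M" using that by (auto simp: W_def)
    then have "grid M j \<le> x + pi" using M0 pi_gt_zero by (simp add: grid_def field_simps)
    ultimately show ?thesis by (simp add: abs_le_iff)
  qed
  have finJ: "finite J"
  proof (rule finite_subset)
    show "J \<subseteq> {\<lceil>real M * (a - d) / (2 * pi)\<rceil>..\<lfloor>real M * (b + d) / (2 * pi)\<rfloor>}"
      using M0 pi_gt_zero by (auto simp: J_def grid_def ceiling_le_iff le_floor_iff field_simps)
  qed simp
  have "real M = (\<Sum>j\<in>W. fejer N (x - grid M j))" unfolding W_def by (rule fejer_grid_sum[OF assms(1,2), symmetric])
  also have "\<dots> = (\<Sum>j\<in>W \<inter> J. fejer N (x - grid M j)) + (\<Sum>j\<in>W - J. fejer N (x - grid M j))"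
    by (rule sum.Int_Diff) (simp add: W_def)
  also have "(\<Sum>j\<in>W \<inter> J. fejer N (x - grid M j)) \<le> (\<Sum>j\<in>J. fejer N (x - grid M j))"
    by (rule sum_mono2) (auto simp: finJ fejer_nonneg)
  also have "(\<Sum>j\<in>W - J. fejer N (x - grid M j)) \<le> (\<Sum>j\<in>W - J. T)"
  proof (rule sum_mono)
    fix j assume j: "j \<in> W - J"
    then have "d \<le> \<bar>x - grid M j\<bar>" using assms(4,5) by (auto simp: J_def)
    then show "fejer N (x - grid M j) \<le> T" unfolding T_def using j win[of j] assms by (intro fejer_le) auto
  qed
  also have "(\<Sum>j\<in>W - J. T) \<le> (\<Sum>j\<in>W. T)" by (rule sum_mono2) (auto simp: W_def T_def)
  also have "(\<Sum>j\<in>W. T) = real M * T" by (simp add: W_def)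
  finally show ?thesis by (simp add: T_def J_def)
qed

definition arg_sum :: "nat \<Rightarrow> int \<Rightarrow> complex" where
  "arg_sum n m = (\<Sum>z\<in>lattice_pts n. cis (of_int m * arg0 z))"

lemma norm_arg_sum_abs: "cmod (arg_sum n m) = cmod (arg_sum n \<bar>m\<bar>)"
proof (cases "m \<ge> 0")
  case False
  have "cnj (arg_sum n m) = arg_sum n (- m)" by (simp add: arg_sum_def cis_cnj)
  then have "cmod (arg_sum n m) = cmod (arg_sum n (- m))" by (metis complex_mod_cnj)
  then show ?thesis using False by simp
qed simp

lemma sum_off_diagonal_le:
  fixes h :: "nat \<Rightarrow> real"
  assumes "\<And>k. h k \<ge> 0"
  shows "(\<Sum>a<N. \<Sum>b\<in>{..<N} - {a}. h (nat \<bar>int a - int b\<bar>)) \<le> real N * (2 * (\<Sum>k=1..<N. h k))"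
proof -
  have "(\<Sum>b\<in>{..<N} - {a}. h (nat \<bar>int a - int b\<bar>)) \<le> 2 * (\<Sum>k=1..<N. h k)" if a: "a < N" for a
  proof -
    have un: "{..<N} - {a} = {..<a} \<union> {a<..<N}" using a by auto
    have "(\<Sum>b\<in>{..<N} - {a}. h (nat \<bar>int a - int b\<bar>)) = (\<Sum>b<a. h (nat \<bar>int a - int b\<bar>)) + (\<Sum>b\<in>{a<..<N}. h (nat \<bar>int a - int b\<bar>))"
      unfolding un by (rule sum.union_disjoint) auto
    also have "(\<Sum>b<a. h (nat \<bar>int a - int b\<bar>)) = (\<Sum>k\<in>(\<lambda>b. a - b) ` {..<a}. h k)"
      by (subst sum.reindex) (auto simp: inj_on_def nat_diff_distrib' of_nat_diff intro!: sum.cong arg_cong[of _ _ h])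
    also have "\<dots> \<le> (\<Sum>k=1..<N. h k)" using a assms by (intro sum_mono2) auto
    also have "(\<Sum>b\<in>{a<..<N}. h (nat \<bar>int a - int b\<bar>)) = (\<Sum>k\<in>(\<lambda>b. b - a) ` {a<..<N}. h k)"
      by (subst sum.reindex) (auto simp: inj_on_def intro!: sum.cong arg_cong[of _ _ h])
    also have "\<dots> \<le> (\<Sum>k=1..<N. h k)" using a assms by (intro sum_mono2) auto
    finally show ?thesis by simp
  qed
  then have "(\<Sum>a<N. \<Sum>b\<in>{..<N} - {a}. h (nat \<bar>int a - int b\<bar>)) \<le> (\<Sum>a<N. 2 * (\<Sum>k=1..<N. h k))"
    by (intro sum_mono) auto
  then show ?thesis by simp
qed

text \<open>Taking \<open>M = 2 * N\<close> keeps the half angle \<open>pi * k / M\<close> below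
  \<open>pi / 2\<close>, where the sine is at least half of its argument.\<close>

lemma geometric_grid_le:
  assumes "0 < k" "k < int N" "M = 2 * N"
  shows "cmod (\<Sum>j\<in>{A..B}. cis (of_int (- k) * grid M j)) \<le> real M / of_int k"
proof -
  define t where "t = - (2 * pi / real M * of_int k)"
  have M0: "real M > 0" using assms by linarith
  have "\<bar>t / 2\<bar> = pi * of_int k / real M" using assms M0 by (simp add: t_def abs_mult)
  also have "\<dots> \<le> pi / 2" using assms M0 by (simp add: field_simps)
  finally have "\<bar>sin (t / 2)\<bar> \<ge> \<bar>t / 2\<bar> / 2" by (rule abs_sin_ge_half)
  then have s: "2 * \<bar>sin (t / 2)\<bar> \<ge> pi * of_int k / real M" using \<open>\<bar>t / 2\<bar> = pi * of_int k / real M\<close> by linarith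
  have e: "(\<Sum>j\<in>{A..B}. cis (of_int (- k) * grid M j)) = (\<Sum>j\<in>{A..B}. cis (of_int j * t))"
    by (intro sum.cong refl arg_cong[of _ _ cis]) (simp add: grid_def t_def)
  have "pi * of_int k / real M * cmod (\<Sum>j\<in>{A..B}. cis (of_int j * t)) \<le> 2 * \<bar>sin (t / 2)\<bar> * cmod (\<Sum>j\<in>{A..B}. cis (of_int j * t))"
    using s by (intro mult_right_mono) auto
  also have "\<dots> \<le> 2" using geometric_cis[of t A B] by (simp only: norm_one_minus_cis)
  finally have "cmod (\<Sum>j\<in>{A..B}. cis (of_int j * t)) \<le> 2 * real M / (pi * of_int k)"
    using M0 assms pi_gt_zero by (simp add: field_simps)
  also have "\<dots> \<le> real M / of_int k" using M0 assms pi_ge_two by (simp add: field_simps)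
  finally show ?thesis using e by simp
qed

text \<open>Expanding the kernel separates the sum over the points from the sum over the grid. The
  diagonal gives the main term; off the diagonal the grid sum is geometric and at most
  \<open>M / k\<close>, and each \<open>k\<close> occurs at most twice for every
  \<open>a\<close>.\<close>

lemma fejer_sum_le:
  assumes "N > 0" "M = 2 * N" "A \<le> B + 1"
  shows "(\<Sum>z\<in>lattice_pts n. \<Sum>j\<in>{A..B}. fejer N (arg0 z - grid M j))
    \<le> of_int (B - A + 1) * real (card (lattice_pts n)) + 2 * real M * (\<Sum>k=1..<N. cmod (arg_sum n (int k)) / real k)"
proof -
  define X where "X = (\<Sum>z\<in>lattice_pts n. \<Sum>j\<in>{A..B}. fejer N (arg0 z - grid M j))"
  define V where "V m = (\<Sum>j\<in>{A..B}. cis (of_int (- m) * grid M j))" for m :: int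
  have X0: "X \<ge> 0" unfolding X_def by (intro sum_nonneg fejer_nonneg)
  have "complex_of_real X = (\<Sum>z\<in>lattice_pts n. \<Sum>j\<in>{A..B}. \<Sum>a<N. \<Sum>b<N. cis ((real a - real b) * (arg0 z - grid M j))) / of_nat N"
    by (simp add: X_def fejer_expand sum_divide_distrib)
  also have "(\<Sum>z\<in>lattice_pts n. \<Sum>j\<in>{A..B}. \<Sum>a<N. \<Sum>b<N. cis ((real a - real b) * (arg0 z - grid M j)))
     = (\<Sum>z\<in>lattice_pts n. \<Sum>a<N. \<Sum>b<N. \<Sum>j\<in>{A..B}. cis ((real a - real b) * (arg0 z - grid M j)))"
    by (intro sum.cong refl) (subst sum.swap, intro sum.cong refl, subst sum.swap, rule refl)
  also have "\<dots> = (\<Sum>a<N. \<Sum>b<N. \<Sum>z\<in>lattice_pts n. \<Sum>j\<in>{A..B}. cis ((real a - real b) * (arg0 z - grid M j)))"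
    by (subst sum.swap, intro sum.cong refl, subst sum.swap, rule refl)
  also have "\<dots> = (\<Sum>a<N. \<Sum>b<N. arg_sum n (int a - int b) * V (int a - int b))"
  proof (intro sum.cong refl)
    fix a b
    have "cis ((real a - real b) * (arg0 z - grid M j)) = cis (of_int (int a - int b) * arg0 z) * cis (of_int (- (int a - int b)) * grid M j)" for z j
      by (simp add: cis_mult algebra_simps)
    then show "(\<Sum>z\<in>lattice_pts n. \<Sum>j\<in>{A..B}. cis ((real a - real b) * (arg0 z - grid M j))) = arg_sum n (int a - int b) * V (int a - int b)"
      by (simp only: arg_sum_def V_def sum_product)
  qed
  finally have "complex_of_real X * of_nat N = (\<Sum>a<N. \<Sum>b<N. arg_sum n (int a - int b) * V (int a - int b))" using assms(1) by simp
  then have "cmod (complex_of_real X * of_nat N) = cmod (\<Sum>a<N. \<Sum>b<N. arg_sum n (int a - int b) * V (int a - int b))" by simp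
  then have "X * real N = cmod (\<Sum>a<N. \<Sum>b<N. arg_sum n (int a - int b) * V (int a - int b))" using X0 by (simp add: norm_mult)
  also have "\<dots> \<le> (\<Sum>a<N. \<Sum>b<N. cmod (arg_sum n (int a - int b)) * cmod (V (int a - int b)))"
    by (intro order_trans[OF norm_sum] sum_mono order_trans[OF norm_sum]) (simp add: norm_mult)
  also have "\<dots> = (\<Sum>a<N. cmod (arg_sum n 0) * cmod (V 0) + (\<Sum>b\<in>{..<N} - {a}. cmod (arg_sum n (int a - int b)) * cmod (V (int a - int b))))"
    by (intro sum.cong refl) (subst sum.remove, auto)
  also have "\<dots> \<le> (\<Sum>a<N. real (card (lattice_pts n)) * of_int (B - A + 1) + (\<Sum>b\<in>{..<N} - {a}. real M * (cmod (arg_sum n (int (nat \<bar>int a - int b\<bar>))) / real (nat \<bar>int a - int b\<bar>))))"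
  proof (intro sum_mono add_mono)
    fix a assume a: "a \<in> {..<N}"
    show "cmod (arg_sum n 0) * cmod (V 0) \<le> real (card (lattice_pts n)) * of_int (B - A + 1)"
    proof -
      have "V 0 = of_nat (nat (B - A + 1))" by (simp add: V_def add.commute diff_add_eq)
      then have "cmod (V 0) = of_int (B - A + 1)" using assms(3) by (simp only: norm_of_nat)
      then show ?thesis by (simp add: arg_sum_def)
    qed
    fix b assume b: "b \<in> {..<N} - {a}"
    define m where "m = int a - int b"
    have m: "m \<noteq> 0" "\<bar>m\<bar> < int N" using a b by (auto simp: m_def)
    have "cmod (V m) = cmod (V \<bar>m\<bar>)"
    proof (cases "m \<ge> 0")
      case False
      have "cnj (V m) = V (- m)" by (simp add: V_def cis_cnj)
      then have "cmod (V m) = cmod (V (- m))" by (metis complex_mod_cnj)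
      then show ?thesis using False by simp
    qed simp
    also have "\<dots> \<le> real M / of_int \<bar>m\<bar>" unfolding V_def using m assms by (intro geometric_grid_le) auto
    finally have "cmod (arg_sum n m) * cmod (V m) \<le> cmod (arg_sum n \<bar>m\<bar>) * (real M / of_int \<bar>m\<bar>)"
      unfolding norm_arg_sum_abs[of n m] by (intro mult_left_mono) auto
    then show "cmod (arg_sum n (int a - int b)) * cmod (V (int a - int b)) \<le> real M * (cmod (arg_sum n (int (nat \<bar>int a - int b\<bar>))) / real (nat \<bar>int a - int b\<bar>))"
      by (simp add: m_def mult_ac)
  qed
  also have "\<dots> = real N * (real (card (lattice_pts n)) * of_int (B - A + 1)) + real M * (\<Sum>a<N. \<Sum>b\<in>{..<N} - {a}. cmod (arg_sum n (int (nat \<bar>int a - int b\<bar>))) / real (nat \<bar>int a - int b\<bar>))"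
    by (simp add: sum.distrib sum_distrib_left)
  also have "\<dots> \<le> real N * (real (card (lattice_pts n)) * of_int (B - A + 1)) + real M * (real N * (2 * (\<Sum>k=1..<N. cmod (arg_sum n (int k)) / real k)))"
    by (intro add_left_mono mult_left_mono sum_off_diagonal_le[where h = "\<lambda>k. cmod (arg_sum n (int k)) / real k"]) auto
  finally have "X * real N \<le> (of_int (B - A + 1) * real (card (lattice_pts n)) + 2 * real M * (\<Sum>k=1..<N. cmod (arg_sum n (int k)) / real k)) * real N"
    by (simp only: distrib_left distrib_right mult_ac)
  then show ?thesis unfolding X_def using assms(1) by simp
qed

text \<open>Every point of the arc is counted with weight nearly \<open>M\<close> by the grid points
  of the arc enlarged by \<open>d\<close> on both sides. Their number is proportional to its length
  up to 1, which causes the term \<open>1 / N\<close>.\<close>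

lemma arc_count_le:
  assumes "N > 0" "0 < d" "a \<le> b"
  shows "real (card {z \<in> lattice_pts n. arg0 z \<in> {a..<b}})
    \<le> real (card (lattice_pts n)) * ((b - a + 2 * d) / (2 * pi) + 1 / real N + 16 / (real N * d\<^sup>2))
      + 2 * (\<Sum>k=1..<N. cmod (arg_sum n (int k)) / real k)"
proof -
  define M where "M = 2 * N"
  define A where "A = \<lceil>real M * (a - d) / (2 * pi)\<rceil>"
  define B where "B = \<lfloor>real M * (b + d) / (2 * pi)\<rfloor>"
  define T where "T = 16 / (real N * d\<^sup>2)"
  define r where "r = real (card (lattice_pts n))"
  define W where "W = (\<Sum>k=1..<N. cmod (arg_sum n (int k)) / real k)"
  define C where "C = {z \<in> lattice_pts n. arg0 z \<in> {a..<b}}"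
  have M0: "real M > 0" using assms by (simp add: M_def)
  have "{j. a - d \<le> grid M j \<and> grid M j \<le> b + d} = {A..B}"
    using M0 pi_gt_zero by (auto simp: A_def B_def grid_def ceiling_le_iff le_floor_iff field_simps)
  then have cover: "real M - real M * T \<le> (\<Sum>j\<in>{A..B}. fejer N (x - grid M j))" if "a \<le> x" "x \<le> b" for x
    using fejer_partial_cover[of N M d a x b] that assms by (simp add: M_def T_def)
  have lo: "of_int A \<ge> real M * (a - d) / (2 * pi)" "of_int A \<le> real M * (a - d) / (2 * pi) + 1"
    unfolding A_def by linarith+
  have hi: "of_int B \<le> real M * (b + d) / (2 * pi)" "of_int B \<ge> real M * (b + d) / (2 * pi) - 1"
    unfolding B_def by linarith+
  have diff: "real M * (b + d) / (2 * pi) - real M * (a - d) / (2 * pi) = real M * ((b - a + 2 * d) / (2 * pi))"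
    by (simp add: diff_divide_distrib[symmetric] right_diff_distrib[symmetric] algebra_simps)
  have "real M * ((b - a + 2 * d) / (2 * pi)) > 0" using M0 assms pi_gt_zero by (intro mult_pos_pos divide_pos_pos) auto
  then have "real_of_int (A - B) < 2" using lo hi diff by simp
  then have AB: "A \<le> B + 1" by linarith
  have len: "of_int (B - A + 1) \<le> real M * ((b - a + 2 * d) / (2 * pi)) + 1" using lo hi diff by simp
  have "(\<Sum>z\<in>C. real M - real M * T) \<le> (\<Sum>z\<in>C. \<Sum>j\<in>{A..B}. fejer N (arg0 z - grid M j))"
    by (intro sum_mono cover) (auto simp: C_def)
  also have "\<dots> \<le> (\<Sum>z\<in>lattice_pts n. \<Sum>j\<in>{A..B}. fejer N (arg0 z - grid M j))"
    by (intro sum_mono2 sum_nonneg fejer_nonneg) (auto simp: C_def)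
  also have "\<dots> \<le> of_int (B - A + 1) * r + 2 * real M * W"
    unfolding r_def W_def by (rule fejer_sum_le) (use assms AB in \<open>auto simp: M_def\<close>)
  also have "\<dots> \<le> (real M * ((b - a + 2 * d) / (2 * pi)) + 1) * r + 2 * real M * W"
    using len by (intro add_right_mono mult_right_mono) (auto simp: r_def)
  finally have 1: "real (card C) * (real M - real M * T) \<le> (real M * ((b - a + 2 * d) / (2 * pi)) + 1) * r + 2 * real M * W" by simp
  \<comment> \<open>In the error term the count is replaced by the trivial bound \<open>r\<close>,
    which avoids dividing by \<open>1 - T\<close>.\<close>
  have "real (card C) \<le> r" unfolding r_def C_def by (intro of_nat_mono card_mono) auto
  then have "real (card C) * (real M * T) \<le> r * (real M * T)" using M0 by (intro mult_right_mono) (auto simp: T_def)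
  then have "real (card C) * real M \<le> (real M * ((b - a + 2 * d) / (2 * pi)) + 1) * r + 2 * real M * W + r * (real M * T)"
    using 1 by (simp add: right_diff_distrib)
  also have "\<dots> = (r * ((b - a + 2 * d) / (2 * pi) + 1 / real M + T) + 2 * W) * real M"
    using M0 by (simp add: distrib_left distrib_right mult_ac)
  finally have 2: "real (card C) \<le> r * ((b - a + 2 * d) / (2 * pi) + 1 / real M + T) + 2 * W" using M0 by simp
  have "1 / real M \<le> 1 / real N" using assms by (intro divide_left_mono) (auto simp: M_def)
  then have "r * ((b - a + 2 * d) / (2 * pi) + 1 / real M + T) \<le> r * ((b - a + 2 * d) / (2 * pi) + 1 / real N + T)"
    by (intro mult_left_mono add_mono) (auto simp: r_def)
  then have "real (card C) \<le> r * ((b - a + 2 * d) / (2 * pi) + 1 / real N + T) + 2 * W" using 2 by linarith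
  then show ?thesis by (simp only: C_def r_def T_def W_def)
qed

section \<open>From the arguments of lattice points to the discrepancy\<close>

lemma arg0_bounds: "0 \<le> arg0 z" "arg0 z < 2 * pi"
  using Arg_bounded[of z] pi_gt_zero by (auto simp: arg0_def)

lemma cis_arg0: "z \<noteq> 0 \<Longrightarrow> cis (arg0 z) = sgn z"
  using cis_Arg[of z] by (simp add: arg0_def flip: cis_mult)

lemma arg_sum_eq_sgn:
  assumes "n > 0" shows "arg_sum n (int k) = (\<Sum>z\<in>lattice_pts n. sgn z ^ k)"
  unfolding arg_sum_def
proof (intro sum.cong refl)
  fix z assume "z \<in> lattice_pts n"
  then have "z \<noteq> 0" using lattice_pts_nonzero assms by blast
  then show "cis (of_int (int k) * arg0 z) = sgn z ^ k" by (simp add: Complex.DeMoivre flip: cis_arg0)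
qed

lemma arg_sum_multiple_6: "n > 0 \<Longrightarrow> arg_sum n (int (6 * l)) = hecke_sum l n"
  by (simp only: arg_sum_eq_sgn hecke_sum_def ang_def)

lemma omega_units: "omega \<in> units" by (simp add: units_eq)

text \<open>Multiplication by \<open>omega\<close> permutes the points of norm \<open>n\<close> and
  multiplies the sum by \<open>omega ^ k\<close>, which is not 1.\<close>

lemma arg_sum_not_multiple_6:
  assumes "n > 0" "\<not> 6 dvd k" shows "arg_sum n (int k) = 0"
proof -
  have o: "omega * cnj omega = 1" by (rule units_mult_cnj[OF omega_units])
  have o': "cnj omega * omega = 1" using o by (simp add: mult.commute)
  have "(\<Sum>z\<in>lattice_pts n. sgn (omega * z) ^ k) = (\<Sum>z\<in>lattice_pts n. sgn z ^ k)"
  proof (rule sum.reindex_bij_witness[of _ "\<lambda>z. cnj omega * z" "\<lambda>z. omega * z"])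
    fix z assume z: "z \<in> lattice_pts n"
    show "cnj omega * (omega * z) = z" using o' by (simp add: mult.assoc[symmetric])
    show "omega * (cnj omega * z) = z" using o by (simp add: mult.assoc[symmetric])
    show "omega * z \<in> lattice_pts n" "cnj omega * z \<in> lattice_pts n"
      using z units_enorm[OF omega_units] units_enorm[OF units_cnj[OF omega_units]]
      by (auto simp: mem_lattice_pts enorm_mult Eis_mult Eis_cnj)
  qed simp
  moreover have "sgn omega = omega" using units_cmod[OF omega_units] by (simp add: sgn_div_norm)
  ultimately have "omega ^ k * (\<Sum>z\<in>lattice_pts n. sgn z ^ k) = (\<Sum>z\<in>lattice_pts n. sgn z ^ k)"
    by (simp add: sgn_mult power_mult_distrib sum_distrib_left)
  moreover have "omega ^ k \<noteq> 1"
  proof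
    assume "omega ^ k = 1"
    then have "cis (real k * (pi / 3)) = 1" by (simp add: omega_def Complex.DeMoivre)
    then have "cos (real k * (pi / 3)) = 1" by (metis Re_complex_of_real cis.simps(1) of_real_1)
    then obtain m :: int where "real k * (pi / 3) = of_int m * 2 * pi" by (auto simp: cos_one_2pi_int)
    then have "pi * real k = pi * (of_int (6 * m))" by simp
    then have "real k = of_int (6 * m)" using pi_gt_zero by (subst (asm) mult_left_cancel) auto
    then have "int k = 6 * m" by linarith
    then have "6 dvd k" by presburger
    then show False using assms(2) by simp
  qed
  ultimately show ?thesis using arg_sum_eq_sgn[OF assms(1)] by simp
qed

lemma arg_sum_sum_eq:
  assumes "n > 0"
  shows "(\<Sum>k=1..<N. cmod (arg_sum n (int k)) / real k) \<le> (\<Sum>l=1..N. \<bar>hecke l n\<bar> / real l)"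
proof -
  have "(\<Sum>k=1..<N. cmod (arg_sum n (int k)) / real k) = (\<Sum>k\<in>{k\<in>{1..<N}. 6 dvd k}. cmod (arg_sum n (int k)) / real k)"
    by (rule sum.mono_neutral_right) (auto simp: arg_sum_not_multiple_6[OF assms])
  also have "\<dots> \<le> (\<Sum>k\<in>(\<lambda>l. 6 * l) ` {1..N}. cmod (arg_sum n (int k)) / real k)"
    by (rule sum_mono2) auto
  also have "\<dots> = (\<Sum>l=1..N. cmod (arg_sum n (int (6 * l))) / real (6 * l))"
    by (subst sum.reindex) (auto simp: inj_on_def)
  also have "\<dots> = (\<Sum>l=1..N. \<bar>hecke l n\<bar> / real l)"
  proof (intro sum.cong refl)
    fix l
    have "cmod (arg_sum n (int (6 * l))) = 6 * \<bar>hecke l n\<bar>"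
      unfolding arg_sum_multiple_6[OF assms] hecke_sum_eq norm_of_real by (simp add: abs_mult)
    then show "cmod (arg_sum n (int (6 * l))) / real (6 * l) = \<bar>hecke l n\<bar> / real l" by simp
  qed
  finally show ?thesis .
qed

text \<open>Upper bounds for arcs suffice: the lower bound for \<open>[a, b)\<close> follows from
  those for the complementary arcs \<open>[0, a)\<close> and \<open>[b, 2 * pi)\<close>, at the
  price of doubling the error.\<close>

lemma discrepancy_le:
  assumes "n > 0" "N > 0" "0 < d" "rQ n \<noteq> 0"
  shows "discrepancy n \<le> 2 * (d / pi + 1 / real N + 16 / (real N * d\<^sup>2)) + (\<Sum>l=1..N. \<bar>hecke l n\<bar> / (hecke 0 n * real l))"
proof -
  define r where "r = real (rQ n)"
  define E where "E = d / pi + 1 / real N + 16 / (real N * d\<^sup>2)"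
  define W where "W = (\<Sum>l=1..N. \<bar>hecke l n\<bar> / real l)"
  define c where "c a b = real (card {z \<in> lattice_pts n. arg0 z \<in> {a..<b}})" for a b
  have r0: "r > 0" using assms(4) by (simp add: r_def)
  have E0: "E \<ge> 0" unfolding E_def using assms by (intro add_nonneg_nonneg) auto
  have W0: "W \<ge> 0" unfolding W_def by (intro sum_nonneg) auto
  have rc: "r = real (card (lattice_pts n))" by (simp add: r_def rQ_eq_card)
  have up: "c a b \<le> r * ((b - a) / (2 * pi) + E) + 2 * W" if "a \<le> b" for a b
  proof -
    have "c a b \<le> r * ((b - a + 2 * d) / (2 * pi) + 1 / real N + 16 / (real N * d\<^sup>2)) + 2 * (\<Sum>k=1..<N. cmod (arg_sum n (int k)) / real k)"
      unfolding c_def rc by (rule arc_count_le[OF assms(2,3) that])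
    also have "(b - a + 2 * d) / (2 * pi) + 1 / real N + 16 / (real N * d\<^sup>2) = (b - a) / (2 * pi) + E"
      by (simp add: E_def add_divide_distrib)
    also have "r * ((b - a) / (2 * pi) + E) + 2 * (\<Sum>k=1..<N. cmod (arg_sum n (int k)) / real k) \<le> r * ((b - a) / (2 * pi) + E) + 2 * W"
      using arg_sum_sum_eq[OF assms(1), of N] by (simp add: W_def)
    finally show ?thesis .
  qed
  have s0: "hecke 0 n = r / 6" using assms(1) by (simp add: hecke_0 r_def)
  have We: "(\<Sum>l=1..N. \<bar>hecke l n\<bar> / (hecke 0 n * real l)) = 6 * W / r"
    unfolding W_def s0 using r0 by (simp add: sum_distrib_left sum_divide_distrib field_simps)
  have "discrepancy n \<le> 2 * E + 4 * W / r"
    unfolding discrepancy_def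
  proof (rule cSUP_least)
    show "{(\<alpha>, \<beta>). 0 \<le> \<alpha> \<and> \<alpha> < \<beta> \<and> \<beta> \<le> 2 * pi} \<noteq> {}" 
    proof -
      have "(0, 1) \<in> {(\<alpha>, \<beta>). 0 \<le> \<alpha> \<and> \<alpha> < \<beta> \<and> \<beta> \<le> 2 * pi}" using pi_ge_two by simp
      then show ?thesis by blast
    qed
    fix p :: "real \<times> real" assume p: "p \<in> {(\<alpha>, \<beta>). 0 \<le> \<alpha> \<and> \<alpha> < \<beta> \<and> \<beta> \<le> 2 * pi}"
    obtain a b where pe: "p = (a, b)" by (cases p)
    have ab: "0 \<le> a" "a < b" "b \<le> 2 * pi" using p by (auto simp: pe)
    have tot: "r = c 0 a + c a b + c b (2 * pi)"
    proof -
      define X where "X = {z \<in> lattice_pts n. arg0 z \<in> {0..<a}}"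
      define Y where "Y = {z \<in> lattice_pts n. arg0 z \<in> {a..<b}}"
      define Z where "Z = {z \<in> lattice_pts n. arg0 z \<in> {b..<2 * pi}}"
      have fin: "finite X" "finite Y" "finite Z" by (simp_all add: X_def Y_def Z_def)
      have "z \<in> X \<union> Y \<union> Z" if "z \<in> lattice_pts n" for z
        using that arg0_bounds[of z] by (auto simp: X_def Y_def Z_def)
      then have "lattice_pts n = X \<union> Y \<union> Z" by (auto simp: X_def Y_def Z_def)
      then have "card (lattice_pts n) = card (X \<union> Y \<union> Z)" by simp
      also have "\<dots> = card (X \<union> Y) + card Z" using ab by (intro card_Un_disjoint) (auto simp: fin, auto simp: X_def Y_def Z_def)
      also have "card (X \<union> Y) = card X + card Y" using ab by (intro card_Un_disjoint) (auto simp: fin, auto simp: X_def Y_def)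
      finally have "card (lattice_pts n) = card X + card Y + card Z" .
      then show ?thesis by (simp add: rc c_def X_def Y_def Z_def)
    qed
    have u1: "c a b \<le> r * ((b - a) / (2 * pi) + E) + 2 * W" using ab by (intro up) auto
    have u2: "c 0 a \<le> r * (a / (2 * pi) + E) + 2 * W" using up[of 0 a] ab by simp
    have u3: "c b (2 * pi) \<le> r * ((2 * pi - b) / (2 * pi) + E) + 2 * W" using ab by (intro up) auto
    have "c a b \<ge> r * ((b - a) / (2 * pi)) - 2 * (r * E) - 4 * W"
    proof -
      have "a / (2 * pi) + (2 * pi - b) / (2 * pi) = 1 - (b - a) / (2 * pi)" by (simp add: diff_divide_distrib)
      then have "r * (a / (2 * pi)) + r * ((2 * pi - b) / (2 * pi)) = r - r * ((b - a) / (2 * pi))"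
        by (metis distrib_left mult.right_neutral right_diff_distrib)
      then show ?thesis using tot u2 u3 by (simp add: distrib_left)
    qed
    moreover have "c a b \<le> r * ((b - a) / (2 * pi)) + 2 * (r * E) + 4 * W"
    proof -
      have "r * E \<ge> 0" using r0 E0 by simp
      then show ?thesis using u1 W0 unfolding distrib_left by linarith
    qed
    ultimately have "\<bar>c a b - r * ((b - a) / (2 * pi))\<bar> \<le> 2 * (r * E) + 4 * W" by (simp add: abs_le_iff)
    then have "\<bar>c a b - r * ((b - a) / (2 * pi))\<bar> / r \<le> (2 * (r * E) + 4 * W) / r" using r0 by (intro divide_right_mono) auto
    also have "(2 * (r * E) + 4 * W) / r = 2 * E + 4 * W / r" using r0 by (simp add: add_divide_distrib)
    also have "\<bar>c a b - r * ((b - a) / (2 * pi))\<bar> / r = \<bar>c a b / r - (b - a) / (2 * pi)\<bar>"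
    proof -
      have "c a b / r - (b - a) / (2 * pi) = (c a b - r * ((b - a) / (2 * pi))) / r" using r0 by (simp add: diff_divide_distrib)
      then show ?thesis using r0 by simp
    qed
    finally show "\<bar>real (card {z \<in> lattice_pts n. arg0 z \<in> {fst p..<snd p}}) / real (rQ n) - (snd p - fst p) / (2 * pi)\<bar> \<le> 2 * E + 4 * W / r"
      by (simp add: pe c_def r_def)
  qed
  also have "\<dots> \<le> 2 * E + 6 * W / r" using W0 r0 by (intro add_left_mono divide_right_mono) auto
  finally show ?thesis unfolding We E_def .
qed

section \<open>Counting exceptional numbers\<close>

text \<open>The six associates of a point are distinct. As \<open>hecke 0\<close> thus takes no
  value strictly between 0 and 1, it dominates all its powers with exponent at most 1.\<close>

lemma hecke_0_ge_1:
  assumes "n > 0" "hecke 0 n \<noteq> 0" shows "hecke 0 n \<ge> 1"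
proof -
  have "lattice_pts n \<noteq> {}" using assms hecke_0_card[of n] by auto
  then obtain z where z: "z \<in> lattice_pts n" by blast
  have z0: "z \<noteq> 0" using lattice_pts_nonzero[OF assms(1) z] .
  have "(\<lambda>u. u * z) ` units \<subseteq> lattice_pts n"
    using z by (auto simp: mem_lattice_pts enorm_mult units_Eis units_enorm Eis_mult)
  then have "card ((\<lambda>u. u * z) ` units) \<le> card (lattice_pts n)" by (intro card_mono) auto
  moreover have "card ((\<lambda>u. u * z) ` units) = 6"
    by (subst card_image) (use z0 in \<open>auto simp: inj_on_def card_units\<close>)
  ultimately show ?thesis using assms(1) by (simp add: hecke_0_card)
qed

lemma rQ_nonzero_iff: "n > 0 \<Longrightarrow> rQ n \<noteq> 0 \<longleftrightarrow> hecke 0 n \<noteq> 0"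
  by (simp add: hecke_0)

lemma hecke_0_powr_le:
  assumes "n > 0" "t \<le> 1" shows "hecke 0 n powr t \<le> hecke 0 n"
proof (cases "hecke 0 n = 0")
  case False
  then have "hecke 0 n powr t \<le> hecke 0 n powr 1" using hecke_0_ge_1[OF assms(1)] assms(2) by (intro powr_mono) auto
  then show ?thesis using hecke_0_nonneg[of n] by simp
qed simp

lemma mult_fn_hecke_0_powr: "mult_fn (\<lambda>n. hecke 0 n powr t)"
  unfolding mult_fn_def
proof (intro conjI allI impI)
  show "hecke 0 1 powr t = 1" by (simp only: hecke_1_right) simp
  fix m n :: nat assume "coprime m n" "m > 0" "n > 0"
  then show "hecke 0 (m * n) powr t = hecke 0 m powr t * hecke 0 n powr t" by (simp only: hecke_mult powr_mult)
qed

definition twisted_weight :: "real \<Rightarrow> nat \<Rightarrow> nat \<Rightarrow> real" where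
  "twisted_weight t k n = hecke 0 n powr (t - 1) * \<bar>hecke k n\<bar>"

lemma mult_fn_twisted_weight: "mult_fn (twisted_weight t k)"
  unfolding mult_fn_def
proof (intro conjI allI impI)
  show "twisted_weight t k 1 = 1" unfolding twisted_weight_def by (simp only: hecke_1_right) simp
  fix m n :: nat assume "coprime m n" "m > 0" "n > 0"
  then show "twisted_weight t k (m * n) = twisted_weight t k m * twisted_weight t k n" by (simp add: twisted_weight_def hecke_mult powr_mult abs_mult)
qed

lemma twisted_weight_nonneg: "twisted_weight t k n \<ge> 0" by (simp add: twisted_weight_def)

lemma twisted_weight_le:
  assumes "n > 0" "t \<le> 1" shows "twisted_weight t k n \<le> hecke 0 n"
proof (cases "hecke 0 n = 0")
  case False
  have "twisted_weight t k n \<le> hecke 0 n powr (t - 1) * hecke 0 n" unfolding twisted_weight_def using abs_hecke_le[OF assms(1)] by (intro mult_left_mono) auto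
  also have "\<dots> = hecke 0 n powr (t - 1) * hecke 0 n powr 1" using hecke_0_nonneg[of n] by simp
  also have "\<dots> = hecke 0 n powr t" by (simp only: powr_add[symmetric]) simp
  also have "\<dots> \<le> hecke 0 n" by (rule hecke_0_powr_le[OF assms])
  finally show ?thesis .
qed (simp add: twisted_weight_def)

lemma dterm_dominated:
  assumes "1 < x" "x \<le> 2" "\<And>n. n > 0 \<Longrightarrow> 0 \<le> f n" "\<And>n. n > 0 \<Longrightarrow> f n \<le> hecke 0 n"
  shows "dterm f x summable_on UNIV"
proof (rule abs_summable_summable, rule summable_on_comparison_test[OF dterm_hecke_0_summable[OF assms(1,2)]])
  fix n :: nat
  show "norm (dterm f x n) \<le> dterm (hecke 0) x n"
  proof (cases "n = 0")
    case False
    then show ?thesis using assms(3,4)[of n] by (simp add: dterm_def abs_mult mult_right_mono)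
  qed simp
qed simp

text \<open>Being dominated by \<open>hecke 0\<close>, the function vanishes at inert primes, and
  the prime 3 contributes at most 1.\<close>

lemma primesum_split_primes:
  assumes "1 < x" "x \<le> 2" "\<And>n. n > 0 \<Longrightarrow> 0 \<le> f n" "\<And>n. n > 0 \<Longrightarrow> f n \<le> hecke 0 n"
  shows "(\<Sum>\<^sub>\<infinity>p\<in>split_primes. dterm f x p) \<le> primesum (dterm f x)" "primesum (dterm f x) \<le> (\<Sum>\<^sub>\<infinity>p\<in>split_primes. dterm f x p) + 1"
proof -
  have sm: "dterm f x summable_on A" for A
    by (rule summable_on_subset_banach[OF dterm_dominated[OF assms]]) simp_all
  have "primesum (dterm f x) = (\<Sum>\<^sub>\<infinity>p\<in>split_primes \<union> {3}. dterm f x p)"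
    unfolding primesum_def
  proof (rule infsum_cong_neutral)
    fix p assume "p \<in> {p. prime p} - (split_primes \<union> {3})"
    then have p: "prime p" "p mod 3 \<noteq> 1" "p \<noteq> 3" by (auto simp: split_primes_def)
    have p0: "p > 0" using prime_gt_0_nat[OF p(1)] .
    from p(1) have "p mod 3 = 2" by (rule prime_mod3_cases) (use p in auto)
    then have "hecke 0 p = 0" using hecke_inert_prime[OF p(1)] by simp
    then have "f p = 0" using assms(3,4)[OF p0] by simp
    then show "dterm f x p = 0" by (simp add: dterm_def)
  next
    fix p assume "p \<in> (split_primes \<union> {3}) - {p. prime p}"
    then show "dterm f x p = 0" by (auto simp: split_primes_def)
  qed simp
  also have "\<dots> = (\<Sum>\<^sub>\<infinity>p\<in>split_primes. dterm f x p) + (\<Sum>\<^sub>\<infinity>p\<in>{3}. dterm f x p)"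
    by (rule infsum_Un_disjoint[OF sm sm]) (simp add: split_primes_def)
  finally have e: "primesum (dterm f x) = (\<Sum>\<^sub>\<infinity>p\<in>split_primes. dterm f x p) + dterm f x 3" by simp
  have "(3::real) powr - x \<le> 3 powr 0" using assms by (intro powr_mono) auto
  then have "f 3 * 3 powr - x \<le> 1 * 1" using assms(3,4)[of 3] hecke_0_ramified[of 1] by (intro mult_mono) auto
  moreover have "f 3 * 3 powr - x \<ge> 0" using assms(3)[of 3] by simp
  ultimately show "(\<Sum>\<^sub>\<infinity>p\<in>split_primes. dterm f x p) \<le> primesum (dterm f x)" "primesum (dterm f x) \<le> (\<Sum>\<^sub>\<infinity>p\<in>split_primes. dterm f x p) + 1"
    unfolding e dterm_def[of f x 3] by simp_all
qed

definition split_series :: "real \<Rightarrow> real" where "split_series x = (\<Sum>\<^sub>\<infinity>p\<in>split_primes. real p powr - x)"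

lemma split_series_bounds:
  assumes "1 < x" "x \<le> 2"
  shows "split_series x \<le> ln (1 / (x - 1)) / 2 + 302" "split_series x \<ge> ln (1 / (x - 1)) / 2 - 121"
proof -
  have "(\<Sum>\<^sub>\<infinity>p\<in>split_primes. dterm (hecke 0) x p) = (\<Sum>\<^sub>\<infinity>p\<in>split_primes. 2 * real p powr - x)"
    by (rule infsum_cong) (simp add: dterm_def hecke_split_angle)
  also have "\<dots> = 2 * split_series x" unfolding split_series_def by (rule infsum_cmult_right')
  finally have "2 * split_series x \<le> hecke_prime_series 0 x" "hecke_prime_series 0 x \<le> 2 * split_series x + 1"
    using primesum_split_primes[OF assms, of "hecke 0"] hecke_0_nonneg unfolding hecke_prime_series_def by simp_all
  then show "split_series x \<le> ln (1 / (x - 1)) / 2 + 302" "split_series x \<ge> ln (1 / (x - 1)) / 2 - 121"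
    using hecke_prime_series_0_bounds[OF assms] by argo+
qed

lemma dterm_split_primes_const:
  assumes "\<And>p. p \<in> split_primes \<Longrightarrow> f p = c" shows "(\<Sum>\<^sub>\<infinity>p\<in>split_primes. dterm f x p) = c * split_series x"
proof -
  have "(\<Sum>\<^sub>\<infinity>p\<in>split_primes. dterm f x p) = (\<Sum>\<^sub>\<infinity>p\<in>split_primes. c * real p powr - x)"
    by (rule infsum_cong) (simp add: dterm_def assms)
  then show ?thesis unfolding split_series_def by (simp add: infsum_cmult_right')
qed

text \<open>The constant does not depend on \<open>f\<close>. This is what makes the estimate
  uniform in the harmonic \<open>k\<close>.\<close>

lemma mean_le_exp:
  "\<exists>C>0. \<forall>f N. mult_fn f \<longrightarrow> (\<forall>n. f n \<ge> 0) \<longrightarrow> (\<forall>n>0. f n \<le> hecke 0 n) \<longrightarrow> N \<ge> 3 \<longrightarrow>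
     (\<Sum>n=1..N. f n) \<le> C * (real N / ln (real N)) * exp (\<Sum>\<^sub>\<infinity>p\<in>split_primes. dterm f (1 + 1 / ln (real N)) p)"
proof -
  obtain C where C: "C > 0" "\<And>f N. mult_fn f \<Longrightarrow> (\<forall>n. f n \<ge> 0) \<Longrightarrow> (\<forall>p a. prime p \<longrightarrow> f (p ^ a) \<le> real (a + 1)) \<Longrightarrow>
     N \<ge> 2 \<Longrightarrow> dterm f (1 + 1 / ln (real N)) summable_on UNIV \<Longrightarrow>
     (\<Sum>n=1..N. f n) \<le> C * (real N / ln (real N)) * exp (primesum (dterm f (1 + 1 / ln (real N))))"
    using mult_fn_mean_le_exp by blast
  have "(\<Sum>n=1..N. f n) \<le> (C * exp 1) * (real N / ln (real N)) * exp (\<Sum>\<^sub>\<infinity>p\<in>split_primes. dterm f (1 + 1 / ln (real N)) p)"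
    if f: "mult_fn f" "\<forall>n. f n \<ge> 0" "\<forall>n>0. f n \<le> hecke 0 n" "N \<ge> 3" for f N
  proof -
    have "exp 1 \<le> real N" using exp_le f(4) by linarith
    then have "ln (exp 1) \<le> ln (real N)" by (intro ln_mono) auto
    then have L: "ln (real N) \<ge> 1" by simp
    then have x: "1 < 1 + 1 / ln (real N)" "1 + 1 / ln (real N) \<le> 2" by auto
    have "f (p ^ a) \<le> real (a + 1)" if "prime p" for p a
    proof -
      have "f (p ^ a) \<le> hecke 0 (p ^ a)" using f(3) prime_gt_0_nat[OF that] by simp
      also have "\<dots> \<le> real (a + 1)" by (rule hecke_0_prime_power_le[OF that])
      finally show ?thesis .
    qed
    then have "(\<Sum>n=1..N. f n) \<le> C * (real N / ln (real N)) * exp (primesum (dterm f (1 + 1 / ln (real N))))"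
      using f by (intro C(2) dterm_dominated x) auto
    also have "\<dots> \<le> C * (real N / ln (real N)) * exp ((\<Sum>\<^sub>\<infinity>p\<in>split_primes. dterm f (1 + 1 / ln (real N)) p) + 1)"
    proof (rule mult_left_mono)
      show "exp (primesum (dterm f (1 + 1 / ln (real N)))) \<le> exp ((\<Sum>\<^sub>\<infinity>p\<in>split_primes. dterm f (1 + 1 / ln (real N)) p) + 1)"
        using primesum_split_primes(2)[OF x, of f] f(2,3) by simp
    qed (use C(1) L in auto)
    finally show ?thesis by (simp add: exp_add mult_ac)
  qed
  then show ?thesis using C(1) by (intro exI[of _ "C * exp 1"]) auto
qed

lemma hecke_0_split_primes: "p \<in> split_primes \<Longrightarrow> hecke 0 p = 2" by (simp add: hecke_split_angle)

text \<open>At split primes, which make up half of all primes in the logarithmic mean, the function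
  equals \<open>2 powr t\<close>. The cases \<open>t = 1\<close> and \<open>t = -1\<close> later
  bound the numbers with many and with few representations.\<close>

lemma sum_hecke_0_powr_le:
  assumes "t \<le> 1"
  shows "\<exists>C>0. \<forall>N\<ge>3. (\<Sum>n=1..N. hecke 0 n powr t) \<le> C * real N * ln (real N) powr (2 powr t / 2 - 1)"
proof -
  obtain C where C: "C > 0" "\<And>f N. mult_fn f \<Longrightarrow> (\<forall>n. f n \<ge> 0) \<Longrightarrow> (\<forall>n>0. f n \<le> hecke 0 n) \<Longrightarrow> N \<ge> 3 \<Longrightarrow>
     (\<Sum>n=1..N. f n) \<le> C * (real N / ln (real N)) * exp (\<Sum>\<^sub>\<infinity>p\<in>split_primes. dterm f (1 + 1 / ln (real N)) p)"
    using mean_le_exp by blast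
  define D where "D = C * exp (2 powr t * 302)"
  have "(\<Sum>n=1..N. hecke 0 n powr t) \<le> D * real N * ln (real N) powr (2 powr t / 2 - 1)" if N: "N \<ge> 3" for N
  proof -
    define L where "L = ln (real N)"
    have "exp 1 \<le> real N" using exp_le N by linarith
    then have "ln (exp 1) \<le> ln (real N)" by (intro ln_mono) auto
    then have L: "L \<ge> 1" by (simp add: L_def)
    then have x: "1 < 1 + 1 / L" "1 + 1 / L \<le> 2" by auto
    have "(\<Sum>n=1..N. hecke 0 n powr t) \<le> C * (real N / L) * exp (\<Sum>\<^sub>\<infinity>p\<in>split_primes. dterm (\<lambda>n. hecke 0 n powr t) (1 + 1 / L) p)"
      unfolding L_def using assms N by (intro C(2) mult_fn_hecke_0_powr) (auto intro: hecke_0_powr_le)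
    also have "(\<Sum>\<^sub>\<infinity>p\<in>split_primes. dterm (\<lambda>n. hecke 0 n powr t) (1 + 1 / L) p) = 2 powr t * split_series (1 + 1 / L)"
      by (rule dterm_split_primes_const) (simp add: hecke_0_split_primes)
    finally have 1: "(\<Sum>n=1..N. hecke 0 n powr t) \<le> C * (real N / L) * exp (2 powr t * split_series (1 + 1 / L))" .
    have "exp (2 powr t * split_series (1 + 1 / L)) \<le> exp (2 powr t * (ln L / 2 + 302))"
      using split_series_bounds(1)[OF x] by simp
    also have "exp (2 powr t * (ln L / 2 + 302)) = exp (2 powr t * 302) * L powr (2 powr t / 2)"
      using L by (simp add: powr_def distrib_left exp_add mult_ac)
    finally have "C * (real N / L) * exp (2 powr t * split_series (1 + 1 / L)) \<le> C * (real N / L) * (exp (2 powr t * 302) * L powr (2 powr t / 2))"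
      using C(1) L by (intro mult_left_mono) auto
    with 1 have "(\<Sum>n=1..N. hecke 0 n powr t) \<le> C * (real N / L) * (exp (2 powr t * 302) * L powr (2 powr t / 2))" by (rule order_trans)
    also have "\<dots> = D * real N * (L powr (2 powr t / 2) / L)" by (simp add: D_def)
    also have "L powr (2 powr t / 2) / L = L powr (2 powr t / 2 - 1)" using L by (simp add: powr_diff)
    finally show ?thesis by (simp add: L_def)
  qed
  moreover have "D > 0" using C(1) by (simp add: D_def)
  ultimately show ?thesis by blast
qed

lemma filterlim_inverse_ln: "filterlim (\<lambda>N::nat. 1 / ln (real N)) (at_right 0) sequentially"
  by real_asymp

text \<open>The condition on \<open>t\<close> says that \<open>2 powr (t - 1) = pi / 4\<close>,
  which cancels the mean \<open>4 / pi\<close> of \<open>|hecke k p|\<close>. The prime sum is then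
  half of \<open>ln (ln N)\<close> up to \<open>e\<close>, as for the indicator function of the
  represented numbers.\<close>

lemma sum_twisted_weight_le:
  assumes "e > 0" "0 < t" "t \<le> 1" "2 powr t = pi / 2"
  shows "\<exists>C>0. \<forall>\<^sub>F N in sequentially. \<forall>k\<ge>1. real k \<le> ln (real N) powr 4 \<longrightarrow>
    (\<Sum>n=1..N. twisted_weight t k n) \<le> C * real N * ln (real N) powr (-1/2 + e)"
proof -
  obtain C where C: "C > 0" "\<And>f N. mult_fn f \<Longrightarrow> (\<forall>n. f n \<ge> 0) \<Longrightarrow> (\<forall>n>0. f n \<le> hecke 0 n) \<Longrightarrow> N \<ge> 3 \<Longrightarrow>
     (\<Sum>n=1..N. f n) \<le> C * (real N / ln (real N)) * exp (\<Sum>\<^sub>\<infinity>p\<in>split_primes. dterm f (1 + 1 / ln (real N)) p)"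
    using mean_le_exp by blast
  have "\<forall>\<^sub>F N in sequentially. \<forall>k\<ge>1. real k \<le> (1 / ln (real N)) powr - 4 \<longrightarrow>
     (\<Sum>\<^sub>\<infinity>p\<in>split_primes. \<bar>hecke k p\<bar> * real p powr - (1 + 1 / ln (real N))) \<le> (2 / pi + e) * ln (1 / (1 / ln (real N)))"
    by (rule eventually_compose_filterlim[OF abs_hecke_prime_series_bound[OF assms(1)] filterlim_inverse_ln])
  then have "\<forall>\<^sub>F N in sequentially. \<forall>k\<ge>1. real k \<le> ln (real N) powr 4 \<longrightarrow>
    (\<Sum>n=1..N. twisted_weight t k n) \<le> C * real N * ln (real N) powr (-1/2 + e)"
    using eventually_ge_at_top[of "3::nat"]
  proof eventually_elim
    case (elim N)
    define L where "L = ln (real N)"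
    have "exp 1 \<le> real N" using exp_le elim by linarith
    then have "ln (exp 1) \<le> ln (real N)" by (intro ln_mono) auto
    then have L: "L \<ge> 1" by (simp add: L_def)
    show ?case
    proof (intro allI impI)
      fix k :: nat assume k: "k \<ge> 1" "real k \<le> ln (real N) powr 4"
      have "(1 / L) powr - 4 = L powr 4" using L by (simp add: powr_divide powr_minus)
      then have hecke_sum: "(\<Sum>\<^sub>\<infinity>p\<in>split_primes. \<bar>hecke k p\<bar> * real p powr - (1 + 1 / L)) \<le> (2 / pi + e) * ln L"
        using elim(1) k by (simp add: L_def)
      have "(\<Sum>\<^sub>\<infinity>p\<in>split_primes. dterm (twisted_weight t k) (1 + 1 / L) p) = (\<Sum>\<^sub>\<infinity>p\<in>split_primes. pi / 4 * (\<bar>hecke k p\<bar> * real p powr - (1 + 1 / L)))"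
      proof (rule infsum_cong)
        fix p assume p: "p \<in> split_primes"
        have "2 powr (t - 1) = pi / 4" by (simp add: powr_diff assms(4))
        then show "dterm (twisted_weight t k) (1 + 1 / L) p = pi / 4 * (\<bar>hecke k p\<bar> * real p powr - (1 + 1 / L))"
          by (simp add: dterm_def twisted_weight_def hecke_0_split_primes[OF p])
      qed
      also have "\<dots> = pi / 4 * (\<Sum>\<^sub>\<infinity>p\<in>split_primes. \<bar>hecke k p\<bar> * real p powr - (1 + 1 / L))" by (rule infsum_cmult_right')
      also have "\<dots> \<le> pi / 4 * ((2 / pi + e) * ln L)" using hecke_sum by (intro mult_left_mono) auto
      also have "\<dots> = (1/2 + pi / 4 * e) * ln L" by (simp add: field_simps)
      also have "\<dots> \<le> (1/2 + e) * ln L"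
      proof (intro mult_right_mono add_left_mono)
        have "pi / 4 * e \<le> 1 * e" using pi_less_4 assms(1) by (intro mult_right_mono) auto
        then show "pi / 4 * e \<le> e" by simp
      qed (use L in simp)
      finally have E: "(\<Sum>\<^sub>\<infinity>p\<in>split_primes. dterm (twisted_weight t k) (1 + 1 / L) p) \<le> (1/2 + e) * ln L" .
      have "(\<Sum>n=1..N. twisted_weight t k n) \<le> C * (real N / L) * exp (\<Sum>\<^sub>\<infinity>p\<in>split_primes. dterm (twisted_weight t k) (1 + 1 / L) p)"
        unfolding L_def using assms(3) elim(2) by (intro C(2) mult_fn_twisted_weight) (auto intro: twisted_weight_le twisted_weight_nonneg)
      also have "\<dots> \<le> C * (real N / L) * exp ((1/2 + e) * ln L)" using E C(1) L by (intro mult_left_mono) auto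
      also have "exp ((1/2 + e) * ln L) = L powr (1/2 + e)" using L by (simp add: powr_def)
      also have "C * (real N / L) * L powr (1/2 + e) = C * real N * (L powr (1/2 + e) / L)" by simp
      also have "L powr (1/2 + e) / L = L powr (1/2 + e) / L powr 1" using L by simp
      also have "\<dots> = L powr (-1/2 + e)" by (simp only: powr_diff[symmetric]) (simp add: add.commute)
      finally show "(\<Sum>n=1..N. twisted_weight t k n) \<le> C * real N * ln (real N) powr (-1/2 + e)" by (simp add: L_def)
    qed
  qed
  then show ?thesis using C(1) by blast
qed

text \<open>The indicator function of the represented numbers is written \<open>hecke 0 m powr 0\<close>, as
  \<open>0 powr 0 = 0\<close>.\<close>
lemma representable_log_sum:
  "\<exists>c>0. \<forall>h M. 0 < h \<longrightarrow> h \<le> 1 \<longrightarrow> M \<ge> 1 \<longrightarrow>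
     (\<Sum>m=1..M. hecke 0 m powr 0 / real m) \<ge> c * h powr (-1/2) - 8 / h * real M powr (- h / 2)"
proof -
  have "(\<Sum>m=1..M. hecke 0 m powr 0 / real m) \<ge> exp (- 721) * h powr (-1/2) - 8 / h * real M powr (- h / 2)"
    if h: "0 < h" "h \<le> 1" and M: "M \<ge> 1" for h :: real and M :: nat
  proof -
    let ?f = "\<lambda>n. hecke 0 n powr 0"
    have x: "1 < 1 + h" "1 + h \<le> 2" "1 < 1 + h / 2" "1 + h / 2 \<le> 2" using h by auto
    have dom: "0 \<le> ?f n" "?f n \<le> hecke 0 n" if "n > 0" for n using hecke_0_powr_le[OF that, of 0] by auto
    have nn: "dterm ?f (1 + h) n \<ge> 0" for n by (simp add: dterm_def)
    have sm: "dterm ?f (1 + h) summable_on A" for A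
      by (rule summable_on_subset_banach[OF dterm_dominated[OF x(1,2) dom]]) simp_all
    have "ln (1 / h) / 2 - 121 \<le> split_series (1 + h)" using split_series_bounds(2)[OF x(1,2)] by simp
    also have "split_series (1 + h) = (\<Sum>\<^sub>\<infinity>p\<in>split_primes. dterm ?f (1 + h) p)" using dterm_split_primes_const[of ?f 1 "1 + h"] by (simp add: hecke_0_split_primes)
    also have "\<dots> \<le> primesum (dterm ?f (1 + h))" by (rule primesum_split_primes(1)[OF x(1,2) dom])
    finally have "exp (ln (1 / h) / 2 - 121 - 600) \<le> exp (primesum (dterm ?f (1 + h)) - 600)" by simp
    also have "\<dots> \<le> infsum (dterm ?f (1 + h)) UNIV"
    proof (rule dirichlet_ge_exp[OF mult_fn_hecke_0_powr])
      show "\<bar>?f (p ^ a)\<bar> \<le> real (a + 1)" if "prime p" for p a by simp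
      show "(\<lambda>n. \<bar>dterm ?f (1 + h) n\<bar>) summable_on UNIV" using sm nn by simp
      fix p :: nat assume p: "prime p"
      have "inj ((^) p)" using prime_gt_1_nat[OF p] by (auto intro!: injI)
      then have sp: "(\<lambda>a. dterm ?f (1 + h) (p ^ a)) summable_on UNIV"
        using summable_on_reindex[of "(^) p" UNIV "dterm ?f (1 + h)"] sm by (simp add: o_def)
      \<comment> \<open>The term with exponent 0 alone equals 1, and all others are
        nonnegative.\<close>
      have "(\<Sum>a\<in>{0}. dterm ?f (1 + h) (p ^ a)) \<le> (\<Sum>\<^sub>\<infinity>a. dterm ?f (1 + h) (p ^ a))"
        by (rule finite_sum_le_infsum[OF sp]) (use nn in auto)
      moreover have "hecke 0 (Suc 0) = 1" using hecke_1_right[of 0] by simp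
      ultimately show "(\<Sum>\<^sub>\<infinity>a. dterm ?f (1 + h) (p ^ a)) \<ge> 1/2" by (simp add: dterm_def)
    qed (use h in simp)
    also have "\<dots> = infsum (dterm ?f (1 + h)) {..M} + infsum (dterm ?f (1 + h)) {M<..}"
    proof -
      have u: "(UNIV :: nat set) = {..M} \<union> {M<..}" and i: "{..M} \<inter> {M<..} = {}" by auto
      show ?thesis unfolding u by (rule infsum_Un_disjoint[OF sm sm i])
    qed
    finally have A: "exp (ln (1 / h) / 2 - 121 - 600) \<le> infsum (dterm ?f (1 + h)) {..M} + infsum (dterm ?f (1 + h)) {M<..}" .
    have "infsum (dterm ?f (1 + h)) {..M} = (\<Sum>n\<le>M. dterm ?f (1 + h) n)" by simp
    also have "\<dots> = (\<Sum>n=1..M. dterm ?f (1 + h) n)"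
      by (rule sum.mono_neutral_right) (auto simp: Suc_le_eq)
    also have "\<dots> \<le> (\<Sum>m=1..M. hecke 0 m powr 0 / real m)"
    proof (rule sum_mono)
      fix n assume n: "n \<in> {1..M}"
      have "real n powr - (1 + h) \<le> 1 / real n ^ 1" using n h by (intro powr_le_inverse_power) auto
      then have "?f n * real n powr - (1 + h) \<le> ?f n * (1 / real n ^ 1)" by (intro mult_left_mono) auto
      then show "dterm ?f (1 + h) n \<le> hecke 0 n powr 0 / real n" by (simp add: dterm_def)
    qed
    finally have B: "infsum (dterm ?f (1 + h)) {..M} \<le> (\<Sum>m=1..M. hecke 0 m powr 0 / real m)" .
    have sm2: "(\<lambda>n. real M powr (- h / 2) * dterm (hecke 0) (1 + h / 2) n) summable_on A" for A
      by (intro summable_on_cmult_right summable_on_subset_banach[OF dterm_hecke_0_summable[OF x(3,4)]]) simp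
    have "infsum (dterm ?f (1 + h)) {M<..} \<le> (\<Sum>\<^sub>\<infinity>n\<in>{M<..}. real M powr (- h / 2) * dterm (hecke 0) (1 + h / 2) n)"
    proof (rule infsum_mono[OF sm sm2])
      fix n assume n: "n \<in> {M<..}"
      \<comment> \<open>Half of the excess \<open>h\<close> is spent on the factor
        \<open>M powr (- h / 2)\<close>; the other half keeps the majorant
        \<open>hecke_series 0\<close> convergent.\<close>
      have eq: "- (1 + h) = - h / 2 + - (1 + h / 2)" by (simp add: field_simps)
      have "real n powr - (1 + h) = real n powr (- h / 2) * real n powr - (1 + h / 2)" by (simp only: eq powr_add)
      also have "\<dots> \<le> real M powr (- h / 2) * real n powr - (1 + h / 2)"
        using n M h by (intro mult_right_mono powr_mono2') auto
      finally have "?f n * real n powr - (1 + h) \<le> hecke 0 n * (real M powr (- h / 2) * real n powr - (1 + h / 2))"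
        using dom[of n] n hecke_0_nonneg[of n] by (intro mult_mono) auto
      then show "dterm ?f (1 + h) n \<le> real M powr (- h / 2) * dterm (hecke 0) (1 + h / 2) n" by (simp add: dterm_def mult_ac)
    qed
    also have "\<dots> \<le> (\<Sum>\<^sub>\<infinity>n. real M powr (- h / 2) * dterm (hecke 0) (1 + h / 2) n)"
      by (rule infsum_mono_neutral[OF sm2 sm2]) (auto simp: dterm_hecke_0_nonneg)
    also have "\<dots> = real M powr (- h / 2) * hecke_series 0 (1 + h / 2)" unfolding hecke_series_def by (rule infsum_cmult_right')
    also have "\<dots> \<le> real M powr (- h / 2) * (4 / (1 + h / 2 - 1))" by (intro mult_left_mono hecke_series_0_bounds x) auto
    finally have T: "infsum (dterm ?f (1 + h)) {M<..} \<le> 8 / h * real M powr (- h / 2)" by (simp add: mult.commute)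
    have "exp (ln (1 / h) / 2 - 121 - 600) = exp (- 721) * h powr (-1/2)"
      using h by (simp add: powr_def ln_div exp_add[symmetric] algebra_simps)
    then show ?thesis using A B T by linarith
  qed
  then show ?thesis by (intro exI[of _ "exp (- 721)"]) auto
qed

text \<open>Counts the products \<open>m * p\<close> with \<open>m\<close> represented and \<open>p \<equiv> 1 (mod 3)\<close> a prime comparable
  to \<open>N / m\<close>, which determines both factors.\<close>
lemma representable_count_ge:
  "\<exists>B\<ge>2. \<forall>N M. 4 * B \<le> M \<longrightarrow> M ^ 3 \<le> N \<longrightarrow>
     real N / (2 * real B * ln (real N)) * (\<Sum>m=1..M. hecke 0 m powr 0 / real m) \<le> real (card {n\<in>{1..N}. hecke 0 n \<noteq> 0})"
proof -
  obtain B where B: "B \<ge> 2" "\<And>y. y \<ge> 1 \<Longrightarrow> real y / ln (real (B * y)) \<le> real (card {p. prime p \<and> p mod 3 = 1 \<and> y < p \<and> p \<le> B * y})"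
    using primes_1_mod_3_short_interval by blast
  have "real N / (2 * real B * ln (real N)) * (\<Sum>m=1..M. hecke 0 m powr 0 / real m) \<le> real (card {n\<in>{1..N}. hecke 0 n \<noteq> 0})"
    if MB: "4 * B \<le> M" and NM: "M ^ 3 \<le> N" for N M
  proof -
    \<comment> \<open>A prime \<open>p \<le> B * y m\<close> satisfies \<open>m * p \<le> N\<close>.
      The size conditions give \<open>y m \<ge> M\<close>, so a prime above \<open>y m\<close>
      exceeds every \<open>m\<close> and can be recovered from the product.\<close>
    define y where "y m = N div (m * B)" for m
    define Q where "Q m = {p. prime p \<and> p mod 3 = 1 \<and> y m < p \<and> p \<le> B * y m}" for m
    define R where "R = {m\<in>{1..M}. hecke 0 m \<noteq> 0}"
    define T where "T = (SIGMA m:R. Q m)"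
    have fQ: "finite (Q m)" for m unfolding Q_def by (rule finite_subset[of _ "{..B * y m}"]) auto
    have fR: "finite R" by (simp add: R_def)
    have M1: "M \<ge> 8" using MB B(1) by linarith
    have N1: "N \<ge> 8" 
    proof -
      have "M ^ 1 \<le> M ^ 3" using M1 by (intro power_increasing) auto
      then show ?thesis using M1 NM by simp
    qed
    have lN: "ln (real N) > 0" using N1 by simp
    have ratio: "4 * real M \<le> real N / (real m * real B)" if m: "1 \<le> m" "m \<le> M" for m
    proof -
      have "4 * M * (m * B) = M * m * (4 * B)" by simp
      also have "\<dots> \<le> M * M * M" using m MB by (intro mult_le_mono) auto
      also have "\<dots> \<le> N" using NM by (simp add: power3_eq_cube)
      finally have "real (4 * M * (m * B)) \<le> real N" by (rule of_nat_mono)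
      then show ?thesis using m B(1) by (simp add: field_simps)
    qed
    have ylow: "real (y m) \<ge> real N / (real m * real B) - 1" if m: "1 \<le> m" for m
    proof -
      have "N < m * B + m * B * (N div (m * B))" using m B(1) by (intro dividend_less_times_div) simp
      then have "real N < real (m * B + m * B * (N div (m * B)))" by (rule of_nat_less_iff[THEN iffD2])
      then have "real N < (real m * real B) * (1 + real (y m))" by (simp add: y_def distrib_left)
      then show ?thesis using m B(1) by (simp add: field_simps)
    qed
    have yM: "y m \<ge> M" if m: "1 \<le> m" "m \<le> M" for m
    proof -
      have "4 * real M - 1 \<le> real (y m)" using ratio[OF m] ylow[OF m(1)] by linarith
      then have "real M \<le> real (y m)" using M1 by linarith
      then show ?thesis by simp
    qed
    have up: "m * (B * y m) \<le> N" for m by (simp add: y_def mult.assoc[symmetric])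
    have Qcard: "real N / (2 * real B * ln (real N)) * (1 / real m) \<le> real (card (Q m))" if m: "1 \<le> m" "m \<le> M" for m
    proof -
      have y1: "y m \<ge> 1" using yM[OF m] M1 by linarith
      have "B * y m \<le> m * (B * y m)" using m by simp
      then have BN: "B * y m \<le> N" using up[of m] by linarith
      have "2 * 1 \<le> B * y m" using B(1) y1 by (intro mult_le_mono) auto
      then have By2: "real (B * y m) > 1" by linarith
      have lB: "0 < ln (real (B * y m))" "ln (real (B * y m)) \<le> ln (real N)" 
      proof -
        show "0 < ln (real (B * y m))" using By2 by (rule ln_gt_zero)
        have "real (B * y m) \<le> real N" using BN by (rule of_nat_mono)
        then show "ln (real (B * y m)) \<le> ln (real N)" using By2 by (intro ln_mono) linarith+
      qed
      have "real N / (2 * (real m * real B)) \<le> real (y m)"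
      proof -
        have "real N / (real m * real B) \<ge> 2" using ratio[OF m] M1 by linarith
        moreover have "real N / (2 * (real m * real B)) = real N / (real m * real B) / 2" by simp
        ultimately show ?thesis using ylow[OF m(1)] by argo
      qed
      then have "real N / (2 * (real m * real B)) / ln (real N) \<le> real (y m) / ln (real (B * y m))"
        using lB by (intro frac_le) auto
      also have "\<dots> \<le> real (card (Q m))" unfolding Q_def by (rule B(2)[OF y1])
      finally show ?thesis by (simp add: mult_ac)
    qed
    have inj: "inj_on (\<lambda>(m, p). m * p) T"
    proof (rule inj_onI)
      fix u v assume uv: "u \<in> T" "v \<in> T" "(case u of (m, p) \<Rightarrow> m * p) = (case v of (m, p) \<Rightarrow> m * p)"
      obtain m p m' p' where e: "u = (m, p)" "v = (m', p')" by (cases u, cases v)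
      have m: "1 \<le> m" "m \<le> M" "1 \<le> m'" "m' \<le> M" and p: "prime p" "prime p'" "y m < p" "y m' < p'"
        using uv by (auto simp: e T_def R_def Q_def)
      have pM: "M < p" using yM[OF m(1,2)] p(3) by linarith
      have "m * p = m' * p'" using uv(3) by (simp add: e)
      then have "p dvd m' * p'" by (metis dvd_triv_right)
      then have "p dvd m' \<or> p dvd p'" using p(1) prime_dvd_multD by blast
      moreover have "\<not> p dvd m'"
      proof
        assume "p dvd m'"
        then have "p \<le> m'" using m(3) by (intro dvd_imp_le) auto
        then show False using pM m(4) by linarith
      qed
      ultimately have "p = p'" using primes_dvd_imp_eq[OF p(1,2)] by blast
      moreover then have "m = m'" using uv(3) prime_gt_0_nat[OF p(1)] by (simp add: e)
      ultimately show "u = v" by (simp add: e)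
    qed
    have img: "(\<lambda>(m, p). m * p) ` T \<subseteq> {n\<in>{1..N}. hecke 0 n \<noteq> 0}"
    proof
      fix n assume "n \<in> (\<lambda>(m, p). m * p) ` T"
      then obtain m p where n: "n = m * p" "m \<in> R" "p \<in> Q m" by (auto simp: T_def)
      have m: "1 \<le> m" "m \<le> M" "hecke 0 m \<noteq> 0" and p: "prime p" "p mod 3 = 1" "y m < p" "p \<le> B * y m"
        using n by (auto simp: R_def Q_def)
      have "m * p \<le> m * (B * y m)" using p(4) by (rule mult_le_mono2)
      then have "n \<le> N" using up[of m] n(1) by linarith
      moreover have "n \<ge> 1" using n(1) m(1) prime_gt_0_nat[OF p(1)] by simp
      moreover have "hecke 0 n \<noteq> 0"
      proof -
        have "\<not> p dvd m"
        proof
          assume "p dvd m"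
          then have "p \<le> m" using m(1) by (intro dvd_imp_le) auto
          then show False using p(3) yM[OF m(1,2)] m(2) by linarith
        qed
        then have "coprime m p" using p(1) prime_imp_coprime coprime_commute by blast
        then have "hecke 0 n = hecke 0 m * hecke 0 p" unfolding n(1) using m(1) prime_gt_0_nat[OF p(1)] by (intro hecke_mult) auto
        moreover have "hecke 0 p = 2" using p by (intro hecke_0_split_primes) (simp add: split_primes_def)
        ultimately show ?thesis using m(3) by simp
      qed
      ultimately show "n \<in> {n\<in>{1..N}. hecke 0 n \<noteq> 0}" by simp
    qed
    have "real N / (2 * real B * ln (real N)) * (\<Sum>m=1..M. hecke 0 m powr 0 / real m) = real N / (2 * real B * ln (real N)) * (\<Sum>m\<in>R. 1 / real m)"
    proof -
      have "(\<Sum>m=1..M. hecke 0 m powr 0 / real m) = (\<Sum>m\<in>R. hecke 0 m powr 0 / real m)"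
        unfolding R_def by (rule sum.mono_neutral_right) auto
      also have "\<dots> = (\<Sum>m\<in>R. 1 / real m)" by (intro sum.cong refl) (auto simp: R_def)
      finally show ?thesis by simp
    qed
    also have "\<dots> = (\<Sum>m\<in>R. real N / (2 * real B * ln (real N)) * (1 / real m))" by (rule sum_distrib_left)
    also have "\<dots> \<le> (\<Sum>m\<in>R. real (card (Q m)))" by (intro sum_mono Qcard) (auto simp: R_def)
    also have "\<dots> = real (card T)" unfolding T_def using fR fQ by (subst card_SigmaI) auto
    also have "card T = card ((\<lambda>(m, p). m * p) ` T)" by (rule card_image[OF inj, symmetric])
    also have "real \<dots> \<le> real (card {n\<in>{1..N}. hecke 0 n \<noteq> 0})" by (intro of_nat_mono card_mono img) simp
    finally show ?thesis .
  qed
  then show ?thesis using B(1) by blast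
qed

section \<open>Lower bound for the number of represented integers\<close>

lemma eventually_ln_nat:
  "eventually P at_top \<Longrightarrow> \<forall>\<^sub>F N in sequentially. P (ln (real N))"
proof -
  assume "eventually P at_top"
  moreover have "filterlim (\<lambda>N::nat. ln (real N)) at_top sequentially" by real_asymp
  ultimately show ?thesis by (rule eventually_compose_filterlim)
qed

lemma eventually_const_le_powr:
  assumes "a > 0" "c > 0" shows "\<forall>\<^sub>F L::real in at_top. C \<le> c * L powr a"
proof -
  have "filterlim (\<lambda>L::real. L powr a) at_top at_top" using assms by real_asymp
  then have "\<forall>\<^sub>F L in at_top. C / c \<le> L powr a" by (auto simp: filterlim_at_top)
  then show ?thesis by eventually_elim (use assms in \<open>simp add: field_simps\<close>)
qed

lemma eventually_ln_le_powr:
  assumes "a > 0" "c > 0" shows "\<forall>\<^sub>F L::real in at_top. 1 + 8 * ln L \<le> c * L powr a"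
proof -
  have "((\<lambda>L::real. (1 + 8 * ln L) / L powr a) \<longlongrightarrow> 0) at_top" using assms by real_asymp
  then have "\<forall>\<^sub>F L in at_top. (1 + 8 * ln L) / L powr a < c" using assms(2) by (rule order_tendstoD(2))
  with eventually_gt_at_top[of 0] show ?thesis by eventually_elim (simp add: field_simps)
qed

text \<open>The loss of \<open>e / 2\<close> in the exponent comes from the factor
  \<open>ln L\<close> that is given away in \<open>h\<close>. It takes the place of an asymptotic
  formula for the count.\<close>

lemma representable_count_lower:
  assumes "0 < e" "e < 1"
  shows "\<exists>c>0. \<forall>\<^sub>F N in sequentially. real (card {n\<in>{1..N}. hecke 0 n \<noteq> 0}) \<ge> c * real N * ln (real N) powr (-1/2 - e / 2)"
proof -
  obtain c where c: "c > 0" "\<And>h M. 0 < h \<Longrightarrow> h \<le> 1 \<Longrightarrow> M \<ge> 1 \<Longrightarrow>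
     (\<Sum>m=1..M. hecke 0 m powr 0 / real m) \<ge> c * h powr (-1/2) - 8 / h * real M powr (- h / 2)"
    using representable_log_sum by blast
  obtain B where B: "B \<ge> 2" "\<And>N M. 4 * B \<le> M \<Longrightarrow> M ^ 3 \<le> N \<Longrightarrow>
     real N / (2 * real B * ln (real N)) * (\<Sum>m=1..M. hecke 0 m powr 0 / real m) \<le> real (card {n\<in>{1..N}. hecke 0 n \<noteq> 0})"
    using representable_count_ge by blast
  have "\<forall>\<^sub>F L::real in at_top. L / 4 \<le> L / 3 - ln 2 \<and> 4 * real B + 1 \<le> exp (L / 3) \<and> 1 \<le> ln L \<and> L \<ge> 1"
    by (intro eventually_conj; real_asymp)
  note this[THEN eventually_ln_nat]
  moreover have "\<forall>\<^sub>F N in sequentially. 1 + 8 * ln (ln (real N)) \<le> 1 * ln (real N) powr e"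
    by (rule eventually_ln_nat[OF eventually_ln_le_powr]) (use assms in auto)
  moreover have "\<forall>\<^sub>F N in sequentially. 1 \<le> c / 2 * ln (real N) powr ((1 - e) / 2)"
    by (rule eventually_ln_nat[OF eventually_const_le_powr]) (use assms c(1) in auto)
  moreover have "\<forall>\<^sub>F N in sequentially. 1 \<le> N" by (rule eventually_ge_at_top)
  ultimately have "\<forall>\<^sub>F N in sequentially. real (card {n\<in>{1..N}. hecke 0 n \<noteq> 0}) \<ge> c / (4 * real B) * real N * ln (real N) powr (-1/2 - e / 2)"
  proof eventually_elim
    case (elim N)
    define L where "L = ln (real N)"
    \<comment> \<open>The cube root of \<open>N\<close>, rounded down, as the condition
      \<open>M ^ 3 \<le> N\<close> permits.\<close>
    define M where "M = nat \<lfloor>exp (L / 3)\<rfloor>"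
    \<comment> \<open>With \<open>ln M \<ge> L / 4\<close> this gives
      \<open>M powr (- h / 2) \<le> 1 / L\<close>, so that the subtracted tail is at most
      \<open>1 / ln L\<close>, hence at most 1.\<close>
    define h where "h = 8 * ln L / L"
    have L: "L / 4 \<le> L / 3 - ln 2" "4 * real B + 1 \<le> exp (L / 3)" "1 \<le> ln L" "L \<ge> 1" using elim(1) by (simp_all add: L_def)
    have L0: "L > 0" using L(4) by linarith
    have lnL: "1 + 8 * ln L \<le> L powr e" using elim(2) by (simp add: L_def)
    have M1: "real M \<le> exp (L / 3)" "real M \<ge> exp (L / 3) - 1" 
    proof -
      have "0 \<le> exp (L / 3)" by simp
      then show "real M \<le> exp (L / 3)" unfolding M_def by (rule of_nat_floor)
      show "real M \<ge> exp (L / 3) - 1" unfolding M_def using real_nat_ceiling_ge[of "exp (L/3)"] by linarith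
    qed
    have MB: "4 * B \<le> M" using L(2) M1(2) by linarith
    have NM: "M ^ 3 \<le> N"
    proof -
      have "real M ^ 3 \<le> exp (L / 3) ^ 3" using M1 by (intro power_mono) auto
      also have "\<dots> = exp (3 * (L / 3))" using exp_of_nat_mult[of 3 "L / 3"] by simp
      also have "\<dots> = real N" using elim(4) by (simp add: L_def)
      finally have "real (M ^ 3) \<le> real N" by simp
      then show ?thesis by (simp only: of_nat_le_iff)
    qed
    have lnM: "ln (real M) \<ge> L / 4"
    proof -
      have "exp (L / 3) \<ge> 2" using L(2) B(1) by linarith
      then have "exp (L / 3) / 2 \<le> real M" using M1(2) by linarith
      then have "ln (exp (L / 3) / 2) \<le> ln (real M)" by (intro ln_mono) auto
      then show ?thesis using L(1) by (simp add: ln_div)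
    qed
    have "L powr e \<le> L powr 1" using L assms by (intro powr_mono) auto
    then have h: "0 < h" "h \<le> 1" using L lnL by (auto simp: h_def field_simps)
    have "real M powr (- h / 2) = exp (- (h / 2 * ln (real M)))" using MB B(1) by (simp add: powr_def)
    also have "\<dots> \<le> exp (- (h / 2 * (L / 4)))" using lnM h by simp
    also have "- (h / 2 * (L / 4)) = - ln L" using L by (simp add: h_def)
    also have "exp (- ln L) = 1 / L" by (simp only: exp_minus exp_ln[OF L0] inverse_eq_divide)
    finally have "8 / h * real M powr (- h / 2) \<le> 8 / h * (1 / L)" using h by (intro mult_left_mono) auto
    also have "\<dots> = 1 / ln L" using L by (simp add: h_def)
    also have "1 / ln L \<le> 1 / 1" by (rule divide_left_mono) (use L(3) in simp_all)
    also have "1 / 1 = (1::real)" by simp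
    finally have t1: "8 / h * real M powr (- h / 2) \<le> 1" .
    have "h \<le> L powr (e - 1)"
    proof -
      have "h \<le> L powr e / L" unfolding h_def using lnL L by (intro divide_right_mono) auto
      then show ?thesis using L by (simp add: powr_diff)
    qed
    then have "(L powr (e - 1)) powr (-1/2) \<le> h powr (-1/2)" using h by (intro powr_mono2') auto
    moreover have "(L powr (e - 1)) powr (-1/2) = L powr ((e - 1) * (-1/2))" by (rule powr_powr)
    moreover have "(e - 1) * (-1/2) = (1 - e) / 2" by (simp add: field_simps)
    ultimately have "L powr ((1 - e) / 2) \<le> h powr (-1/2)" by (simp only:)
    then have "c * L powr ((1 - e) / 2) \<le> c * h powr (-1/2)" using c(1) by (intro mult_left_mono) auto
    moreover have "1 \<le> c / 2 * L powr ((1 - e) / 2)" using elim(3) by (simp add: L_def)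
    moreover have "c * L powr ((1 - e) / 2) = c / 2 * L powr ((1 - e) / 2) + c / 2 * L powr ((1 - e) / 2)" by simp
    ultimately have sum: "c / 2 * L powr ((1 - e) / 2) \<le> (\<Sum>m=1..M. hecke 0 m powr 0 / real m)"
      using c(2)[OF h, of M] t1 MB B(1) by linarith
    have "c / (4 * real B) * real N * L powr (-1/2 - e / 2) = real N / (2 * real B * L) * (c / 2 * L powr ((1 - e) / 2))"
    proof -
      have "L powr ((1 - e) / 2) / L = L powr ((1 - e) / 2) / L powr 1" using L by simp
      also have "\<dots> = L powr (-1/2 - e / 2)" by (simp only: powr_diff[symmetric]) (simp add: diff_divide_distrib)
      finally have eq: "L powr ((1 - e) / 2) / L = L powr (-1/2 - e / 2)" .
      show ?thesis unfolding eq[symmetric] by (simp add: mult_ac)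
    qed
    also have "\<dots> \<le> real N / (2 * real B * L) * (\<Sum>m=1..M. hecke 0 m powr 0 / real m)"
      using sum L B(1) by (intro mult_left_mono) auto
    also have "\<dots> \<le> real (card {n\<in>{1..N}. hecke 0 n \<noteq> 0})" unfolding L_def by (rule B(2)[OF MB NM])
    finally show ?case by (simp add: L_def)
  qed
  moreover have "c / (4 * real B) > 0" using c(1) B(1) by simp
  ultimately show ?thesis by blast
qed

section \<open>The exceptional sets\<close>

lemma markov_count:
  assumes "finite A" "\<And>n. n \<in> A \<Longrightarrow> f n \<ge> (0::real)" "c > 0" "\<And>n. n \<in> E \<Longrightarrow> n \<in> A \<and> f n \<ge> c"
  shows "real (card E) \<le> sum f A / c"
proof -
  have EA: "E \<subseteq> A" using assms(4) by blast
  have "real (card E) * c = (\<Sum>n\<in>E. c)" by simp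
  also have "\<dots> \<le> sum f E" using assms(4) by (intro sum_mono) auto
  also have "\<dots> \<le> sum f A" using assms(1,2) EA by (intro sum_mono2) auto
  finally show ?thesis using assms(3) by (simp add: field_simps)
qed

lemma harmonic_le:
  assumes "K \<ge> 1" shows "(\<Sum>k=1..K. 1 / real k) \<le> 1 + ln (real K)"
  using assms
proof (induction K rule: dec_induct)
  case (step K)
  have "ln (real K / real (Suc K)) \<le> real K / real (Suc K) - 1" using step by (intro ln_le_minus_one) auto
  moreover have "real K / real (Suc K) - 1 = - (1 / real (Suc K))" by (simp add: field_simps)
  moreover have "ln (real K / real (Suc K)) = ln (real K) - ln (real (Suc K))" using step by (simp add: ln_div)
  ultimately have "1 / real (Suc K) \<le> ln (real (Suc K)) - ln (real K)" by linarith
  then show ?case using step.IH by simp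
qed simp

text \<open>The deterministic half: the hypotheses describe a number outside the three exceptional
  sets of \<open>sparse_exceptions\<close>. \<open>K \<ge> L ^ 3\<close> and
  \<open>hecke 0 n \<le> L\<close> keep the truncation error below
  \<open>36 * hecke 0 n powr - t\<close>.\<close>

lemma good_discrepancy:
  fixes L e g t :: real
  assumes "n > 0" "hecke 0 n \<noteq> 0" "L \<ge> 1" "K \<ge> 1" "L ^ 3 \<le> real K" "hecke 0 n \<le> L" "0 < g" "g < t" "t \<le> 1"
    "L powr (1/8) \<le> hecke 0 n" "(\<Sum>k=1..K. twisted_weight t k n / real k) \<le> L powr (2 * e)" "e > 0" "t - g = 32 * e"
    "222 \<le> L powr (2 * e)"
  shows "discrepancy n \<le> real (rQ n) powr - g"
proof -
  define a where "a = hecke 0 n"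
  \<comment> \<open>Balances \<open>d\<close> against \<open>16 / (K * d ^ 2)\<close>, which becomes
    \<open>16 * d\<close>.\<close>
  define d where "d = real K powr (-1/3)"
  have a1: "a \<ge> 1" unfolding a_def by (rule hecke_0_ge_1[OF assms(1,2)])
  have K0: "real K > 0" using assms(4) by simp
  have d0: "d > 0" using K0 by (simp add: d_def)
  have "discrepancy n \<le> 2 * (d / pi + 1 / real K + 16 / (real K * d\<^sup>2)) + (\<Sum>l=1..K. \<bar>hecke l n\<bar> / (hecke 0 n * real l))"
    by (rule discrepancy_le) (use assms d0 rQ_nonzero_iff in auto)
  also have "(\<Sum>l=1..K. \<bar>hecke l n\<bar> / (hecke 0 n * real l)) = a powr - t * (\<Sum>k=1..K. twisted_weight t k n / real k)"
  proof -
    have "\<bar>hecke l n\<bar> / (hecke 0 n * real l) = a powr - t * (twisted_weight t l n / real l)" for l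
    proof -
      have "a powr - t * a powr (t - 1) = a powr - 1" by (simp only: powr_add[symmetric]) simp
      also have "\<dots> = 1 / a" using a1 by (simp add: powr_minus divide_inverse)
      finally show ?thesis by (simp add: twisted_weight_def a_def mult.assoc[symmetric])
    qed
    then show ?thesis by (simp add: sum_distrib_left)
  qed
  also have "\<dots> \<le> a powr - t * L powr (2 * e)" using assms(11) by (intro mult_left_mono) auto
  \<comment> \<open>Each of the three terms is a multiple of \<open>d\<close>, and
    \<open>36 = 2 * (1 + 1 + 16)\<close>.\<close>
  also have "2 * (d / pi + 1 / real K + 16 / (real K * d\<^sup>2)) \<le> 36 * a powr - t"
  proof -
    have d1: "d \<le> a powr - t"
    proof -
      have "d \<le> (L ^ 3) powr (-1/3)" unfolding d_def using assms by (intro powr_mono2') auto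
      also have "\<dots> = (L powr 3) powr (-1/3)" using assms(3) by simp
      also have "\<dots> = L powr (3 * (-1/3))" by (rule powr_powr)
      also have "\<dots> = L powr - 1" by simp
      also have "\<dots> \<le> a powr - 1" using assms(6) a1 by (intro powr_mono2') (auto simp: a_def)
      also have "\<dots> \<le> a powr - t" using a1 assms(9) by (intro powr_mono) auto
      finally show ?thesis .
    qed
    have "d / pi \<le> d / 1" using d0 pi_ge_two by (intro divide_left_mono) auto
    then have "d / pi \<le> d" by simp
    moreover have "1 / real K \<le> d"
    proof -
      have "1 / real K = real K powr - 1" using K0 by (simp add: powr_minus divide_inverse)
      also have "\<dots> \<le> d" unfolding d_def using assms(4) by (intro powr_mono) auto
      finally show ?thesis .
    qed
    moreover have "16 / (real K * d\<^sup>2) = 16 * d"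
    proof -
      have "real K * d\<^sup>2 * d = real K * d ^ 3" by (simp add: power2_eq_square power3_eq_cube)
      also have "d ^ 3 = d powr 3" using d0 by simp
      also have "d powr 3 = real K powr (-1/3 * 3)" unfolding d_def by (rule powr_powr)
      also have "-1/3 * 3 = (-1::real)" by simp
      also have "real K powr -1 = 1 / real K" using K0 by (simp add: powr_minus divide_inverse)
      finally have "real K * d\<^sup>2 * d = 1" using K0 by simp
      then show ?thesis using K0 d0 by (simp add: field_simps)
    qed
    ultimately show ?thesis using d1 by argo
  qed
  finally have D: "discrepancy n \<le> 36 * a powr - t + a powr - t * L powr (2 * e)" by simp
  have "36 * a powr - t \<le> 36 * a powr - t * L powr (2 * e)"
  proof -
    have "1 \<le> L powr (2 * e)" using assms(14) by linarith
    then have "36 * a powr - t * 1 \<le> 36 * a powr - t * L powr (2 * e)" by (intro mult_left_mono) auto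
    then show ?thesis by simp
  qed
  moreover have "36 * a powr - t * L powr (2 * e) + a powr - t * L powr (2 * e) = 37 * L powr (2 * e) * a powr - t" by simp
  ultimately have "discrepancy n \<le> 37 * L powr (2 * e) * a powr - t" using D by linarith
  also have "\<dots> \<le> a powr (t - g) / 6 * a powr - t"
  proof (rule mult_right_mono)
    show "37 * L powr (2 * e) \<le> a powr (t - g) / 6"
    proof -
      \<comment> \<open>As \<open>t - g = 32 * e\<close>, the bound \<open>L powr (1/8)\<close> for
        \<open>a\<close> makes \<open>a powr (t - g)\<close> at least \<open>L powr (4 * e)\<close>.
        One half of this covers the factor from Markov's inequality, the other half covers
        \<open>222 = 6 * 37\<close>, where the 6 prepares the passage from \<open>hecke 0 n\<close>
        to \<open>rQ n\<close>.\<close>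
      have "222 * L powr (2 * e) \<le> L powr (2 * e) * L powr (2 * e)" using assms(14) by (intro mult_right_mono) auto
      also have "\<dots> = L powr (1/8 * (t - g))" unfolding assms(13) by (simp only: powr_add[symmetric]) simp
      also have "\<dots> = (L powr (1/8)) powr (t - g)" by (simp only: powr_powr)
      also have "\<dots> \<le> a powr (t - g)" using assms by (intro powr_mono2) (auto simp: a_def)
      finally show ?thesis by simp
    qed
  qed simp
  also have "a powr (t - g) / 6 * a powr - t = a powr - g / 6"
  proof -
    have "a powr (t - g) * a powr - t = a powr - g" by (simp only: powr_add[symmetric]) simp
    then show ?thesis by simp
  qed
  also have "a powr - g / 6 \<le> real (rQ n) powr - g"
  proof -
    have r: "real (rQ n) = 6 * a" using assms(1) by (simp add: a_def hecke_0)
    have "(6::real) powr - 1 \<le> 6 powr - g" using assms by (intro powr_mono) auto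
    then have "a powr - g * 6 powr - 1 \<le> a powr - g * 6 powr - g" by (intro mult_left_mono) auto
    moreover have "(6::real) powr - 1 = 1 / 6" by (simp add: powr_minus_divide)
    moreover have "a powr - g / 6 = a powr - g * (1 / 6)" by (rule divide_inverse[THEN trans]) (simp only: inverse_eq_divide)
    moreover have "real (rQ n) powr - g = a powr - g * 6 powr - g" unfolding r by (simp only: powr_mult mult.commute)
    ultimately show ?thesis by (simp only:)
  qed
  finally show ?thesis .
qed

text \<open>The summand 1 allows for \<open>n = 0\<close>, which may occur in the count up to
  \<open>x\<close> but lies outside \<open>{1..N}\<close>.\<close>

lemma representable_count_transfer:
  assumes "\<forall>\<^sub>F N in sequentially. real (card {n\<in>{1..N}. P n}) + 1 \<le> c * real (card {n\<in>{1..N}. rQ n \<noteq> 0})" "c > 0"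
  shows "\<forall>\<^sub>F x in at_top. real (card {n. real n \<le> x \<and> P n}) \<le> c * real (BQ x)"
proof -
  have "filterlim (\<lambda>x::real. nat \<lfloor>x\<rfloor>) sequentially at_top"
    by (rule filterlim_compose[OF filterlim_nat_sequentially filterlim_floor_sequentially])
  from eventually_compose_filterlim[OF assms(1) this] eventually_ge_at_top[of 0]
  show ?thesis
  proof eventually_elim
    case (elim x)
    have iff: "real n \<le> x \<longleftrightarrow> n \<le> nat \<lfloor>x\<rfloor>" for n
      using elim(2) le_nat_iff[of "\<lfloor>x\<rfloor>" n] by (auto simp: le_floor_iff)
    have fin: "finite {n. n \<le> nat \<lfloor>x\<rfloor> \<and> R n}" for R by (rule finite_subset[of _ "{..nat \<lfloor>x\<rfloor>}"]) auto
    have "card {n. real n \<le> x \<and> P n} \<le> card (insert 0 {n\<in>{1..nat \<lfloor>x\<rfloor>}. P n})"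
      by (rule card_mono) (auto simp: iff Suc_le_eq)
    also have "\<dots> \<le> card {n\<in>{1..nat \<lfloor>x\<rfloor>}. P n} + 1" using card_insert_le_m1 by simp
    finally have "real (card {n. real n \<le> x \<and> P n}) \<le> real (card {n\<in>{1..nat \<lfloor>x\<rfloor>}. P n} + 1)" by (rule of_nat_mono)
    also have "\<dots> \<le> c * real (card {n\<in>{1..nat \<lfloor>x\<rfloor>}. rQ n \<noteq> 0})" using elim(1) by simp
    also have "\<dots> \<le> c * real (BQ x)"
      unfolding BQ_def iff using assms(2) by (intro mult_left_mono of_nat_mono card_mono fin) auto
    finally show ?case .
  qed
qed

lemma sparse_exceptions:
  fixes g t \<kappa> :: real
  assumes g: "0 < g" "g < t" and t: "t = ln pi / ln 2 - 1" and \<kappa>: "\<kappa> > 0"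
  shows "\<forall>\<^sub>F N in sequentially. real (card {n\<in>{1..N}. rQ n \<noteq> 0 \<and> discrepancy n > real (rQ n) powr - g}) + 1
           \<le> \<kappa> * real (card {n\<in>{1..N}. rQ n \<noteq> 0})"
proof -
  have "ln pi \<le> ln 4" using pi_less_4 by simp
  also have "ln 4 = 2 * ln (2::real)" using ln_realpow[of 2 2] by simp
  finally have t1: "t \<le> 1" unfolding t by (simp add: field_simps)
  have "t * ln 2 = ln pi - ln 2" unfolding t by (simp add: field_simps)
  then have t2: "2 powr t = pi / 2" by (simp add: powr_def exp_diff)
  \<comment> \<open>The gap is divided by 32 because \<open>hecke 0 n\<close> is only known to
    exceed \<open>L powr (1/8)\<close> and a factor \<open>L powr (4 * e)\<close> has to be
    absorbed.\<close>
  define e where "e = (t - g) / 32"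
  have e: "0 < e" "e < 1/32" "t - g = 32 * e" using g t1 by (simp_all add: e_def)
  obtain c where c: "c > 0" "\<forall>\<^sub>F N in sequentially. real (card {n\<in>{1..N}. hecke 0 n \<noteq> 0}) \<ge> c * real N * ln (real N) powr (-1/2 - e / 2)"
    using representable_count_lower[of e] e by auto
  obtain C1 where C1: "C1 > 0" "\<And>N. N \<ge> 3 \<Longrightarrow> (\<Sum>n=1..N. hecke 0 n powr 1) \<le> C1 * real N * ln (real N) powr (2 powr 1 / 2 - 1)"
    using sum_hecke_0_powr_le[of 1] by auto
  obtain C2 where C2: "C2 > 0" "\<And>N. N \<ge> 3 \<Longrightarrow> (\<Sum>n=1..N. hecke 0 n powr - 1) \<le> C2 * real N * ln (real N) powr (2 powr - 1 / 2 - 1)"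
    using sum_hecke_0_powr_le[of "- 1"] by auto
  obtain C3 where C3: "C3 > 0" "\<forall>\<^sub>F N in sequentially. \<forall>k\<ge>1. real k \<le> ln (real N) powr 4 \<longrightarrow>
      (\<Sum>n=1..N. twisted_weight t k n) \<le> C3 * real N * ln (real N) powr (-1/2 + e)"
    using sum_twisted_weight_le[of e t] e g t1 t2 by auto
  \<comment> \<open>Four equal shares: one for each exceptional set and one for the summand
    1.\<close>
  define k where "k = \<kappa> * c / 4"
  have k: "k > 0" using \<kappa> c(1) by (simp add: k_def)
  have ev1: "\<forall>\<^sub>F L::real in at_top. 2 \<le> L" by (rule eventually_ge_at_top)
  have ev2: "\<forall>\<^sub>F L::real in at_top. 222 \<le> 1 * L powr (2 * e)" using e by (intro eventually_const_le_powr) auto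
  have ev3: "\<forall>\<^sub>F L::real in at_top. C1 \<le> k * L powr (1/2 - e / 2)" using e k by (intro eventually_const_le_powr) auto
  have ev4: "\<forall>\<^sub>F L::real in at_top. C2 \<le> k * L powr (1/8 - e / 2)" using e k by (intro eventually_const_le_powr) auto
  have ev5: "\<forall>\<^sub>F L::real in at_top. 1 + 8 * ln L \<le> k / C3 * L powr (e / 2)" using e k C3(1) by (intro eventually_ln_le_powr) auto
  have ev6: "\<forall>\<^sub>F L::real in at_top. 1 \<le> k * (exp L * L powr - 1)" using k by real_asymp
  show ?thesis
    using eventually_ge_at_top[of 3] c(2) C3(2) eventually_ln_nat[OF ev1] eventually_ln_nat[OF ev2] eventually_ln_nat[OF ev3]
      eventually_ln_nat[OF ev4] eventually_ln_nat[OF ev5] eventually_ln_nat[OF ev6]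
  proof eventually_elim
    case (elim N)
    define L where "L = ln (real N)"
    \<comment> \<open>At least \<open>L ^ 3\<close>, as the truncation error demands, and within the
      range of harmonics of \<open>sum_twisted_weight_le\<close>.\<close>
    define K where "K = nat \<lfloor>L powr 4\<rfloor>"
    define Z where "Z = real N * L powr (-1/2 - e / 2)"
    have L2: "2 \<le> L" using elim(4) by (simp only: L_def)
    have L0: "L > 0" using L2 by simp
    have N: "real N = exp L" using elim(1) by (simp add: L_def)
    have L4: "L powr 4 = L ^ 4" using L0 by simp
    have K1: "real K \<le> L powr 4" unfolding K_def by (rule of_nat_floor) simp
    have K2: "L ^ 3 \<le> real K"
    proof -
      have "1 \<le> L ^ 3" using L2 by (intro one_le_power) simp
      moreover have "2 * L ^ 3 \<le> L * L ^ 3" using L2 by (intro mult_right_mono) auto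
      moreover have "L * L ^ 3 = L powr 4" using L4 by (simp add: power_Suc[symmetric])
      moreover have "L powr 4 - 1 \<le> real K" unfolding K_def using floor_correct[of "L powr 4"] by linarith
      ultimately show ?thesis by linarith
    qed
    have K0: "K \<ge> 1"
    proof -
      have "1 \<le> L ^ 3" using L2 by (intro one_le_power) simp
      then show ?thesis using K2 by simp
    qed
    have lnK: "ln (real K) \<le> 4 * ln L"
    proof -
      have "ln (real K) \<le> ln (L powr 4)" using K0 K1 by (intro ln_mono) auto
      then show ?thesis by (simp add: ln_powr)
    qed
    \<comment> \<open>All three sets must be sparser than \<open>L powr (-1/2 - e / 2)\<close>.
      Markov's inequality gives \<open>L powr - 1\<close> for \<open>E1\<close>, from the mean of
      \<open>hecke 0\<close>; \<open>L powr (-3/4 + 1/8)\<close> for \<open>E2\<close>, as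
      \<open>1 / hecke 0\<close> is 1/2 at split primes; and
      \<open>L powr (-1/2 + e - 2 * e)\<close> for \<open>E3\<close>, up to the harmonic sum of
      order \<open>ln L\<close>.\<close>
    define E1 where "E1 = {n\<in>{1..N}. L < hecke 0 n}"
    define E2 where "E2 = {n\<in>{1..N}. hecke 0 n \<noteq> 0 \<and> hecke 0 n < L powr (1/8)}"
    define E3 where "E3 = {n\<in>{1..N}. L powr (2 * e) < (\<Sum>k=1..K. twisted_weight t k n / real k)}"
    have scale: "C * real N * L powr a \<le> k * Z" if "C \<le> k * L powr b" "b + a = -1/2 - e / 2" for C a b
    proof -
      have "C * (real N * L powr a) \<le> k * L powr b * (real N * L powr a)" using that(1) by (intro mult_right_mono) auto
      also have "\<dots> = k * (real N * (L powr b * L powr a))" by simp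
      also have "\<dots> = k * Z" unfolding Z_def that(2)[symmetric] powr_add ..
      finally show ?thesis by simp
    qed
    have E1: "real (card E1) \<le> k * Z"
    proof -
      have "real (card E1) \<le> (\<Sum>n=1..N. hecke 0 n powr 1) / L"
        by (rule markov_count) (use L0 in \<open>auto simp: E1_def\<close>)
      also have "(\<Sum>n=1..N. hecke 0 n powr 1) \<le> C1 * real N * L powr (2 powr 1 / 2 - 1)" unfolding L_def by (rule C1(2)[OF elim(1)])
      also have "\<dots> = C1 * real N" using L0 by simp
      also have "C1 * real N / L = C1 * real N * L powr - 1" using L0 by (simp add: powr_minus divide_inverse)
      also have "\<dots> \<le> k * Z" by (rule scale[OF elim(6)[folded L_def]]) (simp add: field_simps)
      finally show ?thesis using L0 by (simp add: divide_right_mono)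
    qed
    have E2: "real (card E2) \<le> k * Z"
    proof -
      have "real (card E2) \<le> (\<Sum>n=1..N. hecke 0 n powr - 1) / L powr (-1/8)"
      proof (rule markov_count)
        fix n assume n: "n \<in> E2"
        have "hecke 0 n > 0" using n hecke_0_nonneg[of n] by (simp add: E2_def less_le)
        then have "(L powr (1/8)) powr - 1 \<le> hecke 0 n powr - 1" using n by (intro powr_mono2') (auto simp: E2_def)
        moreover have "(L powr (1/8)) powr - 1 = L powr (1/8 * - 1)" by (rule powr_powr)
        moreover have "1/8 * - 1 = (-1/8 :: real)" by simp
        ultimately show "n \<in> {1..N} \<and> L powr (-1/8) \<le> hecke 0 n powr - 1" using n by (simp only: E2_def) simp
      qed (use L0 in auto)
      also have "\<dots> \<le> C2 * real N * L powr (2 powr - 1 / 2 - 1) / L powr (-1/8)" unfolding L_def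
        by (intro divide_right_mono C2(2)[OF elim(1)]) simp
      also have "2 powr - 1 / 2 - 1 = (-3/4 :: real)" by (simp add: powr_minus)
      also have "C2 * real N * L powr (-3/4) / L powr (-1/8) = C2 * real N * L powr (-3/4 - -1/8)" by (simp only: powr_diff times_divide_eq_right)
      also have "\<dots> \<le> k * Z" by (rule scale[OF elim(7)[folded L_def]]) (simp add: field_simps)
      finally show ?thesis .
    qed
    have E3: "real (card E3) \<le> k * Z"
    proof -
      have "real (card E3) \<le> (\<Sum>n=1..N. \<Sum>k=1..K. twisted_weight t k n / real k) / L powr (2 * e)"
        by (rule markov_count) (use L0 in \<open>auto simp: E3_def intro!: sum_nonneg divide_nonneg_nonneg twisted_weight_nonneg\<close>)
      also have "(\<Sum>n=1..N. \<Sum>k=1..K. twisted_weight t k n / real k) = (\<Sum>k=1..K. (\<Sum>n=1..N. twisted_weight t k n) / real k)"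
        by (subst sum.swap) (simp add: sum_divide_distrib)
      also have "\<dots> / L powr (2 * e) \<le> C3 * (1 + 8 * ln L) * real N * L powr (-1/2 + e) / L powr (2 * e)"
      proof (rule divide_right_mono)
        have "(\<Sum>k=1..K. (\<Sum>n=1..N. twisted_weight t k n) / real k) \<le> (\<Sum>k=1..K. (C3 * real N * L powr (-1/2 + e)) / real k)"
        proof (intro sum_mono divide_right_mono)
          fix j assume j: "j \<in> {1..K}"
          then have "real j \<le> ln (real N) powr 4" using K1 by (simp only: L_def[symmetric]) simp
          then show "(\<Sum>n=1..N. twisted_weight t j n) \<le> C3 * real N * L powr (-1/2 + e)" using elim(3) j unfolding L_def by auto
        qed simp
        also have "\<dots> = C3 * real N * L powr (-1/2 + e) * (\<Sum>k=1..K. 1 / real k)" by (simp add: sum_distrib_left)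
        also have "\<dots> \<le> C3 * real N * L powr (-1/2 + e) * (1 + 8 * ln L)"
        proof (rule mult_left_mono)
          have "0 \<le> ln L" using L2 by simp
          then show "(\<Sum>k=1..K. 1 / real k) \<le> 1 + 8 * ln L" using harmonic_le[OF K0] lnK by linarith
        qed (use C3(1) in simp)
        finally show "(\<Sum>k=1..K. (\<Sum>n=1..N. twisted_weight t k n) / real k) \<le> C3 * (1 + 8 * ln L) * real N * L powr (-1/2 + e)" by (simp add: mult_ac)
      qed simp
      also have "\<dots> = C3 * (1 + 8 * ln L) * real N * L powr (-1/2 + e - 2 * e)" by (simp only: powr_diff times_divide_eq_right)
      also have "\<dots> \<le> k * Z"
      proof (rule scale)
        have "1 + 8 * ln L \<le> k / C3 * L powr (e / 2)" using elim(8) by (simp only: L_def)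
        then show "C3 * (1 + 8 * ln L) \<le> k * L powr (e / 2)" using C3(1) by (simp add: field_simps)
      qed (simp add: field_simps)
      finally show ?thesis .
    qed
    have one: "1 \<le> k * Z"
    proof -
      have "1 \<le> k * (exp L * L powr - 1)" using elim(9) by (simp only: L_def)
      also have "\<dots> \<le> k * (exp L * L powr (-1/2 - e / 2))"
        using k e L2 by (intro mult_left_mono powr_mono) auto
      finally show ?thesis by (simp only: Z_def N)
    qed
    let ?bad = "{n\<in>{1..N}. rQ n \<noteq> 0 \<and> discrepancy n > real (rQ n) powr - g}"
    have "?bad \<subseteq> E1 \<union> E2 \<union> E3"
    proof
      fix n assume n: "n \<in> ?bad"
      then have n1: "n \<in> {1..N}" "n > 0" and s0: "hecke 0 n \<noteq> 0" and D: "\<not> discrepancy n \<le> real (rQ n) powr - g"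
        using rQ_nonzero_iff[of n] by auto
      show "n \<in> E1 \<union> E2 \<union> E3"
      proof (rule ccontr)
        assume ne: "n \<notin> E1 \<union> E2 \<union> E3"
        have "hecke 0 n \<le> L" "L powr (1/8) \<le> hecke 0 n" "(\<Sum>k=1..K. twisted_weight t k n / real k) \<le> L powr (2 * e)"
          using ne n1 s0 by (auto simp: E1_def E2_def E3_def)
        moreover have "222 \<le> L powr (2 * e)" using elim(5) by (simp add: L_def)
        moreover have "1 \<le> L" using L2 by simp
        ultimately have "discrepancy n \<le> real (rQ n) powr - g"
          using good_discrepancy[of n L K g t e] n1(2) s0 K0 K2 g t1 e by simp
        then show False using D by simp
      qed
    qed
    then have "card ?bad \<le> card (E1 \<union> E2 \<union> E3)" by (intro card_mono) (auto simp: E1_def E2_def E3_def)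
    also have "\<dots> \<le> card E1 + card E2 + card E3" 
      using card_Un_le[of "E1 \<union> E2" E3] card_Un_le[of E1 E2] by linarith
    finally have "real (card ?bad) \<le> real (card E1) + real (card E2) + real (card E3)" by linarith
    then have "real (card ?bad) + 1 \<le> 4 * (k * Z)" using E1 E2 E3 one by linarith
    also have "\<dots> = \<kappa> * (c * real N * L powr (-1/2 - e / 2))" by (simp add: k_def Z_def)
    also have "\<dots> \<le> \<kappa> * real (card {n\<in>{1..N}. hecke 0 n \<noteq> 0})" unfolding L_def
      using elim(2) \<kappa> by (intro mult_left_mono) auto
    also have "{n\<in>{1..N}. hecke 0 n \<noteq> 0} = {n\<in>{1..N}. rQ n \<noteq> 0}" using rQ_nonzero_iff by auto
    finally show ?case .
  qed
qed

theorem theorem6p2: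
  fixes \<gamma> :: real
  assumes "0 < \<gamma>" and "\<gamma> < ln pi / ln 2 - 1"
  shows "(\<lambda>x. real (card {n :: nat. real n \<le> x \<and> rQ n \<noteq> 0 \<and>
              discrepancy n > real (rQ n) powr (- \<gamma>)}))
         \<in> o[at_top](\<lambda>x. real (BQ x))"
proof (rule landau_o.smallI)
  fix c :: real assume c: "c > 0"
  from representable_count_transfer[OF sparse_exceptions[OF assms refl c] c]
  show "\<forall>\<^sub>F x in at_top. norm (real (card {n :: nat. real n \<le> x \<and> rQ n \<noteq> 0 \<and>
          discrepancy n > real (rQ n) powr (- \<gamma>)})) \<le> c * norm (real (BQ x))" by simp
qed

end
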